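(* Let $G\ltimes X$ and $K\ltimes Y$ be Morita equivalent compact action orbifolds, let $\phi=(\alpha,Q,\varrho)$ be any Morita equivalence between them, and let $\xi$ be any complex vector bundle on $G\ltimes X$ (with a $G$-invariant hermitian structure). Then the map $\chi: C^\infty(Q)\odot_\Theta\Gamma^\infty(\xi)\to\Gamma^\infty(\phi_\#\xi)$, $$\chi(f\odot\psi)_q(y)=\frac1{\#G}\sum_{\sigma\in\Theta^{\varrho(q)}}f(q\cdot\sigma)\,\rho(\sigma)\psi_{s(\sigma)}\qquad(y\in Y,\ q\in\alpha^{-1}(y)),$$ extends to an isomorphism of $C^\infty(K\ltimes Y)$-representations $$\chi:\phi_\#L^2(\xi)\to L^2(\phi_\#\xi).$$
   Context: **Compact action orbifolds.** $G\ltimes X$ is a compact action orbifold if $G$ is a finite group acting effectively by diffeomorphisms on a compact connected smooth manifold $X$; it is regarded as the action Lie groupoid $G\times X\rightrightarrows X$ with $s(g,x)=x$, $t(g,x)=g\cdot x$. Write $\Theta=G\ltimes X$, $\Theta^x=t^{-1}(x)$, $\Theta_x=s^{-1}(x)$; likewise $\Xi=K\ltimes Y$. Integrals are normalized sums: $\int_{\Theta^x}h=\frac1{\#G}\sum_{\sigma\in\Theta^x}h(\sigma)$, and similarly over $\Theta_x$, $\Xi^y$, $\Xi_y$ (with $\#K$). $C^\infty(\Theta)$ is the convolution $*$-algebra of smooth functions on $G\times X$ with $(f\cdot g)(\sigma)=\int_{\tau\in\Theta_{s(\sigma)}}f(\sigma\tau^{-1})g(\tau)$, $f^*(\sigma)=\overline{f(\sigma^{-1})}$;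 similarly $C^\infty(\Xi)=C^\infty(K\ltimes Y)$. **Geometric Morita equivalence.** $\phi=(\alpha,Q,\varrho)$ is a Morita equivalence (Morita bitorsor) between $G\ltimes X$ and $K\ltimes Y$ if $Q$ is a smooth manifold, $\alpha:Q\to Y$ and $\varrho:Q\to X$ are surjective local diffeomorphisms, $\Theta$ acts smoothly on $Q$ from the right with anchor $\varrho$ ($q\cdot\sigma$ is defined when $t(\sigma)=\varrho(q)$, and $\varrho(q\cdot\sigma)=s(\sigma)$), $\Xi$ acts smoothly on $Q$ from the left with anchor $\alpha$ ($\tau\cdot q$ is defined when $s(\tau)=\alpha(q)$, and $\alpha(\tau\cdot q)=t(\tau)$), the two actions commute, $\Theta$ acts freely and transitively on every fibre $\alpha^{-1}(y)$, and $\Xi$ acts freely and transitively on every fibre $\varrho^{-1}(x)$. **Module structures.** $C^\infty(Q)$ is a $C^\infty(\Xi)$-$C^\infty(\Theta)$-bimodule via $(f\cdot a)(q)=\int_{\sigma\in\Theta^{\varrho(q)}}a(\sigma^{-1})f(q\cdot\sigma)$ and $(b\cdot f)(q)=\int_{\tau\in\Xi^{\alpha(q)}}b(\tau)f(\tau^{-1}\cdot q)$, with $C^\infty(\Theta)$-valued pairing $(f,g)_\Theta(\sigma)=\int_{\tau\in\Xi^{\alpha(q)}}\overline{f(\tau^{-1}\cdot q)}\,g(\tau^{-1}\cdot q\cdot\sigma)$, where $q$ is any point with $\varrho(q)=t(\sigma)$. A vector bundle on $G\ltimes X$ is a $G$-equivariant complex vector bundle $\pi:\xi\to X$, with isomorphisms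 $\rho(\sigma):\xi_{s(\sigma)}\to\xi_{t(\sigma)}$, $\sigma\in\Theta$; $C^\infty(\Theta)$ acts on smooth sections $\Gamma^\infty(\xi)$ by $(a\cdot\psi)_x=\int_{\Theta^x}a(\sigma)\rho(\sigma)\psi_{s(\sigma)}$. $C^\infty(Q)\odot_\Theta\Gamma^\infty(\xi)$ is the algebraic tensor product over $C^\infty(\Theta)$. **Induced bundle.** $\phi_\#\xi$ is the quotient of $\{(q,u)\in Q\times\xi:\varrho(q)=\pi(u)\}$ by the $\Theta$-action $\sigma\cdot(q,u)=(q\cdot\sigma^{-1},\rho(\sigma)u)$; it is a vector bundle over $Y$ with projection $[q,u]\mapsto\alpha(q)$ and $\Xi$-action $\tau\cdot[q,u]=[\tau\cdot q,u]$. For a section $\eta$, $\eta_q(y)\in\xi_{\varrho(q)}$ denotes the representative of $\eta(y)$ at $q\in\alpha^{-1}(y)$, i.e. $\eta(y)=[q,\eta_q(y)]$; thus $\rho(\sigma)\eta_{q\cdot\sigma}(y)=\eta_q(y)$. $C^\infty(\Xi)$ acts on $\Gamma^\infty(\phi_\#\xi)$ by $(b\cdot\eta)(y)=\int_{\tau\in\Xi^y}b(\tau)\,\tau\cdot\eta(s(\tau))$. **Hilbert spaces.** $X$ carries a $G$-invariant Riemannian structure with $G$-invariant Riemannian volume form $\nu$, and $\xi$ a smooth $G$-invariant hermitian inner product $(\cdot,\cdot)$ (linear in the first variable). $\phi_\#\nu$ is the unique form on $Y$ with $\alpha^*(\phi_\#\nu)=\varrho^*\nu$ ($Y$ being oriented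 by it), and $(\eta,\eta')_{\#,y}=(\eta_q(y),\eta'_q(y))_{\varrho(q)}$ for any $q\in\alpha^{-1}(y)$. $\phi_\#L^2(\xi)$ is the completion of $C^\infty(Q)\odot_\Theta\Gamma^\infty(\xi)$ in the inner product $\langle f_1\odot\psi_1,f_2\odot\psi_2\rangle=\int_X((f_2,f_1)_\Theta\cdot\psi_1,\psi_2)\,\nu$, with the extended left $C^\infty(\Xi)$-action. $L^2(\phi_\#\xi)$ is the completion of $\Gamma^\infty(\phi_\#\xi)$ in the inner product $\int_Y(\eta_1,\eta_2)_\#\,\phi_\#\nu$, with the extended $C^\infty(\Xi)$-action. *)

theory Defs
  imports "HOL-Analysis.Analysis" "HOL-Algebra.Group_Action" "HOL-Algebra.FiniteProduct"
begin

section \<open>Smooth manifolds\<close>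

primrec Ck_on ::
  "nat \<Rightarrow> 'a::real_normed_vector set \<Rightarrow> ('a \<Rightarrow> 'b::real_normed_vector) \<Rightarrow> bool" where
  "Ck_on 0 S f \<longleftrightarrow> continuous_on S f"
| "Ck_on (Suc k) S f \<longleftrightarrow>
     (\<forall>x\<in>S. f differentiable (at x)) \<and> (\<forall>v. Ck_on k S (\<lambda>x. frechet_derivative f (at x) v))"

text \<open>Smoothness on an arbitrary subset, by local smooth extension; on an open set this is
  ordinary smoothness, and on a single point it is no condition.\<close>

definition smooth_on ::
  "'a::real_normed_vector set \<Rightarrow> ('a \<Rightarrow> 'b::real_normed_vector) \<Rightarrow> bool" where
  "smooth_on S f \<longleftrightarrow>
     (\<forall>x\<in>S. \<exists>W g. open W \<and> x \<in> W \<and> (\<forall>k. Ck_on k W g) \<and> (\<forall>z\<in>S \<inter> W. g z = f z))"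

text \<open>A manifold is a whole (Hausdorff, second countable) type with an atlas. Charts take values
  in a model space \<open>V\<close>, which is either all of \<open>real^'n\<close> or the zero space: the second case
  gives the manifolds of dimension 0, which an index type, being nonempty, cannot provide.\<close>

definition model_space :: "(real^'n) set \<Rightarrow> bool" where
  "model_space V \<longleftrightarrow> V = UNIV \<or> V = {0}"

type_synonym ('x, 'n) chart = "'x set \<times> ('x \<Rightarrow> (real, 'n) vec)"

abbreviation chart_inv :: "('x, 'n) chart \<Rightarrow> real^'n \<Rightarrow> 'x" where
  "chart_inv C \<equiv> inv_into (fst C) (snd C)"

definition in_charts ::
  "('x, 'n) chart \<Rightarrow> ('y, 'n) chart \<Rightarrow> ('x \<Rightarrow> 'y) \<Rightarrow> real^'n \<Rightarrow> real^'n" where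
  "in_charts C D F = snd D \<circ> F \<circ> chart_inv C"

definition smooth_atlas ::
  "(real^'n) set \<Rightarrow> ('x::topological_space, 'n) chart set \<Rightarrow> bool" where
  "smooth_atlas V A \<longleftrightarrow>
     (\<Union>C\<in>A. fst C) = UNIV \<and>
     (\<forall>C\<in>A. open (fst C) \<and> openin (top_of_set V) (snd C ` fst C) \<and>
        homeomorphism (fst C) (snd C ` fst C) (snd C) (chart_inv C)) \<and>
     (\<forall>C\<in>A. \<forall>D\<in>A. smooth_on (snd C ` (fst C \<inter> fst D)) (in_charts C D id))"

definition smooth_fun_on ::
  "('x, 'n::finite) chart set \<Rightarrow> 'x set \<Rightarrow> ('x \<Rightarrow> 'b::real_normed_vector) \<Rightarrow> bool" where
  "smooth_fun_on A S f \<longleftrightarrow> (\<forall>C\<in>A. smooth_on (snd C ` (fst C \<inter> S)) (f \<circ> chart_inv C))"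

definition smooth_map_on ::
  "('x::topological_space, 'n::finite) chart set \<Rightarrow> ('y::topological_space, 'n) chart set \<Rightarrow>
   'x set \<Rightarrow> ('x \<Rightarrow> 'y) \<Rightarrow> bool" where
  "smooth_map_on A B S F \<longleftrightarrow> continuous_on S F \<and>
     (\<forall>C\<in>A. \<forall>D\<in>B. smooth_on (snd C ` (fst C \<inter> S \<inter> F -` fst D)) (in_charts C D F))"

definition local_diffeo ::
  "('x::topological_space, 'n::finite) chart set \<Rightarrow> ('y::topological_space, 'n) chart set \<Rightarrow>
   ('x \<Rightarrow> 'y) \<Rightarrow> bool" where
  "local_diffeo A B F \<longleftrightarrow>
     (\<forall>x. \<exists>U. open U \<and> x \<in> U \<and> inj_on F U \<and> open (F ` U) \<and>
        smooth_map_on A B U F \<and> smooth_map_on B A (F ` U) (inv_into U F))"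

section \<open>Metrics, volume forms and integration\<close>

text \<open>Tensor fields are given by their coordinate expressions: \<open>g C x\<close> and \<open>\<nu> C x\<close> are the
  metric and the coefficient \<open>\<nu>(\<partial>\<^sub>1, \<dots>, \<partial>\<^sub>n)\<close> at the point \<open>x\<close> in the chart \<open>C\<close>. In dimension 0 the
  empty determinants (Jacobian and Gram) are 1.\<close>

type_synonym ('x, 'n) metric_field =
  "('x, 'n) chart \<Rightarrow> 'x \<Rightarrow> (real, 'n) vec \<Rightarrow> (real, 'n) vec \<Rightarrow> real"
type_synonym ('x, 'n) top_form = "('x, 'n) chart \<Rightarrow> 'x \<Rightarrow> real"

definition tderiv ::
  "(real^'n) set \<Rightarrow> (real^'n \<Rightarrow> real^'n) \<Rightarrow> real^'n \<Rightarrow> real^'n \<Rightarrow> real^'n" where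
  "tderiv V F z = (if V = {0} then id else frechet_derivative F (at z))"

definition jacobian :: "(real^'n) set \<Rightarrow> (real^'n \<Rightarrow> real^'n) \<Rightarrow> real^'n \<Rightarrow> real" where
  "jacobian V F z = det (matrix (tderiv V F z))"

text \<open>\<open>pullback_metric V A B F g h\<close> says \<open>h = F\<^sup>* g\<close>; similarly for forms. With \<open>F = id\<close> this is
  the transformation law under changes of charts.\<close>

definition pullback_metric ::
  "(real^'n) set \<Rightarrow> ('x, 'n) chart set \<Rightarrow> ('y, 'n) chart set \<Rightarrow> ('x \<Rightarrow> 'y) \<Rightarrow>
   ('y, 'n) metric_field \<Rightarrow> ('x, 'n) metric_field \<Rightarrow> bool" where
  "pullback_metric V A B F g h \<longleftrightarrow>
     (\<forall>C\<in>A. \<forall>D\<in>B. \<forall>x\<in>fst C. F x \<in> fst D \<longrightarrow> (\<forall>v\<in>V. \<forall>w\<in>V.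
        h C x v w = g D (F x) (tderiv V (in_charts C D F) (snd C x) v)
                              (tderiv V (in_charts C D F) (snd C x) w)))"

definition pullback_form ::
  "(real^'n) set \<Rightarrow> ('x, 'n) chart set \<Rightarrow> ('y, 'n) chart set \<Rightarrow> ('x \<Rightarrow> 'y) \<Rightarrow>
   ('y, 'n) top_form \<Rightarrow> ('x, 'n) top_form \<Rightarrow> bool" where
  "pullback_form V A B F \<omega> \<theta> \<longleftrightarrow>
     (\<forall>C\<in>A. \<forall>D\<in>B. \<forall>x\<in>fst C. F x \<in> fst D \<longrightarrow>
        \<theta> C x = jacobian V (in_charts C D F) (snd C x) * \<omega> D (F x))"

definition riemannian_metric ::
  "(real^'n) set \<Rightarrow> ('x, 'n) chart set \<Rightarrow> ('x, 'n) metric_field \<Rightarrow> bool" where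
  "riemannian_metric V A g \<longleftrightarrow>
     (\<forall>C\<in>A. (\<forall>v\<in>V. \<forall>w\<in>V. smooth_on (snd C ` fst C) (\<lambda>z. g C (chart_inv C z) v w)) \<and>
        (\<forall>x\<in>fst C. bilinear (g C x) \<and> (\<forall>v\<in>V. \<forall>w\<in>V. g C x v w = g C x w v) \<and>
           (\<forall>v\<in>V. v \<noteq> 0 \<longrightarrow> g C x v v > 0))) \<and>
     pullback_metric V A A id g g"

definition volume_form ::
  "(real^'n) set \<Rightarrow> ('x, 'n) chart set \<Rightarrow> ('x, 'n) top_form \<Rightarrow> bool" where
  "volume_form V A \<nu> \<longleftrightarrow>
     (\<forall>C\<in>A. smooth_on (snd C ` fst C) (\<lambda>z. \<nu> C (chart_inv C z)) \<and> (\<forall>x\<in>fst C. \<nu> C x \<noteq> 0)) \<and>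
     pullback_form V A A id \<nu> \<nu>"

definition gram_det :: "(real^'n) set \<Rightarrow> (real^'n \<Rightarrow> real^'n \<Rightarrow> real) \<Rightarrow> real" where
  "gram_det V b = (if V = {0} then 1 else det (\<chi> i j. b (axis i 1) (axis j 1)))"

text \<open>\<open>\<nu> = \<plusminus>\<surd>(det g) dx\<^sub>1 \<and> \<dots> \<and> dx\<^sub>n\<close> in every chart, the sign being decided by the orientation.\<close>

definition riemannian_volume_form ::
  "(real^'n) set \<Rightarrow> ('x, 'n) chart set \<Rightarrow> ('x, 'n) metric_field \<Rightarrow> ('x, 'n) top_form \<Rightarrow> bool" where
  "riemannian_volume_form V A g \<nu> \<longleftrightarrow>
     volume_form V A \<nu> \<and> (\<forall>C\<in>A. \<forall>x\<in>fst C. (\<nu> C x)\<^sup>2 = gram_det V (g C x))"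

definition model_measure :: "(real^'n) set \<Rightarrow> (real^'n) measure" where
  "model_measure V = (if V = {0} then count_space {0} else lborel)"

text \<open>Integration against \<open>\<nu>\<close> on the manifold oriented by \<open>\<nu>\<close>, as a Borel measure: the unique one
  which in each chart has density \<open>\<bar>\<nu> C\<bar>\<close> with respect to Lebesgue measure.\<close>

definition form_measure ::
  "(real^'n) set \<Rightarrow> ('x::topological_space, 'n) chart set \<Rightarrow> ('x, 'n) top_form \<Rightarrow> 'x measure" where
  "form_measure V A \<nu> =
     (THE M. sets M = sets borel \<and>
        (\<forall>C\<in>A. \<forall>S\<in>sets borel. S \<subseteq> fst C \<longrightarrow>
           emeasure M S =
             (\<integral>\<^sup>+z\<in>snd C ` S. ennreal \<bar>\<nu> C (chart_inv C z)\<bar> \<partial>model_measure V)))"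

section \<open>Action groupoids\<close>

record ('g, 'x, 'n) action_orbifold =
  group_of :: "'g monoid"
  act :: "'g \<Rightarrow> 'x \<Rightarrow> 'x"
  atlas :: "('x, 'n) chart set"

definition compact_action_orbifold ::
  "(real^'n) set \<Rightarrow> ('g, 'x::{t2_space, second_countable_topology}, 'n) action_orbifold \<Rightarrow> bool" where
  "compact_action_orbifold V \<Theta> \<longleftrightarrow>
     smooth_atlas V (atlas \<Theta>) \<and> compact (UNIV :: 'x set) \<and> connected (UNIV :: 'x set) \<and>
     finite (carrier (group_of \<Theta>)) \<and> faithful_action (group_of \<Theta>) UNIV (act \<Theta>) \<and>
     (\<forall>g\<in>carrier (group_of \<Theta>). smooth_map_on (atlas \<Theta>) (atlas \<Theta>) UNIV (act \<Theta> g))"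

definition arrows :: "('g, 'x, 'n) action_orbifold \<Rightarrow> ('g \<times> 'x) set" where
  "arrows \<Theta> = carrier (group_of \<Theta>) \<times> UNIV"

definition src :: "'g \<times> 'x \<Rightarrow> 'x" where "src \<sigma> = snd \<sigma>"

definition tgt :: "('g, 'x, 'n) action_orbifold \<Rightarrow> 'g \<times> 'x \<Rightarrow> 'x" where
  "tgt \<Theta> \<sigma> = act \<Theta> (fst \<sigma>) (snd \<sigma>)"

definition unit_arrow :: "('g, 'x, 'n) action_orbifold \<Rightarrow> 'x \<Rightarrow> 'g \<times> 'x" where
  "unit_arrow \<Theta> x = (one (group_of \<Theta>), x)"

text \<open>The product \<open>\<sigma>\<tau>\<close>, meaningful when \<open>src \<sigma> = tgt \<Theta> \<tau>\<close>.\<close>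

definition comp_arrow ::
  "('g, 'x, 'n) action_orbifold \<Rightarrow> 'g \<times> 'x \<Rightarrow> 'g \<times> 'x \<Rightarrow> 'g \<times> 'x" where
  "comp_arrow \<Theta> \<sigma> \<tau> = (mult (group_of \<Theta>) (fst \<sigma>) (fst \<tau>), snd \<tau>)"

definition inv_arrow :: "('g, 'x, 'n) action_orbifold \<Rightarrow> 'g \<times> 'x \<Rightarrow> 'g \<times> 'x" where
  "inv_arrow \<Theta> \<sigma> = (m_inv (group_of \<Theta>) (fst \<sigma>), act \<Theta> (fst \<sigma>) (snd \<sigma>))"

definition arrows_into :: "('g, 'x, 'n) action_orbifold \<Rightarrow> 'x \<Rightarrow> ('g \<times> 'x) set" where
  "arrows_into \<Theta> x = {\<sigma> \<in> arrows \<Theta>. tgt \<Theta> \<sigma> = x}"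

definition arrows_from :: "('g, 'x, 'n) action_orbifold \<Rightarrow> 'x \<Rightarrow> ('g \<times> 'x) set" where
  "arrows_from \<Theta> x = {\<sigma> \<in> arrows \<Theta>. src \<sigma> = x}"

definition mass :: "('g, 'x, 'n) action_orbifold \<Rightarrow> complex" where
  "mass \<Theta> = 1 / of_nat (card (carrier (group_of \<Theta>)))"

text \<open>Arrows form the disjoint union of copies of the manifold indexed by the group, so smoothness
  is smoothness on each copy; functions are 0 off the arrows to make them determined by their
  restriction.\<close>

definition conv_algebra :: "('g, 'x, 'n::finite) action_orbifold \<Rightarrow> ('g \<times> 'x \<Rightarrow> complex) set" where
  "conv_algebra \<Theta> =
     {a. (\<forall>g\<in>carrier (group_of \<Theta>). smooth_fun_on (atlas \<Theta>) UNIV (\<lambda>x. a (g, x))) \<and>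
         (\<forall>\<sigma>. \<sigma> \<notin> arrows \<Theta> \<longrightarrow> a \<sigma> = 0)}"

definition conv ::
  "('g, 'x, 'n) action_orbifold \<Rightarrow> ('g \<times> 'x \<Rightarrow> complex) \<Rightarrow> ('g \<times> 'x \<Rightarrow> complex) \<Rightarrow>
   'g \<times> 'x \<Rightarrow> complex" where
  "conv \<Theta> a b \<sigma> =
     (if \<sigma> \<in> arrows \<Theta>
      then mass \<Theta> * (\<Sum>\<tau>\<in>arrows_from \<Theta> (src \<sigma>). a (comp_arrow \<Theta> \<sigma> (inv_arrow \<Theta> \<tau>)) * b \<tau>)
      else 0)"

definition star ::
  "('g, 'x, 'n) action_orbifold \<Rightarrow> ('g \<times> 'x \<Rightarrow> complex) \<Rightarrow> 'g \<times> 'x \<Rightarrow> complex" where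
  "star \<Theta> a \<sigma> = (if \<sigma> \<in> arrows \<Theta> then cnj (a (inv_arrow \<Theta> \<sigma>)) else 0)"

section \<open>Morita equivalences\<close>

text \<open>\<open>lanchor\<close> and \<open>ranchor\<close> are the maps \<open>\<alpha> : Q \<rightarrow> Y\<close> and \<open>\<varrho> : Q \<rightarrow> X\<close>. The values of \<open>lact\<close> and
  \<open>ract\<close> matter only where the actions are defined.\<close>

record ('g, 'x, 'k, 'y, 'q, 'n) bitorsor =
  qatlas :: "('q, 'n) chart set"
  lanchor :: "'q \<Rightarrow> 'y"
  ranchor :: "'q \<Rightarrow> 'x"
  lact :: "'k \<times> 'y \<Rightarrow> 'q \<Rightarrow> 'q"
  ract :: "'q \<Rightarrow> 'g \<times> 'x \<Rightarrow> 'q"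

definition right_action ::
  "('g, 'x, 'n::finite) action_orbifold \<Rightarrow>
   ('g, 'x, 'k, 'y, 'q::topological_space, 'n) bitorsor \<Rightarrow> bool" where
  "right_action \<Theta> \<phi> \<longleftrightarrow>
     (\<forall>q. ract \<phi> q (unit_arrow \<Theta> (ranchor \<phi> q)) = q) \<and>
     (\<forall>q. \<forall>\<sigma>\<in>arrows_into \<Theta> (ranchor \<phi> q). ranchor \<phi> (ract \<phi> q \<sigma>) = src \<sigma> \<and>
        (\<forall>\<tau>\<in>arrows_into \<Theta> (src \<sigma>).
           ract \<phi> (ract \<phi> q \<sigma>) \<tau> = ract \<phi> q (comp_arrow \<Theta> \<sigma> \<tau>))) \<and>
     (\<forall>g\<in>carrier (group_of \<Theta>). smooth_map_on (qatlas \<phi>) (qatlas \<phi>) UNIV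
        (\<lambda>q. ract \<phi> q (g, act \<Theta> (m_inv (group_of \<Theta>) g) (ranchor \<phi> q))))"

definition left_action ::
  "('k, 'y, 'n::finite) action_orbifold \<Rightarrow>
   ('g, 'x, 'k, 'y, 'q::topological_space, 'n) bitorsor \<Rightarrow> bool" where
  "left_action \<Xi> \<phi> \<longleftrightarrow>
     (\<forall>q. lact \<phi> (unit_arrow \<Xi> (lanchor \<phi> q)) q = q) \<and>
     (\<forall>q. \<forall>\<tau>\<in>arrows_from \<Xi> (lanchor \<phi> q). lanchor \<phi> (lact \<phi> \<tau> q) = tgt \<Xi> \<tau> \<and>
        (\<forall>\<tau>'\<in>arrows_from \<Xi> (tgt \<Xi> \<tau>).
           lact \<phi> \<tau>' (lact \<phi> \<tau> q) = lact \<phi> (comp_arrow \<Xi> \<tau>' \<tau>) q)) \<and>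
     (\<forall>k\<in>carrier (group_of \<Xi>). smooth_map_on (qatlas \<phi>) (qatlas \<phi>) UNIV
        (\<lambda>q. lact \<phi> (k, lanchor \<phi> q) q))"

definition morita_equivalence ::
  "(real^'n) set \<Rightarrow> ('g, 'x::topological_space, 'n) action_orbifold \<Rightarrow>
   ('k, 'y::topological_space, 'n) action_orbifold \<Rightarrow>
   ('g, 'x, 'k, 'y, 'q::{t2_space, second_countable_topology}, 'n) bitorsor \<Rightarrow> bool" where
  "morita_equivalence V \<Theta> \<Xi> \<phi> \<longleftrightarrow>
     smooth_atlas V (qatlas \<phi>) \<and>
     surj (lanchor \<phi>) \<and> local_diffeo (qatlas \<phi>) (atlas \<Xi>) (lanchor \<phi>) \<and>
     surj (ranchor \<phi>) \<and> local_diffeo (qatlas \<phi>) (atlas \<Theta>) (ranchor \<phi>) \<and>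
     right_action \<Theta> \<phi> \<and> left_action \<Xi> \<phi> \<and>
     (\<forall>q. \<forall>\<sigma>\<in>arrows_into \<Theta> (ranchor \<phi> q). lanchor \<phi> (ract \<phi> q \<sigma>) = lanchor \<phi> q) \<and>
     (\<forall>q. \<forall>\<tau>\<in>arrows_from \<Xi> (lanchor \<phi> q). ranchor \<phi> (lact \<phi> \<tau> q) = ranchor \<phi> q) \<and>
     (\<forall>q. \<forall>\<sigma>\<in>arrows_into \<Theta> (ranchor \<phi> q). \<forall>\<tau>\<in>arrows_from \<Xi> (lanchor \<phi> q).
        lact \<phi> \<tau> (ract \<phi> q \<sigma>) = ract \<phi> (lact \<phi> \<tau> q) \<sigma>) \<and>
     (\<forall>q q'. lanchor \<phi> q = lanchor \<phi> q' \<longrightarrow>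
        (\<exists>!\<sigma>. \<sigma> \<in> arrows_into \<Theta> (ranchor \<phi> q) \<and> ract \<phi> q \<sigma> = q')) \<and>
     (\<forall>q q'. ranchor \<phi> q = ranchor \<phi> q' \<longrightarrow>
        (\<exists>!\<tau>. \<tau> \<in> arrows_from \<Xi> (lanchor \<phi> q) \<and> lact \<phi> \<tau> q = q'))"

definition smooth_fun_space :: "('q, 'n::finite) chart set \<Rightarrow> ('q \<Rightarrow> complex) set" where
  "smooth_fun_space A = {f. smooth_fun_on A UNIV f}"

text \<open>The bimodule structure \<open>f \<cdot> a\<close>, \<open>b \<cdot> f\<close> and the pairing \<open>(f, g)\<^sub>\<Theta>\<close>.\<close>

definition fun_ract ::
  "('g, 'x, 'n) action_orbifold \<Rightarrow> ('g, 'x, 'k, 'y, 'q, 'n) bitorsor \<Rightarrow>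
   ('q \<Rightarrow> complex) \<Rightarrow> ('g \<times> 'x \<Rightarrow> complex) \<Rightarrow> 'q \<Rightarrow> complex" where
  "fun_ract \<Theta> \<phi> f a q =
     mass \<Theta> * (\<Sum>\<sigma>\<in>arrows_into \<Theta> (ranchor \<phi> q). a (inv_arrow \<Theta> \<sigma>) * f (ract \<phi> q \<sigma>))"

definition fun_lact ::
  "('k, 'y, 'n) action_orbifold \<Rightarrow> ('g, 'x, 'k, 'y, 'q, 'n) bitorsor \<Rightarrow>
   ('k \<times> 'y \<Rightarrow> complex) \<Rightarrow> ('q \<Rightarrow> complex) \<Rightarrow> 'q \<Rightarrow> complex" where
  "fun_lact \<Xi> \<phi> b f q =
     mass \<Xi> * (\<Sum>\<tau>\<in>arrows_into \<Xi> (lanchor \<phi> q). b \<tau> * f (lact \<phi> (inv_arrow \<Xi> \<tau>) q))"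

definition pairing ::
  "('g, 'x, 'n) action_orbifold \<Rightarrow> ('k, 'y, 'n) action_orbifold \<Rightarrow>
   ('g, 'x, 'k, 'y, 'q, 'n) bitorsor \<Rightarrow> ('q \<Rightarrow> complex) \<Rightarrow> ('q \<Rightarrow> complex) \<Rightarrow>
   'g \<times> 'x \<Rightarrow> complex" where
  "pairing \<Theta> \<Xi> \<phi> f g \<sigma> =
     (if \<sigma> \<in> arrows \<Theta>
      then let q = (SOME q. ranchor \<phi> q = tgt \<Theta> \<sigma>) in
        mass \<Xi> * (\<Sum>\<tau>\<in>arrows_into \<Xi> (lanchor \<phi> q).
          cnj (f (lact \<phi> (inv_arrow \<Xi> \<tau>) q)) * g (ract \<phi> (lact \<phi> (inv_arrow \<Xi> \<tau>) q) \<sigma>))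
      else 0)"

section \<open>Equivariant hermitian vector bundles\<close>

text \<open>\<open>(U, r, \<Phi>)\<close> in \<open>trivs\<close> is a local trivialisation over \<open>U\<close>, given by its fibre coordinates
  \<open>\<Phi> : \<pi>\<^sup>-\<^sup>1(U) \<rightarrow> \<complex>\<^sup>r\<close>; these determine the smooth structure of the total space. The space \<open>\<complex>\<^sup>r\<close> is
  \<open>coords r\<close>, so that the rank may be any natural number. The field \<open>rho\<close> is the action of the
  arrows and \<open>herm\<close> the hermitian product, relevant only on pairs in the same fibre.\<close>

record ('g, 'x, 'u) hbundle =
  tot :: "'u set"
  proj :: "'u \<Rightarrow> 'x"
  vadd :: "'u \<Rightarrow> 'u \<Rightarrow> 'u"
  vzero :: "'x \<Rightarrow> 'u"
  vscale :: "complex \<Rightarrow> 'u \<Rightarrow> 'u"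
  trivs :: "('x set \<times> nat \<times> ('u \<Rightarrow> nat \<Rightarrow> complex)) set"
  rho :: "'g \<times> 'x \<Rightarrow> 'u \<Rightarrow> 'u"
  herm :: "'u \<Rightarrow> 'u \<Rightarrow> complex"

definition coords :: "nat \<Rightarrow> (nat \<Rightarrow> complex) set" where
  "coords r = {v. \<forall>i\<ge>r. v i = 0}"

definition fibre :: "('g, 'x, 'u) hbundle \<Rightarrow> 'x \<Rightarrow> 'u set" where
  "fibre \<xi> x = {u \<in> tot \<xi>. proj \<xi> u = x}"

definition fibre_sum :: "('g, 'x, 'u) hbundle \<Rightarrow> 'x \<Rightarrow> ('i \<Rightarrow> 'u) \<Rightarrow> 'i set \<Rightarrow> 'u" where
  "fibre_sum \<xi> x f I = finprod \<lparr>carrier = fibre \<xi> x, mult = vadd \<xi>, one = vzero \<xi> x\<rparr> f I"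

text \<open>The vector space axioms in a fibre follow from the existence of a linear bijection to
  \<open>coords r\<close>.\<close>

definition vector_bundle ::
  "('x::topological_space, 'n::finite) chart set \<Rightarrow> ('g, 'x, 'u) hbundle \<Rightarrow> bool" where
  "vector_bundle A \<xi> \<longleftrightarrow>
     (\<forall>x. vzero \<xi> x \<in> fibre \<xi> x \<and>
        (\<forall>u\<in>fibre \<xi> x. (\<forall>v\<in>fibre \<xi> x. vadd \<xi> u v \<in> fibre \<xi> x) \<and>
           (\<forall>z. vscale \<xi> z u \<in> fibre \<xi> x))) \<and>
     (\<Union>(U, r, \<Phi>)\<in>trivs \<xi>. U) = UNIV \<and>
     (\<forall>(U, r, \<Phi>)\<in>trivs \<xi>. open U \<and>
        (\<forall>x\<in>U. bij_betw \<Phi> (fibre \<xi> x) (coords r) \<and> \<Phi> (vzero \<xi> x) = (\<lambda>_. 0) \<and>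
           (\<forall>u\<in>fibre \<xi> x. (\<forall>v\<in>fibre \<xi> x. \<Phi> (vadd \<xi> u v) = (\<lambda>i. \<Phi> u i + \<Phi> v i)) \<and>
              (\<forall>z. \<Phi> (vscale \<xi> z u) = (\<lambda>i. z * \<Phi> u i))))) \<and>
     (\<forall>(U, r, \<Phi>)\<in>trivs \<xi>. \<forall>(U', r', \<Phi>')\<in>trivs \<xi>. \<forall>v\<in>coords r. \<forall>i<r'.
        smooth_fun_on A (U \<inter> U') (\<lambda>x. \<Phi>' (inv_into (fibre \<xi> x) \<Phi> v) i))"

definition equivariant_bundle ::
  "('g, 'x::topological_space, 'n::finite) action_orbifold \<Rightarrow> ('g, 'x, 'u) hbundle \<Rightarrow> bool" where
  "equivariant_bundle \<Theta> \<xi> \<longleftrightarrow>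
     vector_bundle (atlas \<Theta>) \<xi> \<and>
     (\<forall>\<sigma>\<in>arrows \<Theta>. bij_betw (rho \<xi> \<sigma>) (fibre \<xi> (src \<sigma>)) (fibre \<xi> (tgt \<Theta> \<sigma>)) \<and>
        (\<forall>u\<in>fibre \<xi> (src \<sigma>).
           (\<forall>v\<in>fibre \<xi> (src \<sigma>). rho \<xi> \<sigma> (vadd \<xi> u v) = vadd \<xi> (rho \<xi> \<sigma> u) (rho \<xi> \<sigma> v)) \<and>
           (\<forall>z. rho \<xi> \<sigma> (vscale \<xi> z u) = vscale \<xi> z (rho \<xi> \<sigma> u)) \<and>
           (\<forall>\<tau>\<in>arrows_from \<Theta> (tgt \<Theta> \<sigma>). rho \<xi> (comp_arrow \<Theta> \<tau> \<sigma>) u = rho \<xi> \<tau> (rho \<xi> \<sigma> u)))) \<and>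
     (\<forall>x. \<forall>u\<in>fibre \<xi> x. rho \<xi> (unit_arrow \<Theta> x) u = u) \<and>
     (\<forall>g\<in>carrier (group_of \<Theta>). \<forall>(U, r, \<Phi>)\<in>trivs \<xi>. \<forall>(U', r', \<Phi>')\<in>trivs \<xi>.
        \<forall>v\<in>coords r. \<forall>i<r'. smooth_fun_on (atlas \<Theta>) (U \<inter> act \<Theta> g -` U')
          (\<lambda>x. \<Phi>' (rho \<xi> (g, x) (inv_into (fibre \<xi> x) \<Phi> v)) i))"

definition invariant_hermitian ::
  "('g, 'x::topological_space, 'n::finite) action_orbifold \<Rightarrow> ('g, 'x, 'u) hbundle \<Rightarrow> bool" where
  "invariant_hermitian \<Theta> \<xi> \<longleftrightarrow>
     (\<forall>x. \<forall>u\<in>fibre \<xi> x. \<forall>w\<in>fibre \<xi> x.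
        (\<forall>v\<in>fibre \<xi> x. herm \<xi> (vadd \<xi> u v) w = herm \<xi> u w + herm \<xi> v w) \<and>
        (\<forall>z. herm \<xi> (vscale \<xi> z u) w = z * herm \<xi> u w) \<and>
        herm \<xi> w u = cnj (herm \<xi> u w)) \<and>
     (\<forall>x. \<forall>u\<in>fibre \<xi> x. u \<noteq> vzero \<xi> x \<longrightarrow> Re (herm \<xi> u u) > 0) \<and>
     (\<forall>(U, r, \<Phi>)\<in>trivs \<xi>. \<forall>v\<in>coords r. \<forall>w\<in>coords r. smooth_fun_on (atlas \<Theta>) U
        (\<lambda>x. herm \<xi> (inv_into (fibre \<xi> x) \<Phi> v) (inv_into (fibre \<xi> x) \<Phi> w))) \<and>
     (\<forall>\<sigma>\<in>arrows \<Theta>. \<forall>u\<in>fibre \<xi> (src \<sigma>). \<forall>v\<in>fibre \<xi> (src \<sigma>).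
        herm \<xi> (rho \<xi> \<sigma> u) (rho \<xi> \<sigma> v) = herm \<xi> u v)"

definition sections :: "('x, 'n::finite) chart set \<Rightarrow> ('g, 'x, 'u) hbundle \<Rightarrow> ('x \<Rightarrow> 'u) set" where
  "sections A \<xi> =
     {\<psi>. (\<forall>x. \<psi> x \<in> fibre \<xi> x) \<and>
         (\<forall>(U, r, \<Phi>)\<in>trivs \<xi>. \<forall>i<r. smooth_fun_on A U (\<lambda>x. \<Phi> (\<psi> x) i))}"

definition sec_act ::
  "('g, 'x, 'n) action_orbifold \<Rightarrow> ('g, 'x, 'u) hbundle \<Rightarrow> ('g \<times> 'x \<Rightarrow> complex) \<Rightarrow>
   ('x \<Rightarrow> 'u) \<Rightarrow> 'x \<Rightarrow> 'u" where
  "sec_act \<Theta> \<xi> a \<psi> x =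
     vscale \<xi> (mass \<Theta>)
       (fibre_sum \<xi> x (\<lambda>\<sigma>. vscale \<xi> (a \<sigma>) (rho \<xi> \<sigma> (\<psi> (src \<sigma>)))) (arrows_into \<Theta> x))"

section \<open>The induced bundle\<close>

text \<open>\<open>ind_class \<Theta> \<phi> \<xi> q u\<close> is \<open>[q, u]\<close>, and \<open>rep_at q z\<close> is the representative of \<open>z\<close> at \<open>q\<close>.\<close>

definition ind_class ::
  "('g, 'x, 'n) action_orbifold \<Rightarrow> ('g, 'x, 'k, 'y, 'q, 'n) bitorsor \<Rightarrow> ('g, 'x, 'u) hbundle \<Rightarrow>
   'q \<Rightarrow> 'u \<Rightarrow> ('q \<times> 'u) set" where
  "ind_class \<Theta> \<phi> \<xi> q u =
     (\<lambda>\<sigma>. (ract \<phi> q (inv_arrow \<Theta> \<sigma>), rho \<xi> \<sigma> u)) ` arrows_from \<Theta> (ranchor \<phi> q)"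

definition rep_at :: "'q \<Rightarrow> ('q \<times> 'u) set \<Rightarrow> 'u" where
  "rep_at q z = (THE u. (q, u) \<in> z)"

definition ind_proj :: "('g, 'x, 'k, 'y, 'q, 'n) bitorsor \<Rightarrow> ('q \<times> 'u) set \<Rightarrow> 'y" where
  "ind_proj \<phi> z = lanchor \<phi> (fst (SOME p. p \<in> z))"

definition over :: "('g, 'x, 'k, 'y, 'q, 'n) bitorsor \<Rightarrow> 'y \<Rightarrow> 'q" where
  "over \<phi> y = (SOME q. lanchor \<phi> q = y)"

text \<open>The trivialisations come from those of \<open>\<xi>\<close> through local sections of \<open>\<alpha>\<close>, that is, inverses
  of \<open>\<alpha>\<close> on open sets \<open>W\<close> on which it is injective.\<close>

definition induced_bundle ::
  "('g, 'x, 'n) action_orbifold \<Rightarrow> ('g, 'x, 'k, 'y, 'q::topological_space, 'n) bitorsor \<Rightarrow>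
   ('g, 'x, 'u) hbundle \<Rightarrow> ('k, 'y, ('q \<times> 'u) set) hbundle" where
  "induced_bundle \<Theta> \<phi> \<xi> = \<lparr>
     tot = {ind_class \<Theta> \<phi> \<xi> q u | q u. u \<in> fibre \<xi> (ranchor \<phi> q)},
     proj = ind_proj \<phi>,
     vadd = (\<lambda>z z'. let q = over \<phi> (ind_proj \<phi> z) in
               ind_class \<Theta> \<phi> \<xi> q (vadd \<xi> (rep_at q z) (rep_at q z'))),
     vzero = (\<lambda>y. ind_class \<Theta> \<phi> \<xi> (over \<phi> y) (vzero \<xi> (ranchor \<phi> (over \<phi> y)))),
     vscale = (\<lambda>c z. let q = over \<phi> (ind_proj \<phi> z) in
               ind_class \<Theta> \<phi> \<xi> q (vscale \<xi> c (rep_at q z))),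
     trivs = {(lanchor \<phi> ` W, r, \<lambda>z. \<Phi> (rep_at (inv_into W (lanchor \<phi>) (ind_proj \<phi> z)) z)) | W U r \<Phi>.
               open W \<and> inj_on (lanchor \<phi>) W \<and> (U, r, \<Phi>) \<in> trivs \<xi> \<and> ranchor \<phi> ` W \<subseteq> U},
     rho = (\<lambda>\<tau> z. let q = over \<phi> (src \<tau>) in ind_class \<Theta> \<phi> \<xi> (lact \<phi> \<tau> q) (rep_at q z)),
     herm = (\<lambda>z z'. let q = over \<phi> (ind_proj \<phi> z) in herm \<xi> (rep_at q z) (rep_at q z'))\<rparr>"

text \<open>\<open>\<phi>\<^sub># \<nu>\<close>, the form with \<open>\<alpha>\<^sup>*(\<phi>\<^sub># \<nu>) = \<varrho>\<^sup>* \<nu>\<close>. It is unique on the domains of the charts; its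
  remaining values are irrelevant.\<close>

definition induced_form ::
  "(real^'n) set \<Rightarrow> ('g, 'x, 'n) action_orbifold \<Rightarrow> ('k, 'y, 'n) action_orbifold \<Rightarrow>
   ('g, 'x, 'k, 'y, 'q, 'n) bitorsor \<Rightarrow> ('x, 'n) top_form \<Rightarrow> ('y, 'n) top_form" where
  "induced_form V \<Theta> \<Xi> \<phi> \<nu> =
     (SOME \<omega>. volume_form V (atlas \<Xi>) \<omega> \<and>
        (\<exists>\<theta>. pullback_form V (qatlas \<phi>) (atlas \<Xi>) (lanchor \<phi>) \<omega> \<theta> \<and>
             pullback_form V (qatlas \<phi>) (atlas \<Theta>) (ranchor \<phi>) \<nu> \<theta>))"

section \<open>Inner product spaces, quotients and completions\<close>

record 'v inner_space =
  vecs :: "'v set"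
  plus_in :: "'v \<Rightarrow> 'v \<Rightarrow> 'v"
  zero_in :: "'v"
  scale_in :: "complex \<Rightarrow> 'v \<Rightarrow> 'v"
  inner_in :: "'v \<Rightarrow> 'v \<Rightarrow> complex"

definition norm_in :: "'v inner_space \<Rightarrow> 'v \<Rightarrow> real" where
  "norm_in S v = sqrt (Re (inner_in S v v))"

definition diff_in :: "'v inner_space \<Rightarrow> 'v \<Rightarrow> 'v \<Rightarrow> 'v" where
  "diff_in S v w = plus_in S v (scale_in S (-1) w)"

definition linear_in :: "'v inner_space \<Rightarrow> 'w inner_space \<Rightarrow> ('v \<Rightarrow> 'w) \<Rightarrow> bool" where
  "linear_in S T F \<longleftrightarrow>
     F ` vecs S \<subseteq> vecs T \<and>
     (\<forall>v\<in>vecs S. (\<forall>w\<in>vecs S. F (plus_in S v w) = plus_in T (F v) (F w)) \<and>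
        (\<forall>z. F (scale_in S z v) = scale_in T z (F v)))"

definition bounded_in :: "'v inner_space \<Rightarrow> 'w inner_space \<Rightarrow> ('v \<Rightarrow> 'w) \<Rightarrow> bool" where
  "bounded_in S T F \<longleftrightarrow>
     linear_in S T F \<and> (\<exists>c. \<forall>v\<in>vecs S. norm_in T (F v) \<le> c * norm_in S v)"

definition coset_in :: "'v inner_space \<Rightarrow> 'v set \<Rightarrow> 'v \<Rightarrow> 'v set" where
  "coset_in S N v = {plus_in S v n | n. n \<in> N}"

definition some_rep :: "'v set \<Rightarrow> 'v" where "some_rep a = (SOME v. v \<in> a)"

definition quotient_space :: "'v inner_space \<Rightarrow> 'v set \<Rightarrow> 'v set inner_space" where
  "quotient_space S N = \<lparr>
     vecs = coset_in S N ` vecs S,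
     plus_in = (\<lambda>a b. coset_in S N (plus_in S (some_rep a) (some_rep b))),
     zero_in = coset_in S N (zero_in S),
     scale_in = (\<lambda>z a. coset_in S N (scale_in S z (some_rep a))),
     inner_in = (\<lambda>a b. inner_in S (some_rep a) (some_rep b))\<rparr>"

definition quotient_op :: "'v inner_space \<Rightarrow> 'v set \<Rightarrow> ('v \<Rightarrow> 'v) \<Rightarrow> 'v set \<Rightarrow> 'v set" where
  "quotient_op S N F a = coset_in S N (F (some_rep a))"

text \<open>The completion: Cauchy sequences modulo null sequences.\<close>

definition cauchy_space :: "'v inner_space \<Rightarrow> (nat \<Rightarrow> 'v) inner_space" where
  "cauchy_space S = \<lparr>
     vecs = {s. range s \<subseteq> vecs S \<and>
               (\<forall>e>0. \<exists>k. \<forall>m\<ge>k. \<forall>n\<ge>k. norm_in S (diff_in S (s m) (s n)) < e)},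
     plus_in = (\<lambda>s t n. plus_in S (s n) (t n)),
     zero_in = (\<lambda>_. zero_in S),
     scale_in = (\<lambda>z s n. scale_in S z (s n)),
     inner_in = (\<lambda>s t. lim (\<lambda>n. inner_in S (s n) (t n)))\<rparr>"

definition null_seqs :: "'v inner_space \<Rightarrow> (nat \<Rightarrow> 'v) set" where
  "null_seqs S = {s. range s \<subseteq> vecs S \<and> (\<lambda>n. norm_in S (s n)) \<longlonglongrightarrow> 0}"

definition hilbert_completion :: "'v inner_space \<Rightarrow> (nat \<Rightarrow> 'v) set inner_space" where
  "hilbert_completion S = quotient_space (cauchy_space S) (null_seqs S)"

definition to_completion :: "'v inner_space \<Rightarrow> 'v \<Rightarrow> (nat \<Rightarrow> 'v) set" where
  "to_completion S v = coset_in (cauchy_space S) (null_seqs S) (\<lambda>_. v)"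

definition completion_op ::
  "'v inner_space \<Rightarrow> ('v \<Rightarrow> 'v) \<Rightarrow> (nat \<Rightarrow> 'v) set \<Rightarrow> (nat \<Rightarrow> 'v) set" where
  "completion_op S F = quotient_op (cauchy_space S) (null_seqs S) (\<lambda>s n. F (s n))"

text \<open>Representations of the *-algebra of \<open>\<Xi>\<close> by bounded operators, and their isomorphisms. An
  isomorphism is a topological linear isomorphism; it need not preserve the inner products.\<close>

definition representation ::
  "('k, 'y, 'n::finite) action_orbifold \<Rightarrow> 'v inner_space \<Rightarrow>
   (('k \<times> 'y \<Rightarrow> complex) \<Rightarrow> 'v \<Rightarrow> 'v) \<Rightarrow> bool" where
  "representation \<Xi> S R \<longleftrightarrow>
     (\<forall>a\<in>conv_algebra \<Xi>. bounded_in S S (R a) \<and>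
        (\<forall>v\<in>vecs S. \<forall>w\<in>vecs S. inner_in S (R a v) w = inner_in S v (R (star \<Xi> a) w)) \<and>
        (\<forall>b\<in>conv_algebra \<Xi>. \<forall>v\<in>vecs S. R (conv \<Xi> a b) v = R a (R b v) \<and>
           (\<forall>z. R (\<lambda>\<tau>. z * a \<tau> + b \<tau>) v = plus_in S (scale_in S z (R a v)) (R b v))))"

definition representation_iso ::
  "('k, 'y, 'n::finite) action_orbifold \<Rightarrow>
   'v inner_space \<Rightarrow> (('k \<times> 'y \<Rightarrow> complex) \<Rightarrow> 'v \<Rightarrow> 'v) \<Rightarrow>
   'w inner_space \<Rightarrow> (('k \<times> 'y \<Rightarrow> complex) \<Rightarrow> 'w \<Rightarrow> 'w) \<Rightarrow> ('v \<Rightarrow> 'w) \<Rightarrow> bool" where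
  "representation_iso \<Xi> S R S' R' T \<longleftrightarrow>
     representation \<Xi> S R \<and> representation \<Xi> S' R' \<and>
     bij_betw T (vecs S) (vecs S') \<and>
     bounded_in S S' T \<and> bounded_in S' S (inv_into (vecs S) T) \<and>
     (\<forall>b\<in>conv_algebra \<Xi>. \<forall>v\<in>vecs S. T (R b v) = R' b (T v))"

section \<open>The two Hilbert spaces\<close>

definition section_space ::
  "('x::topological_space, 'n::finite) chart set \<Rightarrow> ('g, 'x, 'u) hbundle \<Rightarrow> 'x measure \<Rightarrow>
   ('x \<Rightarrow> 'u) inner_space" where
  "section_space A \<xi> M = \<lparr>
     vecs = sections A \<xi>,
     plus_in = (\<lambda>\<psi> \<psi>' x. vadd \<xi> (\<psi> x) (\<psi>' x)),
     zero_in = vzero \<xi>,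
     scale_in = (\<lambda>z \<psi> x. vscale \<xi> z (\<psi> x)),
     inner_in = (\<lambda>\<psi> \<psi>'. \<integral>x. herm \<xi> (\<psi> x) (\<psi>' x) \<partial>M)\<rparr>"

text \<open>The tensor product over \<open>C\<^sup>\<infinity>(\<Theta>)\<close> is the space of formal complex combinations of pairs
  \<open>(f, \<psi>)\<close> modulo the bilinearity and balancing relations.\<close>

definition point_mass :: "'p \<Rightarrow> 'p \<Rightarrow> complex" where
  "point_mass p p' = of_bool (p' = p)"

definition formal_space ::
  "(real^'n) set \<Rightarrow> ('g, 'x::topological_space, 'n) action_orbifold \<Rightarrow>
   ('k, 'y, 'n) action_orbifold \<Rightarrow> ('g, 'x, 'k, 'y, 'q, 'n) bitorsor \<Rightarrow>
   ('g, 'x, 'u) hbundle \<Rightarrow> ('x, 'n) top_form \<Rightarrow>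
   (('q \<Rightarrow> complex) \<times> ('x \<Rightarrow> 'u) \<Rightarrow> complex) inner_space" where
  "formal_space V \<Theta> \<Xi> \<phi> \<xi> \<nu> = \<lparr>
     vecs = {r. finite {p. r p \<noteq> 0} \<and>
               {p. r p \<noteq> 0} \<subseteq> smooth_fun_space (qatlas \<phi>) \<times> sections (atlas \<Theta>) \<xi>},
     plus_in = (\<lambda>r r' p. r p + r' p),
     zero_in = (\<lambda>_. 0),
     scale_in = (\<lambda>z r p. z * r p),
     inner_in = (\<lambda>r r'. \<Sum>p1 | r p1 \<noteq> 0. \<Sum>p2 | r' p2 \<noteq> 0. r p1 * cnj (r' p2) *
        (\<integral>x. herm \<xi> (sec_act \<Theta> \<xi> (pairing \<Theta> \<Xi> \<phi> (fst p2) (fst p1)) (snd p1) x) (snd p2 x)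
           \<partial>form_measure V (atlas \<Theta>) \<nu>))\<rparr>"

inductive_set tensor_relations ::
  "('g, 'x::topological_space, 'n::finite) action_orbifold \<Rightarrow>
   ('g, 'x, 'k, 'y, 'q, 'n) bitorsor \<Rightarrow> ('g, 'x, 'u) hbundle \<Rightarrow>
   (('q \<Rightarrow> complex) \<times> ('x \<Rightarrow> 'u) \<Rightarrow> complex) set"
  for \<Theta> \<phi> \<xi> where
  zero: "(\<lambda>_. 0) \<in> tensor_relations \<Theta> \<phi> \<xi>"
| lincomb: "\<lbrakk>r \<in> tensor_relations \<Theta> \<phi> \<xi>; r' \<in> tensor_relations \<Theta> \<phi> \<xi>\<rbrakk> \<Longrightarrow>
    (\<lambda>p. z * r p + r' p) \<in> tensor_relations \<Theta> \<phi> \<xi>"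
| add_left: "\<lbrakk>f \<in> smooth_fun_space (qatlas \<phi>); f' \<in> smooth_fun_space (qatlas \<phi>);
    \<psi> \<in> sections (atlas \<Theta>) \<xi>\<rbrakk> \<Longrightarrow>
    (\<lambda>p. point_mass (\<lambda>q. f q + f' q, \<psi>) p - point_mass (f, \<psi>) p - point_mass (f', \<psi>) p)
      \<in> tensor_relations \<Theta> \<phi> \<xi>"
| add_right: "\<lbrakk>f \<in> smooth_fun_space (qatlas \<phi>); \<psi> \<in> sections (atlas \<Theta>) \<xi>;
    \<psi>' \<in> sections (atlas \<Theta>) \<xi>\<rbrakk> \<Longrightarrow>
    (\<lambda>p. point_mass (f, \<lambda>x. vadd \<xi> (\<psi> x) (\<psi>' x)) p - point_mass (f, \<psi>) p - point_mass (f, \<psi>') p)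
      \<in> tensor_relations \<Theta> \<phi> \<xi>"
| scale_left: "\<lbrakk>f \<in> smooth_fun_space (qatlas \<phi>); \<psi> \<in> sections (atlas \<Theta>) \<xi>\<rbrakk> \<Longrightarrow>
    (\<lambda>p. point_mass (\<lambda>q. z * f q, \<psi>) p - z * point_mass (f, \<psi>) p) \<in> tensor_relations \<Theta> \<phi> \<xi>"
| scale_right: "\<lbrakk>f \<in> smooth_fun_space (qatlas \<phi>); \<psi> \<in> sections (atlas \<Theta>) \<xi>\<rbrakk> \<Longrightarrow>
    (\<lambda>p. point_mass (f, \<lambda>x. vscale \<xi> z (\<psi> x)) p - z * point_mass (f, \<psi>) p)
      \<in> tensor_relations \<Theta> \<phi> \<xi>"
| balance: "\<lbrakk>f \<in> smooth_fun_space (qatlas \<phi>); a \<in> conv_algebra \<Theta>; \<psi> \<in> sections (atlas \<Theta>) \<xi>\<rbrakk> \<Longrightarrow>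
    (\<lambda>p. point_mass (fun_ract \<Theta> \<phi> f a, \<psi>) p - point_mass (f, sec_act \<Theta> \<xi> a \<psi>) p)
      \<in> tensor_relations \<Theta> \<phi> \<xi>"

definition tensor_space ::
  "(real^'n) set \<Rightarrow> ('g, 'x::topological_space, 'n) action_orbifold \<Rightarrow>
   ('k, 'y, 'n) action_orbifold \<Rightarrow> ('g, 'x, 'k, 'y, 'q, 'n) bitorsor \<Rightarrow>
   ('g, 'x, 'u) hbundle \<Rightarrow> ('x, 'n) top_form \<Rightarrow>
   (('q \<Rightarrow> complex) \<times> ('x \<Rightarrow> 'u) \<Rightarrow> complex) set inner_space" where
  "tensor_space V \<Theta> \<Xi> \<phi> \<xi> \<nu> =
     quotient_space (formal_space V \<Theta> \<Xi> \<phi> \<xi> \<nu>) (tensor_relations \<Theta> \<phi> \<xi>)"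

definition tensor ::
  "(real^'n) set \<Rightarrow> ('g, 'x::topological_space, 'n) action_orbifold \<Rightarrow>
   ('k, 'y, 'n) action_orbifold \<Rightarrow> ('g, 'x, 'k, 'y, 'q, 'n) bitorsor \<Rightarrow>
   ('g, 'x, 'u) hbundle \<Rightarrow> ('x, 'n) top_form \<Rightarrow> ('q \<Rightarrow> complex) \<Rightarrow> ('x \<Rightarrow> 'u) \<Rightarrow>
   (('q \<Rightarrow> complex) \<times> ('x \<Rightarrow> 'u) \<Rightarrow> complex) set" where
  "tensor V \<Theta> \<Xi> \<phi> \<xi> \<nu> f \<psi> =
     coset_in (formal_space V \<Theta> \<Xi> \<phi> \<xi> \<nu>) (tensor_relations \<Theta> \<phi> \<xi>) (point_mass (f, \<psi>))"

text \<open>\<open>b \<cdot> (f \<odot> \<psi>) = (b \<cdot> f) \<odot> \<psi>\<close>, extended linearly.\<close>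

definition formal_act ::
  "('k, 'y, 'n) action_orbifold \<Rightarrow> ('g, 'x, 'k, 'y, 'q, 'n) bitorsor \<Rightarrow> ('k \<times> 'y \<Rightarrow> complex) \<Rightarrow>
   (('q \<Rightarrow> complex) \<times> 's \<Rightarrow> complex) \<Rightarrow> ('q \<Rightarrow> complex) \<times> 's \<Rightarrow> complex" where
  "formal_act \<Xi> \<phi> b r p = (\<Sum>p' | r p' \<noteq> 0. r p' * point_mass (fun_lact \<Xi> \<phi> b (fst p'), snd p') p)"

definition tensor_act ::
  "(real^'n) set \<Rightarrow> ('g, 'x::topological_space, 'n) action_orbifold \<Rightarrow>
   ('k, 'y, 'n) action_orbifold \<Rightarrow> ('g, 'x, 'k, 'y, 'q, 'n) bitorsor \<Rightarrow>
   ('g, 'x, 'u) hbundle \<Rightarrow> ('x, 'n) top_form \<Rightarrow> ('k \<times> 'y \<Rightarrow> complex) \<Rightarrow>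
   (('q \<Rightarrow> complex) \<times> ('x \<Rightarrow> 'u) \<Rightarrow> complex) set \<Rightarrow>
   (('q \<Rightarrow> complex) \<times> ('x \<Rightarrow> 'u) \<Rightarrow> complex) set" where
  "tensor_act V \<Theta> \<Xi> \<phi> \<xi> \<nu> b =
     quotient_op (formal_space V \<Theta> \<Xi> \<phi> \<xi> \<nu>) (tensor_relations \<Theta> \<phi> \<xi>) (formal_act \<Xi> \<phi> b)"

definition induced_section_space ::
  "(real^'n) set \<Rightarrow> ('g, 'x, 'n) action_orbifold \<Rightarrow> ('k, 'y::topological_space, 'n) action_orbifold \<Rightarrow>
   ('g, 'x, 'k, 'y, 'q::topological_space, 'n) bitorsor \<Rightarrow> ('g, 'x, 'u) hbundle \<Rightarrow>
   ('x, 'n) top_form \<Rightarrow> ('y \<Rightarrow> ('q \<times> 'u) set) inner_space" where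
  "induced_section_space V \<Theta> \<Xi> \<phi> \<xi> \<nu> =
     section_space (atlas \<Xi>) (induced_bundle \<Theta> \<phi> \<xi>)
       (form_measure V (atlas \<Xi>) (induced_form V \<Theta> \<Xi> \<phi> \<nu>))"

end

theory Submission imports Defs begin

text \<open>
Write \<open>\<alpha> : Q \<rightarrow> Y\<close> and \<open>\<rho> : Q \<rightarrow> X\<close> for the two anchors, \<open>q \<cdot> g\<close> for the action of the arrow with
group component \<open>g \<in> G\<close> that ends at \<open>\<rho>(q)\<close>, and \<open>g \<cdot> \<psi>\<close> for the translate of a section \<open>\<psi>\<close> of
\<open>\<xi>\<close>. Then the representative of \<open>\<chi>(f \<odot> \<psi>)\<close> at \<open>q\<close> is
\<open>c(f, \<psi>)(q) = 1/#G \<Sum>\<^sub>g f(q \<cdot> g) (g \<cdot> \<psi>)(\<rho>(q))\<close>. Substitutions in the sum over \<open>G\<close> show that it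
transforms along the fibres of \<open>\<alpha>\<close> as representatives of a section of the induced bundle do
(\<open>crep_R\<close>) and that it is balanced over the convolution algebra of \<open>G \<ltimes> X\<close> (\<open>crep_balanced\<close>). As
the actions of \<open>G\<close> and \<open>K\<close> on \<open>Q\<close> commute, \<open>\<chi>\<close> intertwines the two actions of the convolution
algebra of \<open>K \<ltimes> Y\<close> (\<open>fimage_act\<close>).

The heart of the matter is that \<open>\<chi>\<close> is an isometry up to a constant. Put
\<open>F(q) = (c(f\<^sub>1, \<psi>\<^sub>1)(q), f\<^sub>2(q) \<psi>\<^sub>2(\<rho>(q)))\<close>, the function called \<open>overlap\<close> below. Expanding the second
argument of \<open>(\<chi>(f\<^sub>1 \<odot> \<psi>\<^sub>1), \<chi>(f\<^sub>2 \<odot> \<psi>\<^sub>2))\<close> at \<open>y\<close>, by invariance of the metric of \<open>\<xi>\<close>, gives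
\<open>1/#G\<close> times the sum of \<open>F\<close> over the fibre of \<open>\<alpha>\<close> above \<open>y\<close>, which is a \<open>G\<close>-orbit. On the other hand
\<open>((f\<^sub>2, f\<^sub>1)\<^sub>\<Theta> \<cdot> \<psi>\<^sub>1, \<psi>\<^sub>2)\<close> at \<open>x\<close> is \<open>1/#K\<close> times the sum of \<open>F\<close> over the fibre of \<open>\<rho>\<close> above \<open>x\<close>,
which is a \<open>K\<close>-orbit. Since \<open>\<rho>\<^sup>*\<nu> = \<alpha>\<^sup>*(\<phi>\<^sub>#\<nu>)\<close>, integrating the first sum over \<open>Y\<close> and the second one
over \<open>X\<close> both give the integral of \<open>F\<close> over \<open>Q\<close> (\<open>fibre_integrals_agree\<close>). Hence \<open>\<chi>\<close> multiplies
inner products by \<open>#K/#G\<close> (\<open>fimage_inner\<close>).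

Moreover \<open>\<chi>\<close> is onto: a section \<open>\<eta>\<close> is cut up by bump functions on \<open>Q\<close> whose supports lie in sets
on which \<open>\<rho>\<close> is injective, and each piece is carried over to \<open>X\<close> (\<open>fimage_onto\<close>). Since
vectors of norm zero become zero in a completion, a linear surjection that multiplies inner products
by a positive constant induces a bounded bijection with bounded inverse between the completions
(\<open>scaled_isometry_completion_iso\<close>). The algebra acts on the sections of the induced bundle by
bounded operators, compatibly with adjoints, because the measure on \<open>Y\<close> is invariant under \<open>K\<close> (\<open>induced_measure_invariant\<close>, \<open>representation_Sec\<close>); the same
properties on the tensor product are transported back through \<open>\<chi>\<close>.

What remains is to see that all objects exist and are smooth: the induced form is the quotient of
\<open>\<rho>\<^sup>*\<nu>\<close> by the Jacobian of \<open>\<alpha>\<close>, which by \<open>G\<close>-invariance of \<open>\<nu>\<close> depends only on the point of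
\<open>Y\<close> (\<open>yform_eq\<close>, \<open>yform_volume\<close>); the measure of a form is glued from charts (\<open>form_measure_works\<close>);
and the induced bundle is locally the pullback of \<open>\<xi>\<close> along \<open>\<rho>\<close> composed with a local inverse of
\<open>\<alpha>\<close> (\<open>induced_transition_smooth\<close>).
\<close>

section \<open>Calculus of smooth functions\<close>

lemma Ck_on_subset: "Ck_on k W f \<Longrightarrow> W' \<subseteq> W \<Longrightarrow> Ck_on k W' f"
  by (induction k arbitrary: f) (auto intro: continuous_on_subset)

lemma frechet_derivative_cong_open:
  assumes "open W" "x \<in> W" "\<And>z. z \<in> W \<Longrightarrow> f z = g z" "f differentiable (at x)"
  shows "g differentiable (at x)" "frechet_derivative g (at x) = frechet_derivative f (at x)"
proof -
  have "(f has_derivative frechet_derivative f (at x)) (at x)"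
    using assms(4) by (simp add: frechet_derivative_works)
  then have g: "(g has_derivative frechet_derivative f (at x)) (at x)"
    using has_derivative_transform_within_open[OF _ assms(1,2)] assms(3) by blast
  show "g differentiable (at x)" using g by (auto simp: differentiable_def)
  show "frechet_derivative g (at x) = frechet_derivative f (at x)"
    using frechet_derivative_at[OF g] by simp
qed

lemma Ck_on_cong_open:
  "Ck_on k W f \<Longrightarrow> open W \<Longrightarrow> (\<And>z. z \<in> W \<Longrightarrow> f z = g z) \<Longrightarrow> Ck_on k W g"
proof (induction k arbitrary: f g)
  case 0
  then show ?case by (simp cong: continuous_on_cong)
next
  case (Suc k)
  have d: "\<And>x. x \<in> W \<Longrightarrow> f differentiable (at x)" using Suc.prems(1) by simp
  have "Ck_on k W (\<lambda>x. frechet_derivative g (at x) v)" for v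
  proof (rule Suc.IH[of "\<lambda>x. frechet_derivative f (at x) v"])
    show "frechet_derivative f (at z) v = frechet_derivative g (at z) v" if "z \<in> W" for z
      using frechet_derivative_cong_open(2)[OF Suc.prems(2) that Suc.prems(3) d[OF that]] by simp
  qed (use Suc.prems in auto)
  moreover have "g differentiable (at x)" if "x \<in> W" for x
    using frechet_derivative_cong_open(1)[OF Suc.prems(2) that Suc.prems(3) d[OF that]] by simp
  ultimately show ?case by simp
qed

lemma Ck_on_local:
  "(\<And>x. x \<in> W \<Longrightarrow> \<exists>N. open N \<and> x \<in> N \<and> Ck_on k N f) \<Longrightarrow> open W \<Longrightarrow> Ck_on k W f"
proof (induction k arbitrary: f)
  case 0
  then show ?case
    by (metis Ck_on.simps(1) continuous_at_imp_continuous_on continuous_on_eq_continuous_at)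
next
  case (Suc k)
  have "Ck_on k W (\<lambda>x. frechet_derivative f (at x) v)" for v
    by (rule Suc.IH) (use Suc.prems in fastforce)+
  then show ?case using Suc.prems by fastforce
qed

lemma Ck_on_SucD: "Ck_on (Suc k) W f \<Longrightarrow> Ck_on k W f"
proof (induction k arbitrary: f)
  case 0
  then show ?case
    by (auto intro!: continuous_at_imp_continuous_on differentiable_imp_continuous_within)
next
  case (Suc k)
  then show ?case by auto
qed

text \<open>The predicate speaks of the derivative chosen by \<open>frechet_derivative\<close>; this rule lets the closure
  properties below be proved with whatever formula the derivative rules provide.\<close>

lemma Ck_on_Suc_has_derivativeI:
  assumes "open W" "\<And>x. x \<in> W \<Longrightarrow> (f has_derivative f' x) (at x)"
    and "\<And>v. Ck_on k W (\<lambda>x. f' x v)"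
  shows "Ck_on (Suc k) W f"
proof -
  have "frechet_derivative f (at x) = f' x" if "x \<in> W" for x
    using frechet_derivative_at[OF assms(2)[OF that]] by simp
  then have "Ck_on k W (\<lambda>x. frechet_derivative f (at x) v)" for v
    using Ck_on_cong_open[OF assms(3)[of v] assms(1)] by simp
  then show ?thesis using assms(2) by (auto simp: differentiable_def)
qed

lemma Ck_on_Suc_has_derivative:
  "Ck_on (Suc k) W f \<Longrightarrow> x \<in> W \<Longrightarrow> (f has_derivative frechet_derivative f (at x)) (at x)"
  by (simp add: frechet_derivative_works)

lemma Ck_on_const: "open W \<Longrightarrow> Ck_on k W (\<lambda>_. c)"
proof (induction k arbitrary: c)
  case (Suc k)
  then show ?case by (intro Ck_on_Suc_has_derivativeI[where f' = "\<lambda>_ _. 0"]) auto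
qed simp

lemma Ck_on_bounded_linear:
  assumes "bounded_linear L"
  shows "open W \<Longrightarrow> Ck_on k W L"
proof (cases k)
  case 0
  then show ?thesis using assms by (auto intro: linear_continuous_on)
next
  case (Suc m)
  assume "open W"
  then show ?thesis unfolding Suc
    by (intro Ck_on_Suc_has_derivativeI[where f' = "\<lambda>_. L"])
      (auto intro: Ck_on_const bounded_linear_imp_has_derivative assms)
qed

lemma Ck_on_linear_comp:
  assumes L: "bounded_linear L"
  shows "Ck_on k W f \<Longrightarrow> open W \<Longrightarrow> Ck_on k W (\<lambda>x. L (f x))"
proof (induction k arbitrary: f)
  case 0
  then show ?case using L by (auto intro: bounded_linear.continuous_on)
next
  case (Suc k)
  show ?case
    by (rule Ck_on_Suc_has_derivativeI[where f' = "\<lambda>x v. L (frechet_derivative f (at x) v)"])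
      (use Suc Ck_on_Suc_has_derivative[OF Suc.prems(1)] in
        \<open>auto intro: bounded_linear.has_derivative[OF L]\<close>)
qed

lemma Ck_on_add: "Ck_on k W f \<Longrightarrow> Ck_on k W g \<Longrightarrow> open W \<Longrightarrow> Ck_on k W (\<lambda>x. f x + g x)"
proof (induction k arbitrary: f g)
  case 0
  then show ?case by (auto intro: continuous_on_add)
next
  case (Suc k)
  show ?case
    by (rule Ck_on_Suc_has_derivativeI[where
          f' = "\<lambda>x v. frechet_derivative f (at x) v + frechet_derivative g (at x) v"])
      (use Suc Ck_on_Suc_has_derivative[OF Suc.prems(1)] Ck_on_Suc_has_derivative[OF Suc.prems(2)] in
        \<open>auto intro: has_derivative_add\<close>)
qed

lemma Ck_on_sum:
  "open W \<Longrightarrow> (\<And>i. i \<in> I \<Longrightarrow> Ck_on k W (f i)) \<Longrightarrow> Ck_on k W (\<lambda>x. \<Sum>i\<in>I. f i x)"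
  by (induction I rule: infinite_finite_induct) (auto intro: Ck_on_const Ck_on_add)

lemma Ck_on_bilinear:
  assumes B: "bounded_bilinear B"
  shows "Ck_on k W f \<Longrightarrow> Ck_on k W g \<Longrightarrow> open W \<Longrightarrow> Ck_on k W (\<lambda>x. B (f x) (g x))"
proof (induction k arbitrary: f g)
  case 0
  then show ?case using bounded_bilinear.continuous_on[OF B] by auto
next
  case (Suc k)
  note d = Ck_on_Suc_has_derivative[OF Suc.prems(1)] Ck_on_Suc_has_derivative[OF Suc.prems(2)]
  show ?case
  proof (rule Ck_on_Suc_has_derivativeI[where
          f' = "\<lambda>x v. B (f x) (frechet_derivative g (at x) v) + B (frechet_derivative f (at x) v) (g x)"])
    show "((\<lambda>x. B (f x) (g x)) has_derivative
        (\<lambda>v. B (f x) (frechet_derivative g (at x) v) + B (frechet_derivative f (at x) v) (g x))) (at x)"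
      if "x \<in> W" for x
      using bounded_bilinear.FDERIV[OF B d(1)[OF that] d(2)[OF that]] .
    show "Ck_on k W (\<lambda>x. B (f x) (frechet_derivative g (at x) v) + B (frechet_derivative f (at x) v) (g x))" for v
      using Suc.prems Ck_on_SucD[OF Suc.prems(1)] Ck_on_SucD[OF Suc.prems(2)]
      by (intro Ck_on_add Suc.IH) auto
  qed (use Suc in auto)
qed

text \<open>The derivative of a composite is linear in the derivative of the inner function; written in
  a basis it becomes a sum of products of functions to which the induction applies.\<close>

lemma Ck_on_comp:
  fixes g :: "'a::real_normed_vector \<Rightarrow> 'b::euclidean_space"
  shows "Ck_on k W g \<Longrightarrow> Ck_on k W' f \<Longrightarrow> g ` W \<subseteq> W' \<Longrightarrow> open W \<Longrightarrow> open W' \<Longrightarrow>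
    Ck_on k W (\<lambda>x. f (g x))"
proof (induction k arbitrary: f)
  case 0
  then show ?case by (auto intro: continuous_on_compose2)
next
  case (Suc k)
  note dg = Ck_on_Suc_has_derivative[OF Suc.prems(1)]
  note df = Ck_on_Suc_has_derivative[OF Suc.prems(2)]
  let ?D = "\<lambda>x v. \<Sum>b\<in>Basis. (frechet_derivative g (at x) v \<bullet> b) *\<^sub>R frechet_derivative f (at (g x)) b"
  show ?case
  proof (rule Ck_on_Suc_has_derivativeI[where f' = ?D])
    fix x assume x: "x \<in> W"
    then have gx: "g x \<in> W'" using Suc.prems by auto
    have lin: "linear (frechet_derivative f (at (g x)))"
      using df[OF gx] by (simp add: has_derivative_linear)
    have "?D x v = frechet_derivative f (at (g x)) (frechet_derivative g (at x) v)" for v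
    proof -
      have "?D x v = (\<Sum>b\<in>Basis. frechet_derivative f (at (g x)) ((frechet_derivative g (at x) v \<bullet> b) *\<^sub>R b))"
        by (simp add: linear_scale[OF lin])
      also have "\<dots> = frechet_derivative f (at (g x)) (\<Sum>b\<in>Basis. (frechet_derivative g (at x) v \<bullet> b) *\<^sub>R b)"
        by (rule linear_sum[OF lin, symmetric])
      finally show ?thesis by (simp add: euclidean_representation)
    qed
    moreover have "((\<lambda>x. f (g x)) has_derivative
        (\<lambda>v. frechet_derivative f (at (g x)) (frechet_derivative g (at x) v))) (at x)"
      using has_derivative_compose[OF dg[OF x] df[OF gx]] .
    ultimately show "((\<lambda>x. f (g x)) has_derivative ?D x) (at x)" by presburger
  next
    fix v
    have 1: "Ck_on k W (\<lambda>x. frechet_derivative f (at (g x)) b)" for b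
      using Suc.prems Ck_on_SucD[OF Suc.prems(1)]
      by (intro Suc.IH[of "\<lambda>y. frechet_derivative f (at y) b"]) auto
    have 2: "Ck_on k W (\<lambda>x. frechet_derivative g (at x) v \<bullet> b)" for b
      using Suc.prems by (intro Ck_on_linear_comp[OF bounded_linear_inner_left]) auto
    show "Ck_on k W (\<lambda>x. ?D x v)"
      using 1 2 Suc.prems(4) by (intro Ck_on_sum Ck_on_bilinear[OF bounded_bilinear_scaleR]) auto
  qed (use Suc in auto)
qed

lemma Ck_on_inverse:
  fixes f :: "'a::real_normed_vector \<Rightarrow> 'b::real_normed_div_algebra"
  shows "Ck_on k W f \<Longrightarrow> open W \<Longrightarrow> (\<And>x. x \<in> W \<Longrightarrow> f x \<noteq> 0) \<Longrightarrow> Ck_on k W (\<lambda>x. inverse (f x))"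
proof (induction k)
  case 0
  then show ?case by (auto intro: continuous_on_inverse)
next
  case (Suc k)
  note d = Ck_on_Suc_has_derivative[OF Suc.prems(1)]
  show ?case
  proof (rule Ck_on_Suc_has_derivativeI[where
        f' = "\<lambda>x v. - (inverse (f x) * frechet_derivative f (at x) v * inverse (f x))"])
    show "((\<lambda>x. inverse (f x)) has_derivative
       (\<lambda>v. - (inverse (f x) * frechet_derivative f (at x) v * inverse (f x)))) (at x)" if "x \<in> W" for x
      using Deriv.has_derivative_inverse[OF _ d[OF that]] Suc.prems(3)[OF that] by blast
    have i: "Ck_on k W (\<lambda>x. inverse (f x))"
      using Suc Ck_on_SucD by blast
    show "Ck_on k W (\<lambda>x. - (inverse (f x) * frechet_derivative f (at x) v * inverse (f x)))" for v
      using i Suc.prems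
      by (intro Ck_on_linear_comp[OF bounded_linear_minus[OF bounded_linear_ident]]
          Ck_on_bilinear[OF bounded_bilinear_mult]) auto
  qed (use Suc in auto)
qed

subsection \<open>A flat function\<close>

text \<open>The functions \<open>t\<^sup>-\<^sup>k exp (-1/t)\<close>, extended by zero, are closed under differentiation up to
  linear combinations; this makes all of them smooth at once, in particular the flat function
  \<open>k = 0\<close>.\<close>

definition flat :: "nat \<Rightarrow> real \<Rightarrow> real" where
  "flat k t = (if t > 0 then inverse t ^ k * exp (- inverse t) else 0)"

lemma flat_tendsto_0: "((\<lambda>t. flat k t) \<longlongrightarrow> 0) (at 0)"
proof -
  have "((\<lambda>t::real. (inverse t) ^ k / exp (inverse t)) \<longlongrightarrow> 0) (at_right 0)"
    using tendsto_power_div_exp_0[of k] filterlim_inverse_at_top_right filterlim_compose by blast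
  then have "((\<lambda>t. flat k t) \<longlongrightarrow> 0) (at_right 0)"
    by (rule Lim_transform_eventually)
      (auto simp: flat_def eventually_at_right_less exp_minus field_simps intro!: eventually_mono[OF eventually_at_right_less[of 0]])
  moreover have "((\<lambda>t. flat k t) \<longlongrightarrow> 0) (at_left 0)"
    by (rule Lim_transform_eventually[OF tendsto_const])
      (auto simp: flat_def intro!: eventually_mono[OF eventually_at_left_real[of "-1" 0]])
  ultimately show ?thesis by (simp add: filterlim_split_at)
qed

lemma flat_deriv: "(flat k has_real_derivative (flat (k + 2) t - of_nat k * flat (k + 1) t)) (at t)"
proof -
  consider "t > 0" | "t < 0" | "t = 0" by linarith
  then show ?thesis
  proof cases
    case 1
    have i: "(inverse has_real_derivative - (inverse t * inverse t)) (at t)"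
      using DERIV_inverse[of t] 1 by (simp add: power2_eq_square)
    have p: "((\<lambda>t. inverse t ^ k) has_real_derivative - (of_nat k * inverse t ^ (k + 1))) (at t)"
      using DERIV_power[OF i, of k] by (cases k) (auto simp: algebra_simps)
    have e: "((\<lambda>t. exp (- inverse t)) has_real_derivative
        exp (- inverse t) * (inverse t * inverse t)) (at t)"
      using DERIV_chain2[OF DERIV_exp DERIV_minus[OF i]] by simp
    have "((\<lambda>t. inverse t ^ k * exp (- inverse t)) has_real_derivative
      (flat (k + 2) t - of_nat k * flat (k + 1) t)) (at t)"
      using DERIV_mult[OF p e] 1 by (simp add: flat_def algebra_simps)
    then show ?thesis
      by (rule has_field_derivative_transform_within_open[where S = "{0<..}"]) (use 1 in \<open>auto simp: flat_def\<close>)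
  next
    case 2
    have "((\<lambda>_. 0) has_real_derivative 0) (at t)" by simp
    then have "(flat k has_real_derivative 0) (at t)"
      by (rule has_field_derivative_transform_within_open[where S = "{..<0}"]) (use 2 in \<open>auto simp: flat_def\<close>)
    then show ?thesis using 2 by (simp add: flat_def)
  next
    case 3
    have "((\<lambda>h. (flat k (0 + h) - flat k 0) / h) \<longlongrightarrow> 0) (at 0)"
      using flat_tendsto_0[of "k + 1"]
      by (rule Lim_transform_eventually)
        (auto simp: flat_def eventually_at_filter field_simps)
    then show ?thesis using 3 by (simp add: flat_def DERIV_def)
  qed
qed

lemma Ck_on_flat: "Ck_on m UNIV (flat k)"
proof (induction m arbitrary: k)
  case 0
  have "isCont (flat k) t" for t using flat_deriv DERIV_isCont by blast
  then show ?case by (simp add: continuous_at_imp_continuous_on)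
next
  case (Suc m)
  show ?case
  proof (rule Ck_on_Suc_has_derivativeI[where
        f' = "\<lambda>t v. (flat (k + 2) t - of_nat k * flat (k + 1) t) * v"])
    show "(flat k has_derivative (*) (flat (k + 2) t - of_nat k * flat (k + 1) t)) (at t)" for t
      using flat_deriv[of k t] by (simp add: has_field_derivative_def)
    have "Ck_on m UNIV (\<lambda>t. (flat (k + 2) t + (- of_nat k) * flat (k + 1) t) * v)" for v
      by (intro Ck_on_linear_comp[OF bounded_linear_mult_left] Ck_on_add
          Ck_on_linear_comp[OF bounded_linear_mult_right] Suc) auto
    then show "Ck_on m UNIV (\<lambda>t. (flat (k + 2) t - of_nat k * flat (k + 1) t) * v)" for v by simp
  qed simp
qed

subsection \<open>Smoothness on arbitrary sets\<close>

lemma smooth_onI_open: "open S \<Longrightarrow> (\<And>k. Ck_on k S f) \<Longrightarrow> smooth_on S f"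
  unfolding smooth_on_def by blast

text \<open>On an open set the local extensions agree with the function itself, so that the definition by
  extensions reduces to ordinary differentiability.\<close>

lemma smooth_on_open_Ck:
  assumes "open S" "smooth_on S f"
  shows "Ck_on k S f"
proof (rule Ck_on_local[OF _ assms(1)])
  fix x assume "x \<in> S"
  then obtain W g where "open W" "x \<in> W" "Ck_on k W g" "\<forall>z\<in>S \<inter> W. g z = f z"
    using assms(2) unfolding smooth_on_def by blast
  then have "Ck_on k (S \<inter> W) f"
    using assms(1) Ck_on_cong_open[of k "S \<inter> W" g f] Ck_on_subset[of k W g "S \<inter> W"] by auto
  then show "\<exists>N. open N \<and> x \<in> N \<and> Ck_on k N f"
    using \<open>x \<in> S\<close> \<open>x \<in> W\<close> \<open>open W\<close> assms(1) by blast
qed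

lemma smooth_onE:
  assumes "smooth_on S f" "x \<in> S"
  obtains W g where "open W" "x \<in> W" "\<And>k. Ck_on k W g" "\<And>z. z \<in> S \<Longrightarrow> z \<in> W \<Longrightarrow> g z = f z"
  using assms unfolding smooth_on_def by fast

lemma smooth_onI:
  assumes "\<And>x. x \<in> S \<Longrightarrow> \<exists>W g. open W \<and> x \<in> W \<and> (\<forall>k. Ck_on k W g) \<and> (\<forall>z\<in>S \<inter> W. g z = f z)"
  shows "smooth_on S f"
  using assms unfolding smooth_on_def by fast

lemma smooth_on_mono_cong:
  assumes "smooth_on S f" "T \<subseteq> S" "\<And>x. x \<in> T \<Longrightarrow> f x = g x"
  shows "smooth_on T g"
proof (rule smooth_onI)
  fix x assume x: "x \<in> T"
  then have "x \<in> S" using assms(2) by blast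
  then obtain W h where "open W" "x \<in> W" "\<And>k. Ck_on k W h" "\<And>z. z \<in> S \<Longrightarrow> z \<in> W \<Longrightarrow> h z = f z"
    using smooth_onE[OF assms(1)] by metis
  then show "\<exists>W h. open W \<and> x \<in> W \<and> (\<forall>k. Ck_on k W h) \<and> (\<forall>z\<in>T \<inter> W. h z = g z)"
    using assms(2,3) by (intro exI[of _ W] exI[of _ h]) auto
qed

lemma smooth_on_subset: "smooth_on S f \<Longrightarrow> T \<subseteq> S \<Longrightarrow> smooth_on T f"
  using smooth_on_mono_cong[of S f T f] by simp

lemma smooth_on_cong: "smooth_on S f \<Longrightarrow> (\<And>x. x \<in> S \<Longrightarrow> f x = g x) \<Longrightarrow> smooth_on S g"
  using smooth_on_mono_cong[of S f S g] by simp

lemma smooth_on_local: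
  assumes "\<And>x. x \<in> S \<Longrightarrow> \<exists>N. open N \<and> x \<in> N \<and> smooth_on (S \<inter> N) f"
  shows "smooth_on S f"
proof (rule smooth_onI)
  fix x assume x: "x \<in> S"
  then obtain N where N: "open N" "x \<in> N" "smooth_on (S \<inter> N) f" using assms by blast
  then obtain W g where "open W" "x \<in> W" "\<forall>k. Ck_on k W g" "\<forall>z\<in>S \<inter> N \<inter> W. g z = f z"
    using x unfolding smooth_on_def by fast
  then show "\<exists>W g. open W \<and> x \<in> W \<and> (\<forall>k. Ck_on k W g) \<and> (\<forall>z\<in>S \<inter> W. g z = f z)"
    using N Ck_on_subset[of _ W g "W \<inter> N"] by (intro exI[of _ "W \<inter> N"] exI[of _ g]) auto
qed

lemma smooth_on_continuous: "smooth_on S f \<Longrightarrow> continuous_on S f"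
proof (subst continuous_on_eq_continuous_within, rule ballI)
  fix x assume s: "smooth_on S f" and x: "x \<in> S"
  then obtain W g where W: "open W" "x \<in> W" "Ck_on 0 W g" "\<forall>z\<in>S \<inter> W. g z = f z"
    unfolding smooth_on_def by blast
  then have "continuous_on (S \<inter> W) f"
    by (metis Ck_on.simps(1) continuous_on_cong continuous_on_subset inf_le2)
  then have "continuous (at x within (S \<inter> W)) f"
    using x W by (auto simp: continuous_on_eq_continuous_within)
  then show "continuous (at x within S) f"
    using W(1,2) using at_within_nhd[of x W "S \<inter> W" S] by (simp add: continuous_within Int_assoc)
qed

lemma smooth_on_const: "smooth_on S (\<lambda>_. c)"
  unfolding smooth_on_def using Ck_on_const[of UNIV] by blast

lemma smooth_on_linear_comp:
  assumes "bounded_linear L" "smooth_on S f" shows "smooth_on S (\<lambda>x. L (f x))"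
proof (rule smooth_onI)
  fix x assume "x \<in> S"
  then obtain W g where "open W" "x \<in> W" "\<And>k. Ck_on k W g" "\<And>z. z \<in> S \<Longrightarrow> z \<in> W \<Longrightarrow> g z = f z"
    using smooth_onE[OF assms(2)] by metis
  moreover from this have "Ck_on k W (\<lambda>z. L (g z))" for k
    using Ck_on_linear_comp[OF assms(1), of k W g] by blast
  ultimately show "\<exists>W h. open W \<and> x \<in> W \<and> (\<forall>k. Ck_on k W h) \<and> (\<forall>z\<in>S \<inter> W. h z = L (f z))"
    by (intro exI[of _ W] exI[of _ "\<lambda>z. L (g z)"]) auto
qed

lemma smooth_on_bilinear:
  assumes "bounded_bilinear B" "smooth_on S f" "smooth_on S g"
  shows "smooth_on S (\<lambda>x. B (f x) (g x))"
proof (rule smooth_onI)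
  fix x assume x: "x \<in> S"
  obtain W f' where W: "open W" "x \<in> W" "\<And>k. Ck_on k W f'" "\<forall>z\<in>S \<inter> W. f' z = f z"
    using assms(2) x unfolding smooth_on_def by blast
  obtain W' g' where W': "open W'" "x \<in> W'" "\<And>k. Ck_on k W' g'" "\<forall>z\<in>S \<inter> W'. g' z = g z"
    using assms(3) x unfolding smooth_on_def by blast
  have "Ck_on k (W \<inter> W') (\<lambda>x. B (f' x) (g' x))" for k
    by (rule Ck_on_bilinear[OF assms(1) Ck_on_subset[OF W(3)] Ck_on_subset[OF W'(3)]]) (use W W' in auto)
  then show "\<exists>W h. open W \<and> x \<in> W \<and> (\<forall>k. Ck_on k W h) \<and> (\<forall>z\<in>S \<inter> W. h z = B (f z) (g z))"
    using W W' by (intro exI[of _ "W \<inter> W'"] exI[of _ "\<lambda>x. B (f' x) (g' x)"]) auto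
qed

lemma smooth_on_add:
  assumes "smooth_on S f" "smooth_on S g"
  shows "smooth_on S (\<lambda>x. f x + g x)"
proof (rule smooth_onI)
  fix x assume x: "x \<in> S"
  obtain W f' where W: "open W" "x \<in> W" "\<And>k. Ck_on k W f'" "\<forall>z\<in>S \<inter> W. f' z = f z"
    using assms(1) x unfolding smooth_on_def by blast
  obtain W' g' where W': "open W'" "x \<in> W'" "\<And>k. Ck_on k W' g'" "\<forall>z\<in>S \<inter> W'. g' z = g z"
    using assms(2) x unfolding smooth_on_def by blast
  have "Ck_on k (W \<inter> W') (\<lambda>x. f' x + g' x)" for k
    by (rule Ck_on_add[OF Ck_on_subset[OF W(3)] Ck_on_subset[OF W'(3)]]) (use W W' in auto)
  then show "\<exists>W h. open W \<and> x \<in> W \<and> (\<forall>k. Ck_on k W h) \<and> (\<forall>z\<in>S \<inter> W. h z = f z + g z)"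
    using W W' by (intro exI[of _ "W \<inter> W'"] exI[of _ "\<lambda>x. f' x + g' x"]) auto
qed

lemma smooth_on_sum:
  "(\<And>i. i \<in> I \<Longrightarrow> smooth_on S (f i)) \<Longrightarrow> smooth_on S (\<lambda>x. \<Sum>i\<in>I. f i x)"
  by (induction I rule: infinite_finite_induct) (auto intro: smooth_on_const smooth_on_add)

lemma smooth_on_mult:
  fixes f g :: "'a::real_normed_vector \<Rightarrow> 'b::real_normed_algebra"
  shows "smooth_on S f \<Longrightarrow> smooth_on S g \<Longrightarrow> smooth_on S (\<lambda>x. f x * g x)"
  by (rule smooth_on_bilinear[OF bounded_bilinear_mult])

lemma smooth_on_prod:
  fixes f :: "'i \<Rightarrow> 'a::real_normed_vector \<Rightarrow> 'b::{real_normed_algebra_1,comm_ring_1}"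
  shows "(\<And>i. i \<in> I \<Longrightarrow> smooth_on S (f i)) \<Longrightarrow> smooth_on S (\<lambda>x. \<Prod>i\<in>I. f i x)"
  by (induction I rule: infinite_finite_induct) (auto intro: smooth_on_const smooth_on_mult)

lemma smooth_on_comp:
  fixes g :: "'a::real_normed_vector \<Rightarrow> 'b::euclidean_space"
  assumes "smooth_on S g" "smooth_on T f" "g ` S \<subseteq> T"
  shows "smooth_on S (\<lambda>x. f (g x))"
proof (rule smooth_onI)
  fix x assume x: "x \<in> S"
  obtain W g' where W: "open W" "x \<in> W" "\<And>k. Ck_on k W g'" "\<forall>z\<in>S \<inter> W. g' z = g z"
    using assms(1) x unfolding smooth_on_def by blast
  have "g x \<in> T" using assms(3) x by blast
  then obtain W' f' where W': "open W'" "g x \<in> W'" "\<And>k. Ck_on k W' f'" "\<forall>z\<in>T \<inter> W'. f' z = f z"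
    using assms(2) unfolding smooth_on_def by blast
  have "continuous_on W g'" using W(3)[of 0] by simp
  then have o: "open (W \<inter> g' -` W')" using W(1) W'(1) by (simp add: continuous_open_preimage)
  have "Ck_on k (W \<inter> g' -` W') (\<lambda>x. f' (g' x))" for k
    by (rule Ck_on_comp[OF Ck_on_subset[OF W(3)] W'(3)]) (use W' o in auto)
  then show "\<exists>W h. open W \<and> x \<in> W \<and> (\<forall>k. Ck_on k W h) \<and> (\<forall>z\<in>S \<inter> W. h z = f (g z))"
    using W W' o x assms(3)
    by (intro exI[of _ "W \<inter> g' -` W'"] exI[of _ "\<lambda>x. f' (g' x)"]) auto
qed

lemma smooth_on_inverse:
  fixes f :: "'a::real_normed_vector \<Rightarrow> 'b::real_normed_div_algebra"
  assumes "smooth_on S f" "\<And>x. x \<in> S \<Longrightarrow> f x \<noteq> 0"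
  shows "smooth_on S (\<lambda>x. inverse (f x))"
proof (rule smooth_onI)
  fix x assume x: "x \<in> S"
  obtain W g where W: "open W" "x \<in> W" "\<And>k. Ck_on k W g" "\<forall>z\<in>S \<inter> W. g z = f z"
    using assms(1) x unfolding smooth_on_def by blast
  have "continuous_on W g" using W(3)[of 0] by simp
  then have o: "open (W \<inter> g -` (- {0}))"
    using W(1) by (intro continuous_open_preimage) auto
  have "Ck_on k (W \<inter> g -` (- {0})) (\<lambda>x. inverse (g x))" for k
    by (rule Ck_on_inverse[OF Ck_on_subset[OF W(3)]]) (use o in auto)
  then show "\<exists>W h. open W \<and> x \<in> W \<and> (\<forall>k. Ck_on k W h) \<and> (\<forall>z\<in>S \<inter> W. h z = inverse (f z))"
    using W o x assms(2) by (intro exI[of _ "W \<inter> g -` (- {0})"] exI[of _ "\<lambda>x. inverse (g x)"]) auto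
qed

lemma smooth_on_frechet_derivative:
  "open S \<Longrightarrow> smooth_on S f \<Longrightarrow> smooth_on S (\<lambda>x. frechet_derivative f (at x) v)"
  using smooth_on_open_Ck[of S f "Suc k" for k] by (intro smooth_onI_open) auto

lemma smooth_on_has_derivative:
  "open S \<Longrightarrow> smooth_on S f \<Longrightarrow> x \<in> S \<Longrightarrow> (f has_derivative frechet_derivative f (at x)) (at x)"
  using smooth_on_open_Ck[of S f "Suc 0"] Ck_on_Suc_has_derivative by blast

lemma smooth_on_jacobian:
  fixes F :: "real^'n \<Rightarrow> real^'n"
  assumes "open S" "smooth_on S F"
  shows "smooth_on S (\<lambda>z. det (matrix (frechet_derivative F (at z))))"
  unfolding det_def matrix_def
  by (auto intro!: smooth_on_sum smooth_on_mult smooth_on_const smooth_on_prod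
      smooth_on_linear_comp[OF bounded_linear_vec_nth] smooth_on_frechet_derivative assms)

section \<open>Smooth functions and maps on manifolds\<close>

locale manifold =
  fixes V :: "(real^'n::finite) set"
    and A :: "('x::{t2_space, second_countable_topology}, 'n) chart set"
  assumes model: "model_space V" and atl: "smooth_atlas V A"
begin

lemma chart_exists: obtains C where "C \<in> A" "x \<in> fst C"
  using atl unfolding smooth_atlas_def by blast

lemma
  assumes "C \<in> A"
  shows chart_open: "open (fst C)"
    and chart_image_openin: "openin (top_of_set V) (snd C ` fst C)"
    and chart_homeo: "homeomorphism (fst C) (snd C ` fst C) (snd C) (chart_inv C)"
  using assms atl unfolding smooth_atlas_def by blast+

lemma
  assumes "C \<in> A" "x \<in> fst C"
  shows chart_inv_left: "chart_inv C (snd C x) = x"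
    and chart_in_model: "snd C x \<in> V"
  using chart_homeo[OF assms(1)] assms(2) openin_imp_subset[OF chart_image_openin[OF assms(1)]]
  unfolding homeomorphism_def by auto

lemma chart_image_openin_subset:
  assumes "C \<in> A" "open N"
  shows "openin (top_of_set V) (snd C ` (fst C \<inter> N))"
proof -
  have "openin (top_of_set (fst C)) (fst C \<inter> N)" using assms(2) by (simp add: openin_open_Int)
  then have "openin (top_of_set (snd C ` fst C)) (snd C ` (fst C \<inter> N))"
    using chart_homeo[OF assms(1)] homeomorphism_imp_open_map by blast
  then show ?thesis using chart_image_openin[OF assms(1)] openin_trans by blast
qed

lemma chart_image_open_nbhd:
  assumes "C \<in> A" "open N"
  obtains Ob where "open Ob" "snd C ` (fst C \<inter> N) = V \<inter> Ob"
  using chart_image_openin_subset[OF assms] unfolding openin_open by blast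

lemma chart_image_open:
  assumes "C \<in> A" "open N" "V = UNIV"
  shows "open (snd C ` (fst C \<inter> N))"
  using chart_image_openin_subset[OF assms(1,2)] assms(3) by simp

lemma transition_smooth: "C \<in> A \<Longrightarrow> D \<in> A \<Longrightarrow> smooth_on (snd C ` (fst C \<inter> fst D)) (in_charts C D id)"
  using atl unfolding smooth_atlas_def by blast

lemma smooth_fun_onD: "smooth_fun_on A S f \<Longrightarrow> C \<in> A \<Longrightarrow> smooth_on (snd C ` (fst C \<inter> S)) (f \<circ> chart_inv C)"
  unfolding smooth_fun_on_def by blast

lemma smooth_fun_on_mono_cong:
  assumes "smooth_fun_on A S f" "T \<subseteq> S" "\<And>x. x \<in> T \<Longrightarrow> f x = g x"
  shows "smooth_fun_on A T g"
  unfolding smooth_fun_on_def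
proof
  fix C assume C: "C \<in> A"
  show "smooth_on (snd C ` (fst C \<inter> T)) (g \<circ> chart_inv C)"
    by (rule smooth_on_mono_cong[OF smooth_fun_onD[OF assms(1) C]])
      (use assms(2,3) chart_inv_left[OF C] in auto)
qed

lemma smooth_fun_on_subset: "smooth_fun_on A S f \<Longrightarrow> T \<subseteq> S \<Longrightarrow> smooth_fun_on A T f"
  using smooth_fun_on_mono_cong[of S f T f] by simp

lemma smooth_fun_on_cong: "smooth_fun_on A S f \<Longrightarrow> (\<And>x. x \<in> S \<Longrightarrow> f x = g x) \<Longrightarrow> smooth_fun_on A S g"
  using smooth_fun_on_mono_cong[of S f S g] by simp

lemma smooth_fun_on_local:
  assumes "\<And>x. x \<in> S \<Longrightarrow> \<exists>N. open N \<and> x \<in> N \<and> smooth_fun_on A (S \<inter> N) f"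
  shows "smooth_fun_on A S f"
  unfolding smooth_fun_on_def
proof
  fix C assume C: "C \<in> A"
  show "smooth_on (snd C ` (fst C \<inter> S)) (f \<circ> chart_inv C)"
  proof (rule smooth_on_local)
    fix z assume "z \<in> snd C ` (fst C \<inter> S)"
    then obtain x where x: "x \<in> fst C" "x \<in> S" "z = snd C x" by blast
    then obtain N where N: "open N" "x \<in> N" "smooth_fun_on A (S \<inter> N) f" using assms by blast
    obtain Ob where Ob: "open Ob" "snd C ` (fst C \<inter> N) = V \<inter> Ob"
      using chart_image_open_nbhd[OF C N(1)] .
    have "snd C ` (fst C \<inter> S) \<inter> Ob \<subseteq> snd C ` (fst C \<inter> (S \<inter> N))"
    proof
      fix w assume w: "w \<in> snd C ` (fst C \<inter> S) \<inter> Ob"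
      then obtain a where a: "a \<in> fst C" "a \<in> S" "w = snd C a" by blast
      then have "w \<in> snd C ` (fst C \<inter> N)" using w Ob chart_in_model[OF C] by blast
      then obtain b where "b \<in> fst C" "b \<in> N" "snd C b = snd C a" using a by auto
      then have "a \<in> N" using chart_inv_left[OF C] a by metis
      then show "w \<in> snd C ` (fst C \<inter> (S \<inter> N))" using a by blast
    qed
    then show "\<exists>Ob. open Ob \<and> z \<in> Ob \<and> smooth_on (snd C ` (fst C \<inter> S) \<inter> Ob) (f \<circ> chart_inv C)"
      using Ob x N smooth_on_subset[OF smooth_fun_onD[OF N(3) C]] by (intro exI[of _ Ob]) blast
  qed
qed

lemma smooth_fun_on_const: "smooth_fun_on A S (\<lambda>_. c)"
  unfolding smooth_fun_on_def by (simp add: o_def smooth_on_const)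

lemma smooth_fun_on_add:
  "smooth_fun_on A S f \<Longrightarrow> smooth_fun_on A S g \<Longrightarrow> smooth_fun_on A S (\<lambda>x. f x + g x)"
  unfolding smooth_fun_on_def o_def by (simp add: smooth_on_add)

lemma smooth_fun_on_sum:
  "(\<And>i. i \<in> I \<Longrightarrow> smooth_fun_on A S (f i)) \<Longrightarrow> smooth_fun_on A S (\<lambda>x. \<Sum>i\<in>I. f i x)"
  unfolding smooth_fun_on_def o_def by (simp add: smooth_on_sum)

lemma smooth_fun_on_mult:
  fixes f g :: "'x \<Rightarrow> 'b::real_normed_algebra"
  shows "smooth_fun_on A S f \<Longrightarrow> smooth_fun_on A S g \<Longrightarrow> smooth_fun_on A S (\<lambda>x. f x * g x)"
  unfolding smooth_fun_on_def o_def by (simp add: smooth_on_mult)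

lemma smooth_fun_on_linear_comp:
  assumes "bounded_linear L" "smooth_fun_on A S f"
  shows "smooth_fun_on A S (\<lambda>x. L (f x))"
  using assms(2) unfolding smooth_fun_on_def o_def by (simp add: smooth_on_linear_comp[OF assms(1)])

lemma smooth_fun_on_inverse:
  fixes f :: "'x \<Rightarrow> 'b::real_normed_div_algebra"
  assumes "smooth_fun_on A S f" "\<And>x. x \<in> S \<Longrightarrow> f x \<noteq> 0"
  shows "smooth_fun_on A S (\<lambda>x. inverse (f x))"
  unfolding smooth_fun_on_def
proof
  fix C assume C: "C \<in> A"
  have "smooth_on (snd C ` (fst C \<inter> S)) (\<lambda>z. inverse ((f \<circ> chart_inv C) z))"
    by (rule smooth_on_inverse[OF smooth_fun_onD[OF assms(1) C]])
      (use assms(2) chart_inv_left[OF C] in auto)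
  then show "smooth_on (snd C ` (fst C \<inter> S)) ((\<lambda>x. inverse (f x)) \<circ> chart_inv C)"
    by (simp add: o_def)
qed

text \<open>Smoothness on a subset of one chart domain is checked in that chart only; the changes of charts
  carry it to the others.\<close>

lemma smooth_fun_on_chartI:
  assumes C: "C \<in> A" and s: "smooth_on (snd C ` (fst C \<inter> S)) (f \<circ> chart_inv C)"
  shows "smooth_fun_on A (fst C \<inter> S) f"
  unfolding smooth_fun_on_def
proof
  fix D assume D: "D \<in> A"
  have "smooth_on (snd D ` (fst D \<inter> (fst C \<inter> S))) (\<lambda>z. (f \<circ> chart_inv C) (in_charts D C id z))"
    by (rule smooth_on_comp[OF smooth_on_subset[OF transition_smooth[OF D C]] s])
      (auto simp: in_charts_def chart_inv_left[OF D])
  then show "smooth_on (snd D ` (fst D \<inter> (fst C \<inter> S))) (f \<circ> chart_inv D)"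
    by (rule smooth_on_cong) (auto simp: in_charts_def chart_inv_left[OF D] chart_inv_left[OF C])
qed

lemma smooth_fun_on_continuous:
  assumes "smooth_fun_on A S f" "open S"
  shows "continuous_on S f"
proof -
  have "continuous_on (fst C \<inter> S) f" if C: "C \<in> A" for C
  proof -
    have "continuous_on (fst C \<inter> S) (\<lambda>x. (f \<circ> chart_inv C) (snd C x))"
      by (rule continuous_on_compose2[OF smooth_on_continuous[OF smooth_fun_onD[OF assms(1) C]]])
        (use homeomorphism_cont1[OF chart_homeo[OF C]] in \<open>auto intro: continuous_on_subset\<close>)
    then show ?thesis by (rule continuous_on_cong[THEN iffD1, rotated -1]) (auto simp: chart_inv_left[OF C])
  qed
  then have "continuous_on (\<Union>C\<in>A. fst C \<inter> S) f"
    using assms(2) chart_open by (intro continuous_on_open_UN) auto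
  moreover have "(\<Union>C\<in>A. fst C \<inter> S) = S" using chart_exists by blast
  ultimately show ?thesis by simp
qed

lemma smooth_fun_extend_zero:
  assumes "smooth_fun_on A U f" "open U" "closed K" "K \<subseteq> U" "\<And>x. x \<notin> K \<Longrightarrow> f x = 0"
  shows "smooth_fun_on A S f"
proof (rule smooth_fun_on_local)
  fix x assume "x \<in> S"
  show "\<exists>N. open N \<and> x \<in> N \<and> smooth_fun_on A (S \<inter> N) f"
  proof (cases "x \<in> K")
    case True
    then show ?thesis using assms smooth_fun_on_subset[OF assms(1), of "S \<inter> U"] by blast
  next
    case False
    have "smooth_fun_on A (S \<inter> - K) f"
      by (rule smooth_fun_on_cong[OF smooth_fun_on_const[of _ 0]]) (use assms(5) in auto)
    then show ?thesis using False assms(3) by (intro exI[of _ "- K"]) auto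
  qed
qed

text \<open>A flat function of the squared distance from the centre of a small ball in a chart; the
  closed ball is compact, hence so is its preimage, and in a Hausdorff space the function can be
  continued by zero.\<close>

lemma bump_function:
  assumes U: "open U" "x \<in> U"
  obtains f :: "'x \<Rightarrow> real" and K where "smooth_fun_on A UNIV f" "f x > 0" "\<And>z. f z \<ge> 0"
    "compact K" "K \<subseteq> U" "\<And>z. z \<notin> K \<Longrightarrow> f z = 0"
proof -
  obtain C where C: "C \<in> A" "x \<in> fst C" using chart_exists .
  obtain Ob where Ob: "open Ob" "snd C ` (fst C \<inter> U) = V \<inter> Ob"
    using chart_image_open_nbhd[OF C(1) U(1)] .
  define p where "p = snd C x"
  have "p \<in> Ob" using Ob(2) U(2) C unfolding p_def by blast
  then obtain r where r: "r > 0" "cball p r \<subseteq> Ob" using Ob(1) open_contains_cball by blast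
  define K where "K = chart_inv C ` (V \<inter> cball p r)"
  define f where "f z = (if z \<in> fst C then flat 0 (r\<^sup>2 - (snd C z - p) \<bullet> (snd C z - p)) else 0)" for z
  have clV: "closed V" using model unfolding model_space_def by auto
  have sub: "V \<inter> cball p r \<subseteq> snd C ` (fst C \<inter> U)" using Ob r by blast
  have "continuous_on (V \<inter> cball p r) (chart_inv C)"
    using homeomorphism_cont2[OF chart_homeo[OF C(1)]] sub by (auto intro: continuous_on_subset)
  then have K: "compact K" unfolding K_def
    using clV by (intro compact_continuous_image) (auto simp: closed_Int_compact)
  have KU: "K \<subseteq> fst C \<inter> U" unfolding K_def using sub chart_inv_left[OF C(1)] by fastforce
  have f0: "f z = 0" if "z \<notin> K" for z
  proof (cases "z \<in> fst C")
    case True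
    have "snd C z \<notin> cball p r"
      using that True chart_in_model[OF C(1) True] chart_inv_left[OF C(1) True] unfolding K_def
      by (metis IntI imageI)
    then have "r < norm (snd C z - p)" by (simp add: dist_norm norm_minus_commute)
    then have "r\<^sup>2 < (snd C z - p) \<bullet> (snd C z - p)"
      using r(1) by (simp add: dot_square_norm power_strict_mono)
    then show ?thesis by (simp add: f_def flat_def)
  qed (simp add: f_def)
  have "smooth_on (snd C ` (fst C \<inter> UNIV)) (\<lambda>z. flat 0 (r\<^sup>2 - (z - p) \<bullet> (z - p)))"
  proof -
    have "smooth_on UNIV (\<lambda>z::real^'n. z)"
      by (intro smooth_onI_open Ck_on_bounded_linear[OF bounded_linear_ident] open_UNIV)
    then have *: "smooth_on UNIV (\<lambda>z::real^'n. z + - p)"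
      by (intro smooth_on_add smooth_on_const)
    have "smooth_on UNIV (\<lambda>z. r\<^sup>2 + - ((z + - p) \<bullet> (z + - p)))"
      by (rule smooth_on_add[OF smooth_on_const
          smooth_on_linear_comp[OF bounded_linear_minus[OF bounded_linear_ident]
          smooth_on_bilinear[OF bounded_bilinear_inner * *]]])
    then have "smooth_on UNIV (\<lambda>z. flat 0 (r\<^sup>2 + - ((z + - p) \<bullet> (z + - p))))"
      by (rule smooth_on_comp[where T = UNIV]) (auto intro: smooth_onI_open Ck_on_flat)
    then show ?thesis by (rule smooth_on_mono_cong) auto
  qed
  then have "smooth_on (snd C ` (fst C \<inter> UNIV)) (f \<circ> chart_inv C)"
    by (rule smooth_on_cong) (auto simp: f_def chart_inv_left[OF C(1)])
  then have "smooth_fun_on A (fst C \<inter> UNIV) f" by (rule smooth_fun_on_chartI[OF C(1)])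
  then have "smooth_fun_on A (fst C) f" by simp
  then have "smooth_fun_on A UNIV f"
    by (rule smooth_fun_extend_zero[OF _ chart_open[OF C(1)] compact_imp_closed[OF K] _ f0])
      (use KU in auto)
  moreover have "f x > 0" using r(1) C by (simp add: f_def p_def flat_def)
  moreover have "f z \<ge> 0" for z by (simp add: f_def flat_def)
  ultimately show thesis using that K KU f0 by blast
qed

end

subsection \<open>Maps\<close>

lemma smooth_map_onD:
  "smooth_map_on A B S F \<Longrightarrow> C \<in> A \<Longrightarrow> D \<in> B \<Longrightarrow> smooth_on (snd C ` (fst C \<inter> S \<inter> F -` fst D)) (in_charts C D F)"
  unfolding smooth_map_on_def by blast

lemma smooth_map_on_cont: "smooth_map_on A B S F \<Longrightarrow> continuous_on S F"
  unfolding smooth_map_on_def by blast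

lemma (in manifold) smooth_map_on_mono_cong:
  assumes "smooth_map_on A B S F" "T \<subseteq> S" "\<And>x. x \<in> T \<Longrightarrow> F x = G x"
  shows "smooth_map_on A B T G"
  unfolding smooth_map_on_def
proof (intro conjI ballI)
  show "continuous_on T G"
    using assms smooth_map_on_cont by (metis continuous_on_cong continuous_on_subset)
  fix C D assume C: "C \<in> A" and D: "D \<in> B"
  show "smooth_on (snd C ` (fst C \<inter> T \<inter> G -` fst D)) (in_charts C D G)"
    by (rule smooth_on_mono_cong[OF smooth_map_onD[OF assms(1) C D]])
      (use assms(2,3) chart_inv_left[OF C] in \<open>auto simp: in_charts_def\<close>)
qed

lemma (in manifold) smooth_map_on_subset: "smooth_map_on A B S F \<Longrightarrow> T \<subseteq> S \<Longrightarrow> smooth_map_on A B T F"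
  using smooth_map_on_mono_cong[of B S F T F] by simp

lemma (in manifold) smooth_map_on_id: "smooth_map_on A A S (\<lambda>x. x)"
  unfolding smooth_map_on_def
proof (intro conjI ballI)
  fix C D assume C: "C \<in> A" and D: "D \<in> A"
  show "smooth_on (snd C ` (fst C \<inter> S \<inter> (\<lambda>x. x) -` fst D)) (in_charts C D (\<lambda>x. x))"
    by (rule smooth_on_mono_cong[OF transition_smooth[OF C D]]) (auto simp: in_charts_def)
qed simp

locale two_manifolds = MA: manifold V A + MB: manifold V B
  for V :: "(real^'n::finite) set"
    and A :: "('x::{t2_space, second_countable_topology}, 'n) chart set"
    and B :: "('y::{t2_space, second_countable_topology}, 'n) chart set"
begin

lemma smooth_fun_on_comp:
  assumes F: "smooth_map_on A B S F" and f: "smooth_fun_on B T f" and sub: "F ` S \<subseteq> T"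
    and S: "open S"
  shows "smooth_fun_on A S (\<lambda>x. f (F x))"
proof (rule MA.smooth_fun_on_local)
  fix x assume x: "x \<in> S"
  obtain D where D: "D \<in> B" "F x \<in> fst D" using MB.chart_exists .
  obtain C where C: "C \<in> A" "x \<in> fst C" using MA.chart_exists .
  have o: "open (S \<inter> F -` fst D)"
    using continuous_open_preimage[OF smooth_map_on_cont[OF F] S MB.chart_open[OF D(1)]] .
  have "smooth_on (snd C ` (fst C \<inter> (S \<inter> F -` fst D))) (\<lambda>z. (f \<circ> chart_inv D) (in_charts C D F z))"
    by (rule smooth_on_comp[OF smooth_on_subset[OF smooth_map_onD[OF F C(1) D(1)]]
          MB.smooth_fun_onD[OF f D(1)]])
      (use sub in \<open>auto simp: in_charts_def MA.chart_inv_left[OF C(1)]\<close>)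
  then have "smooth_on (snd C ` (fst C \<inter> (S \<inter> F -` fst D))) ((\<lambda>x. f (F x)) \<circ> chart_inv C)"
    by (rule smooth_on_cong)
      (auto simp: in_charts_def MA.chart_inv_left[OF C(1)] MB.chart_inv_left[OF D(1)])
  from MA.smooth_fun_on_chartI[OF C(1) this]
  have "smooth_fun_on A (S \<inter> (fst C \<inter> (S \<inter> F -` fst D))) (\<lambda>x. f (F x))"
    by (rule MA.smooth_fun_on_subset) auto
  then show "\<exists>N. open N \<and> x \<in> N \<and> smooth_fun_on A (S \<inter> N) (\<lambda>x. f (F x))"
    using o x C D MA.chart_open[OF C(1)] by (intro exI[of _ "fst C \<inter> (S \<inter> F -` fst D)"]) auto
qed

end

lemma smooth_map_on_comp:
  assumes "two_manifolds V A B" "smooth_map_on A B S F" "smooth_map_on B E T G" "F ` S \<subseteq> T" "open S"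
    and E: "smooth_atlas V E"
  shows "smooth_map_on A E S (\<lambda>x. G (F x))"
  unfolding smooth_map_on_def
proof (intro conjI ballI)
  interpret two_manifolds V A B by fact
  show cont: "continuous_on S (\<lambda>x. G (F x))"
    using assms smooth_map_on_cont by (metis continuous_on_compose2)
  fix C H assume C: "C \<in> A" and H: "H \<in> E"
  show "smooth_on (snd C ` (fst C \<inter> S \<inter> (\<lambda>x. G (F x)) -` fst H)) (in_charts C H (\<lambda>x. G (F x)))"
  proof (rule smooth_on_local)
    fix z assume "z \<in> snd C ` (fst C \<inter> S \<inter> (\<lambda>x. G (F x)) -` fst H)"
    then obtain x where x: "x \<in> fst C" "x \<in> S" "G (F x) \<in> fst H" "z = snd C x" by blast
    obtain D where D: "D \<in> B" "F x \<in> fst D" using MB.chart_exists .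
    let ?N = "S \<inter> F -` fst D"
    have o: "open ?N"
      using continuous_open_preimage[OF smooth_map_on_cont[OF assms(2)] assms(5) MB.chart_open[OF D(1)]] .
    obtain Ob where Ob: "open Ob" "snd C ` (fst C \<inter> ?N) = V \<inter> Ob"
      using MA.chart_image_open_nbhd[OF C o] .
    have *: "F a \<in> fst D" if "a \<in> fst C" "a \<in> S" "snd C a \<in> Ob" for a
    proof -
      have "snd C a \<in> snd C ` (fst C \<inter> ?N)" using that Ob(2) MA.chart_in_model[OF C] by blast
      then obtain b where "b \<in> fst C" "b \<in> ?N" "snd C b = snd C a" by auto
      then show ?thesis using MA.chart_inv_left[OF C] that(1) by (metis IntD2 vimageD)
    qed
    have "smooth_on (snd C ` (fst C \<inter> S \<inter> (\<lambda>x. G (F x)) -` fst H \<inter> F -` fst D))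
        (\<lambda>z. in_charts D H G (in_charts C D F z))"
      by (rule smooth_on_comp[OF smooth_on_subset[OF smooth_map_onD[OF assms(2) C D(1)]]
            smooth_map_onD[OF assms(3) D(1) H]])
        (use assms(4) in \<open>auto simp: in_charts_def MA.chart_inv_left[OF C]\<close>)
    then have "smooth_on (snd C ` (fst C \<inter> S \<inter> (\<lambda>x. G (F x)) -` fst H) \<inter> Ob)
        (in_charts C H (\<lambda>x. G (F x)))"
      by (rule smooth_on_mono_cong)
        (use * in \<open>auto simp: in_charts_def MA.chart_inv_left[OF C] MB.chart_inv_left[OF D(1)]\<close>)
    moreover have "z \<in> Ob" using x Ob(2) D by blast
    ultimately show "\<exists>N. open N \<and> z \<in> N \<and>
        smooth_on (snd C ` (fst C \<inter> S \<inter> (\<lambda>x. G (F x)) -` fst H) \<inter> N) (in_charts C H (\<lambda>x. G (F x)))"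
      using Ob(1) by blast
  qed
qed

subsection \<open>Jacobians in charts\<close>

text \<open>On the model space \<open>{0}\<close> of dimension zero the tangent map is the identity and all Jacobians are
  one, which makes the rules below hold in every dimension.\<close>

lemma jacobian_zero: "jacobian {0} F z = 1"
  by (simp add: jacobian_def tderiv_def matrix_id_mat_1)

lemma (in two_manifolds) in_charts_has_derivative:
  assumes "V = UNIV" "smooth_map_on A B U F" "open U" "C \<in> A" "D \<in> B" "x \<in> fst C" "x \<in> U" "F x \<in> fst D"
  shows "(in_charts C D F has_derivative frechet_derivative (in_charts C D F) (at (snd C x))) (at (snd C x))"
proof -
  have o: "open (U \<inter> F -` fst D)"
    using continuous_open_preimage[OF smooth_map_on_cont[OF assms(2)] assms(3) MB.chart_open[OF assms(5)]] .
  have "open (snd C ` (fst C \<inter> U \<inter> F -` fst D))"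
    using MA.chart_image_open[OF assms(4) o assms(1)] by (simp add: Int_assoc)
  from smooth_on_has_derivative[OF this smooth_map_onD[OF assms(2,4,5)], of "snd C x"]
  show ?thesis using assms by auto
qed

lemma (in two_manifolds) jacobian_smooth:
  assumes "smooth_map_on A B U F" "open U" "C \<in> A" "D \<in> B"
  shows "smooth_on (snd C ` (fst C \<inter> U \<inter> F -` fst D)) (\<lambda>z. jacobian V (in_charts C D F) z)"
proof -
  have o: "open (U \<inter> F -` fst D)"
    using continuous_open_preimage[OF smooth_map_on_cont[OF assms(1)] assms(2) MB.chart_open[OF assms(4)]] .
  consider "V = UNIV" "V \<noteq> {0}" | "V = {0}" using MA.model unfolding model_space_def by blast
  then show ?thesis
  proof cases
    case 1
    have "open (snd C ` (fst C \<inter> U \<inter> F -` fst D))"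
      using MA.chart_image_open[OF assms(3) o 1(1)] by (simp add: Int_assoc)
    from smooth_on_jacobian[OF this smooth_map_onD[OF assms(1,3,4)]]
    show ?thesis using 1(2) by (simp add: jacobian_def tderiv_def)
  qed (simp add: jacobian_zero smooth_on_const)
qed

lemma (in two_manifolds) jacobian_cong:
  assumes "smooth_map_on A B U F" "open U" "x \<in> U" "\<And>z. z \<in> U \<Longrightarrow> F z = G z"
    and "C \<in> A" "D \<in> B" "x \<in> fst C" "F x \<in> fst D"
  shows "jacobian V (in_charts C D F) (snd C x) = jacobian V (in_charts C D G) (snd C x)"
proof -
  consider "V = UNIV" "V \<noteq> {0}" | "V = {0}" using MA.model unfolding model_space_def by blast
  then show ?thesis
  proof cases
    case 1
    have "frechet_derivative (in_charts C D G) (at (snd C x)) = frechet_derivative (in_charts C D F) (at (snd C x))"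
      by (rule frechet_derivative_cong_open(2)[where W = "snd C ` (fst C \<inter> U)"])
        (use assms MA.chart_image_open[OF assms(5) assms(2) 1(1)]
          in_charts_has_derivative[OF 1(1) assms(1,2,5,6,7,3,8)] in
          \<open>auto simp: in_charts_def MA.chart_inv_left differentiable_def\<close>)
    then show ?thesis using 1(2) by (simp add: jacobian_def tderiv_def)
  qed (simp add: jacobian_zero)
qed

lemma (in manifold) jacobian_id:
  assumes "C \<in> A" "x \<in> fst C"
  shows "jacobian V (in_charts C C (\<lambda>x. x)) (snd C x) = 1"
proof -
  consider "V = UNIV" "V \<noteq> {0}" | "V = {0}" using model unfolding model_space_def by blast
  then show ?thesis
  proof cases
    case 1
    have "frechet_derivative (in_charts C C (\<lambda>x. x)) (at (snd C x)) = frechet_derivative (\<lambda>z. z) (at (snd C x))"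
      by (rule frechet_derivative_cong_open(2)[where W = "snd C ` (fst C \<inter> UNIV)"])
        (use assms chart_image_open[OF assms(1) open_UNIV 1(1)] in
          \<open>auto simp: in_charts_def chart_inv_left\<close>)
    also have "\<dots> = (\<lambda>z. z)"
      using frechet_derivative_at[OF has_derivative_ident] by metis
    finally show ?thesis using 1(2) by (simp add: jacobian_def tderiv_def matrix_id_mat_1[unfolded id_def])
  qed (simp add: jacobian_zero)
qed

lemma jacobian_chain:
  assumes "two_manifolds V A B" "two_manifolds V B E"
    and F: "smooth_map_on A B U F" "open U" "x \<in> U"
    and G: "smooth_map_on B E W G" "open W" "F x \<in> W"
    and C: "C \<in> A" "x \<in> fst C" and D: "D \<in> B" "F x \<in> fst D" and H: "H \<in> E" "G (F x) \<in> fst H"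
  shows "jacobian V (in_charts C H (\<lambda>x. G (F x))) (snd C x) =
    jacobian V (in_charts C D F) (snd C x) * jacobian V (in_charts D H G) (snd D (F x))"
proof -
  interpret I: two_manifolds V A B by fact
  interpret J: two_manifolds V B E by fact
  consider "V = UNIV" "V \<noteq> {0}" | "V = {0}" using I.MA.model unfolding model_space_def by blast
  then show ?thesis
  proof cases
    case 1
    let ?f = "in_charts C D F" and ?g = "in_charts D H G"
    let ?N = "U \<inter> F -` fst D"
    have o: "open ?N"
      using continuous_open_preimage[OF smooth_map_on_cont[OF F(1)] F(2) I.MB.chart_open[OF D(1)]] .
    have fx: "?f (snd C x) = snd D (F x)"
      by (simp add: in_charts_def I.MA.chart_inv_left[OF C])
    note f = I.in_charts_has_derivative[OF 1(1) F(1,2) C(1) D(1) C(2) F(3) D(2)]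
    note g = J.in_charts_has_derivative[OF 1(1) G(1,2) D(1) H(1) D(2) G(3) H(2)]
    let ?f' = "frechet_derivative ?f (at (snd C x))" and ?g' = "frechet_derivative ?g (at (snd D (F x)))"
    have c: "((\<lambda>z. ?g (?f z)) has_derivative (\<lambda>v. ?g' (?f' v))) (at (snd C x))"
      using has_derivative_compose[OF f] g fx by simp
    have "frechet_derivative (in_charts C H (\<lambda>x. G (F x))) (at (snd C x)) =
        frechet_derivative (\<lambda>z. ?g (?f z)) (at (snd C x))"
      by (rule frechet_derivative_cong_open(2)[where W = "snd C ` (fst C \<inter> ?N)"])
        (use C F D c I.MA.chart_image_open[OF C(1) o 1(1)] in
          \<open>auto simp: in_charts_def I.MA.chart_inv_left I.MB.chart_inv_left differentiable_def\<close>)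
    also have "\<dots> = ?g' \<circ> ?f'" using frechet_derivative_at[OF c] by (simp add: o_def)
    finally have "matrix (frechet_derivative (in_charts C H (\<lambda>x. G (F x))) (at (snd C x))) =
        matrix ?g' ** matrix ?f'"
      using matrix_compose f g has_derivative_linear by metis
    then show ?thesis using 1(2) by (simp add: jacobian_def tderiv_def det_mul mult.commute)
  qed (simp add: jacobian_zero)
qed

section \<open>Integration against volume forms\<close>

lemma homeomorphism_borel_image:
  fixes f :: "'a::topological_space \<Rightarrow> 'b::topological_space"
  assumes h: "homeomorphism T T' f g" and T': "T' \<in> sets borel" and S: "S \<in> sets borel" "S \<subseteq> T"
  shows "f ` S \<in> sets borel"
proof -
  have "f ` S = g -` S \<inter> T'"
    using h S(2) unfolding homeomorphism_def by force
  moreover have "g -` S \<inter> T' \<in> sets (restrict_space borel T')"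
    using measurable_sets[OF borel_measurable_continuous_on_restrict[OF homeomorphism_cont2[OF h]] S(1)]
    by (simp add: space_restrict_space)
  ultimately show ?thesis using T' by (simp add: sets_restrict_space_iff)
qed

text \<open>The change of variables formula for absolutely integrable functions also says that one side is
  absolutely integrable if and only if the other one is; for a nonnegative integrand the remaining
  case is therefore that both integrals are infinite.\<close>

lemma nn_integral_change_of_variables:
  fixes f :: "real^'n::{finite,wellorder} \<Rightarrow> real" and g :: "real^'n::_ \<Rightarrow> real^'n::_"
  assumes S: "S \<in> sets lebesgue"
    and der: "\<And>x. x \<in> S \<Longrightarrow> (g has_derivative g' x) (at x within S)"
    and inj: "inj_on g S"
    and nn: "\<And>z. f z \<ge> 0"
    and m1: "(\<lambda>z. indicator (g ` S) z * f z) \<in> borel_measurable lebesgue"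
    and m2: "(\<lambda>z. indicator S z * (\<bar>det (matrix (g' z))\<bar> * f (g z))) \<in> borel_measurable lebesgue"
  shows "(\<integral>\<^sup>+z\<in>g ` S. ennreal (f z) \<partial>lebesgue) =
    (\<integral>\<^sup>+z\<in>S. ennreal (\<bar>det (matrix (g' z))\<bar> * f (g z)) \<partial>lebesgue)"
proof -
  let ?h = "\<lambda>z. \<bar>det (matrix (g' z))\<bar> * f (g z)"
  have iff: "?h absolutely_integrable_on S \<and> integral S ?h = b \<longleftrightarrow>
      f absolutely_integrable_on (g ` S) \<and> integral (g ` S) f = b" for b
    using has_absolute_integral_change_of_variables[OF S der inj, of "\<lambda>z. vec (f z) :: real^1" "vec b"]
    by (simp add: absolutely_integrable_on_1_iff integral_on_1_eq)
  have *: "(\<integral>\<^sup>+z\<in>T. ennreal (k z) \<partial>lebesgue) = ennreal (integral T k)"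
    if "k absolutely_integrable_on T" "\<And>z. k z \<ge> 0" for T and k :: "real^'n::_ \<Rightarrow> real"
  proof -
    have "(\<integral>\<^sup>+z\<in>T. ennreal (k z) \<partial>lebesgue) = (\<integral>\<^sup>+z. ennreal (indicator T z *\<^sub>R k z) \<partial>lebesgue)"
      by (intro nn_integral_cong) (auto simp: indicator_def)
    also have "\<dots> = ennreal (LINT z:T|lebesgue. k z)"
      using that unfolding set_integrable_def set_lebesgue_integral_def
      by (intro nn_integral_eq_integral) auto
    finally show ?thesis using set_lebesgue_integral_eq_integral(2)[OF that(1)] by simp
  qed
  have fin: "k absolutely_integrable_on T"
    if "(\<integral>\<^sup>+z\<in>T. ennreal (k z) \<partial>lebesgue) < \<infinity>" "\<And>z. k z \<ge> 0"
      "(\<lambda>z. indicator T z * k z) \<in> borel_measurable lebesgue" for T and k :: "real^'n::_ \<Rightarrow> real"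
  proof -
    have "(\<integral>\<^sup>+z\<in>T. ennreal (k z) \<partial>lebesgue) = (\<integral>\<^sup>+z. ennreal (indicator T z * k z) \<partial>lebesgue)"
      by (intro nn_integral_cong) (auto simp: indicator_def)
    then have "integrable lebesgue (\<lambda>z. indicator T z * k z)"
      using that by (intro integrableI_nonneg) auto
    then show ?thesis unfolding set_integrable_def by simp
  qed
  have hn: "?h z \<ge> 0" for z using nn by simp
  show ?thesis
  proof (cases "(\<integral>\<^sup>+z\<in>g ` S. ennreal (f z) \<partial>lebesgue) < \<infinity>")
    case True
    then have "f absolutely_integrable_on (g ` S)" using fin nn m1 by blast
    then show ?thesis using iff[of "integral (g ` S) f"] *[of "g ` S" f] *[of S ?h] nn hn by simp
  next
    case False
    have inf: "a = \<infinity>" if "\<not> a < \<infinity>" for a :: ennreal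
      using that by (metis infinity_ennreal_def less_top)
    have "\<not> (\<integral>\<^sup>+z\<in>S. ennreal (?h z) \<partial>lebesgue) < \<infinity>"
    proof
      assume "(\<integral>\<^sup>+z\<in>S. ennreal (?h z) \<partial>lebesgue) < \<infinity>"
      then have "?h absolutely_integrable_on S" using fin[of ?h S] hn m2 by blast
      then have "f absolutely_integrable_on (g ` S)" using iff[of "integral S ?h"] by blast
      then show False using False *[of "g ` S" f] nn by simp
    qed
    from inf[OF this] show ?thesis using inf[OF False] by simp
  qed
qed

definition chart_measure ::
  "(real^'n) set \<Rightarrow> ('x, 'n) top_form \<Rightarrow> ('x, 'n) chart \<Rightarrow> (real^'n::finite) measure" where
  "chart_measure V \<omega> C = density (model_measure V)
     (\<lambda>z. ennreal (indicator (snd C ` fst C) z * \<bar>\<omega> C (chart_inv C z)\<bar>))"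

locale volume_manifold = manifold V A
  for V :: "(real^'n::{finite,wellorder}) set"
    and A :: "('x::{t2_space, second_countable_topology}, 'n) chart set" +
  fixes \<omega> :: "('x, 'n) top_form"
  assumes compact_space: "compact (UNIV :: 'x set)"
    and form_cont: "\<And>C. C \<in> A \<Longrightarrow> continuous_on (snd C ` fst C) (\<lambda>z. \<omega> C (chart_inv C z))"
    and form_transf: "pullback_form V A A id \<omega> \<omega>"
begin

lemma chart_image_sets:
  assumes "C \<in> A" "S \<in> sets borel" "S \<subseteq> fst C"
  shows "snd C ` S \<in> sets (model_measure V)"
proof (cases "V = {0}")
  case True
  then show ?thesis using chart_in_model[OF assms(1)] assms(3) by (auto simp: model_measure_def)
next
  case False
  then have "V = UNIV" using model by (simp add: model_space_def)
  then have "open (snd C ` fst C)" using chart_image_open[OF assms(1) open_UNIV] by simp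
  then have "snd C ` S \<in> sets borel"
    using homeomorphism_borel_image[OF chart_homeo[OF assms(1)] _ assms(2,3)] by simp
  then show ?thesis using False by (simp add: model_measure_def)
qed

lemma chart_density_measurable:
  assumes "C \<in> A" "S \<in> sets borel" "S \<subseteq> fst C"
  shows "(\<lambda>z. indicator (snd C ` S) z * \<bar>\<omega> C (chart_inv C z)\<bar>) \<in> borel_measurable (model_measure V)"
proof (cases "V = {0}")
  case False
  have c: "continuous_on (snd C ` S) (\<lambda>z. \<bar>\<omega> C (chart_inv C z)\<bar>)"
    using continuous_on_subset[OF form_cont[OF assms(1)]] assms(3) by (intro continuous_on_rabs) blast
  show ?thesis
    using borel_measurable_continuous_on_indicator[OF _ c] chart_image_sets[OF assms] False
    by (simp add: model_measure_def)
qed (simp add: model_measure_def)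

lemma emeasure_chart_measure:
  assumes "C \<in> A" "S \<in> sets borel" "S \<subseteq> fst C"
  shows "emeasure (chart_measure V \<omega> C) (snd C ` S) =
    (\<integral>\<^sup>+z\<in>snd C ` S. ennreal \<bar>\<omega> C (chart_inv C z)\<bar> \<partial>model_measure V)"
proof -
  have "emeasure (chart_measure V \<omega> C) (snd C ` S) =
      (\<integral>\<^sup>+z. ennreal (indicator (snd C ` fst C) z * \<bar>\<omega> C (chart_inv C z)\<bar>) * indicator (snd C ` S) z \<partial>model_measure V)"
    unfolding chart_measure_def
    using chart_density_measurable[OF assms(1)] chart_open[OF assms(1)] chart_image_sets[OF assms]
    by (subst emeasure_density) auto
  also have "\<dots> = (\<integral>\<^sup>+z\<in>snd C ` S. ennreal \<bar>\<omega> C (chart_inv C z)\<bar> \<partial>model_measure V)"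
    using assms(3) by (intro nn_integral_cong) (auto simp: indicator_def)
  finally show ?thesis .
qed

text \<open>Finitely many chart domains cover the compact space; removing from each the earlier ones makes
  them disjoint.\<close>

lemma chart_partition:
  obtains n :: nat and C P where "\<And>i. i < n \<Longrightarrow> C i \<in> A" "\<And>i. i < n \<Longrightarrow> P i \<subseteq> fst (C i)"
    "\<And>i. i < n \<Longrightarrow> P i \<in> sets borel" "disjoint_family_on P {..<n}" "(\<Union>i<n. P i) = UNIV"
proof -
  have "UNIV \<subseteq> \<Union> (fst ` A)" using chart_exists by blast
  then obtain F where "F \<subseteq> fst ` A" "finite F" "UNIV \<subseteq> \<Union> F"
    using compactE[OF compact_space, of "fst ` A"] chart_open by blast
  then obtain A' where A': "finite A'" "A' \<subseteq> A" "(\<Union>C\<in>A'. fst C) = UNIV"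
    by (metis finite_subset_image top.extremum_uniqueI)
  obtain C and n :: nat where C: "A' = C ` {i. i < n}"
    using finite_imp_nat_seg_image_inj_on[OF A'(1)] by metis
  define P where "P i = fst (C i) - (\<Union>j<i. fst (C j))" for i
  have CA: "C i \<in> A" if "i < n" for i using C A'(2) that by blast
  have "(\<Union>i<n. P i) = UNIV"
  proof -
    have "x \<in> (\<Union>i<n. P i)" for x
    proof -
      have ex: "\<exists>i. i < n \<and> x \<in> fst (C i)" using A'(3) C by fastforce
      define k where "k = (LEAST i. i < n \<and> x \<in> fst (C i))"
      have "k < n \<and> x \<in> fst (C k)" using LeastI_ex[OF ex] unfolding k_def by blast
      moreover have "x \<notin> fst (C j)" if "j < k" for j
        using not_less_Least[of j "\<lambda>i. i < n \<and> x \<in> fst (C i)"] that calculation unfolding k_def by auto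
      ultimately show ?thesis unfolding P_def by blast
    qed
    then show ?thesis by blast
  qed
  moreover have "disjoint_family_on P {..<n}"
  proof -
    have "P i \<inter> P j = {}" if "i < j" for i j unfolding P_def using that by blast
    then show ?thesis unfolding disjoint_family_on_def by (metis Int_commute linorder_neqE_nat)
  qed
  moreover have "P i \<in> sets borel" if "i < n" for i
    unfolding P_def using CA chart_open that by (intro sets.Diff sets.finite_UN) (auto intro: borel_open)
  ultimately show thesis using that[of n C P] CA unfolding P_def by blast
qed

end

lemma model_measure_eq: "model_measure UNIV = (lborel :: (real^'n::finite) measure)"
proof -
  have "(UNIV :: (real^'n) set) \<noteq> {0}"
    by (metis UNIV_I axis_eq_0_iff singletonD zero_neq_one)
  then show ?thesis by (simp add: model_measure_def)
qed

locale two_volume_manifolds = MA: volume_manifold V A \<theta> + MB: volume_manifold V B \<omega>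
  for V :: "(real^'n::{finite,wellorder}) set"
    and A :: "('x::{t2_space, second_countable_topology}, 'n) chart set"
    and B :: "('y::{t2_space, second_countable_topology}, 'n) chart set"
    and \<theta> :: "('x, 'n) top_form" and \<omega> :: "('y, 'n) top_form"
begin

sublocale two_manifolds V A B ..

text \<open>For \<open>\<theta> = F\<^sup>*\<omega>\<close> the density of \<open>\<theta>\<close> is that of \<open>\<omega>\<close> times the Jacobian of \<open>F\<close> in charts, so the
  claim is the change of variables formula. With \<open>F = id\<close> it says that the measures of two charts
  agree on the overlap.\<close>

lemma chart_measure_pullback:
  assumes F: "smooth_map_on A B U F" "open U" "inj_on F U" and pb: "pullback_form V A B F \<omega> \<theta>"
    and C: "C \<in> A" and D: "D \<in> B" and S: "S \<in> sets borel" "S \<subseteq> U" "S \<subseteq> fst C"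
    and FS: "F ` S \<in> sets borel" "F ` S \<subseteq> fst D"
  shows "emeasure (chart_measure V \<omega> D) (snd D ` (F ` S)) = emeasure (chart_measure V \<theta> C) (snd C ` S)"
proof -
  have \<theta>: "\<theta> C x = jacobian V (in_charts C D F) (snd C x) * \<omega> D (F x)" if "x \<in> S" for x
    using pb C D that S FS unfolding pullback_form_def by blast
  let ?f = "\<lambda>z. \<bar>\<omega> D (chart_inv D z)\<bar>" and ?g = "in_charts C D F"
  have g: "?g (snd C x) = snd D (F x)" if "x \<in> S" for x
    using that S(3) MA.chart_inv_left[OF C] by (auto simp: in_charts_def)
  have gS: "?g ` (snd C ` S) = snd D ` (F ` S)" using g by (force simp: image_image)
  have inj: "inj_on ?g (snd C ` S)"
  proof (rule inj_onI)
    fix z w assume "z \<in> snd C ` S" "w \<in> snd C ` S" "?g z = ?g w"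
    then obtain a b where ab: "a \<in> S" "b \<in> S" "z = snd C a" "w = snd C b" by blast
    then have "snd D (F a) = snd D (F b)" using g \<open>?g z = ?g w\<close> by simp
    then have "F a = F b" using ab FS(2) MB.chart_inv_left[OF D] by (metis imageI subsetD)
    then show "z = w" using F(3) ab S(2) by (metis inj_onD subsetD)
  qed
  have "(\<integral>\<^sup>+z\<in>snd D ` (F ` S). ennreal (?f z) \<partial>model_measure V) =
      (\<integral>\<^sup>+z\<in>snd C ` S. ennreal \<bar>\<theta> C (chart_inv C z)\<bar> \<partial>model_measure V)"
  proof (cases "V = {0}")
    case True
    have z: "snd C x = 0" "snd D (F x) = 0" if "x \<in> S" for x
    proof -
      have "x \<in> fst C" "F x \<in> fst D" using that S(3) FS(2) by auto
      then show "snd C x = 0" "snd D (F x) = 0"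
        using MA.chart_in_model[OF C] MB.chart_in_model[OF D] True by auto
    qed
    have "x = y" if "x \<in> S" "y \<in> S" for x y
      using that z[of x] z[of y] S(3) MA.chart_inv_left[OF C] by (metis subsetD)
    then have "S = {} \<or> (\<exists>x. S = {x})" by blast
    with z have "S = {} \<or> (\<exists>x. S = {x} \<and> snd C x = 0 \<and> snd D (F x) = 0)" by blast
    then consider "S = {}" | x where "S = {x}" "snd C x = 0" "snd D (F x) = 0" by blast
    then show ?thesis
    proof cases
      case 2
      have "chart_inv C 0 = x" "chart_inv D 0 = F x"
        using 2 MA.chart_inv_left[OF C, of x] MB.chart_inv_left[OF D, of "F x"] S FS by auto
      moreover have "\<theta> C x = \<omega> D (F x)" using \<theta>[of x] 2 True by (simp add: jacobian_zero)
      ultimately show ?thesis using True 2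
        by (simp add: model_measure_def nn_integral_count_space_finite)
    qed simp
  next
    case False
    then have V: "V = UNIV" using MA.model by (simp add: model_space_def)
    have *: "indicator (snd C ` S) z * (\<bar>det (matrix (frechet_derivative ?g (at z)))\<bar> * ?f (?g z)) =
        indicator (snd C ` S) z * \<bar>\<theta> C (chart_inv C z)\<bar>" for z
    proof (cases "z \<in> snd C ` S")
      case True
      then obtain x where x: "x \<in> S" "z = snd C x" by blast
      then have "chart_inv C z = x" "?g z = snd D (F x)" "chart_inv D (snd D (F x)) = F x"
        using g MA.chart_inv_left[OF C] MB.chart_inv_left[OF D] S FS by auto
      then show ?thesis using \<theta>[OF x(1)] x False by (simp add: jacobian_def tderiv_def abs_mult)
    qed simp
    have "snd C ` S \<in> sets lebesgue"
      using MA.chart_image_sets[OF C S(1,3)] by (simp add: V model_measure_eq)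
    moreover have "(?g has_derivative frechet_derivative ?g (at z)) (at z within snd C ` S)"
      if zS: "z \<in> snd C ` S" for z
    proof -
      from zS obtain x where x: "x \<in> S" "z = snd C x" by blast
      then have "x \<in> fst C" "x \<in> U" "F x \<in> fst D" using S FS by auto
      from in_charts_has_derivative[OF V F(1,2) C D this] show ?thesis
        unfolding x(2) by (rule has_derivative_at_withinI)
    qed
    moreover have "(\<lambda>z. indicator (?g ` (snd C ` S)) z * ?f z) \<in> borel_measurable lebesgue"
      using MB.chart_density_measurable[OF D FS] unfolding gS by (simp add: V model_measure_eq measurable_completion)
    moreover have "(\<lambda>z. indicator (snd C ` S) z * (\<bar>det (matrix (frechet_derivative ?g (at z)))\<bar> * ?f (?g z)))
        \<in> borel_measurable lebesgue"
      unfolding * using MA.chart_density_measurable[OF C S(1,3)]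
      by (simp add: V model_measure_eq measurable_completion)
    ultimately have "(\<integral>\<^sup>+z\<in>?g ` (snd C ` S). ennreal (?f z) \<partial>lebesgue) =
       (\<integral>\<^sup>+z\<in>snd C ` S. ennreal (\<bar>det (matrix (frechet_derivative ?g (at z)))\<bar> * ?f (?g z)) \<partial>lebesgue)"
      using inj by (intro nn_integral_change_of_variables) auto
    also have "\<dots> = (\<integral>\<^sup>+z\<in>snd C ` S. ennreal \<bar>\<theta> C (chart_inv C z)\<bar> \<partial>lebesgue)"
      using * by (intro nn_integral_cong) (auto simp: indicator_def split: if_splits)
    finally show ?thesis unfolding gS by (simp add: V model_measure_eq nn_integral_completion)
  qed
  then show ?thesis
    using MA.emeasure_chart_measure[OF C S(1,3)] MB.emeasure_chart_measure[OF D FS] by simp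
qed

end

context volume_manifold
begin

lemma chart_measure_transition:
  assumes "C \<in> A" "D \<in> A" "S \<in> sets borel" "S \<subseteq> fst C" "S \<subseteq> fst D"
  shows "emeasure (chart_measure V \<omega> D) (snd D ` S) = emeasure (chart_measure V \<omega> C) (snd C ` S)"
proof -
  interpret T: two_volume_manifolds V A A \<omega> \<omega> ..
  show ?thesis
    using T.chart_measure_pullback[of UNIV "\<lambda>x. x" C D S] smooth_map_on_id assms form_transf
    by (simp add: id_def)
qed

lemma chart_measure_countably_additive:
  assumes C: "C \<in> A" and S: "range S \<subseteq> sets borel" "disjoint_family S" "\<And>i. S i \<subseteq> fst C"
  shows "(\<Sum>i. emeasure (chart_measure V \<omega> C) (snd C ` S i)) =
    emeasure (chart_measure V \<omega> C) (snd C ` (\<Union>i. S i))"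
proof -
  have "snd C ` S i \<in> sets (chart_measure V \<omega> C)" for i
    using chart_image_sets[OF C, of "S i"] S by (auto simp: chart_measure_def)
  moreover have "disjoint_family (\<lambda>i. snd C ` S i)"
  proof -
    have "inj_on (snd C) (fst C)" using chart_inv_left[OF C] by (metis inj_onI)
    then have "snd C ` S i \<inter> snd C ` S j = snd C ` (S i \<inter> S j)" for i j
      using inj_on_image_Int[OF _ S(3) S(3)] by metis
    then show ?thesis using S(2) by (simp add: disjoint_family_on_def)
  qed
  ultimately show ?thesis by (subst suminf_emeasure) (auto simp: image_UN)
qed

text \<open>The measures given in the charts agree on overlaps and are glued along a finite partition
  into Borel sets, each of which lies in one chart.\<close>

lemma form_measure_works:
  shows sets_form_measure: "sets (form_measure V A \<omega>) = sets borel"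
    and emeasure_form_measure: "\<And>C S. C \<in> A \<Longrightarrow> S \<in> sets borel \<Longrightarrow> S \<subseteq> fst C \<Longrightarrow>
      emeasure (form_measure V A \<omega>) S = emeasure (chart_measure V \<omega> C) (snd C ` S)"
proof -
  let ?P = "\<lambda>M. sets M = sets borel \<and> (\<forall>C\<in>A. \<forall>S\<in>sets borel. S \<subseteq> fst C \<longrightarrow>
     emeasure M S = (\<integral>\<^sup>+z\<in>snd C ` S. ennreal \<bar>\<omega> C (chart_inv C z)\<bar> \<partial>model_measure V))"
  obtain n :: nat and C P where CP: "\<And>i. i < n \<Longrightarrow> C i \<in> A" "\<And>i. i < n \<Longrightarrow> P i \<subseteq> fst (C i)"
    "\<And>i. i < n \<Longrightarrow> P i \<in> sets borel" "disjoint_family_on P {..<n}" "(\<Union>i<n. P i) = UNIV"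
    by (rule chart_partition) (rule that)
  have split: "S = (\<Union>i<n. S \<inter> P i)" for S using CP(5) by blast
  have sB: "S \<inter> P i \<in> sets borel" if "S \<in> sets borel" "i < n" for S i using CP(3) that by simp
  have dis: "disjoint_family_on (\<lambda>i. S \<inter> P i) {..<n}" for S
    using CP(4) unfolding disjoint_family_on_def by blast
  define \<mu> where "\<mu> S = (\<Sum>i<n. emeasure (chart_measure V \<omega> (C i)) (snd (C i) ` (S \<inter> P i)))" for S
  define M where "M = measure_of UNIV (sets borel) \<mu>"
  have "sigma_algebra UNIV (sets (borel :: 'x measure))" using sets.sigma_algebra_axioms[of borel] by simp
  moreover have "positive (sets borel) \<mu>" by (simp add: positive_def \<mu>_def)
  moreover have "countably_additive (sets borel) \<mu>"
  proof (rule countably_additiveI)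
    fix S :: "nat \<Rightarrow> 'x set" assume S: "range S \<subseteq> sets borel" "disjoint_family S"
    have "(\<Sum>k. \<mu> (S k)) = (\<Sum>i<n. \<Sum>k. emeasure (chart_measure V \<omega> (C i)) (snd (C i) ` (S k \<inter> P i)))"
      unfolding \<mu>_def by (rule suminf_sum) simp
    also have "\<dots> = (\<Sum>i<n. emeasure (chart_measure V \<omega> (C i)) (snd (C i) ` (\<Union>k. S k \<inter> P i)))"
    proof (rule sum.cong[OF refl])
      fix i assume "i \<in> {..<n}"
      then show "(\<Sum>k. emeasure (chart_measure V \<omega> (C i)) (snd (C i) ` (S k \<inter> P i))) =
          emeasure (chart_measure V \<omega> (C i)) (snd (C i) ` (\<Union>k. S k \<inter> P i))"
      proof (intro chart_measure_countably_additive)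
        show "disjoint_family (\<lambda>k. S k \<inter> P i)" using S(2) unfolding disjoint_family_on_def by blast
      qed (use \<open>i \<in> {..<n}\<close> CP(1,2) sB S(1) in auto)
    qed
    also have "\<dots> = \<mu> (\<Union>k. S k)"
    proof -
      have "(\<Union>k. S k \<inter> P i) = (\<Union>k. S k) \<inter> P i" for i by blast
      then show ?thesis by (simp only: \<mu>_def)
    qed
    finally show "(\<Sum>k. \<mu> (S k)) = \<mu> (\<Union> (range S))" .
  qed
  ultimately have eM: "emeasure M S = \<mu> S" if "S \<in> sets borel" for S
    unfolding M_def using that by (rule emeasure_measure_of_sigma)
  have sM: "sets M = sets borel" unfolding M_def
    by (metis sets.sigma_sets_eq sets_measure_of space_borel subset_Pow_Union top_greatest Pow_UNIV)
  have eC: "emeasure M S = emeasure (chart_measure V \<omega> D) (snd D ` S)"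
    if D: "D \<in> A" and S: "S \<in> sets borel" "S \<subseteq> fst D" for D S
  proof -
    have "emeasure M S = (\<Sum>i<n. emeasure (chart_measure V \<omega> D) (snd D ` (S \<inter> P i)))"
      unfolding eM[OF S(1)] \<mu>_def
      using CP(1,2) sB[OF S(1)] S D by (intro sum.cong refl chart_measure_transition) auto
    also have "\<dots> = emeasure (chart_measure V \<omega> D) (\<Union>i<n. snd D ` (S \<inter> P i))"
    proof (rule sum_emeasure)
      show "(\<lambda>i. snd D ` (S \<inter> P i)) ` {..<n} \<subseteq> sets (chart_measure V \<omega> D)"
        using chart_image_sets[OF D] sB[OF S(1)] S(2) by (auto simp: chart_measure_def)
      have "inj_on (snd D) (fst D)" using chart_inv_left[OF D] by (metis inj_onI)
      then have "snd D ` (S \<inter> P i) \<inter> snd D ` (S \<inter> P j) = snd D ` ((S \<inter> P i) \<inter> (S \<inter> P j))" for i j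
        using S(2) by (intro inj_on_image_Int[symmetric, where C = "fst D"]) auto
      then show "disjoint_family_on (\<lambda>i. snd D ` (S \<inter> P i)) {..<n}"
        using dis[of S] by (simp add: disjoint_family_on_def)
    qed simp
    also have "(\<Union>i<n. snd D ` (S \<inter> P i)) = snd D ` S"
      using split[of S] by (metis image_UN)
    finally show ?thesis .
  qed
  have split_sum: "emeasure N S = (\<Sum>i<n. emeasure N (S \<inter> P i))"
    if "sets N = sets borel" "S \<in> sets borel" for N :: "'x measure" and S
  proof -
    have "(\<Sum>i<n. emeasure N (S \<inter> P i)) = emeasure N (\<Union>i<n. S \<inter> P i)"
      by (rule sum_emeasure) (use sB[OF that(2)] dis that(1) in auto)
    then show ?thesis using split[of S] by simp
  qed
  have PM: "?P M" using sM eC emeasure_chart_measure by simp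
  have uniq: "N = M" if N: "?P N" for N
  proof (rule measure_eqI)
    show "sets N = sets M" using N sM by simp
    fix S assume "S \<in> sets N"
    then have S: "S \<in> sets borel" using N by simp
    have "emeasure N S = (\<Sum>i<n. emeasure N (S \<inter> P i))"
      using split_sum[OF _ S] N by blast
    also have "\<dots> = (\<Sum>i<n. emeasure M (S \<inter> P i))"
    proof (rule sum.cong[OF refl])
      fix i assume "i \<in> {..<n}"
      then have "C i \<in> A" "S \<inter> P i \<subseteq> fst (C i)" "S \<inter> P i \<in> sets borel"
        using CP(1,2) sB[OF S] by auto
      then show "emeasure N (S \<inter> P i) = emeasure M (S \<inter> P i)" using N PM by simp
    qed
    also have "\<dots> = emeasure M S"
      using split_sum[OF sM S] by simp
    finally show "emeasure N S = emeasure M S" .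
  qed
  have "form_measure V A \<omega> = M"
    unfolding form_measure_def using PM uniq by (rule the_equality)
  then show "sets (form_measure V A \<omega>) = sets borel"
    and "\<And>C S. C \<in> A \<Longrightarrow> S \<in> sets borel \<Longrightarrow> S \<subseteq> fst C \<Longrightarrow>
      emeasure (form_measure V A \<omega>) S = emeasure (chart_measure V \<omega> C) (snd C ` S)"
    using sM eC by auto
qed

lemma space_form_measure: "space (form_measure V A \<omega>) = UNIV"
  using sets_eq_imp_space_eq[OF sets_form_measure] by simp

text \<open>On a small closed ball in a chart the density is bounded by continuity, and Lebesgue measure is
  finite.\<close>

lemma form_measure_locally_finite:
  obtains N where "open N" "x \<in> N" "emeasure (form_measure V A \<omega>) N < \<infinity>"
proof -
  obtain C where C: "C \<in> A" "x \<in> fst C" using chart_exists .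
  obtain Ob where Ob: "open Ob" "snd C ` (fst C \<inter> UNIV) = V \<inter> Ob"
    using chart_image_open_nbhd[OF C(1) open_UNIV] .
  then have "snd C x \<in> Ob" using C by blast
  then obtain r where r: "r > 0" "cball (snd C x) r \<subseteq> Ob" using Ob(1) open_contains_cball by blast
  let ?K = "V \<inter> cball (snd C x) r"
  let ?N = "fst C \<inter> snd C -` ball (snd C x) r"
  have "continuous_on (fst C) (snd C)" using chart_homeo[OF C(1)] by (rule homeomorphism_cont1)
  then have oN: "open ?N" using chart_open[OF C(1)] by (simp add: continuous_open_preimage)
  have KI: "?K \<subseteq> snd C ` fst C" using Ob r by auto
  have "closed V" using model unfolding model_space_def by auto
  then have cK: "compact ?K" by (simp add: closed_Int_compact)
  have "continuous_on ?K (\<lambda>z. \<omega> C (chart_inv C z))"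
    using form_cont[OF C(1)] KI continuous_on_subset by blast
  then have "bounded ((\<lambda>z. \<omega> C (chart_inv C z)) ` ?K)"
    using cK compact_continuous_image compact_imp_bounded by blast
  then obtain b where b: "\<forall>z\<in>?K. \<bar>\<omega> C (chart_inv C z)\<bar> \<le> b"
    unfolding bounded_iff by auto
  have "emeasure (form_measure V A \<omega>) ?N = (\<integral>\<^sup>+z\<in>snd C ` ?N. ennreal \<bar>\<omega> C (chart_inv C z)\<bar> \<partial>model_measure V)"
    using emeasure_form_measure[OF C(1), of ?N] emeasure_chart_measure[OF C(1), of ?N] oN by simp
  also have "\<dots> \<le> (\<integral>\<^sup>+z. ennreal b * indicator ?K z \<partial>model_measure V)"
  proof (intro nn_integral_mono)
    fix z
    show "ennreal \<bar>\<omega> C (chart_inv C z)\<bar> * indicator (snd C ` ?N) z \<le> ennreal b * indicator ?K z"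
    proof (cases "z \<in> snd C ` ?N")
      case True
      then have "z \<in> ?K" using chart_in_model[OF C(1)] by auto
      then show ?thesis using b True by (simp add: ennreal_leI)
    qed simp
  qed
  also have "\<dots> = ennreal b * emeasure (model_measure V) ?K"
    using cK by (intro nn_integral_cmult_indicator) (auto simp: model_measure_def compact_imp_closed)
  also have "\<dots> < \<infinity>"
  proof -
    have "emeasure (model_measure V) ?K < \<infinity>"
    proof (cases "V = {0}")
      case True
      then have "?K \<subseteq> {0}" by blast
      then show ?thesis using True emeasure_count_space_finite[of ?K "{0}"] finite_subset[of ?K "{0}"]
        by (simp add: model_measure_def of_nat_less_top)
    next
      case False
      then show ?thesis
        using emeasure_bounded_finite[OF compact_imp_bounded[OF cK]] by (simp add: model_measure_def)
    qed
    then show ?thesis by (simp add: ennreal_mult_less_top)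
  qed
  finally show thesis using that[OF oN] C r by auto
qed

lemma finite_form_measure: "finite_measure (form_measure V A \<omega>)"
proof (rule finite_measureI)
  let ?M = "form_measure V A \<omega>"
  let ?U = "{N. open N \<and> emeasure ?M N < \<infinity>}"
  have "UNIV \<subseteq> \<Union> ?U" using form_measure_locally_finite by blast
  then obtain F where F: "F \<subseteq> ?U" "finite F" "UNIV \<subseteq> \<Union> F"
    using compactE[OF compact_space, of ?U] by blast
  have "emeasure ?M UNIV \<le> emeasure ?M (\<Union> N\<in>F. N)"
    using F by (intro emeasure_mono) (auto simp: sets_form_measure intro!: borel_open)
  also have "\<dots> \<le> (\<Sum>N\<in>F. emeasure ?M N)"
    using F by (intro emeasure_subadditive_finite) (auto simp: sets_form_measure)
  also have "\<dots> < \<infinity>" using F by (auto intro!: ennreal_sum_less_top)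
  finally show "emeasure ?M (space ?M) \<noteq> \<infinity>" by (simp add: space_form_measure)
qed

lemma continuous_integrable:
  fixes f :: "'x \<Rightarrow> complex"
  assumes "continuous_on UNIV f"
  shows "integrable (form_measure V A \<omega>) f"
proof -
  interpret M: finite_measure "form_measure V A \<omega>" by (rule finite_form_measure)
  have "bounded (range f)" using compact_continuous_image[OF assms compact_space] compact_imp_bounded by blast
  then obtain b where "\<And>x. norm (f x) \<le> b" unfolding bounded_iff by auto
  moreover have "f \<in> borel_measurable (form_measure V A \<omega>)"
    using borel_measurable_continuous_onI[OF assms] sets_form_measure measurable_cong_sets by blast
  ultimately show ?thesis by (intro M.integrable_const_bound[where B = b]) auto
qed

end

lemma local_diffeoE:
  assumes "local_diffeo A B F"
  obtains U where "open U" "x \<in> U" "inj_on F U" "open (F ` U)" "smooth_map_on A B U F"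
    "smooth_map_on B A (F ` U) (inv_into U F)"
  using assms unfolding local_diffeo_def by blast

lemma local_diffeo_continuous:
  fixes A :: "('x::t2_space, 'n::finite) chart set" and B :: "('y::t2_space, 'n) chart set"
  assumes "local_diffeo A B F" shows "continuous_on UNIV F"
proof (rule continuous_at_imp_continuous_on, rule ballI)
  fix x
  obtain U where "open U" "x \<in> U" "smooth_map_on A B U F" using local_diffeoE[OF assms] by metis
  then show "isCont F x" using smooth_map_on_cont continuous_on_eq_continuous_at by blast
qed

context two_manifolds
begin

lemma local_diffeo_small:
  assumes F: "local_diffeo A B F" and N: "open N" "x \<in> N"
  obtains U where "open U" "x \<in> U" "U \<subseteq> N" "inj_on F U" "open (F ` U)" "smooth_map_on A B U F"
    "smooth_map_on B A (F ` U) (inv_into U F)" "homeomorphism U (F ` U) F (inv_into U F)"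
proof -
  obtain U where U: "open U" "x \<in> U" "inj_on F U" "open (F ` U)" "smooth_map_on A B U F"
    "smooth_map_on B A (F ` U) (inv_into U F)" using local_diffeoE[OF F] .
  let ?U = "U \<inter> N"
  have inj: "inj_on F ?U" using U(3) inj_on_subset by blast
  have "F ` ?U = F ` U \<inter> inv_into U F -` N" using U(3) by (auto simp: inv_into_f_f)
  then have oF: "open (F ` ?U)"
    using continuous_open_preimage[OF smooth_map_on_cont[OF U(6)] U(4) N(1)] by simp
  have eq: "inv_into U F y = inv_into ?U F y" if "y \<in> F ` ?U" for y
    using that U(3) inj by auto
  have s1: "smooth_map_on A B ?U F" by (rule MA.smooth_map_on_subset[OF U(5)]) blast
  have s2: "smooth_map_on B A (F ` ?U) (inv_into ?U F)"
    by (rule MB.smooth_map_on_mono_cong[OF U(6) _ eq]) blast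
  have "homeomorphism ?U (F ` ?U) F (inv_into ?U F)"
    using smooth_map_on_cont[OF s1] smooth_map_on_cont[OF s2] inj
    by (auto simp: homeomorphism_def)
  then show thesis using that[of ?U] U N inj oF s1 s2 by blast
qed

end

context two_volume_manifolds
begin

text \<open>Fibre integration. Cut the source into finitely many Borel pieces on which \<open>F\<close> is injective
  and preserves measure. The integral over a piece becomes an integral over its image, and in the sum
  over all pieces each point of the fibre above \<open>y\<close> is counted once.\<close>

lemma integral_local_diffeo:
  fixes f :: "'x \<Rightarrow> complex"
  assumes F: "local_diffeo A B F" and pb: "pullback_form V A B F \<omega> \<theta>" and f: "continuous_on UNIV f"
  shows "(\<integral>x. f x \<partial>form_measure V A \<theta>) = (\<integral>y. (\<Sum>x | F x = y. f x) \<partial>form_measure V B \<omega>)"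
proof -
  let ?MA = "form_measure V A \<theta>" and ?MB = "form_measure V B \<omega>"
  define good where "good U \<longleftrightarrow> open U \<and> (\<exists>C\<in>A. \<exists>D\<in>B. U \<subseteq> fst C \<and> F ` U \<subseteq> fst D) \<and> inj_on F U \<and>
    open (F ` U) \<and> smooth_map_on A B U F \<and> homeomorphism U (F ` U) F (inv_into U F)" for U
  have Fc: "continuous_on UNIV F" using local_diffeo_continuous[OF F] .
  have "\<exists>U. x \<in> U \<and> good U" for x
  proof -
    obtain C where C: "C \<in> A" "x \<in> fst C" using MA.chart_exists .
    obtain D where D: "D \<in> B" "F x \<in> fst D" using MB.chart_exists .
    have "open (F -` fst D)"
      using Fc MB.chart_open[OF D(1)] by (simp add: continuous_on_open_vimage)
    then have o: "open (fst C \<inter> F -` fst D)" "x \<in> fst C \<inter> F -` fst D"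
      using MA.chart_open[OF C(1)] C D by auto
    obtain U where "open U" "x \<in> U" "U \<subseteq> fst C \<inter> F -` fst D" "inj_on F U" "open (F ` U)"
      "smooth_map_on A B U F" "homeomorphism U (F ` U) F (inv_into U F)"
      using local_diffeo_small[OF F o] by metis
    then have "good U" using C(1) D(1) unfolding good_def by blast
    then show ?thesis using \<open>x \<in> U\<close> by blast
  qed
  then have "UNIV \<subseteq> \<Union> (Collect good)" by blast
  moreover have "open U" if "U \<in> Collect good" for U using that unfolding good_def by blast
  ultimately obtain \<U> where \<U>: "\<U> \<subseteq> (Collect good)" "finite \<U>" "UNIV \<subseteq> \<Union> \<U>"
    using compactE[OF MA.compact_space, of "Collect good"] by metis
  obtain U and n :: nat where Un: "\<U> = U ` {i. i < n}"
    using finite_imp_nat_seg_image_inj_on[OF \<U>(2)] by metis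
  have "good (U i)" if "i < n" for i using \<U>(1) Un that by blast
  then have Uo: "open (U i)" and Uinj: "inj_on F (U i)" and UF: "open (F ` U i)"
    and Uhom: "homeomorphism (U i) (F ` U i) F (inv_into (U i) F)"
    and Uch: "\<exists>C\<in>A. \<exists>D\<in>B. U i \<subseteq> fst C \<and> F ` U i \<subseteq> fst D \<and> smooth_map_on A B (U i) F"
    if "i < n" for i using that unfolding good_def by blast+
  define P where "P i = U i - (\<Union>j<i. U j)" for i
  have PU: "P i \<subseteq> U i" for i unfolding P_def by blast
  have Pborel: "P i \<in> sets borel" if "i < n" for i
    unfolding P_def using Uo that by (intro sets.Diff sets.finite_UN) (auto intro: borel_open)
  have Pdis: "P i \<inter> P j = {}" if "i \<noteq> j" for i j
  proof -
    have "P i \<inter> P j = {}" if "i < j" for i j unfolding P_def using that by blast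
    then show ?thesis using that by (metis Int_commute linorder_neqE_nat)
  qed
  have Pcov: "\<exists>i<n. x \<in> P i" for x
  proof -
    have "x \<in> \<Union> \<U>" using \<U>(3) by blast
    then have ex: "\<exists>i. i < n \<and> x \<in> U i" unfolding Un by blast
    define k where "k = (LEAST i. i < n \<and> x \<in> U i)"
    have "k < n \<and> x \<in> U k" using LeastI_ex[OF ex] unfolding k_def by blast
    moreover have "x \<notin> U j" if "j < k" for j
      using not_less_Least[of j "\<lambda>i. i < n \<and> x \<in> U i"] that calculation unfolding k_def by auto
    ultimately show ?thesis unfolding P_def by blast
  qed
  have FPborel: "F ` S \<in> sets borel" if "i < n" "S \<in> sets borel" "S \<subseteq> U i" for S i
    by (rule homeomorphism_borel_image[OF Uhom[OF that(1)] borel_open[OF UF[OF that(1)]] that(2,3)])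
  have meas: "emeasure ?MB (F ` S) = emeasure ?MA S" if "i < n" "S \<in> sets borel" "S \<subseteq> U i" for S i
  proof -
    from Uch[OF that(1)] obtain C D where CD: "C \<in> A" "D \<in> B" "U i \<subseteq> fst C" "F ` U i \<subseteq> fst D"
      "smooth_map_on A B (U i) F" by blast
    have sub: "S \<subseteq> fst C" "F ` S \<subseteq> fst D" using CD(3,4) that(3) by blast+
    show ?thesis
      using chart_measure_pullback[OF CD(5) Uo[OF that(1)] Uinj[OF that(1)] pb CD(1,2) that(2,3)
          sub(1) FPborel[OF that] sub(2)]
        MA.emeasure_form_measure[OF CD(1) that(2) sub(1)]
        MB.emeasure_form_measure[OF CD(2) FPborel[OF that] sub(2)] by simp
  qed
  \<comment> \<open>The restriction of \<open>f\<close> to the piece \<open>P i\<close>, carried to the target and extended by zero.\<close>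
  define h where "h i y = indicator (F ` P i) y *\<^sub>R f (inv_into (U i) F y)" for i y
  have hF: "h i (F x) = f x" if "x \<in> P i" "i < n" for i x
    using that PU[of i] Uinj[OF that(2)] by (auto simp: h_def inv_into_f_f subsetD)
  have hmeas: "h i \<in> borel_measurable borel" if "i < n" for i
  proof -
    have "continuous_on (F ` P i) (inv_into (U i) F)"
      by (rule continuous_on_subset[OF homeomorphism_cont2[OF Uhom[OF that]] image_mono[OF PU]])
    then have "continuous_on (F ` P i) (\<lambda>y. f (inv_into (U i) F y))"
      by (rule continuous_on_compose2[OF f]) simp
    from borel_measurable_continuous_on_indicator[OF FPborel[OF that Pborel[OF that] PU] this]
    show ?thesis by (simp only: h_def[abs_def])
  qed
  have mB[measurable_cong]: "sets ?MB = sets borel" and mA[measurable_cong]: "sets ?MA = sets borel"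
    using MA.sets_form_measure MB.sets_form_measure by auto
  have Fm: "F \<in> borel_measurable borel" using borel_measurable_continuous_onI[OF Fc] .
  have fm: "f \<in> borel_measurable borel" using borel_measurable_continuous_onI[OF f] .
  have piece: "(\<integral>x. indicator (P i) x *\<^sub>R f x \<partial>?MA) = (\<integral>y. h i y \<partial>?MB)" if i: "i < n" for i
  proof -
    let ?NA = "density ?MA (\<lambda>x. ennreal (indicator (P i) x))"
    let ?NB = "density ?MB (\<lambda>y. ennreal (indicator (F ` P i) y))"
    have Pm: "P i \<in> sets ?MA" "F ` P i \<in> sets ?MB"
      using Pborel[OF i] FPborel[OF i Pborel[OF i] PU] mA mB by auto
    have "distr ?NA borel F = ?NB"
    proof (rule measure_eqI)
      fix S assume "S \<in> sets (distr ?NA borel F)"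
      then have S: "S \<in> sets borel" by simp
      have FS: "F -` S \<in> sets borel" using measurable_sets[OF Fm S] by simp
      have "emeasure (distr ?NA borel F) S = emeasure ?NA (F -` S)"
        using Fm S by (subst emeasure_distr) (auto simp: MA.space_form_measure mA cong: measurable_cong_sets)
      also have "\<dots> = emeasure ?MA (P i \<inter> F -` S)"
        using Pm FS mA by (subst emeasure_density) (auto simp: ennreal_indicator indicator_inter_arith[symmetric])
      also have "\<dots> = emeasure ?MB (F ` (P i \<inter> F -` S))"
        using meas[OF i sets.Int[OF Pborel[OF i] FS]] PU[of i] by (metis inf.coboundedI1)
      also have "F ` (P i \<inter> F -` S) = F ` P i \<inter> S" by blast
      also have "emeasure ?MB \<dots> = emeasure ?NB S"
        using Pm S mB by (subst emeasure_density) (auto simp: ennreal_indicator indicator_inter_arith[symmetric])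
      finally show "emeasure (distr ?NA borel F) S = emeasure ?NB S" .
    qed (simp add: mB)
    then have "(\<integral>y. h i y \<partial>?NB) = (\<integral>x. h i (F x) \<partial>?NA)"
      using integral_distr[of F ?NA borel "h i"] Fm hmeas[OF i] mA by (simp cong: measurable_cong_sets)
    moreover have "(\<integral>y. h i y \<partial>?NB) = (\<integral>y. h i y \<partial>?MB)"
    proof -
      have "(\<integral>y. h i y \<partial>?NB) = (\<integral>y. indicator (F ` P i) y *\<^sub>R h i y \<partial>?MB)"
        using hmeas[OF i] mB Pm by (intro integral_density) (auto cong: measurable_cong_sets)
      also have "\<dots> = (\<integral>y. h i y \<partial>?MB)" by (intro Bochner_Integration.integral_cong) (auto simp: h_def indicator_def)
      finally show ?thesis .
    qed
    moreover have "(\<integral>x. h i (F x) \<partial>?NA) = (\<integral>x. indicator (P i) x *\<^sub>R f x \<partial>?MA)"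
    proof -
      have "(\<lambda>x. h i (F x)) \<in> borel_measurable borel" using measurable_compose[OF Fm hmeas[OF i]] .
      then have "(\<integral>x. h i (F x) \<partial>?NA) = (\<integral>x. indicator (P i) x *\<^sub>R h i (F x) \<partial>?MA)"
        using mA Pm by (intro integral_density) (auto cong: measurable_cong_sets)
      also have "\<dots> = (\<integral>x. indicator (P i) x *\<^sub>R f x \<partial>?MA)"
        using hF i by (intro Bochner_Integration.integral_cong) (auto simp: indicator_def)
      finally show ?thesis .
    qed
    ultimately show ?thesis by simp
  qed
  interpret MAf: finite_measure ?MA by (rule MA.finite_form_measure)
  interpret MBf: finite_measure ?MB by (rule MB.finite_form_measure)
  have "bounded (range f)" using compact_continuous_image[OF f MA.compact_space] compact_imp_bounded by blast
  then obtain b where "\<And>x. norm (f x) \<le> b" unfolding bounded_iff by auto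
  then have b: "norm (f x) \<le> \<bar>b\<bar>" for x by (meson abs_ge_self order_trans)
  have iA: "integrable ?MA (\<lambda>x. indicator (P i) x *\<^sub>R f x)" if "i < n" for i
    using b fm mA Pborel[OF that]
    by (intro MAf.integrable_const_bound[where B = "\<bar>b\<bar>"]) (auto simp: indicator_def cong: measurable_cong_sets)
  have iB: "integrable ?MB (h i)" if "i < n" for i
    using b hmeas[OF that] mB
    by (intro MBf.integrable_const_bound[where B = "\<bar>b\<bar>"]) (auto simp: h_def indicator_def cong: measurable_cong_sets)
  have fsum: "f x = (\<Sum>i<n. indicator (P i) x *\<^sub>R f x)" for x
  proof -
    obtain k where k: "k < n" "x \<in> P k" using Pcov by blast
    have "(\<Sum>i<n. indicator (P i) x *\<^sub>R f x) = (\<Sum>i<n. if i = k then f x else 0)"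
      using k Pdis by (intro sum.cong) (auto simp: indicator_def)
    then show ?thesis using k by simp
  qed
  have "(\<integral>x. f x \<partial>?MA) = (\<integral>x. (\<Sum>i<n. indicator (P i) x *\<^sub>R f x) \<partial>?MA)"
    by (rule Bochner_Integration.integral_cong[OF refl fsum])
  also have "\<dots> = (\<Sum>i<n. \<integral>x. indicator (P i) x *\<^sub>R f x \<partial>?MA)"
    by (rule Bochner_Integration.integral_sum) (use iA in auto)
  also have "\<dots> = (\<Sum>i<n. \<integral>y. h i y \<partial>?MB)" using piece by simp
  also have "\<dots> = (\<integral>y. (\<Sum>i<n. h i y) \<partial>?MB)"
    by (rule Bochner_Integration.integral_sum[symmetric]) (use iB in auto)
  also have "\<dots> = (\<integral>y. (\<Sum>x | F x = y. f x) \<partial>?MB)"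
  proof (rule Bochner_Integration.integral_cong[OF refl])
    fix y
    have single: "{x. F x = y} \<inter> P i = (if y \<in> F ` P i then {inv_into (U i) F y} else {})" if "i < n" for i
      using inj_on_subset[OF Uinj[OF that] PU[of i]] Uinj[OF that] PU[of i]
      by (auto simp: inv_into_f_f subsetD dest: inj_onD)
    have "{x. F x = y} = (\<Union>i\<in>{..<n}. {x. F x = y} \<inter> P i)" using Pcov by blast
    then have "(\<Sum>x | F x = y. f x) = (\<Sum>x\<in>(\<Union>i\<in>{..<n}. {x. F x = y} \<inter> P i). f x)" by simp
    also have "\<dots> = (\<Sum>i<n. \<Sum>x\<in>{x. F x = y} \<inter> P i. f x)"
    proof (rule sum.UNION_disjoint)
      show "\<forall>i\<in>{..<n}. finite ({x. F x = y} \<inter> P i)" using single by simp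
      show "\<forall>i\<in>{..<n}. \<forall>j\<in>{..<n}. i \<noteq> j \<longrightarrow> ({x. F x = y} \<inter> P i) \<inter> ({x. F x = y} \<inter> P j) = {}"
        using Pdis by blast
    qed simp
    also have "\<dots> = (\<Sum>i<n. h i y)"
      using single by (intro sum.cong) (auto simp: h_def)
    finally show "(\<Sum>i<n. h i y) = (\<Sum>x | F x = y. f x)" by simp
  qed
  finally show ?thesis .
qed

end

section \<open>Semi-inner product spaces and their completions\<close>

locale vec_space =
  fixes S :: "'v inner_space"
  assumes zero_closed [simp]: "zero_in S \<in> vecs S"
    and plus_closed [simp]: "v \<in> vecs S \<Longrightarrow> w \<in> vecs S \<Longrightarrow> plus_in S v w \<in> vecs S"
    and scale_closed [simp]: "v \<in> vecs S \<Longrightarrow> scale_in S z v \<in> vecs S"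
    and plus_assoc: "u \<in> vecs S \<Longrightarrow> v \<in> vecs S \<Longrightarrow> w \<in> vecs S \<Longrightarrow>
      plus_in S (plus_in S u v) w = plus_in S u (plus_in S v w)"
    and plus_comm: "v \<in> vecs S \<Longrightarrow> w \<in> vecs S \<Longrightarrow> plus_in S v w = plus_in S w v"
    and zero_plus: "v \<in> vecs S \<Longrightarrow> plus_in S (zero_in S) v = v"
    and plus_neg: "v \<in> vecs S \<Longrightarrow> plus_in S v (scale_in S (-1) v) = zero_in S"
    and scale_plus: "v \<in> vecs S \<Longrightarrow> w \<in> vecs S \<Longrightarrow>
      scale_in S z (plus_in S v w) = plus_in S (scale_in S z v) (scale_in S z w)"
    and plus_scale: "v \<in> vecs S \<Longrightarrow> scale_in S (z + z') v = plus_in S (scale_in S z v) (scale_in S z' v)"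
    and scale_scale: "v \<in> vecs S \<Longrightarrow> scale_in S z (scale_in S z' v) = scale_in S (z * z') v"
    and scale_one: "v \<in> vecs S \<Longrightarrow> scale_in S 1 v = v"
begin

lemma diff_closed [simp]: "v \<in> vecs S \<Longrightarrow> w \<in> vecs S \<Longrightarrow> diff_in S v w \<in> vecs S"
  by (simp add: diff_in_def)

lemma plus_zero: "v \<in> vecs S \<Longrightarrow> plus_in S v (zero_in S) = v"
  using plus_comm zero_plus by simp

lemma plus_left_comm: "u \<in> vecs S \<Longrightarrow> v \<in> vecs S \<Longrightarrow> w \<in> vecs S \<Longrightarrow>
    plus_in S u (plus_in S v w) = plus_in S v (plus_in S u w)"
  using plus_assoc[of u v w] plus_assoc[of v u w] plus_comm[of u v] by simp

lemma plus_diff: "v \<in> vecs S \<Longrightarrow> w \<in> vecs S \<Longrightarrow> plus_in S w (diff_in S v w) = v"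
  unfolding diff_in_def
  using plus_left_comm[of w v "scale_in S (-1) w"] plus_neg[of w] plus_zero[of v] by simp

lemma plus_cancel: "u \<in> vecs S \<Longrightarrow> v \<in> vecs S \<Longrightarrow> w \<in> vecs S \<Longrightarrow>
    plus_in S u v = plus_in S u w \<Longrightarrow> v = w"
proof -
  assume a: "u \<in> vecs S" "v \<in> vecs S" "w \<in> vecs S" "plus_in S u v = plus_in S u w"
  have "plus_in S (scale_in S (-1) u) (plus_in S u x) = x" if "x \<in> vecs S" for x
    using a(1) that plus_assoc[of "scale_in S (-1) u" u x] plus_comm[of "scale_in S (-1) u" u]
      plus_neg[of u] zero_plus[of x] by simp
  then show "v = w" using a by metis
qed

lemma diff_self: "v \<in> vecs S \<Longrightarrow> diff_in S v v = zero_in S"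
  by (simp add: diff_in_def plus_neg)

end

locale quotient_vec_space = vec_space +
  fixes N
  assumes sub: "N \<subseteq> vecs S" and zeroN: "zero_in S \<in> N"
    and plusN: "m \<in> N \<Longrightarrow> n \<in> N \<Longrightarrow> plus_in S m n \<in> N"
    and scaleN: "n \<in> N \<Longrightarrow> scale_in S z n \<in> N"
begin

abbreviation "cls \<equiv> coset_in S N"

lemma coset_memb: "v \<in> vecs S \<Longrightarrow> v \<in> cls v"
  unfolding coset_in_def using zeroN plus_zero[of v] by force

lemma coset_eqI:
  assumes "v \<in> vecs S" "n \<in> N" "w = plus_in S v n"
  shows "cls v = cls w"
proof -
  have n: "n \<in> vecs S" using assms sub by blast
  have "plus_in S v m \<in> cls w" if m: "m \<in> N" for m
  proof -
    have mv: "m \<in> vecs S" using m sub by blast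
    have d: "diff_in S m n \<in> N" unfolding diff_in_def using plusN scaleN m assms(2) by blast
    have "plus_in S v m = plus_in S v (plus_in S n (diff_in S m n))" using plus_diff[OF mv n] by simp
    also have "\<dots> = plus_in S w (diff_in S m n)" using plus_assoc[of v n "diff_in S m n"] assms n mv by simp
    finally show ?thesis using d unfolding coset_in_def by blast
  qed
  moreover have "plus_in S w m \<in> cls v" if m: "m \<in> N" for m
  proof -
    have "plus_in S w m = plus_in S v (plus_in S n m)"
      using plus_assoc[of v n m] assms n m sub by (simp add: subsetD)
    then show ?thesis using plusN[OF assms(2) m] unfolding coset_in_def by blast
  qed
  ultimately show ?thesis unfolding coset_in_def[of S N v] coset_in_def[of S N w] by blast
qed

lemma coset_eq_iff:
  assumes "v \<in> vecs S" "w \<in> vecs S"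
  shows "cls v = cls w \<longleftrightarrow> diff_in S v w \<in> N"
proof
  assume "cls v = cls w"
  then obtain n where n: "n \<in> N" "v = plus_in S w n"
    using coset_memb[OF assms(1)] unfolding coset_in_def by auto
  then have "diff_in S v w = n"
    using plus_cancel[of w "diff_in S v w" n] plus_diff[OF assms] assms sub by auto
  then show "diff_in S v w \<in> N" using n by simp
next
  assume "diff_in S v w \<in> N"
  then show "cls v = cls w" using coset_eqI[OF assms(2) _ plus_diff[OF assms, symmetric]] by simp
qed

lemma
  assumes "v \<in> vecs S"
  shows rep_closed: "some_rep (cls v) \<in> vecs S" and coset_rep: "cls (some_rep (cls v)) = cls v"
proof -
  have "some_rep (cls v) \<in> cls v" unfolding some_rep_def using coset_memb[OF assms] by (metis someI)
  then obtain n where n: "n \<in> N" "some_rep (cls v) = plus_in S v n" unfolding coset_in_def by blast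
  then show "some_rep (cls v) \<in> vecs S" using assms sub by auto
  show "cls (some_rep (cls v)) = cls v" using coset_eqI[OF assms n] by simp
qed

lemma coset_plus_cong:
  assumes "v \<in> vecs S" "w \<in> vecs S" "v' \<in> vecs S" "w' \<in> vecs S" "cls v = cls v'" "cls w = cls w'"
  shows "cls (plus_in S v w) = cls (plus_in S v' w')"
proof -
  obtain n where n: "n \<in> N" "v' = plus_in S v n" using assms coset_memb[of v'] unfolding coset_in_def by auto
  obtain m where m: "m \<in> N" "w' = plus_in S w m" using assms coset_memb[of w'] unfolding coset_in_def by auto
  have nv: "n \<in> vecs S" "m \<in> vecs S" using n m sub by auto
  have "plus_in S v' w' = plus_in S (plus_in S v w) (plus_in S n m)"
    unfolding n m using nv assms(1,2) by (simp add: plus_assoc plus_left_comm)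
  then show ?thesis using coset_eqI[OF _ plusN[OF n(1) m(1)]] assms(1,2) by simp
qed

lemma coset_scale_cong:
  assumes "v \<in> vecs S" "v' \<in> vecs S" "cls v = cls v'"
  shows "cls (scale_in S z v) = cls (scale_in S z v')"
proof -
  obtain n where n: "n \<in> N" "v' = plus_in S v n" using assms coset_memb[of v'] unfolding coset_in_def by auto
  have "scale_in S z v' = plus_in S (scale_in S z v) (scale_in S z n)"
    unfolding n using n sub assms(1) by (simp add: scale_plus subsetD)
  then show ?thesis using coset_eqI[OF _ scaleN[OF n(1)]] assms(1) by simp
qed

lemma vecs_quotient: "vecs (quotient_space S N) = cls ` vecs S"
  by (simp add: quotient_space_def)

lemma plus_quotient:
  "v \<in> vecs S \<Longrightarrow> w \<in> vecs S \<Longrightarrow> plus_in (quotient_space S N) (cls v) (cls w) = cls (plus_in S v w)"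
  unfolding quotient_space_def inner_space.simps
  by (rule coset_plus_cong) (simp_all add: rep_closed coset_rep)

lemma scale_quotient:
  "v \<in> vecs S \<Longrightarrow> scale_in (quotient_space S N) z (cls v) = cls (scale_in S z v)"
  unfolding quotient_space_def inner_space.simps
  by (rule coset_scale_cong) (simp_all add: rep_closed coset_rep)

lemma zero_quotient: "zero_in (quotient_space S N) = cls (zero_in S)"
  by (simp add: quotient_space_def)

lemma vec_space_quotient: "vec_space (quotient_space S N)"
proof unfold_locales
  fix a b assume "a \<in> vecs (quotient_space S N)" "b \<in> vecs (quotient_space S N)"
  then obtain v w where "v \<in> vecs S" "w \<in> vecs S" "a = cls v" "b = cls w"
    unfolding vecs_quotient by blast
  then show "plus_in (quotient_space S N) a b = plus_in (quotient_space S N) b a"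
    using plus_comm[of v w] by (simp add: plus_quotient)
qed (auto simp: vecs_quotient zero_quotient plus_quotient scale_quotient plus_assoc
      zero_plus plus_neg scale_plus plus_scale scale_scale scale_one)

end

locale semi_inner = vec_space +
  assumes inner_plus: "u \<in> vecs S \<Longrightarrow> v \<in> vecs S \<Longrightarrow> w \<in> vecs S \<Longrightarrow>
      inner_in S (plus_in S u v) w = inner_in S u w + inner_in S v w"
    and inner_scale: "u \<in> vecs S \<Longrightarrow> w \<in> vecs S \<Longrightarrow> inner_in S (scale_in S z u) w = z * inner_in S u w"
    and inner_commute: "u \<in> vecs S \<Longrightarrow> w \<in> vecs S \<Longrightarrow> inner_in S w u = cnj (inner_in S u w)"
    and inner_pos: "u \<in> vecs S \<Longrightarrow> Re (inner_in S u u) \<ge> 0"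
begin

lemma inner_plus_right: "u \<in> vecs S \<Longrightarrow> v \<in> vecs S \<Longrightarrow> w \<in> vecs S \<Longrightarrow>
    inner_in S w (plus_in S u v) = inner_in S w u + inner_in S w v"
  using inner_commute[of "plus_in S u v" w] inner_commute[of u w] inner_commute[of v w]
  by (simp add: inner_plus)

lemma inner_scale_right: "u \<in> vecs S \<Longrightarrow> w \<in> vecs S \<Longrightarrow>
    inner_in S w (scale_in S z u) = cnj z * inner_in S w u"
  using inner_commute[of "scale_in S z u" w] inner_commute[of u w] by (simp add: inner_scale)

lemmas inner_simps = inner_plus inner_scale inner_plus_right inner_scale_right

lemma inner_real: "u \<in> vecs S \<Longrightarrow> inner_in S u u = of_real (Re (inner_in S u u))"
  using inner_commute[of u u] by (simp add: complex_eq_iff)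

lemma norm_nonneg: "v \<in> vecs S \<Longrightarrow> norm_in S v \<ge> 0"
  by (simp add: norm_in_def inner_pos)

lemma norm_square: "v \<in> vecs S \<Longrightarrow> (norm_in S v)\<^sup>2 = Re (inner_in S v v)"
  by (simp add: norm_in_def inner_pos)

lemma inner_square: "v \<in> vecs S \<Longrightarrow> inner_in S v v = of_real ((norm_in S v)\<^sup>2)"
  using inner_real norm_square by metis

text \<open>The usual choice of a minimising multiple of \<open>v\<close> divides by \<open>\<parallel>v\<parallel>\<^sup>2\<close>, which may vanish for a semi-inner
  product. Nonnegativity along all real multiples of the direction \<open>(u, v) v\<close> covers both cases.\<close>

lemma Cauchy_Schwarz:
  assumes "u \<in> vecs S" "v \<in> vecs S"
  shows "cmod (inner_in S u v) \<le> norm_in S u * norm_in S v"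
proof -
  let ?a = "inner_in S u v" and ?U = "(norm_in S u)\<^sup>2" and ?W = "(norm_in S v)\<^sup>2"
  let ?m = "(cmod ?a)\<^sup>2"
  have key: "0 \<le> ?U - 2 * s * ?m + s\<^sup>2 * ?m * ?W" for s :: real
  proof -
    let ?t = "- of_real s * ?a"
    have "inner_in S (plus_in S u (scale_in S ?t v)) (plus_in S u (scale_in S ?t v)) =
        inner_in S u u + cnj ?t * ?a + ?t * cnj ?a + ?t * cnj ?t * inner_in S v v"
      using assms inner_commute[of u v] by (simp add: inner_simps algebra_simps)
    also have "\<dots> = of_real (?U - 2 * s * ?m + s\<^sup>2 * ?m * ?W)"
      using inner_square[OF assms(1)] inner_square[OF assms(2)] complex_norm_square[of ?a]
      by (simp add: algebra_simps power2_eq_square)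
    finally have "Re (inner_in S (plus_in S u (scale_in S ?t v)) (plus_in S u (scale_in S ?t v))) =
      ?U - 2 * s * ?m + s\<^sup>2 * ?m * ?W" by simp
    then show ?thesis using inner_pos[of "plus_in S u (scale_in S ?t v)"] assms by simp
  qed
  have "?m \<le> ?U * ?W"
  proof (cases "?W = 0")
    case True
    have "?m = 0"
    proof (rule ccontr)
      assume "?m \<noteq> 0"
      then show False using key[of "(?U + 1) / (2 * ?m)"] True by simp
    qed
    then show ?thesis using True by simp
  next
    case False
    then have W: "?W > 0" using norm_nonneg[OF assms(2)] by simp
    then have "(1 / ?W)\<^sup>2 * ?m * ?W = ?m / ?W" by (simp add: field_simps power2_eq_square)
    then have "?m / ?W \<le> ?U" using key[of "1 / ?W"] by simp
    then show ?thesis using W by (simp add: pos_divide_le_eq)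
  qed
  then have "?m \<le> (norm_in S u * norm_in S v)\<^sup>2" by (simp add: power_mult_distrib)
  then show ?thesis
    using norm_nonneg[OF assms(1)] norm_nonneg[OF assms(2)] by (meson mult_nonneg_nonneg power2_le_imp_le)
qed

lemma norm_triangle:
  assumes "u \<in> vecs S" "v \<in> vecs S"
  shows "norm_in S (plus_in S u v) \<le> norm_in S u + norm_in S v"
proof (rule power2_le_imp_le)
  have "Re (inner_in S u v) \<le> norm_in S u * norm_in S v"
    using Cauchy_Schwarz[OF assms] complex_Re_le_cmod order_trans by blast
  moreover have "Re (inner_in S v u) = Re (inner_in S u v)" using inner_commute[OF assms] by simp
  ultimately show "(norm_in S (plus_in S u v))\<^sup>2 \<le> (norm_in S u + norm_in S v)\<^sup>2"
    using assms by (simp add: norm_square inner_simps power2_sum)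
qed (use assms norm_nonneg in simp)

lemma norm_scale: "v \<in> vecs S \<Longrightarrow> norm_in S (scale_in S z v) = cmod z * norm_in S v"
proof -
  assume v: "v \<in> vecs S"
  have "inner_in S (scale_in S z v) (scale_in S z v) = of_real ((cmod z)\<^sup>2 * (norm_in S v)\<^sup>2)"
    using v inner_square[OF v] by (simp add: inner_simps complex_norm_square del: of_real_power)
  then have "(norm_in S (scale_in S z v))\<^sup>2 = (cmod z * norm_in S v)\<^sup>2"
    using v by (simp add: norm_square power_mult_distrib del: of_real_power)
  then show ?thesis using v norm_nonneg by (simp add: power2_eq_iff_nonneg)
qed

lemma norm_zero: "norm_in S (zero_in S) = 0"
  using norm_scale[of "zero_in S" 0] scale_one[of "zero_in S"] plus_scale[of "zero_in S" 0 0]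
  by (metis inner_plus add_cancel_right_left norm_in_def zero_closed zero_plus Re_complex_of_real
      of_real_0 real_sqrt_zero)

lemma norm_diff_expand: "u \<in> vecs S \<Longrightarrow> v \<in> vecs S \<Longrightarrow>
   (norm_in S (diff_in S u v))\<^sup>2 = Re (inner_in S u u - inner_in S u v - inner_in S v u + inner_in S v v)"
  by (simp add: norm_square diff_in_def inner_simps)

lemma norm_diff_commute: "u \<in> vecs S \<Longrightarrow> v \<in> vecs S \<Longrightarrow> norm_in S (diff_in S u v) = norm_in S (diff_in S v u)"
  by (rule power2_eq_imp_eq) (simp_all add: norm_diff_expand norm_nonneg)

lemma norm_eqI:
  assumes "u \<in> vecs S" "v \<in> vecs S" "\<And>x. x \<in> vecs S \<Longrightarrow> inner_in S u x = inner_in S v x"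
  shows "norm_in S u = norm_in S v"
proof -
  have "inner_in S u u = inner_in S v v"
    using assms(3)[OF assms(1)] assms(3)[OF assms(2)] inner_commute[OF assms(1,2)]
      inner_commute[OF assms(2,2)] by simp
  then show ?thesis by (simp add: norm_in_def)
qed

lemma norm_diff_plus:
  assumes "u \<in> vecs S" "v \<in> vecs S" "u' \<in> vecs S" "v' \<in> vecs S"
  shows "norm_in S (diff_in S (plus_in S u v) (plus_in S u' v')) \<le>
    norm_in S (diff_in S u u') + norm_in S (diff_in S v v')"
proof -
  have "norm_in S (diff_in S (plus_in S u v) (plus_in S u' v')) =
      norm_in S (plus_in S (diff_in S u u') (diff_in S v v'))"
    by (rule norm_eqI) (use assms in \<open>simp_all add: diff_in_def inner_simps algebra_simps\<close>)
  then show ?thesis using norm_triangle[of "diff_in S u u'" "diff_in S v v'"] assms by simp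
qed

lemma norm_diff_scale:
  assumes "u \<in> vecs S" "u' \<in> vecs S"
  shows "norm_in S (diff_in S (scale_in S z u) (scale_in S z u')) = cmod z * norm_in S (diff_in S u u')"
proof -
  have "norm_in S (diff_in S (scale_in S z u) (scale_in S z u')) = norm_in S (scale_in S z (diff_in S u u'))"
    by (rule norm_eqI) (use assms in \<open>simp_all add: diff_in_def inner_simps algebra_simps\<close>)
  then show ?thesis using norm_scale[of "diff_in S u u'"] assms by simp
qed

lemma norm_diff_bound:
  assumes "u \<in> vecs S" "v \<in> vecs S"
  shows "\<bar>norm_in S u - norm_in S v\<bar> \<le> norm_in S (diff_in S u v)"
proof -
  have 1: "norm_in S u \<le> norm_in S v + norm_in S (diff_in S u v)" if "u \<in> vecs S" "v \<in> vecs S" for u v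
    using norm_triangle[of v "diff_in S u v"] plus_diff[of u v] that by simp
  show ?thesis using 1[OF assms] 1[OF assms(2,1)] norm_diff_commute[OF assms] by linarith
qed

subsection \<open>Cauchy sequences\<close>

lemma cauchy_simps [simp]:
  "plus_in (cauchy_space S) s t = (\<lambda>n. plus_in S (s n) (t n))"
  "zero_in (cauchy_space S) = (\<lambda>_. zero_in S)"
  "scale_in (cauchy_space S) z s = (\<lambda>n. scale_in S z (s n))"
  "inner_in (cauchy_space S) s t = lim (\<lambda>n. inner_in S (s n) (t n))"
  by (simp_all add: cauchy_space_def)

lemma cauchy_iff: "s \<in> vecs (cauchy_space S) \<longleftrightarrow> (\<forall>n. s n \<in> vecs S) \<and>
    (\<forall>e>0. \<exists>k. \<forall>m\<ge>k. \<forall>n\<ge>k. norm_in S (diff_in S (s m) (s n)) < e)"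
  by (auto simp: cauchy_space_def)

lemma cauchy_in [simp]: "s \<in> vecs (cauchy_space S) \<Longrightarrow> s n \<in> vecs S"
  by (simp add: cauchy_iff)

lemma cauchy_bounded:
  assumes "s \<in> vecs (cauchy_space S)"
  obtains b where "b > 0" "\<And>n. norm_in S (s n) \<le> b"
proof -
  obtain k where k: "\<And>m n. m \<ge> k \<Longrightarrow> n \<ge> k \<Longrightarrow> norm_in S (diff_in S (s m) (s n)) < 1"
    using assms unfolding cauchy_iff by (metis zero_less_one)
  let ?b = "(\<Sum>i\<le>k. norm_in S (s i)) + 1"
  have nn: "norm_in S (s i) \<ge> 0" for i using norm_nonneg assms by simp
  then have "?b > 0" by (simp add: add_nonneg_pos sum_nonneg)
  moreover have "norm_in S (s n) \<le> ?b" for n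
  proof (cases "n \<le> k")
    case True
    then have "norm_in S (s n) \<le> (\<Sum>i\<le>k. norm_in S (s i))" using nn by (intro member_le_sum) auto
    then show ?thesis by simp
  next
    case False
    have "norm_in S (s k) \<le> (\<Sum>i\<le>k. norm_in S (s i))" using nn by (intro member_le_sum) auto
    moreover have "\<bar>norm_in S (s n) - norm_in S (s k)\<bar> < 1"
      using norm_diff_bound[of "s n" "s k"] k[of n k] False assms by simp
    ultimately show ?thesis by linarith
  qed
  ultimately show thesis using that by blast
qed

lemma cauchyI_lim:
  assumes "\<And>n. t n \<in> vecs S" "\<And>m n. norm_in S (diff_in S (t m) (t n)) \<le> c * r m n"
    and "\<And>e. e > 0 \<Longrightarrow> \<exists>k. \<forall>m\<ge>k. \<forall>n\<ge>k. r m n < e" "c \<ge> (0::real)"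
  shows "t \<in> vecs (cauchy_space S)"
  unfolding cauchy_iff
proof (intro conjI allI impI)
  fix e :: real assume e: "e > 0"
  then obtain k where k: "\<And>m n. m \<ge> k \<Longrightarrow> n \<ge> k \<Longrightarrow> r m n < e / (c + 1)"
    using assms(3)[of "e / (c + 1)"] assms(4) by auto
  have "norm_in S (diff_in S (t m) (t n)) < e" if "m \<ge> k" "n \<ge> k" for m n
  proof -
    have "c * r m n \<le> c * (e / (c + 1))" using k[OF that] assms(4) by (intro mult_left_mono) auto
    also have "\<dots> < e" using e assms(4) by (simp add: field_simps)
    finally show ?thesis using assms(2)[of m n] by linarith
  qed
  then show "\<exists>k. \<forall>m\<ge>k. \<forall>n\<ge>k. norm_in S (diff_in S (t m) (t n)) < e" by blast
qed (use assms in simp)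

lemma cauchy_plus:
  assumes "s \<in> vecs (cauchy_space S)" "t \<in> vecs (cauchy_space S)"
  shows "(\<lambda>n. plus_in S (s n) (t n)) \<in> vecs (cauchy_space S)"
proof (rule cauchyI_lim[where c = 1 and
      r = "\<lambda>m n. norm_in S (diff_in S (s m) (s n)) + norm_in S (diff_in S (t m) (t n))"])
  fix e :: real assume e: "e > 0"
  obtain k where k: "\<forall>m\<ge>k. \<forall>n\<ge>k. norm_in S (diff_in S (s m) (s n)) < e / 2"
    using assms(1) e unfolding cauchy_iff by (meson half_gt_zero)
  obtain l where l: "\<forall>m\<ge>l. \<forall>n\<ge>l. norm_in S (diff_in S (t m) (t n)) < e / 2"
    using assms(2) e unfolding cauchy_iff by (meson half_gt_zero)
  show "\<exists>k. \<forall>m\<ge>k. \<forall>n\<ge>k. norm_in S (diff_in S (s m) (s n)) + norm_in S (diff_in S (t m) (t n)) < e"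
    using k l by (intro exI[of _ "max k l"]) (metis add_strict_mono field_sum_of_halves max.boundedE)
qed (use assms norm_diff_plus in auto)

lemma cauchy_scale:
  assumes "s \<in> vecs (cauchy_space S)"
  shows "(\<lambda>n. scale_in S z (s n)) \<in> vecs (cauchy_space S)"
  by (rule cauchyI_lim[where c = "cmod z" and r = "\<lambda>m n. norm_in S (diff_in S (s m) (s n))"])
    (use assms cauchy_iff[of s] norm_diff_scale in auto)

lemma cauchy_const: "v \<in> vecs S \<Longrightarrow> (\<lambda>_. v) \<in> vecs (cauchy_space S)"
  unfolding cauchy_iff by (auto simp: diff_self norm_zero)

text \<open>Estimate \<open>(s\<^sub>m, t\<^sub>m) - (s\<^sub>n, t\<^sub>n)\<close> by \<open>(s\<^sub>m - s\<^sub>n, t\<^sub>m) + (s\<^sub>n, t\<^sub>m - t\<^sub>n)\<close> and the Cauchy-Schwarz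
  inequality; Cauchy sequences are bounded.\<close>

lemma inner_convergent:
  assumes s: "s \<in> vecs (cauchy_space S)" and t: "t \<in> vecs (cauchy_space S)"
  shows "(\<lambda>n. inner_in S (s n) (t n)) \<longlonglongrightarrow> inner_in (cauchy_space S) s t"
proof -
  obtain a where a: "a > 0" "\<And>n. norm_in S (s n) \<le> a" by (rule cauchy_bounded[OF s]) (rule that)
  obtain b where b: "b > 0" "\<And>n. norm_in S (t n) \<le> b" by (rule cauchy_bounded[OF t]) (rule that)
  have bd: "cmod (inner_in S (s m) (t m) - inner_in S (s n) (t n)) \<le>
      norm_in S (diff_in S (s m) (s n)) * b + a * norm_in S (diff_in S (t m) (t n))" for m n
  proof -
    have "inner_in S (s m) (t m) - inner_in S (s n) (t n) =
        inner_in S (diff_in S (s m) (s n)) (t m) + inner_in S (s n) (diff_in S (t m) (t n))"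
      using s t by (simp add: diff_in_def inner_simps)
    also have "cmod \<dots> \<le> norm_in S (diff_in S (s m) (s n)) * norm_in S (t m) +
        norm_in S (s n) * norm_in S (diff_in S (t m) (t n))"
      using s t by (intro norm_triangle_mono Cauchy_Schwarz) auto
    also have "\<dots> \<le> norm_in S (diff_in S (s m) (s n)) * b + a * norm_in S (diff_in S (t m) (t n))"
      using a b s t norm_nonneg by (intro add_mono mult_left_mono mult_right_mono) auto
    finally show ?thesis .
  qed
  have "Cauchy (\<lambda>n. inner_in S (s n) (t n))"
  proof (rule CauchyI)
    fix e :: real assume e: "e > 0"
    obtain k where k: "\<forall>m\<ge>k. \<forall>n\<ge>k. norm_in S (diff_in S (s m) (s n)) < e / (2 * b)"
      using s e b(1) unfolding cauchy_iff by (meson divide_pos_pos mult_pos_pos zero_less_numeral)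
    obtain l where l: "\<forall>m\<ge>l. \<forall>n\<ge>l. norm_in S (diff_in S (t m) (t n)) < e / (2 * a)"
      using t e a(1) unfolding cauchy_iff by (meson divide_pos_pos mult_pos_pos zero_less_numeral)
    show "\<exists>M. \<forall>m\<ge>M. \<forall>n\<ge>M. norm (inner_in S (s m) (t m) - inner_in S (s n) (t n)) < e"
    proof (intro exI[of _ "max k l"] allI impI)
      fix m n assume mn: "m \<ge> max k l" "n \<ge> max k l"
      have "norm_in S (diff_in S (s m) (s n)) * b < e / (2 * b) * b"
        using k mn b(1) by (intro mult_strict_right_mono) auto
      moreover have "a * norm_in S (diff_in S (t m) (t n)) < a * (e / (2 * a))"
        using l mn a(1) by (intro mult_strict_left_mono) auto
      ultimately show "norm (inner_in S (s m) (t m) - inner_in S (s n) (t n)) < e"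
        using bd[of m n] a(1) b(1) by simp
    qed
  qed
  then show ?thesis by (simp add: Cauchy_convergent_iff convergent_LIMSEQ_iff)
qed

lemma semi_inner_cauchy: "semi_inner (cauchy_space S)"
proof unfold_locales
  fix s t u assume s: "s \<in> vecs (cauchy_space S)" and t: "t \<in> vecs (cauchy_space S)"
    and u: "u \<in> vecs (cauchy_space S)"
  show "inner_in (cauchy_space S) (plus_in (cauchy_space S) s t) u =
      inner_in (cauchy_space S) s u + inner_in (cauchy_space S) t u"
    using LIMSEQ_unique[OF inner_convergent[OF cauchy_plus[OF s t] u]
        tendsto_add[OF inner_convergent[OF s u] inner_convergent[OF t u], THEN tendsto_cong[THEN iffD1, rotated]]]
      s t u by (simp add: inner_plus)
next
  fix s t z assume s: "s \<in> vecs (cauchy_space S)" and t: "t \<in> vecs (cauchy_space S)"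
  show "inner_in (cauchy_space S) (scale_in (cauchy_space S) z s) t = z * inner_in (cauchy_space S) s t"
    using LIMSEQ_unique[OF inner_convergent[OF cauchy_scale[OF s] t]
        tendsto_mult_left[OF inner_convergent[OF s t], THEN tendsto_cong[THEN iffD1, rotated]]]
      s t by (simp add: inner_scale)
  have "(\<lambda>n. inner_in S (t n) (s n)) \<longlonglongrightarrow> cnj (inner_in (cauchy_space S) s t)"
  proof -
    have "inner_in S (t n) (s n) = cnj (inner_in S (s n) (t n))" for n
      using inner_commute[of "s n" "t n"] s t by simp
    then show ?thesis using tendsto_cnj[OF inner_convergent[OF s t]] by (simp only:)
  qed
  then show "inner_in (cauchy_space S) t s = cnj (inner_in (cauchy_space S) s t)"
    using LIMSEQ_unique[OF inner_convergent[OF t s]] by blast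
next
  fix s assume s: "s \<in> vecs (cauchy_space S)"
  have "0 \<le> Re (inner_in S (s n) (s n))" for n using inner_pos s by simp
  then show "0 \<le> Re (inner_in (cauchy_space S) s s)"
    using LIMSEQ_le_const[OF tendsto_Re[OF inner_convergent[OF s s]]] by blast
qed (auto simp: cauchy_const cauchy_plus cauchy_scale plus_assoc zero_plus plus_neg scale_plus
    plus_scale scale_scale scale_one intro!: ext plus_comm)

lemma norm_cauchy:
  assumes "s \<in> vecs (cauchy_space S)"
  shows "(\<lambda>n. norm_in S (s n)) \<longlonglongrightarrow> norm_in (cauchy_space S) s"
  unfolding norm_in_def by (intro tendsto_real_sqrt tendsto_Re inner_convergent assms)

lemma null_iff: "s \<in> null_seqs S \<longleftrightarrow> (\<forall>n. s n \<in> vecs S) \<and> (\<lambda>n. norm_in S (s n)) \<longlonglongrightarrow> 0"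
  unfolding null_seqs_def by auto

text \<open>Null sequences are the vectors of norm zero for the limit inner product on Cauchy sequences; hence
  they form a subspace, and the inner product descends to the quotient by them.\<close>

lemma null_iff_norm: "s \<in> null_seqs S \<longleftrightarrow> s \<in> vecs (cauchy_space S) \<and> norm_in (cauchy_space S) s = 0"
proof
  assume n: "s \<in> null_seqs S"
  then have v: "s n \<in> vecs S" for n by (simp add: null_iff)
  have "s \<in> vecs (cauchy_space S)"
  proof (rule cauchyI_lim[where c = 1 and r = "\<lambda>m n. norm_in S (s m) + norm_in S (s n)"])
    show "norm_in S (diff_in S (s m) (s n)) \<le> 1 * (norm_in S (s m) + norm_in S (s n))" for m n
      using norm_triangle[of "s m" "scale_in S (-1) (s n)"] norm_scale[of "s n" "-1"] v
      by (simp add: diff_in_def)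
    fix e :: real assume "e > 0"
    then obtain k where "\<And>n. n \<ge> k \<Longrightarrow> norm_in S (s n) < e / 2"
      using n order_tendstoD(2)[of "\<lambda>n. norm_in S (s n)" 0 sequentially "e / 2"]
      unfolding null_iff eventually_sequentially by auto
    then show "\<exists>k. \<forall>m\<ge>k. \<forall>n\<ge>k. norm_in S (s m) + norm_in S (s n) < e"
      by (metis add_strict_mono field_sum_of_halves)
  qed (use v in auto)
  then show "s \<in> vecs (cauchy_space S) \<and> norm_in (cauchy_space S) s = 0"
    using norm_cauchy LIMSEQ_unique n null_iff by blast
qed (use norm_cauchy in \<open>force simp: null_iff\<close>)

sublocale completion: quotient_vec_space "cauchy_space S" "null_seqs S"
proof -
  interpret C: semi_inner "cauchy_space S" by (rule semi_inner_cauchy)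
  show "quotient_vec_space (cauchy_space S) (null_seqs S)"
  proof unfold_locales
    fix m n assume "m \<in> null_seqs S" "n \<in> null_seqs S"
    then show "plus_in (cauchy_space S) m n \<in> null_seqs S"
      using C.norm_triangle[of m n] C.norm_nonneg[of "plus_in (cauchy_space S) m n"]
      unfolding null_iff_norm by (auto simp del: cauchy_simps)
  next
    fix m z assume "m \<in> null_seqs S"
    then show "scale_in (cauchy_space S) z m \<in> null_seqs S"
      using C.norm_scale[of m] unfolding null_iff_norm by (auto simp del: cauchy_simps)
  qed (auto simp: null_iff_norm C.norm_zero simp del: cauchy_simps)
qed

abbreviation "lim_cls \<equiv> coset_in (cauchy_space S) (null_seqs S)"

lemma lim_cls_eq_iff:
  assumes "s \<in> vecs (cauchy_space S)" "t \<in> vecs (cauchy_space S)"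
  shows "lim_cls s = lim_cls t \<longleftrightarrow> (\<lambda>n. norm_in S (diff_in S (s n) (t n))) \<longlonglongrightarrow> 0"
  unfolding completion.coset_eq_iff[OF assms] null_iff using assms by (auto simp: diff_in_def)

lemma inner_completion:
  assumes s: "s \<in> vecs (cauchy_space S)" and t: "t \<in> vecs (cauchy_space S)"
  shows "inner_in (hilbert_completion S) (lim_cls s) (lim_cls t) = inner_in (cauchy_space S) s t"
proof -
  interpret C: semi_inner "cauchy_space S" by (rule semi_inner_cauchy)
  let ?s = "some_rep (lim_cls s)" and ?t = "some_rep (lim_cls t)"
  have st: "?s \<in> vecs (cauchy_space S)" "?t \<in> vecs (cauchy_space S)"
    using completion.rep_closed s t by auto
  have n: "norm_in (cauchy_space S) (diff_in (cauchy_space S) ?s s) = 0"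
    "norm_in (cauchy_space S) (diff_in (cauchy_space S) ?t t) = 0"
    using completion.coset_eq_iff completion.coset_rep s t st null_iff_norm by blast+
  have "inner_in (cauchy_space S) (diff_in (cauchy_space S) ?s s) ?t = 0"
    using C.Cauchy_Schwarz[of "diff_in (cauchy_space S) ?s s" ?t] n s st by (simp del: cauchy_simps)
  moreover have "inner_in (cauchy_space S) s (diff_in (cauchy_space S) ?t t) = 0"
    using C.Cauchy_Schwarz[of s "diff_in (cauchy_space S) ?t t"] n t s st by (simp del: cauchy_simps)
  ultimately have "inner_in (cauchy_space S) ?s ?t = inner_in (cauchy_space S) s t"
    using s t st unfolding diff_in_def by (simp add: C.inner_simps del: cauchy_simps)
  then show ?thesis by (simp add: hilbert_completion_def quotient_space_def del: cauchy_simps)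
qed

lemma norm_completion:
  "s \<in> vecs (cauchy_space S) \<Longrightarrow> (\<lambda>n. norm_in S (s n)) \<longlonglongrightarrow> norm_in (hilbert_completion S) (lim_cls s)"
  using norm_cauchy inner_completion by (simp add: norm_in_def del: cauchy_simps)

lemma vecs_completion: "vecs (hilbert_completion S) = lim_cls ` vecs (cauchy_space S)"
  by (simp add: hilbert_completion_def completion.vecs_quotient)

lemma plus_completion:
  "s \<in> vecs (cauchy_space S) \<Longrightarrow> t \<in> vecs (cauchy_space S) \<Longrightarrow>
    plus_in (hilbert_completion S) (lim_cls s) (lim_cls t) = lim_cls (\<lambda>n. plus_in S (s n) (t n))"
  using completion.plus_quotient by (simp add: hilbert_completion_def)

lemma scale_completion:
  "s \<in> vecs (cauchy_space S) \<Longrightarrow>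
    scale_in (hilbert_completion S) z (lim_cls s) = lim_cls (\<lambda>n. scale_in S z (s n))"
  using completion.scale_quotient by (simp add: hilbert_completion_def)

end

subsection \<open>Extension of operators to completions\<close>

definition completion_map :: "'v inner_space \<Rightarrow> 'w inner_space \<Rightarrow> ('v \<Rightarrow> 'w) \<Rightarrow> (nat \<Rightarrow> 'v) set \<Rightarrow> (nat \<Rightarrow> 'w) set" where
  "completion_map S T F a = coset_in (cauchy_space T) (null_seqs T) (\<lambda>n. F (some_rep a n))"

lemma completion_op_eq_map: "completion_op S F = completion_map S S F"
  by (rule ext) (simp add: completion_op_def quotient_op_def completion_map_def)

lemma (in semi_inner) inner_zero: "w \<in> vecs S \<Longrightarrow> inner_in S (zero_in S) w = 0"
  using inner_plus[of "zero_in S" "zero_in S" w] zero_plus[of "zero_in S"] by simp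

lemma (in semi_inner) norm_diff_zero: "v \<in> vecs S \<Longrightarrow> norm_in S (diff_in S v (zero_in S)) = norm_in S v"
  by (rule norm_eqI) (simp_all add: diff_in_def inner_simps inner_zero)

lemma (in semi_inner) norm_diff_self: "v \<in> vecs S \<Longrightarrow> norm_in S (diff_in S v v) = 0"
  by (simp add: diff_self norm_zero)

text \<open>Linearity is required only up to vectors of norm zero, which become zero in the completion. An
  operator that is intertwined with a linear one by a linear map multiplying norms by a constant is
  known to be linear only in this sense.\<close>

locale almost_linear = S: semi_inner S + T: semi_inner T
  for S :: "'v inner_space" and T :: "'w inner_space" +
  fixes F :: "'v \<Rightarrow> 'w" and c :: real
  assumes F_closed: "v \<in> vecs S \<Longrightarrow> F v \<in> vecs T"
    and c_nonneg: "c \<ge> 0"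
    and lipschitz: "v \<in> vecs S \<Longrightarrow> w \<in> vecs S \<Longrightarrow>
      norm_in T (diff_in T (F v) (F w)) \<le> c * norm_in S (diff_in S v w)"
    and almost_add: "v \<in> vecs S \<Longrightarrow> w \<in> vecs S \<Longrightarrow>
      norm_in T (diff_in T (F (plus_in S v w)) (plus_in T (F v) (F w))) = 0"
    and almost_scale: "v \<in> vecs S \<Longrightarrow>
      norm_in T (diff_in T (F (scale_in S z v)) (scale_in T z (F v))) = 0"
begin

lemma F_cauchy: "s \<in> vecs (cauchy_space S) \<Longrightarrow> (\<lambda>n. F (s n)) \<in> vecs (cauchy_space T)"
  by (rule T.cauchyI_lim[where c = c and r = "\<lambda>m n. norm_in S (diff_in S (s m) (s n))"])
    (use F_closed lipschitz c_nonneg S.cauchy_iff[of s] in auto)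

lemma completion_map_cls:
  assumes "s \<in> vecs (cauchy_space S)"
  shows "completion_map S T F (S.lim_cls s) = T.lim_cls (\<lambda>n. F (s n))"
proof -
  let ?t = "some_rep (S.lim_cls s)"
  have t: "?t \<in> vecs (cauchy_space S)" "S.lim_cls ?t = S.lim_cls s"
    using S.completion.rep_closed S.completion.coset_rep assms by auto
  then have "(\<lambda>n. norm_in S (diff_in S (?t n) (s n))) \<longlonglongrightarrow> 0"
    using S.lim_cls_eq_iff[OF t(1) assms] by simp
  then have lim: "(\<lambda>n. c * norm_in S (diff_in S (?t n) (s n))) \<longlonglongrightarrow> 0"
    by (rule tendsto_mult_right_zero)
  have ge: "0 \<le> norm_in T (diff_in T (F (?t n)) (F (s n)))"
    and le: "norm_in T (diff_in T (F (?t n)) (F (s n))) \<le> c * norm_in S (diff_in S (?t n) (s n))" for n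
    using t assms F_closed lipschitz T.norm_nonneg by auto
  have "(\<lambda>n. norm_in T (diff_in T (F (?t n)) (F (s n)))) \<longlonglongrightarrow> 0"
    by (rule tendsto_sandwich[OF always_eventually[OF allI[OF ge]] always_eventually[OF allI[OF le]]
          tendsto_const lim])
  then show ?thesis
    unfolding completion_map_def using T.lim_cls_eq_iff[OF F_cauchy[OF t(1)] F_cauchy[OF assms]] by simp
qed

lemma norm_F_zero: "norm_in T (F (zero_in S)) = 0"
proof -
  let ?z = "F (zero_in S)"
  have z: "?z \<in> vecs T" by (simp add: F_closed)
  have "norm_in T (diff_in T ?z (plus_in T ?z ?z)) = norm_in T (scale_in T (-1) ?z)"
    by (rule T.norm_eqI) (simp_all add: z diff_in_def T.inner_simps)
  then show ?thesis
    using almost_add[of "zero_in S" "zero_in S"] S.zero_plus[of "zero_in S"] T.norm_scale[OF z, of "-1"]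
    by simp
qed

lemma norm_bound:
  assumes v: "v \<in> vecs S" shows "norm_in T (F v) \<le> c * norm_in S v"
proof -
  have "\<bar>norm_in T (F v) - norm_in T (F (zero_in S))\<bar> \<le> c * norm_in S (diff_in S v (zero_in S))"
    using T.norm_diff_bound[of "F v" "F (zero_in S)"] lipschitz[OF v S.zero_closed] F_closed v
    by fastforce
  then show ?thesis using norm_F_zero S.norm_diff_zero[OF v] by simp
qed

lemma completion_map_linear: "linear_in (hilbert_completion S) (hilbert_completion T) (completion_map S T F)"
  unfolding linear_in_def
proof (intro conjI ballI allI subsetI)
  fix y assume "y \<in> completion_map S T F ` vecs (hilbert_completion S)"
  then show "y \<in> vecs (hilbert_completion T)"
    unfolding S.vecs_completion T.vecs_completion by (auto simp: completion_map_cls F_cauchy)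
next
  fix a b assume "a \<in> vecs (hilbert_completion S)" "b \<in> vecs (hilbert_completion S)"
  then obtain s t where st: "s \<in> vecs (cauchy_space S)" "t \<in> vecs (cauchy_space S)"
    "a = S.lim_cls s" "b = S.lim_cls t" unfolding S.vecs_completion by blast
  have "T.lim_cls (\<lambda>n. F (plus_in S (s n) (t n))) = T.lim_cls (\<lambda>n. plus_in T (F (s n)) (F (t n)))"
    using T.lim_cls_eq_iff[OF F_cauchy[OF S.cauchy_plus[OF st(1,2)]]
        T.cauchy_plus[OF F_cauchy[OF st(1)] F_cauchy[OF st(2)]]] almost_add st by simp
  then show "completion_map S T F (plus_in (hilbert_completion S) a b) =
      plus_in (hilbert_completion T) (completion_map S T F a) (completion_map S T F b)"
    using st by (simp add: S.plus_completion T.plus_completion completion_map_cls S.cauchy_plus F_cauchy)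
next
  fix a z assume "a \<in> vecs (hilbert_completion S)"
  then obtain s where s: "s \<in> vecs (cauchy_space S)" "a = S.lim_cls s"
    unfolding S.vecs_completion by blast
  have "T.lim_cls (\<lambda>n. F (scale_in S z (s n))) = T.lim_cls (\<lambda>n. scale_in T z (F (s n)))"
    using T.lim_cls_eq_iff[OF F_cauchy[OF S.cauchy_scale[OF s(1)]]
        T.cauchy_scale[OF F_cauchy[OF s(1)]]] almost_scale s by simp
  then show "completion_map S T F (scale_in (hilbert_completion S) z a) =
      scale_in (hilbert_completion T) z (completion_map S T F a)"
    using s by (simp add: S.scale_completion T.scale_completion completion_map_cls S.cauchy_scale F_cauchy)
qed

lemma completion_map_bounded: "bounded_in (hilbert_completion S) (hilbert_completion T) (completion_map S T F)"
  unfolding bounded_in_def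
proof (intro conjI completion_map_linear exI[of _ c] ballI)
  fix a assume "a \<in> vecs (hilbert_completion S)"
  then obtain s where s: "s \<in> vecs (cauchy_space S)" "a = S.lim_cls s"
    unfolding S.vecs_completion by blast
  show "norm_in (hilbert_completion T) (completion_map S T F a) \<le> c * norm_in (hilbert_completion S) a"
    unfolding s(2) completion_map_cls[OF s(1)]
    by (rule LIMSEQ_le[OF T.norm_completion[OF F_cauchy[OF s(1)]]
          tendsto_mult_left[OF S.norm_completion[OF s(1)]]]) (use norm_bound s in auto)
qed

end

text \<open>The situation of the map \<open>\<chi>\<close> before completion. The action on the source is only assumed to be
  closed and intertwined with the representation on the target: applying \<open>J\<close> gives boundedness and
  adjoints on the source, and, up to vectors of norm zero, linearity and multiplicativity.\<close>

locale scaled_isometry = S: semi_inner S + T: semi_inner T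
  for S :: "'v inner_space" and T :: "'w inner_space" +
  fixes J :: "'v \<Rightarrow> 'w" and k :: real
    and \<Xi> :: "('k, 'y, 'n::finite) action_orbifold"
    and R :: "('k \<times> 'y \<Rightarrow> complex) \<Rightarrow> 'v \<Rightarrow> 'v" and R' :: "('k \<times> 'y \<Rightarrow> complex) \<Rightarrow> 'w \<Rightarrow> 'w"
  assumes J_linear: "linear_in S T J"
    and J_onto: "J ` vecs S = vecs T"
    and k_pos: "k > 0"
    and J_inner: "v \<in> vecs S \<Longrightarrow> w \<in> vecs S \<Longrightarrow> inner_in T (J v) (J w) = of_real k * inner_in S v w"
    and R_closed: "b \<in> conv_algebra \<Xi> \<Longrightarrow> v \<in> vecs S \<Longrightarrow> R b v \<in> vecs S"
    and J_R: "b \<in> conv_algebra \<Xi> \<Longrightarrow> v \<in> vecs S \<Longrightarrow> J (R b v) = R' b (J v)"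
    and rep: "representation \<Xi> T R'"
    and star_closed: "b \<in> conv_algebra \<Xi> \<Longrightarrow> star \<Xi> b \<in> conv_algebra \<Xi>"
    and conv_closed: "b \<in> conv_algebra \<Xi> \<Longrightarrow> b' \<in> conv_algebra \<Xi> \<Longrightarrow> conv \<Xi> b b' \<in> conv_algebra \<Xi>"
    and comb_closed: "b \<in> conv_algebra \<Xi> \<Longrightarrow> b' \<in> conv_algebra \<Xi> \<Longrightarrow>
      (\<lambda>\<tau>. z * b \<tau> + b' \<tau>) \<in> conv_algebra \<Xi>"
begin

lemma J_closed [simp]: "v \<in> vecs S \<Longrightarrow> J v \<in> vecs T"
  using J_onto by blast

lemma
  assumes "v \<in> vecs S"
  shows J_plus: "w \<in> vecs S \<Longrightarrow> J (plus_in S v w) = plus_in T (J v) (J w)"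
    and J_scale: "J (scale_in S z v) = scale_in T z (J v)"
  using J_linear assms unfolding linear_in_def by auto

lemma J_diff: "v \<in> vecs S \<Longrightarrow> w \<in> vecs S \<Longrightarrow> J (diff_in S v w) = diff_in T (J v) (J w)"
  by (simp add: diff_in_def J_plus J_scale)

lemma norm_J: "v \<in> vecs S \<Longrightarrow> norm_in T (J v) = sqrt k * norm_in S v"
  by (simp add: norm_in_def J_inner real_sqrt_mult)

lemma null_via_J: "v \<in> vecs S \<Longrightarrow> w \<in> vecs S \<Longrightarrow> J v = J w \<Longrightarrow> norm_in S (diff_in S v w) = 0"
  using norm_J[of "diff_in S v w"] k_pos T.norm_diff_self[of "J w"] by (simp add: J_diff)

lemma R'_closed: "b \<in> conv_algebra \<Xi> \<Longrightarrow> w \<in> vecs T \<Longrightarrow> R' b w \<in> vecs T"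
  using rep unfolding representation_def bounded_in_def linear_in_def by blast

lemma R'_linear:
  assumes "b \<in> conv_algebra \<Xi>" "v \<in> vecs T"
  shows "w \<in> vecs T \<Longrightarrow> R' b (plus_in T v w) = plus_in T (R' b v) (R' b w)"
    and "R' b (scale_in T z v) = scale_in T z (R' b v)"
  using rep assms unfolding representation_def bounded_in_def linear_in_def by blast+

lemma R'_bounded:
  assumes "b \<in> conv_algebra \<Xi>"
  obtains c where "c \<ge> 0" "\<And>w. w \<in> vecs T \<Longrightarrow> norm_in T (R' b w) \<le> c * norm_in T w"
proof -
  have "\<exists>c. \<forall>w\<in>vecs T. norm_in T (R' b w) \<le> c * norm_in T w"
    using rep assms unfolding representation_def bounded_in_def by blast
  then obtain c where c: "\<forall>w\<in>vecs T. norm_in T (R' b w) \<le> c * norm_in T w" ..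
  have "norm_in T (R' b w) \<le> \<bar>c\<bar> * norm_in T w" if "w \<in> vecs T" for w
  proof -
    have "c * norm_in T w \<le> \<bar>c\<bar> * norm_in T w"
      using T.norm_nonneg[OF that] by (intro mult_right_mono) auto
    then show ?thesis using c that by fastforce
  qed
  then show thesis using that[of "\<bar>c\<bar>"] by simp
qed

lemma R_almost_linear:
  assumes b: "b \<in> conv_algebra \<Xi>"
  obtains c where "almost_linear S S (R b) c"
proof -
  obtain c where c: "c \<ge> 0" "\<And>w. w \<in> vecs T \<Longrightarrow> norm_in T (R' b w) \<le> c * norm_in T w"
    by (rule R'_bounded[OF b]) (rule that)
  have "almost_linear S S (R b) c"
  proof unfold_locales
    fix v w assume vw: "v \<in> vecs S" "w \<in> vecs S"
    have "J (diff_in S (R b v) (R b w)) = R' b (J (diff_in S v w))"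
      using vw b by (simp add: J_diff R_closed J_R) (simp add: diff_in_def R'_linear)
    then have "sqrt k * norm_in S (diff_in S (R b v) (R b w)) \<le> c * (sqrt k * norm_in S (diff_in S v w))"
      using c(2)[of "J (diff_in S v w)"] vw b norm_J by (metis J_closed R_closed S.diff_closed)
    then show "norm_in S (diff_in S (R b v) (R b w)) \<le> c * norm_in S (diff_in S v w)"
      using k_pos by (simp add: mult.left_commute)
    show "norm_in S (diff_in S (R b (plus_in S v w)) (plus_in S (R b v) (R b w))) = 0"
      using vw b by (intro null_via_J) (simp_all add: R_closed J_R J_plus R'_linear)
  next
    fix v z assume v: "v \<in> vecs S"
    show "norm_in S (diff_in S (R b (scale_in S z v)) (scale_in S z (R b v))) = 0"
      using v b by (intro null_via_J) (simp_all add: R_closed J_R J_scale R'_linear)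
  qed (use R_closed b c(1) in auto)
  then show thesis by (rule that)
qed

lemma R_adjoint:
  assumes b: "b \<in> conv_algebra \<Xi>" and vw: "v \<in> vecs S" "w \<in> vecs S"
  shows "inner_in S (R b v) w = inner_in S v (R (star \<Xi> b) w)"
proof -
  have "of_real k * inner_in S (R b v) w = inner_in T (R' b (J v)) (J w)"
    using J_inner[of "R b v" w] vw b by (simp add: R_closed J_R)
  also have "\<dots> = inner_in T (J v) (R' (star \<Xi> b) (J w))"
    using rep b vw unfolding representation_def by simp
  also have "\<dots> = of_real k * inner_in S v (R (star \<Xi> b) w)"
    using J_inner[of v "R (star \<Xi> b) w"] vw star_closed[OF b] by (simp add: R_closed J_R)
  finally show ?thesis using k_pos by simp
qed

lemma representation_completion:
  "representation \<Xi> (hilbert_completion S) (\<lambda>b. completion_op S (R b))"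
  unfolding representation_def completion_op_eq_map
proof (intro ballI conjI allI)
  fix a assume a: "a \<in> conv_algebra \<Xi>"
  obtain c where "almost_linear S S (R a) c" by (rule R_almost_linear[OF a]) (rule that)
  then interpret A: almost_linear S S "R a" c .
  obtain c' where "almost_linear S S (R (star \<Xi> a)) c'"
    by (rule R_almost_linear[OF star_closed[OF a]]) (rule that)
  then interpret A': almost_linear S S "R (star \<Xi> a)" c' .
  show "bounded_in (hilbert_completion S) (hilbert_completion S) (completion_map S S (R a))"
    by (rule A.completion_map_bounded)
  show "inner_in (hilbert_completion S) (completion_map S S (R a) v) w =
      inner_in (hilbert_completion S) v (completion_map S S (R (star \<Xi> a)) w)"
    if "v \<in> vecs (hilbert_completion S)" "w \<in> vecs (hilbert_completion S)" for v w
  proof -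
    from that obtain s t where st: "s \<in> vecs (cauchy_space S)" "t \<in> vecs (cauchy_space S)"
      "v = S.lim_cls s" "w = S.lim_cls t" unfolding S.vecs_completion by blast
    have "(\<lambda>n. inner_in S (R a (s n)) (t n)) = (\<lambda>n. inner_in S (s n) (R (star \<Xi> a) (t n)))"
      using R_adjoint[OF a] st by auto
    then show ?thesis
      using st by (simp add: A.completion_map_cls A'.completion_map_cls S.inner_completion A.F_cauchy A'.F_cauchy)
  qed
  fix b assume b: "b \<in> conv_algebra \<Xi>"
  obtain d where "almost_linear S S (R b) d" by (rule R_almost_linear[OF b]) (rule that)
  then interpret B: almost_linear S S "R b" d .
  fix v assume "v \<in> vecs (hilbert_completion S)"
  then obtain s where s: "s \<in> vecs (cauchy_space S)" "v = S.lim_cls s"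
    unfolding S.vecs_completion by blast
  obtain d' where "almost_linear S S (R (conv \<Xi> a b)) d'"
    by (rule R_almost_linear[OF conv_closed[OF a b]]) (rule that)
  then interpret AB: almost_linear S S "R (conv \<Xi> a b)" d' .
  have "norm_in S (diff_in S (R (conv \<Xi> a b) (s n)) (R a (R b (s n)))) = 0" for n
    using s a b conv_closed[OF a b] rep unfolding representation_def
    by (intro null_via_J) (simp_all add: R_closed J_R)
  then have "S.lim_cls (\<lambda>n. R (conv \<Xi> a b) (s n)) = S.lim_cls (\<lambda>n. R a (R b (s n)))"
    using S.lim_cls_eq_iff[OF AB.F_cauchy[OF s(1)] A.F_cauchy[OF B.F_cauchy[OF s(1)]]] by simp
  then show "completion_map S S (R (conv \<Xi> a b)) v = completion_map S S (R a) (completion_map S S (R b) v)"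
    using s by (simp add: A.completion_map_cls B.completion_map_cls AB.completion_map_cls B.F_cauchy)
  fix z
  obtain d'' where "almost_linear S S (R (\<lambda>\<tau>. z * a \<tau> + b \<tau>)) d''"
    by (rule R_almost_linear[OF comb_closed[OF a b]]) (rule that)
  then interpret C: almost_linear S S "R (\<lambda>\<tau>. z * a \<tau> + b \<tau>)" d'' .
  have "norm_in S (diff_in S (R (\<lambda>\<tau>. z * a \<tau> + b \<tau>) (s n)) (plus_in S (scale_in S z (R a (s n))) (R b (s n)))) = 0" for n
    using s a b comb_closed[OF a b, of z] rep unfolding representation_def
    by (intro null_via_J) (simp_all add: R_closed J_R J_plus J_scale)
  then have "S.lim_cls (\<lambda>n. R (\<lambda>\<tau>. z * a \<tau> + b \<tau>) (s n)) =
      S.lim_cls (\<lambda>n. plus_in S (scale_in S z (R a (s n))) (R b (s n)))"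
    using S.lim_cls_eq_iff[OF C.F_cauchy[OF s(1)]
        S.cauchy_plus[OF S.cauchy_scale[OF A.F_cauchy[OF s(1)]] B.F_cauchy[OF s(1)]]] by simp
  then show "completion_map S S (R (\<lambda>\<tau>. z * a \<tau> + b \<tau>)) v =
      plus_in (hilbert_completion S) (scale_in (hilbert_completion S) z (completion_map S S (R a) v)) (completion_map S S (R b) v)"
    using s by (simp add: A.completion_map_cls B.completion_map_cls C.completion_map_cls S.plus_completion S.scale_completion
        A.F_cauchy B.F_cauchy S.cauchy_scale)
qed

sublocale J: almost_linear S T J "sqrt k"
proof unfold_locales
  fix v w assume "v \<in> vecs S" "w \<in> vecs S"
  then show "norm_in T (diff_in T (J v) (J w)) \<le> sqrt k * norm_in S (diff_in S v w)"
    using norm_J[of "diff_in S v w"] by (simp add: J_diff)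
qed (use k_pos in \<open>simp_all add: J_plus J_scale T.norm_diff_self\<close>)

lemma completion_map_J_const: "v \<in> vecs S \<Longrightarrow> completion_map S T J (to_completion S v) = to_completion T (J v)"
  unfolding to_completion_def using J.completion_map_cls[OF S.cauchy_const] by simp

lemma norm_completion_map_J:
  assumes "a \<in> vecs (hilbert_completion S)"
  shows "norm_in (hilbert_completion T) (completion_map S T J a) = sqrt k * norm_in (hilbert_completion S) a"
proof -
  obtain s where s: "s \<in> vecs (cauchy_space S)" "a = S.lim_cls s"
    using assms unfolding S.vecs_completion by blast
  have "(\<lambda>n. norm_in T (J (s n))) \<longlonglongrightarrow> sqrt k * norm_in (hilbert_completion S) a"
    using tendsto_mult_left[OF S.norm_completion[OF s(1)], of "sqrt k"] s norm_J by simp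
  then show ?thesis
    using LIMSEQ_unique[OF T.norm_completion[OF J.F_cauchy[OF s(1)]]] s J.completion_map_cls by simp
qed

text \<open>Injectivity holds because \<open>J\<close> multiplies norms by \<open>\<surd>k\<close>. For surjectivity, preimages of the terms
  of a Cauchy sequence form again a Cauchy sequence.\<close>

lemma completion_map_J_bij: "bij_betw (completion_map S T J) (vecs (hilbert_completion S)) (vecs (hilbert_completion T))"
proof (rule bij_betw_imageI)
  show "inj_on (completion_map S T J) (vecs (hilbert_completion S))"
  proof (rule inj_onI)
    fix a b assume ab: "a \<in> vecs (hilbert_completion S)" "b \<in> vecs (hilbert_completion S)"
      "completion_map S T J a = completion_map S T J b"
    then obtain s t where st: "s \<in> vecs (cauchy_space S)" "t \<in> vecs (cauchy_space S)"
      "a = S.lim_cls s" "b = S.lim_cls t" unfolding S.vecs_completion by blast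
    then have "(\<lambda>n. norm_in T (diff_in T (J (s n)) (J (t n)))) \<longlonglongrightarrow> 0"
      using ab(3) T.lim_cls_eq_iff[OF J.F_cauchy[OF st(1)] J.F_cauchy[OF st(2)]] by (simp add: J.completion_map_cls)
    then have "(\<lambda>n. sqrt k * norm_in S (diff_in S (s n) (t n))) \<longlonglongrightarrow> 0"
      using st norm_J[of "diff_in S (s n) (t n)" for n] by (simp add: J_diff)
    then have "(\<lambda>n. norm_in S (diff_in S (s n) (t n))) \<longlonglongrightarrow> 0"
      using tendsto_mult_left_iff[of "sqrt k" _ 0] k_pos by simp
    then show "a = b" using S.lim_cls_eq_iff[OF st(1,2)] st by simp
  qed
  show "completion_map S T J ` vecs (hilbert_completion S) = vecs (hilbert_completion T)"
  proof
    show "completion_map S T J ` vecs (hilbert_completion S) \<subseteq> vecs (hilbert_completion T)"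
      using J.completion_map_linear unfolding linear_in_def by blast
    show "vecs (hilbert_completion T) \<subseteq> completion_map S T J ` vecs (hilbert_completion S)"
    proof
      fix b assume "b \<in> vecs (hilbert_completion T)"
      then obtain t where t: "t \<in> vecs (cauchy_space T)" "b = T.lim_cls t"
        unfolding T.vecs_completion by blast
      have "\<forall>n. \<exists>v. v \<in> vecs S \<and> J v = t n" using J_onto t T.cauchy_in by (metis imageE)
      then obtain s where s: "\<And>n. s n \<in> vecs S" "\<And>n. J (s n) = t n" by metis
      have "s \<in> vecs (cauchy_space S)"
      proof (rule S.cauchyI_lim[where c = "1 / sqrt k" and r = "\<lambda>m n. norm_in T (diff_in T (t m) (t n))"])
        show "norm_in S (diff_in S (s m) (s n)) \<le> 1 / sqrt k * norm_in T (diff_in T (t m) (t n))" for m n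
          using norm_J[of "diff_in S (s m) (s n)"] s k_pos by (simp add: J_diff)
      qed (use s t T.cauchy_iff[of t] k_pos in auto)
      moreover from this have "completion_map S T J (S.lim_cls s) = b"
        using J.completion_map_cls s t by simp
      ultimately show "b \<in> completion_map S T J ` vecs (hilbert_completion S)"
        unfolding S.vecs_completion by blast
    qed
  qed
qed

lemma completion_map_J_inverse_bounded:
  "bounded_in (hilbert_completion T) (hilbert_completion S)
     (inv_into (vecs (hilbert_completion S)) (completion_map S T J))"
proof -
  let ?E = "completion_map S T J" and ?A = "vecs (hilbert_completion S)"
  let ?I = "inv_into ?A ?E"
  have lin: "?E (plus_in (hilbert_completion S) a b) = plus_in (hilbert_completion T) (?E a) (?E b)"
    "?E (scale_in (hilbert_completion S) z a) = scale_in (hilbert_completion T) z (?E a)"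
    if "a \<in> ?A" "b \<in> ?A" for a b z using J.completion_map_linear that unfolding linear_in_def by auto
  have onto: "\<exists>a\<in>?A. b = ?E a" if "b \<in> vecs (hilbert_completion T)" for b
    using completion_map_J_bij that unfolding bij_betw_def by blast
  have inv: "?I (?E a) = a" if "a \<in> ?A" for a
    using completion_map_J_bij that by (simp add: bij_betw_inv_into_left)
  interpret Q: vec_space "hilbert_completion S"
    unfolding hilbert_completion_def by (rule S.completion.vec_space_quotient)
  show ?thesis
    unfolding bounded_in_def linear_in_def
  proof (intro conjI ballI allI exI[of _ "1 / sqrt k"] subsetI)
    fix a assume "a \<in> ?I ` vecs (hilbert_completion T)"
    then obtain b where "b \<in> vecs (hilbert_completion T)" "a = ?I b" by blast
    moreover from this(1) obtain a' where "a' \<in> ?A" "b = ?E a'" using onto by blast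
    ultimately show "a \<in> ?A" using inv by simp
  next
    fix b b' assume "b \<in> vecs (hilbert_completion T)" "b' \<in> vecs (hilbert_completion T)"
    then obtain a a' where a: "a \<in> ?A" "a' \<in> ?A" "b = ?E a" "b' = ?E a'" using onto by blast
    then show "?I (plus_in (hilbert_completion T) b b') = plus_in (hilbert_completion S) (?I b) (?I b')"
      using inv[of "plus_in (hilbert_completion S) a a'"] inv lin(1)[of a a'] by simp
  next
    fix b z assume "b \<in> vecs (hilbert_completion T)"
    then obtain a where a: "a \<in> ?A" "b = ?E a" using onto by blast
    then show "?I (scale_in (hilbert_completion T) z b) = scale_in (hilbert_completion S) z (?I b)"
      using inv[of "scale_in (hilbert_completion S) z a"] inv lin(2)[of a a] by simp
  next
    fix b assume "b \<in> vecs (hilbert_completion T)"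
    then obtain a where a: "a \<in> ?A" "b = ?E a" using onto by blast
    then show "norm_in (hilbert_completion S) (?I b) \<le> 1 / sqrt k * norm_in (hilbert_completion T) b"
      using inv norm_completion_map_J k_pos by simp
  qed
qed

lemma completion_map_J_intertwines:
  assumes b: "b \<in> conv_algebra \<Xi>" and v: "v \<in> vecs (hilbert_completion S)"
    and R': "almost_linear T T (R' b) c'"
  shows "completion_map S T J (completion_op S (R b) v) = completion_op T (R' b) (completion_map S T J v)"
proof -
  obtain c where "almost_linear S S (R b) c" by (rule R_almost_linear[OF b]) (rule that)
  then interpret A: almost_linear S S "R b" c .
  interpret A': almost_linear T T "R' b" c' by (rule R')
  obtain s where s: "s \<in> vecs (cauchy_space S)" "v = S.lim_cls s"
    using v unfolding S.vecs_completion by blast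
  have "(\<lambda>n. J (R b (s n))) = (\<lambda>n. R' b (J (s n)))" using J_R b s by auto
  then show ?thesis unfolding completion_op_eq_map
    using s by (simp add: A.completion_map_cls A'.completion_map_cls J.completion_map_cls A.F_cauchy J.F_cauchy)
qed

end

theorem scaled_isometry_completion_iso:
  assumes "scaled_isometry S T J k \<Xi> R R'"
  shows "representation_iso \<Xi> (hilbert_completion S) (\<lambda>b. completion_op S (R b))
    (hilbert_completion T) (\<lambda>b. completion_op T (R' b)) (completion_map S T J)"
proof -
  interpret scaled_isometry S T J k \<Xi> R R' by fact
  interpret T: scaled_isometry T T "\<lambda>w. w" 1 \<Xi> R' R'
    by unfold_locales
      (auto simp: linear_in_def R'_closed rep star_closed conv_closed comb_closed)
  have "completion_map S T J (completion_op S (R b) v) = completion_op T (R' b) (completion_map S T J v)"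
    if b: "b \<in> conv_algebra \<Xi>" and v: "v \<in> vecs (hilbert_completion S)" for b v
  proof -
    obtain c' where "almost_linear T T (R' b) c'" by (rule T.R_almost_linear[OF b]) (rule that)
    then show ?thesis by (rule completion_map_J_intertwines[OF b v])
  qed
  then show ?thesis
    unfolding representation_iso_def
    using representation_completion T.representation_completion completion_map_J_bij J.completion_map_bounded
      completion_map_J_inverse_bounded by blast
qed

section \<open>Action orbifolds and vector bundles\<close>

locale orbifold =
  fixes V :: "(real^'n::{finite,wellorder}) set"
    and \<Theta> :: "('g, 'x::{t2_space, second_countable_topology}, 'n) action_orbifold"
  assumes model_V: "model_space V" and orb: "compact_action_orbifold V \<Theta>"
begin

abbreviation G where "G \<equiv> carrier (group_of \<Theta>)"
abbreviation gmul where "gmul \<equiv> mult (group_of \<Theta>)"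
abbreviation ginv where "ginv \<equiv> m_inv (group_of \<Theta>)"
abbreviation gone where "gone \<equiv> one (group_of \<Theta>)"

sublocale manifold V "atlas \<Theta>"
  using model_V orb unfolding compact_action_orbifold_def by unfold_locales auto

lemma compact_X: "compact (UNIV :: 'x set)" and finite_G: "finite G"
  and act_smooth: "g \<in> G \<Longrightarrow> smooth_map_on (atlas \<Theta>) (atlas \<Theta>) UNIV (act \<Theta> g)"
  using orb unfolding compact_action_orbifold_def by auto

sublocale act: group_action "group_of \<Theta>" UNIV "act \<Theta>"
  using orb unfolding compact_action_orbifold_def faithful_action_def by blast

sublocale grp: group "group_of \<Theta>"
  using act.group_hom unfolding group_hom_def by blast

lemma act_mult: "g \<in> G \<Longrightarrow> h \<in> G \<Longrightarrow> act \<Theta> (gmul g h) x = act \<Theta> g (act \<Theta> h x)"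
  using act.composition_rule[of x g h] by simp

lemma act_one [simp]: "act \<Theta> gone x = x"
  using fun_cong[OF act.id_eq_one, of x] by simp

lemma act_inv [simp]: "g \<in> G \<Longrightarrow> act \<Theta> (ginv g) (act \<Theta> g x) = x"
    "g \<in> G \<Longrightarrow> act \<Theta> g (act \<Theta> (ginv g) x) = x"
  using act_mult[of "ginv g" g x] act_mult[of g "ginv g" x] by simp_all

lemma act_continuous: "g \<in> G \<Longrightarrow> continuous_on UNIV (act \<Theta> g)"
  using act_smooth smooth_map_on_cont by blast

lemma card_G_pos: "card G > 0"
  using finite_G grp.one_closed card_gt_0_iff by blast

text \<open>The arrows that end at \<open>x\<close> are indexed by their group component, which turns all integrals over
  arrows into sums over the group.\<close>

definition into :: "'g \<Rightarrow> 'x \<Rightarrow> 'g \<times> 'x" where "into g x = (g, act \<Theta> (ginv g) x)"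

lemma arrows_into_eq: "arrows_into \<Theta> x = (\<lambda>g. into g x) ` G"
  unfolding arrows_into_def arrows_def tgt_def into_def by (auto simp: image_iff)

lemma arrows_from_eq: "arrows_from \<Theta> x = (\<lambda>g. (g, x)) ` G"
  unfolding arrows_from_def arrows_def src_def by auto

lemma into_in [simp]: "g \<in> G \<Longrightarrow> into g x \<in> arrows_into \<Theta> x"
  by (auto simp: arrows_into_eq)

lemma from_in [simp]: "g \<in> G \<Longrightarrow> (g, x) \<in> arrows_from \<Theta> x"
  by (auto simp: arrows_from_eq)

lemma in_arrows [simp]: "g \<in> G \<Longrightarrow> into g x \<in> arrows \<Theta>" "g \<in> G \<Longrightarrow> (g, x) \<in> arrows \<Theta>"
  by (auto simp: arrows_def into_def)

lemma into_simps [simp]: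
  "src (into g x) = act \<Theta> (ginv g) x" "g \<in> G \<Longrightarrow> tgt \<Theta> (into g x) = x" "src (g, x) = x"
  "tgt \<Theta> (g, x) = act \<Theta> g x" "fst (into g x) = g"
  "g \<in> G \<Longrightarrow> inv_arrow \<Theta> (into g x) = (ginv g, x)"
  "g \<in> G \<Longrightarrow> inv_arrow \<Theta> (g, x) = into (ginv g) x"
  "g \<in> G \<Longrightarrow> into g (act \<Theta> g x) = (g, x)"
  by (auto simp: into_def src_def tgt_def inv_arrow_def)

lemma into_one [simp]: "into gone x = (gone, x)"
  using into_simps(8)[of gone x] by simp

lemma comp_into: "g \<in> G \<Longrightarrow> h \<in> G \<Longrightarrow>
    comp_arrow \<Theta> (into g x) (into h (act \<Theta> (ginv g) x)) = into (gmul g h) x"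
  by (simp add: comp_arrow_def into_def grp.inv_mult_group act_mult)

lemma inj_into: "inj_on (\<lambda>g. into g x) G"
  by (auto simp: inj_on_def into_def)

lemma sum_arrows_into: "(\<Sum>\<sigma>\<in>arrows_into \<Theta> x. f \<sigma>) = (\<Sum>g\<in>G. f (into g x))"
  unfolding arrows_into_eq by (rule sum.reindex_cong[OF inj_into refl]) simp

lemma sum_arrows_from: "(\<Sum>\<sigma>\<in>arrows_from \<Theta> x. f \<sigma>) = (\<Sum>g\<in>G. f (g, x))"
  unfolding arrows_from_eq by (rule sum.reindex_cong[OF _ refl]) (auto simp: inj_on_def)

lemma finite_arrows_into [simp]: "finite (arrows_into \<Theta> x)"
  unfolding arrows_into_eq using finite_G by simp

lemma sum_inverse: "(\<Sum>g\<in>G. f (ginv g)) = (\<Sum>g\<in>G. f g)"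
  by (rule sum.reindex_bij_witness[of _ ginv ginv]) auto

lemma sum_mult_right: "h \<in> G \<Longrightarrow> (\<Sum>g\<in>G. f (gmul g h)) = (\<Sum>g\<in>G. f g)"
  by (rule sum.reindex_bij_witness[of _ "\<lambda>g. gmul g (ginv h)" "\<lambda>g. gmul g h"])
    (auto simp: grp.m_assoc)

lemma two_manifolds_self: "two_manifolds V (atlas \<Theta>) (atlas \<Theta>)" ..

lemma smooth_translate:
  assumes "g \<in> G" "smooth_fun_on (atlas \<Theta>) U f" "open S" "\<And>x. x \<in> S \<Longrightarrow> act \<Theta> g x \<in> U"
  shows "smooth_fun_on (atlas \<Theta>) S (\<lambda>x. f (act \<Theta> g x))"
  by (rule two_manifolds.smooth_fun_on_comp[OF two_manifolds_self
        smooth_map_on_subset[OF act_smooth[OF assms(1)]] assms(2) _ assms(3)]) (use assms(4) in auto)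

lemma conv_algebra_smooth: "a \<in> conv_algebra \<Theta> \<Longrightarrow> g \<in> G \<Longrightarrow> smooth_fun_on (atlas \<Theta>) UNIV (\<lambda>x. a (g, x))"
  unfolding conv_algebra_def by blast

lemma conv_algebra_into_smooth:
  "a \<in> conv_algebra \<Theta> \<Longrightarrow> g \<in> G \<Longrightarrow> smooth_fun_on (atlas \<Theta>) UNIV (\<lambda>x. a (into g x))"
  unfolding into_def by (rule smooth_translate[OF _ conv_algebra_smooth]) auto

lemma star_closed: "a \<in> conv_algebra \<Theta> \<Longrightarrow> star \<Theta> a \<in> conv_algebra \<Theta>"
proof -
  assume a: "a \<in> conv_algebra \<Theta>"
  have "smooth_fun_on (atlas \<Theta>) UNIV (\<lambda>x. star \<Theta> a (g, x))" if g: "g \<in> G" for g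
  proof -
    have "smooth_fun_on (atlas \<Theta>) UNIV (\<lambda>x. cnj (a (into (ginv g) x)))"
      using g a by (intro smooth_fun_on_linear_comp[OF bounded_linear_cnj] conv_algebra_into_smooth) auto
    then show ?thesis by (rule smooth_fun_on_cong) (use g in \<open>simp add: star_def\<close>)
  qed
  then show ?thesis unfolding conv_algebra_def by (simp add: star_def)
qed

lemma conv_eq: "g \<in> G \<Longrightarrow> conv \<Theta> a b (g, x) =
    mass \<Theta> * (\<Sum>k\<in>G. a (gmul g (ginv k), act \<Theta> k x) * b (k, x))"
  by (simp add: conv_def sum_arrows_from comp_arrow_def into_def)

lemma conv_closed: "a \<in> conv_algebra \<Theta> \<Longrightarrow> b \<in> conv_algebra \<Theta> \<Longrightarrow> conv \<Theta> a b \<in> conv_algebra \<Theta>"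
proof -
  assume ab: "a \<in> conv_algebra \<Theta>" "b \<in> conv_algebra \<Theta>"
  have "smooth_fun_on (atlas \<Theta>) UNIV (\<lambda>x. conv \<Theta> a b (g, x))" if g: "g \<in> G" for g
  proof -
    have "smooth_fun_on (atlas \<Theta>) UNIV (\<lambda>x. a (gmul g (ginv k), act \<Theta> k x))" if "k \<in> G" for k
      by (rule smooth_translate[OF that conv_algebra_smooth[OF ab(1)]]) (use g that in auto)
    then show ?thesis unfolding conv_eq[OF g] using ab
      by (intro smooth_fun_on_mult smooth_fun_on_sum smooth_fun_on_const conv_algebra_smooth) auto
  qed
  then show ?thesis unfolding conv_algebra_def by (simp add: conv_def)
qed

lemma comb_closed:
  assumes "a \<in> conv_algebra \<Theta>" "b \<in> conv_algebra \<Theta>"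
  shows "(\<lambda>\<tau>. z * a \<tau> + b \<tau>) \<in> conv_algebra \<Theta>"
proof -
  have "smooth_fun_on (atlas \<Theta>) UNIV (\<lambda>x. z * a (g, x) + b (g, x))" if "g \<in> G" for g
    using assms that
    by (intro smooth_fun_on_add smooth_fun_on_mult smooth_fun_on_const conv_algebra_smooth) auto
  then show ?thesis using assms unfolding conv_algebra_def by simp
qed

lemma conv_algebra_bounded:
  assumes a: "a \<in> conv_algebra \<Theta>"
  obtains c where "c \<ge> 0" "\<And>g x. g \<in> G \<Longrightarrow> cmod (a (g, x)) \<le> c"
proof -
  have "\<exists>c. \<forall>x. cmod (a (g, x)) \<le> c" if "g \<in> G" for g
  proof -
    have "continuous_on UNIV (\<lambda>x. a (g, x))"
      using smooth_fun_on_continuous[OF conv_algebra_smooth[OF a that] open_UNIV] .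
    then have "bounded (range (\<lambda>x. a (g, x)))"
      using compact_continuous_image compact_X compact_imp_bounded by blast
    then show ?thesis unfolding bounded_iff by auto
  qed
  then obtain c where c: "\<And>g x. g \<in> G \<Longrightarrow> cmod (a (g, x)) \<le> c g" by metis
  have "cmod (a (g, x)) \<le> (\<Sum>g\<in>G. \<bar>c g\<bar>)" if "g \<in> G" for g x
  proof -
    have "\<bar>c g\<bar> \<le> (\<Sum>g\<in>G. \<bar>c g\<bar>)" using that finite_G by (intro member_le_sum) auto
    then show ?thesis using c[OF that, of x] by linarith
  qed
  then show thesis using that[of "\<Sum>g\<in>G. \<bar>c g\<bar>"] by (simp add: sum_nonneg)
qed

end

subsection \<open>Fibres\<close>

text \<open>All identities in a fibre are checked on complex linear functionals: the coordinates of one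
  trivialisation separate the points. This replaces computations with the sums and multiples of the
  fibre by computations with complex numbers.\<close>

definition functional :: "('g, 'x, 'u) hbundle \<Rightarrow> 'x \<Rightarrow> ('u \<Rightarrow> complex) \<Rightarrow> bool" where
  "functional \<xi> x h \<longleftrightarrow> (\<forall>u\<in>fibre \<xi> x. (\<forall>v\<in>fibre \<xi> x. h (vadd \<xi> u v) = h u + h v) \<and>
     (\<forall>z. h (vscale \<xi> z u) = z * h u))"

locale vbundle = manifold V A
  for V :: "(real^'n::finite) set"
    and A :: "('x::{t2_space, second_countable_topology}, 'n) chart set" +
  fixes \<xi> :: "('g, 'x, 'u) hbundle"
  assumes vb: "vector_bundle A \<xi>"
begin

lemma
  shows vzero_in [simp]: "vzero \<xi> x \<in> fibre \<xi> x"
    and vadd_in [simp]: "u \<in> fibre \<xi> x \<Longrightarrow> v \<in> fibre \<xi> x \<Longrightarrow> vadd \<xi> u v \<in> fibre \<xi> x"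
    and vscale_in [simp]: "u \<in> fibre \<xi> x \<Longrightarrow> vscale \<xi> z u \<in> fibre \<xi> x"
    and triv_exists: "\<exists>U r \<Phi>. (U, r, \<Phi>) \<in> trivs \<xi> \<and> x \<in> U"
proof -
  note v = spec[OF vb[unfolded vector_bundle_def, THEN conjunct1], of x]
  show "vzero \<xi> x \<in> fibre \<xi> x" using v by simp
  show "u \<in> fibre \<xi> x \<Longrightarrow> v \<in> fibre \<xi> x \<Longrightarrow> vadd \<xi> u v \<in> fibre \<xi> x"
    "u \<in> fibre \<xi> x \<Longrightarrow> vscale \<xi> z u \<in> fibre \<xi> x"
    using v[THEN conjunct2, THEN bspec, of u] by simp_all
  have "x \<in> (\<Union>(U, r, \<Phi>)\<in>trivs \<xi>. U)"
    using vb[unfolded vector_bundle_def, THEN conjunct2, THEN conjunct1] by simp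
  then show "\<exists>U r \<Phi>. (U, r, \<Phi>) \<in> trivs \<xi> \<and> x \<in> U" by auto
qed

lemma
  assumes T: "(U, r, \<Phi>) \<in> trivs \<xi>"
  shows triv_open: "open U"
    and triv_bij: "x \<in> U \<Longrightarrow> bij_betw \<Phi> (fibre \<xi> x) (coords r)"
    and triv_zero: "x \<in> U \<Longrightarrow> \<Phi> (vzero \<xi> x) = (\<lambda>_. 0)"
    and triv_add: "x \<in> U \<Longrightarrow> u \<in> fibre \<xi> x \<Longrightarrow> v \<in> fibre \<xi> x \<Longrightarrow> \<Phi> (vadd \<xi> u v) = (\<lambda>i. \<Phi> u i + \<Phi> v i)"
    and triv_scale: "x \<in> U \<Longrightarrow> u \<in> fibre \<xi> x \<Longrightarrow> \<Phi> (vscale \<xi> z u) = (\<lambda>i. z * \<Phi> u i)"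
proof -
  note t = bspec[OF vb[unfolded vector_bundle_def, THEN conjunct2, THEN conjunct2, THEN conjunct1] T,
      unfolded case_prod_conv]
  show "open U" using t by simp
  assume x: "x \<in> U"
  note tx = bspec[OF t[THEN conjunct2] x]
  show "bij_betw \<Phi> (fibre \<xi> x) (coords r)" "\<Phi> (vzero \<xi> x) = (\<lambda>_. 0)" using tx by simp_all
  assume u: "u \<in> fibre \<xi> x"
  note txu = bspec[OF tx[THEN conjunct2, THEN conjunct2] u]
  show "\<Phi> (vscale \<xi> z u) = (\<lambda>i. z * \<Phi> u i)" using txu by simp
  show "v \<in> fibre \<xi> x \<Longrightarrow> \<Phi> (vadd \<xi> u v) = (\<lambda>i. \<Phi> u i + \<Phi> v i)" using txu by simp
qed

lemma functional_triv: "(U, r, \<Phi>) \<in> trivs \<xi> \<Longrightarrow> x \<in> U \<Longrightarrow> functional \<xi> x (\<lambda>u. \<Phi> u i)"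
  unfolding functional_def by (simp add: triv_add triv_scale)

lemma fibre_eqI:
  assumes "u \<in> fibre \<xi> x" "v \<in> fibre \<xi> x" "\<And>h. functional \<xi> x h \<Longrightarrow> h u = h v"
  shows "u = v"
proof -
  obtain U r \<Phi> where T: "(U, r, \<Phi>) \<in> trivs \<xi>" "x \<in> U" using triv_exists by blast
  have "\<Phi> u = \<Phi> v" using assms(3)[OF functional_triv[OF T]] by (rule ext)
  then show ?thesis using triv_bij[OF T] assms(1,2) unfolding bij_betw_def inj_on_def by blast
qed

lemma functionalD:
  assumes "functional \<xi> x h"
  shows "u \<in> fibre \<xi> x \<Longrightarrow> v \<in> fibre \<xi> x \<Longrightarrow> h (vadd \<xi> u v) = h u + h v"
    and "u \<in> fibre \<xi> x \<Longrightarrow> h (vscale \<xi> z u) = z * h u"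
  using assms unfolding functional_def by auto

lemma vzero_eq: "u \<in> fibre \<xi> x \<Longrightarrow> vscale \<xi> 0 u = vzero \<xi> x"
proof -
  assume u: "u \<in> fibre \<xi> x"
  obtain U r \<Phi> where T: "(U, r, \<Phi>) \<in> trivs \<xi>" "x \<in> U" using triv_exists by blast
  have "\<Phi> (vscale \<xi> 0 u) = \<Phi> (vzero \<xi> x)" using T u by (simp add: triv_scale triv_zero)
  then show ?thesis using triv_bij[OF T] u unfolding bij_betw_def inj_on_def by simp
qed

lemma functional_zero: "functional \<xi> x h \<Longrightarrow> h (vzero \<xi> x) = 0"
  using functionalD(2)[of x h "vzero \<xi> x" 0] vzero_eq[of "vzero \<xi> x" x] by simp

lemma fibre_monoid: "comm_monoid \<lparr>carrier = fibre \<xi> x, mult = vadd \<xi>, one = vzero \<xi> x\<rparr>"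
proof (rule comm_monoidI, simp_all)
  fix u v w assume "u \<in> fibre \<xi> x" "v \<in> fibre \<xi> x" "w \<in> fibre \<xi> x"
  then show "vadd \<xi> (vadd \<xi> u v) w = vadd \<xi> u (vadd \<xi> v w)"
    by (intro fibre_eqI[where x = x]) (auto simp: functionalD)
next
  fix u v assume "u \<in> fibre \<xi> x" "v \<in> fibre \<xi> x"
  then show "vadd \<xi> u v = vadd \<xi> v u"
    by (intro fibre_eqI[where x = x]) (auto simp: functionalD)
next
  fix u assume "u \<in> fibre \<xi> x"
  then show "vadd \<xi> (vzero \<xi> x) u = u"
    by (intro fibre_eqI[where x = x]) (auto simp: functionalD functional_zero)
qed

lemma fibre_sum_in:
  assumes "\<And>i. i \<in> I \<Longrightarrow> f i \<in> fibre \<xi> x"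
  shows "fibre_sum \<xi> x f I \<in> fibre \<xi> x"
  using comm_monoid.finprod_closed[OF fibre_monoid[of x], of f I] assms
  unfolding fibre_sum_def by (auto simp: Pi_def)

lemma functional_sum:
  assumes h: "functional \<xi> x h" and "finite I" "\<And>i. i \<in> I \<Longrightarrow> f i \<in> fibre \<xi> x"
  shows "h (fibre_sum \<xi> x f I) = (\<Sum>i\<in>I. h (f i))"
  using assms(2,3)
proof (induction I)
  case empty
  then show ?case
    using functional_zero[OF h] comm_monoid.finprod_empty[OF fibre_monoid[of x], of f]
    by (simp add: fibre_sum_def)
next
  case (insert j J)
  have "fibre_sum \<xi> x f (insert j J) = vadd \<xi> (f j) (fibre_sum \<xi> x f J)"
    unfolding fibre_sum_def
    using comm_monoid.finprod_insert[OF fibre_monoid[of x], of J j f] insert by (auto simp: Pi_def)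
  then show ?case using functionalD(1)[OF h] insert fibre_sum_in[of J f x] by simp
qed

text \<open>The vectors with coordinates \<open>\<delta>\<^sub>i\<^sub>j\<close> in a trivialisation form a frame. Smoothness of the metric, of
  the group action and of transition functions is given on frames, and linearity extends it to
  sections.\<close>

lemma functional_frame:
  assumes T: "(U, r, \<Phi>) \<in> trivs \<xi>" "x \<in> U" and h: "functional \<xi> x h" and u: "u \<in> fibre \<xi> x"
  shows "h u = (\<Sum>j<r. \<Phi> u j * h (inv_into (fibre \<xi> x) \<Phi> (\<lambda>i. of_bool (i = j))))"
proof -
  let ?I = "inv_into (fibre \<xi> x) \<Phi>"
  have bij: "bij_betw \<Phi> (fibre \<xi> x) (coords r)" using triv_bij[OF T] .
  have In: "?I v \<in> fibre \<xi> x" "\<Phi> (?I v) = v" if "v \<in> coords r" for v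
    using that bij by (auto simp: bij_betw_def inv_into_into f_inv_into_f)
  have uc: "\<Phi> u \<in> coords r" using bij u by (auto simp: bij_betw_def)
  have ec: "(\<lambda>i. of_bool (i = j)) \<in> coords r" if "j < r" for j using that by (auto simp: coords_def)
  have inj: "v = w" if "v \<in> fibre \<xi> x" "w \<in> fibre \<xi> x" "\<Phi> v = \<Phi> w" for v w
    using bij that unfolding bij_betw_def inj_on_def by blast
  have "h (?I (\<lambda>i. if i \<in> J then \<Phi> u i else 0)) = (\<Sum>j\<in>J. \<Phi> u j * h (?I (\<lambda>i. of_bool (i = j))))"
    if "finite J" "J \<subseteq> {..<r}" for J
    using that
  proof (induction J)
    case empty
    have z: "(\<lambda>i. 0) \<in> coords r" by (simp add: coords_def)
    have "?I (\<lambda>i. 0) = vzero \<xi> x" using In[OF z] triv_zero[OF T] by (intro inj) auto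
    then show ?case using functional_zero[OF h] by simp
  next
    case (insert j J)
    let ?v = "\<lambda>i. if i \<in> J then \<Phi> u i else 0"
    have v: "?v \<in> coords r" "(\<lambda>i. if i \<in> insert j J then \<Phi> u i else 0) \<in> coords r"
      using uc by (auto simp: coords_def)
    have j: "j < r" using insert by simp
    have "?I (\<lambda>i. if i \<in> insert j J then \<Phi> u i else 0) =
        vadd \<xi> (?I ?v) (vscale \<xi> (\<Phi> u j) (?I (\<lambda>i. of_bool (i = j))))"
      using In[OF v(1)] In[OF v(2)] In[OF ec[OF j]] insert(2)
      by (intro inj) (auto simp: triv_add[OF T] triv_scale[OF T])
    then show ?case
      using functionalD[OF h] In[OF v(1)] In[OF ec[OF j]] insert by simp
  qed
  from this[of "{..<r}"] have "h (?I (\<lambda>i. if i < r then \<Phi> u i else 0)) =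
      (\<Sum>j<r. \<Phi> u j * h (?I (\<lambda>i. of_bool (i = j))))" by simp
  moreover have "(\<lambda>i. if i < r then \<Phi> u i else 0) = \<Phi> u" using uc by (auto simp: coords_def)
  moreover have "?I (\<Phi> u) = u" using bij u by (simp add: bij_betw_inv_into_left)
  ultimately show ?thesis by simp
qed

lemma frame_in: "(U, r, \<Phi>) \<in> trivs \<xi> \<Longrightarrow> x \<in> U \<Longrightarrow> v \<in> coords r \<Longrightarrow> inv_into (fibre \<xi> x) \<Phi> v \<in> fibre \<xi> x"
  using triv_bij[of U r \<Phi> x] by (auto simp: bij_betw_def inv_into_into)

lemma unit_coords: "j < r \<Longrightarrow> (\<lambda>i. of_bool (i = j)) \<in> coords r"
  by (auto simp: coords_def)

lemma section_in [simp]: "\<psi> \<in> sections A \<xi> \<Longrightarrow> \<psi> x \<in> fibre \<xi> x"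
  unfolding sections_def by blast

lemma section_smooth:
  "\<psi> \<in> sections A \<xi> \<Longrightarrow> (U, r, \<Phi>) \<in> trivs \<xi> \<Longrightarrow> i < r \<Longrightarrow> smooth_fun_on A U (\<lambda>x. \<Phi> (\<psi> x) i)"
  unfolding sections_def by blast

lemma sectionI:
  assumes "\<And>x. \<psi> x \<in> fibre \<xi> x"
    and "\<And>U r \<Phi> i. (U, r, \<Phi>) \<in> trivs \<xi> \<Longrightarrow> i < r \<Longrightarrow> smooth_fun_on A U (\<lambda>x. \<Phi> (\<psi> x) i)"
  shows "\<psi> \<in> sections A \<xi>"
  using assms unfolding sections_def by blast

lemma section_add:
  assumes "\<psi> \<in> sections A \<xi>" "\<psi>' \<in> sections A \<xi>"
  shows "(\<lambda>x. vadd \<xi> (\<psi> x) (\<psi>' x)) \<in> sections A \<xi>"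
proof (rule sectionI)
  fix U r \<Phi> i assume T: "(U, r, \<Phi>) \<in> trivs \<xi>" "i < r"
  show "smooth_fun_on A U (\<lambda>x. \<Phi> (vadd \<xi> (\<psi> x) (\<psi>' x)) i)"
    by (rule smooth_fun_on_cong[OF smooth_fun_on_add[OF section_smooth[OF assms(1) T] section_smooth[OF assms(2) T]]])
      (use assms T in \<open>simp add: triv_add\<close>)
qed (use assms in simp)

lemma section_mult:
  assumes "\<psi> \<in> sections A \<xi>" "smooth_fun_on A UNIV f"
  shows "(\<lambda>x. vscale \<xi> (f x) (\<psi> x)) \<in> sections A \<xi>"
proof (rule sectionI)
  fix U r \<Phi> i assume T: "(U, r, \<Phi>) \<in> trivs \<xi>" "i < r"
  show "smooth_fun_on A U (\<lambda>x. \<Phi> (vscale \<xi> (f x) (\<psi> x)) i)"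
    by (rule smooth_fun_on_cong[OF smooth_fun_on_mult[OF smooth_fun_on_subset[OF assms(2)] section_smooth[OF assms(1) T]]])
      (use assms T in \<open>auto simp: triv_scale\<close>)
qed (use assms in simp)

lemma section_zero: "vzero \<xi> \<in> sections A \<xi>"
proof (rule sectionI)
  fix U r \<Phi> i assume T: "(U, r, \<Phi>) \<in> trivs \<xi>" "i < r"
  show "smooth_fun_on A U (\<lambda>x. \<Phi> (vzero \<xi> x) i)"
    by (rule smooth_fun_on_cong[OF smooth_fun_on_const[of _ 0]]) (use T in \<open>simp add: triv_zero\<close>)
qed simp

end

subsection \<open>Equivariant hermitian bundles\<close>

locale ebundle = orbifold V \<Theta>
  for V :: "(real^'n::{finite,wellorder}) set"
    and \<Theta> :: "('g, 'x::{t2_space, second_countable_topology}, 'n) action_orbifold" +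
  fixes \<xi> :: "('g, 'x, 'u) hbundle"
  assumes eb: "equivariant_bundle \<Theta> \<xi>" and ih: "invariant_hermitian \<Theta> \<xi>"
begin

sublocale vbundle V "atlas \<Theta>" \<xi>
  using eb unfolding equivariant_bundle_def by unfold_locales blast

lemmas eb_rho = eb[unfolded equivariant_bundle_def, THEN conjunct2, THEN conjunct1]
  and eb_unit = eb[unfolded equivariant_bundle_def, THEN conjunct2, THEN conjunct2, THEN conjunct1]
  and eb_smooth = eb[unfolded equivariant_bundle_def, THEN conjunct2, THEN conjunct2, THEN conjunct2]
  and ih_alg = ih[unfolded invariant_hermitian_def, THEN conjunct1]
  and ih_pos = ih[unfolded invariant_hermitian_def, THEN conjunct2, THEN conjunct1]
  and ih_smooth = ih[unfolded invariant_hermitian_def, THEN conjunct2, THEN conjunct2, THEN conjunct1]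
  and ih_rho = ih[unfolded invariant_hermitian_def, THEN conjunct2, THEN conjunct2, THEN conjunct2]

lemma rho_bij: "g \<in> G \<Longrightarrow> bij_betw (rho \<xi> (g, x)) (fibre \<xi> x) (fibre \<xi> (act \<Theta> g x))"
  using bspec[OF eb_rho, of "(g, x)"] by simp

lemma rho_in [simp]: "g \<in> G \<Longrightarrow> u \<in> fibre \<xi> x \<Longrightarrow> rho \<xi> (g, x) u \<in> fibre \<xi> (act \<Theta> g x)"
  using rho_bij[of g x] by (auto simp: bij_betw_def)

lemma rho_into_in [simp]: "g \<in> G \<Longrightarrow> u \<in> fibre \<xi> (act \<Theta> (ginv g) x) \<Longrightarrow> rho \<xi> (into g x) u \<in> fibre \<xi> x"
  using rho_in[of g u "act \<Theta> (ginv g) x"] by (simp add: into_def)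

lemma
  assumes "g \<in> G" "u \<in> fibre \<xi> x"
  shows rho_add: "v \<in> fibre \<xi> x \<Longrightarrow> rho \<xi> (g, x) (vadd \<xi> u v) = vadd \<xi> (rho \<xi> (g, x) u) (rho \<xi> (g, x) v)"
    and rho_scale: "rho \<xi> (g, x) (vscale \<xi> z u) = vscale \<xi> z (rho \<xi> (g, x) u)"
    and rho_comp: "h \<in> G \<Longrightarrow> rho \<xi> (h, act \<Theta> g x) (rho \<xi> (g, x) u) = rho \<xi> (gmul h g, x) u"
    and rho_one: "rho \<xi> (gone, x) u = u"
proof -
  have s: "(g, x) \<in> arrows \<Theta>" "src (g, x) = x" "tgt \<Theta> (g, x) = act \<Theta> g x" using assms by auto
  note E1 = bspec[OF eb_rho s(1), THEN conjunct2, unfolded s]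
  show "v \<in> fibre \<xi> x \<Longrightarrow> rho \<xi> (g, x) (vadd \<xi> u v) = vadd \<xi> (rho \<xi> (g, x) u) (rho \<xi> (g, x) v)"
    "rho \<xi> (g, x) (vscale \<xi> z u) = vscale \<xi> z (rho \<xi> (g, x) u)"
    using bspec[OF E1 assms(2)] by simp_all
  show "rho \<xi> (h, act \<Theta> g x) (rho \<xi> (g, x) u) = rho \<xi> (gmul h g, x) u" if "h \<in> G"
    using bspec[OF bspec[OF E1 assms(2), THEN conjunct2, THEN conjunct2] from_in[OF that]]
    by (simp add: comp_arrow_def)
  show "rho \<xi> (gone, x) u = u" using bspec[OF spec[OF eb_unit, of x] assms(2)] by (simp add: unit_arrow_def)
qed

lemma rho_into_comp:
  assumes "g \<in> G" "h \<in> G" "u \<in> fibre \<xi> (act \<Theta> (ginv (gmul g h)) x)"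
  shows "rho \<xi> (into g x) (rho \<xi> (into h (act \<Theta> (ginv g) x)) u) = rho \<xi> (into (gmul g h) x) u"
  using rho_comp[of h u "act \<Theta> (ginv h) (act \<Theta> (ginv g) x)" g] assms
  by (simp add: into_def grp.inv_mult_group act_mult)

lemma rho_inverse:
  assumes "g \<in> G" "u \<in> fibre \<xi> x"
  shows "rho \<xi> (into (ginv g) x) (rho \<xi> (g, x) u) = u" "rho \<xi> (ginv g, act \<Theta> g x) (rho \<xi> (g, x) u) = u"
    and "rho \<xi> (into g x) (rho \<xi> (ginv g, x) u) = u"
proof -
  show 1: "rho \<xi> (ginv g, act \<Theta> g x) (rho \<xi> (g, x) u) = u"
    using rho_comp[OF assms, of "ginv g"] assms rho_one by simp
  then show "rho \<xi> (into (ginv g) x) (rho \<xi> (g, x) u) = u" using assms by (simp add: into_def)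
  show "rho \<xi> (into g x) (rho \<xi> (ginv g, x) u) = u"
    using rho_comp[of "ginv g" u x g] assms rho_one by (simp add: into_def)
qed

lemma functional_rho: "g \<in> G \<Longrightarrow> functional \<xi> x h \<Longrightarrow>
    functional \<xi> (act \<Theta> (ginv g) x) (\<lambda>u. h (rho \<xi> (into g x) u))"
  using rho_in[of g _ "act \<Theta> (ginv g) x"] unfolding functional_def into_def
  by (simp add: rho_add rho_scale)

lemma
  assumes "u \<in> fibre \<xi> x" "w \<in> fibre \<xi> x"
  shows herm_add: "v \<in> fibre \<xi> x \<Longrightarrow> herm \<xi> (vadd \<xi> u v) w = herm \<xi> u w + herm \<xi> v w"
    and herm_scale: "herm \<xi> (vscale \<xi> z u) w = z * herm \<xi> u w"
    and herm_commute: "herm \<xi> w u = cnj (herm \<xi> u w)"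
  using bspec[OF bspec[OF spec[OF ih_alg, of x] assms(1)] assms(2)] by simp_all

lemma functional_herm: "w \<in> fibre \<xi> x \<Longrightarrow> functional \<xi> x (\<lambda>u. herm \<xi> u w)"
  unfolding functional_def by (simp add: herm_add herm_scale)

lemma herm_pos: "u \<in> fibre \<xi> x \<Longrightarrow> Re (herm \<xi> u u) \<ge> 0"
proof (cases "u = vzero \<xi> x")
  case False
  moreover assume "u \<in> fibre \<xi> x"
  ultimately show ?thesis using bspec[OF spec[OF ih_pos, of x], of u] by simp
qed (simp add: functional_zero[OF functional_herm])

lemma herm_rho:
  assumes "g \<in> G" "u \<in> fibre \<xi> x" "v \<in> fibre \<xi> x"
  shows "herm \<xi> (rho \<xi> (g, x) u) (rho \<xi> (g, x) v) = herm \<xi> u v"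
proof -
  have "(g, x) \<in> arrows \<Theta>" using assms by simp
  from bspec[OF ih_rho this] show ?thesis using assms by simp
qed

lemma herm_rho_into: "g \<in> G \<Longrightarrow> u \<in> fibre \<xi> (act \<Theta> (ginv g) x) \<Longrightarrow> v \<in> fibre \<xi> (act \<Theta> (ginv g) x) \<Longrightarrow>
    herm \<xi> (rho \<xi> (into g x) u) (rho \<xi> (into g x) v) = herm \<xi> u v"
  unfolding into_def by (rule herm_rho)

lemma herm_sections_smooth:
  assumes \<psi>: "\<psi> \<in> sections (atlas \<Theta>) \<xi>" and \<psi>': "\<psi>' \<in> sections (atlas \<Theta>) \<xi>"
  shows "smooth_fun_on (atlas \<Theta>) UNIV (\<lambda>x. herm \<xi> (\<psi> x) (\<psi>' x))"
proof (rule smooth_fun_on_local)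
  fix x0
  obtain U r \<Phi> where T: "(U, r, \<Phi>) \<in> trivs \<xi>" "x0 \<in> U" using triv_exists by blast
  let ?e = "\<lambda>x j. inv_into (fibre \<xi> x) \<Phi> (\<lambda>i. of_bool (i = j))"
  have sm: "smooth_fun_on (atlas \<Theta>) U (\<lambda>x. herm \<xi> (?e x j) (?e x k))" if "j < r" "k < r" for j k
    using bspec[OF bspec[OF bspec[OF ih_smooth T(1), unfolded case_prod_conv]
        unit_coords[OF that(1)]] unit_coords[OF that(2)]] .
  have "herm \<xi> (\<psi> x) (\<psi>' x) = (\<Sum>j<r. \<Phi> (\<psi> x) j * (\<Sum>k<r. cnj (\<Phi> (\<psi>' x) k) * herm \<xi> (?e x j) (?e x k)))"
    if x: "x \<in> U" for x
  proof -
    have e: "?e x j \<in> fibre \<xi> x" if "j < r" for j using frame_in[OF T(1) x unit_coords[OF that]] .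
    have "herm \<xi> (\<psi> x) (\<psi>' x) = (\<Sum>j<r. \<Phi> (\<psi> x) j * herm \<xi> (?e x j) (\<psi>' x))"
      by (rule functional_frame[OF T(1) x functional_herm]) (use \<psi> \<psi>' in auto)
    also have "\<dots> = (\<Sum>j<r. \<Phi> (\<psi> x) j * (\<Sum>k<r. cnj (\<Phi> (\<psi>' x) k) * herm \<xi> (?e x j) (?e x k)))"
    proof (rule sum.cong[OF refl])
      fix j assume "j \<in> {..<r}"
      then have ej: "?e x j \<in> fibre \<xi> x" using e by simp
      have "herm \<xi> (?e x j) (\<psi>' x) = cnj (herm \<xi> (\<psi>' x) (?e x j))"
        using herm_commute[of "\<psi>' x" x] ej \<psi>' by simp
      also have "herm \<xi> (\<psi>' x) (?e x j) = (\<Sum>k<r. \<Phi> (\<psi>' x) k * herm \<xi> (?e x k) (?e x j))"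
        by (rule functional_frame[OF T(1) x functional_herm]) (use ej \<psi>' in auto)
      also have "cnj \<dots> = (\<Sum>k<r. cnj (\<Phi> (\<psi>' x) k) * herm \<xi> (?e x j) (?e x k))"
        unfolding cnj_sum complex_cnj_mult
      proof (rule sum.cong[OF refl])
        fix k assume "k \<in> {..<r}"
        then have "herm \<xi> (?e x j) (?e x k) = cnj (herm \<xi> (?e x k) (?e x j))"
          using herm_commute[of "?e x k" x "?e x j"] e ej by simp
        then show "cnj (\<Phi> (\<psi>' x) k) * cnj (herm \<xi> (?e x k) (?e x j)) =
          cnj (\<Phi> (\<psi>' x) k) * herm \<xi> (?e x j) (?e x k)" by simp
      qed
      finally show "\<Phi> (\<psi> x) j * herm \<xi> (?e x j) (\<psi>' x) =
        \<Phi> (\<psi> x) j * (\<Sum>k<r. cnj (\<Phi> (\<psi>' x) k) * herm \<xi> (?e x j) (?e x k))" by simp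
    qed
    finally show ?thesis .
  qed
  moreover have "smooth_fun_on (atlas \<Theta>) U
      (\<lambda>x. \<Sum>j<r. \<Phi> (\<psi> x) j * (\<Sum>k<r. cnj (\<Phi> (\<psi>' x) k) * herm \<xi> (?e x j) (?e x k)))"
    using \<psi> \<psi>' T(1) sm
    by (intro smooth_fun_on_sum smooth_fun_on_mult smooth_fun_on_linear_comp[OF bounded_linear_cnj]
        section_smooth) auto
  ultimately have "smooth_fun_on (atlas \<Theta>) (UNIV \<inter> U) (\<lambda>x. herm \<xi> (\<psi> x) (\<psi>' x))"
    using smooth_fun_on_cong by (metis (no_types, lifting) Int_UNIV_left)
  then show "\<exists>N. open N \<and> x0 \<in> N \<and> smooth_fun_on (atlas \<Theta>) (UNIV \<inter> N) (\<lambda>x. herm \<xi> (\<psi> x) (\<psi>' x))"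
    using T triv_open by blast
qed

lemma herm_sections_continuous:
  "\<psi> \<in> sections (atlas \<Theta>) \<xi> \<Longrightarrow> \<psi>' \<in> sections (atlas \<Theta>) \<xi> \<Longrightarrow> continuous_on UNIV (\<lambda>x. herm \<xi> (\<psi> x) (\<psi>' x))"
  using smooth_fun_on_continuous[OF herm_sections_smooth open_UNIV] by blast

definition trans_sec :: "'g \<Rightarrow> ('x \<Rightarrow> 'u) \<Rightarrow> 'x \<Rightarrow> 'u" where
  "trans_sec g \<psi> x = rho \<xi> (into g x) (\<psi> (act \<Theta> (ginv g) x))"

lemma section_translate:
  assumes g: "g \<in> G" and \<psi>: "\<psi> \<in> sections (atlas \<Theta>) \<xi>"
  shows "trans_sec g \<psi> \<in> sections (atlas \<Theta>) \<xi>"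
proof (rule sectionI)
  show "trans_sec g \<psi> x \<in> fibre \<xi> x" for x using g \<psi> by (simp add: trans_sec_def)
  fix U' r' \<Phi>' i assume T': "(U', r', \<Phi>') \<in> trivs \<xi>" "i < r'"
  show "smooth_fun_on (atlas \<Theta>) U' (\<lambda>x. \<Phi>' (trans_sec g \<psi> x) i)"
  proof (rule smooth_fun_on_local)
    fix x0 assume x0: "x0 \<in> U'"
    obtain U r \<Phi> where T: "(U, r, \<Phi>) \<in> trivs \<xi>" "act \<Theta> (ginv g) x0 \<in> U" using triv_exists by blast
    let ?e = "\<lambda>y j. inv_into (fibre \<xi> y) \<Phi> (\<lambda>i. of_bool (i = j))"
    let ?f = "\<lambda>y. \<Sum>j<r. \<Phi> (\<psi> y) j * \<Phi>' (rho \<xi> (g, y) (?e y j)) i"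
    let ?N = "act \<Theta> (ginv g) -` U"
    have N: "open ?N" using act_continuous[of "ginv g"] triv_open[OF T(1)] g by (simp add: continuous_on_open_vimage)
    note E = bspec[OF bspec[OF bspec[OF eb_smooth g] T(1), unfolded case_prod_conv] T'(1), unfolded case_prod_conv]
    have "smooth_fun_on (atlas \<Theta>) (U \<inter> act \<Theta> g -` U') (\<lambda>y. \<Phi>' (rho \<xi> (g, y) (?e y j)) i)" if "j < r" for j
      using bspec[OF E unit_coords[OF that]] T'(2) by blast
    moreover have "smooth_fun_on (atlas \<Theta>) (U \<inter> act \<Theta> g -` U') (\<lambda>y. \<Phi> (\<psi> y) j)" if "j < r" for j
      using smooth_fun_on_subset[OF section_smooth[OF \<psi> T(1) that]] by blast
    ultimately have "smooth_fun_on (atlas \<Theta>) (U \<inter> act \<Theta> g -` U') ?f"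
      by (intro smooth_fun_on_sum smooth_fun_on_mult) auto
    then have "smooth_fun_on (atlas \<Theta>) (U' \<inter> ?N) (\<lambda>x. ?f (act \<Theta> (ginv g) x))"
      by (rule smooth_translate[rotated]) (use g N triv_open[OF T'(1)] in auto)
    then have "smooth_fun_on (atlas \<Theta>) (U' \<inter> ?N) (\<lambda>x. \<Phi>' (trans_sec g \<psi> x) i)"
    proof (rule smooth_fun_on_cong)
      fix x assume x: "x \<in> U' \<inter> ?N"
      have "functional \<xi> x (\<lambda>u. \<Phi>' u i)" using functional_triv T'(1) x by blast
      from functional_frame[OF T(1) _ functional_rho[OF g this], of "\<psi> (act \<Theta> (ginv g) x)"]
      show "?f (act \<Theta> (ginv g) x) = \<Phi>' (trans_sec g \<psi> x) i"
        using x \<psi> by (simp add: trans_sec_def into_def)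
    qed
    then show "\<exists>N. open N \<and> x0 \<in> N \<and> smooth_fun_on (atlas \<Theta>) (U' \<inter> N) (\<lambda>x. \<Phi>' (trans_sec g \<psi> x) i)"
      using N T(2) by blast
  qed
qed

lemma trans_sec_in [simp]: "g \<in> G \<Longrightarrow> \<psi> \<in> sections (atlas \<Theta>) \<xi> \<Longrightarrow> trans_sec g \<psi> x \<in> fibre \<xi> x"
  by (simp add: trans_sec_def)

lemma fibre_sum_arrows_into:
  assumes "\<And>\<sigma>. \<sigma> \<in> arrows_into \<Theta> x \<Longrightarrow> f \<sigma> \<in> fibre \<xi> x'"
  shows "fibre_sum \<xi> x' f (arrows_into \<Theta> x) = fibre_sum \<xi> x' (\<lambda>g. f (into g x)) G"
proof (rule fibre_eqI)
  show "fibre_sum \<xi> x' f (arrows_into \<Theta> x) \<in> fibre \<xi> x'" "fibre_sum \<xi> x' (\<lambda>g. f (into g x)) G \<in> fibre \<xi> x'"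
    by (rule fibre_sum_in[OF assms], assumption) (rule fibre_sum_in[OF assms[OF into_in]])
  show "h (fibre_sum \<xi> x' f (arrows_into \<Theta> x)) = h (fibre_sum \<xi> x' (\<lambda>g. f (into g x)) G)"
    if "functional \<xi> x' h" for h
    using functional_sum[OF that finite_arrows_into, of x f] assms
      functional_sum[OF that finite_G, of "\<lambda>g. f (into g x)"]
    by (simp add: sum_arrows_into)
qed

lemma sec_act_eq:
  assumes "\<psi> \<in> sections (atlas \<Theta>) \<xi>"
  shows "sec_act \<Theta> \<xi> a \<psi> x = vscale \<xi> (mass \<Theta>) (fibre_sum \<xi> x (\<lambda>g. vscale \<xi> (a (into g x)) (trans_sec g \<psi> x)) G)"
  unfolding sec_act_def using assms
  by (subst fibre_sum_arrows_into) (auto simp: arrows_into_eq trans_sec_def)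

lemma sec_act_in:
  assumes "\<psi> \<in> sections (atlas \<Theta>) \<xi>" shows "sec_act \<Theta> \<xi> a \<psi> x \<in> fibre \<xi> x"
  unfolding sec_act_eq[OF assms] using assms by (auto intro!: vscale_in fibre_sum_in)

lemma functional_sec_act:
  assumes "\<psi> \<in> sections (atlas \<Theta>) \<xi>" "functional \<xi> x h"
  shows "h (sec_act \<Theta> \<xi> a \<psi> x) = mass \<Theta> * (\<Sum>g\<in>G. a (into g x) * h (trans_sec g \<psi> x))"
  unfolding sec_act_eq[OF assms(1)]
  using assms finite_G by (simp add: functionalD[OF assms(2)] fibre_sum_in functional_sum)

lemma sec_act_section:
  assumes a: "a \<in> conv_algebra \<Theta>" and \<psi>: "\<psi> \<in> sections (atlas \<Theta>) \<xi>"
  shows "sec_act \<Theta> \<xi> a \<psi> \<in> sections (atlas \<Theta>) \<xi>"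
proof (rule sectionI)
  fix U r \<Phi> i assume T: "(U, r, \<Phi>) \<in> trivs \<xi>" "i < r"
  have "smooth_fun_on (atlas \<Theta>) U (\<lambda>x. mass \<Theta> * (\<Sum>g\<in>G. a (into g x) * \<Phi> (trans_sec g \<psi> x) i))"
    using T section_translate[OF _ \<psi>] smooth_fun_on_subset[OF conv_algebra_into_smooth[OF a]]
    by (intro smooth_fun_on_mult smooth_fun_on_sum smooth_fun_on_const section_smooth) auto
  then show "smooth_fun_on (atlas \<Theta>) U (\<lambda>x. \<Phi> (sec_act \<Theta> \<xi> a \<psi> x) i)"
    by (rule smooth_fun_on_cong) (simp add: functional_sec_act[OF \<psi> functional_triv[OF T(1)]])
qed (rule sec_act_in[OF \<psi>])

lemma rho_trans_sec:
  assumes "g \<in> G" "k \<in> G" "\<psi> \<in> sections (atlas \<Theta>) \<xi>"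
  shows "rho \<xi> (into g x) (trans_sec k \<psi> (act \<Theta> (ginv g) x)) = trans_sec (gmul g k) \<psi> x"
  unfolding trans_sec_def using rho_into_comp[of g k "\<psi> (act \<Theta> (ginv (gmul g k)) x)" x] assms
  by (simp add: grp.inv_mult_group act_mult)

text \<open>Both sides are sums over pairs of group elements; the substitution \<open>l = g k\<close> matches them.\<close>

lemma sec_act_conv:
  assumes a: "a \<in> conv_algebra \<Theta>" and b: "b \<in> conv_algebra \<Theta>" and \<psi>: "\<psi> \<in> sections (atlas \<Theta>) \<xi>"
  shows "sec_act \<Theta> \<xi> (conv \<Theta> a b) \<psi> = sec_act \<Theta> \<xi> a (sec_act \<Theta> \<xi> b \<psi>)"
proof
  fix x
  note b\<psi> = sec_act_section[OF b \<psi>]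
  show "sec_act \<Theta> \<xi> (conv \<Theta> a b) \<psi> x = sec_act \<Theta> \<xi> a (sec_act \<Theta> \<xi> b \<psi>) x"
  proof (rule fibre_eqI[OF sec_act_in[OF \<psi>] sec_act_in[OF b\<psi>]])
    fix h assume h: "functional \<xi> x h"
    let ?t = "\<lambda>l k. a (gmul l (ginv k), act \<Theta> k (act \<Theta> (ginv l) x)) * b (k, act \<Theta> (ginv l) x) * h (trans_sec l \<psi> x)"
    have "h (sec_act \<Theta> \<xi> a (sec_act \<Theta> \<xi> b \<psi>) x) =
        mass \<Theta> * (\<Sum>g\<in>G. a (into g x) * h (rho \<xi> (into g x) (sec_act \<Theta> \<xi> b \<psi> (act \<Theta> (ginv g) x))))"
      using functional_sec_act[OF b\<psi> h] by (simp add: trans_sec_def)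
    also have "\<dots> = mass \<Theta> * (\<Sum>g\<in>G. a (into g x) * (mass \<Theta> * (\<Sum>k\<in>G. b (into k (act \<Theta> (ginv g) x)) *
          h (rho \<xi> (into g x) (trans_sec k \<psi> (act \<Theta> (ginv g) x))))))"
      using functional_sec_act[OF \<psi> functional_rho[OF _ h]] by simp
    also have "\<dots> = mass \<Theta> * (mass \<Theta> * (\<Sum>g\<in>G. \<Sum>k\<in>G. ?t (gmul g k) k))"
    proof -
      have "a (into g x) * (b (into k (act \<Theta> (ginv g) x)) * h (rho \<xi> (into g x) (trans_sec k \<psi> (act \<Theta> (ginv g) x)))) =
          ?t (gmul g k) k" if gk: "g \<in> G" "k \<in> G" for g k
      proof -
        have "rho \<xi> (into g x) (trans_sec k \<psi> (act \<Theta> (ginv g) x)) = trans_sec (gmul g k) \<psi> x"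
          using gk \<psi> by (rule rho_trans_sec)
        then show ?thesis using gk by (simp add: into_def grp.inv_mult_group act_mult grp.m_assoc)
      qed
      then have "(\<Sum>g\<in>G. a (into g x) * (mass \<Theta> * (\<Sum>k\<in>G. b (into k (act \<Theta> (ginv g) x)) *
          h (rho \<xi> (into g x) (trans_sec k \<psi> (act \<Theta> (ginv g) x)))))) =
        (\<Sum>g\<in>G. mass \<Theta> * (\<Sum>k\<in>G. ?t (gmul g k) k))"
        by (intro sum.cong refl) (simp add: sum_distrib_left mult.left_commute[of _ "mass \<Theta>"])
      then show ?thesis by (simp add: sum_distrib_left)
    qed
    also have "(\<Sum>g\<in>G. \<Sum>k\<in>G. ?t (gmul g k) k) = (\<Sum>k\<in>G. \<Sum>g\<in>G. ?t (gmul g k) k)" by (rule sum.swap)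
    also have "\<dots> = (\<Sum>k\<in>G. \<Sum>l\<in>G. ?t l k)"
    proof (rule sum.cong[OF refl])
      fix k assume "k \<in> G"
      then show "(\<Sum>g\<in>G. ?t (gmul g k) k) = (\<Sum>l\<in>G. ?t l k)" by (rule sum_mult_right)
    qed
    also have "\<dots> = (\<Sum>l\<in>G. \<Sum>k\<in>G. ?t l k)" by (rule sum.swap)
    also have "mass \<Theta> * (mass \<Theta> * \<dots>) = h (sec_act \<Theta> \<xi> (conv \<Theta> a b) \<psi> x)"
      using functional_sec_act[OF \<psi> h, of "conv \<Theta> a b"]
      by (simp add: into_def conv_eq sum_distrib_left sum_distrib_right mult.assoc)
    finally show "h (sec_act \<Theta> \<xi> (conv \<Theta> a b) \<psi> x) = h (sec_act \<Theta> \<xi> a (sec_act \<Theta> \<xi> b \<psi>) x)" by simp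
  qed
qed

end

subsection \<open>The representation on sections\<close>

locale ebundle_measure = ebundle V \<Theta> \<xi>
  for V :: "(real^'n::{finite,wellorder}) set"
    and \<Theta> :: "('g, 'x::{t2_space, second_countable_topology}, 'n) action_orbifold"
    and \<xi> :: "('g, 'x, 'u) hbundle" +
  fixes M :: "'x measure"
  assumes integrable_cont: "\<And>f :: 'x \<Rightarrow> complex. continuous_on UNIV f \<Longrightarrow> integrable M f"
    and invariant: "\<And>(f :: 'x \<Rightarrow> complex) g. g \<in> G \<Longrightarrow> continuous_on UNIV f \<Longrightarrow>
      (\<integral>x. f (act \<Theta> g x) \<partial>M) = (\<integral>x. f x \<partial>M)"
begin

abbreviation "Sec \<equiv> section_space (atlas \<Theta>) \<xi> M"

lemma Sec_simps [simp]:
  "vecs Sec = sections (atlas \<Theta>) \<xi>" "plus_in Sec = (\<lambda>\<psi> \<psi>' x. vadd \<xi> (\<psi> x) (\<psi>' x))"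
  "zero_in Sec = vzero \<xi>" "scale_in Sec = (\<lambda>z \<psi> x. vscale \<xi> z (\<psi> x))"
  "inner_in Sec = (\<lambda>\<psi> \<psi>'. \<integral>x. herm \<xi> (\<psi> x) (\<psi>' x) \<partial>M)"
  by (simp_all add: section_space_def)

lemma herm_integrable:
  "\<psi> \<in> sections (atlas \<Theta>) \<xi> \<Longrightarrow> \<psi>' \<in> sections (atlas \<Theta>) \<xi> \<Longrightarrow> integrable M (\<lambda>x. herm \<xi> (\<psi> x) (\<psi>' x))"
  by (rule integrable_cont[OF herm_sections_continuous])

lemma section_identity:
  assumes "\<And>x. \<psi> x \<in> fibre \<xi> x" "\<And>x. \<psi>' x \<in> fibre \<xi> x" "\<And>x h. functional \<xi> x h \<Longrightarrow> h (\<psi> x) = h (\<psi>' x)"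
  shows "\<psi> = \<psi>'"
  using assms fibre_eqI by blast

lemma semi_inner_Sec: "semi_inner Sec"
proof unfold_locales
  fix \<psi> \<psi>' \<psi>'' assume "\<psi> \<in> vecs Sec" "\<psi>' \<in> vecs Sec" "\<psi>'' \<in> vecs Sec"
  then have s: "\<psi> \<in> sections (atlas \<Theta>) \<xi>" "\<psi>' \<in> sections (atlas \<Theta>) \<xi>" "\<psi>'' \<in> sections (atlas \<Theta>) \<xi>" by auto
  show "plus_in Sec (plus_in Sec \<psi> \<psi>') \<psi>'' = plus_in Sec \<psi> (plus_in Sec \<psi>' \<psi>'')"
    by (rule section_identity) (use s in \<open>auto simp: functionalD\<close>)
  have "(\<integral>x. herm \<xi> (vadd \<xi> (\<psi> x) (\<psi>' x)) (\<psi>'' x) \<partial>M) =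
      (\<integral>x. herm \<xi> (\<psi> x) (\<psi>'' x) + herm \<xi> (\<psi>' x) (\<psi>'' x) \<partial>M)"
  proof (rule Bochner_Integration.integral_cong[OF refl])
    fix x show "herm \<xi> (vadd \<xi> (\<psi> x) (\<psi>' x)) (\<psi>'' x) = herm \<xi> (\<psi> x) (\<psi>'' x) + herm \<xi> (\<psi>' x) (\<psi>'' x)"
      using s by (intro herm_add[of _ x]) auto
  qed
  also have "\<dots> = (\<integral>x. herm \<xi> (\<psi> x) (\<psi>'' x) \<partial>M) + (\<integral>x. herm \<xi> (\<psi>' x) (\<psi>'' x) \<partial>M)"
    by (rule Bochner_Integration.integral_add) (use s herm_integrable in auto)
  finally show "inner_in Sec (plus_in Sec \<psi> \<psi>') \<psi>'' = inner_in Sec \<psi> \<psi>'' + inner_in Sec \<psi>' \<psi>''" by simp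
next
  fix \<psi> \<psi>' z assume "\<psi> \<in> vecs Sec" "\<psi>' \<in> vecs Sec"
  then have s: "\<psi> \<in> sections (atlas \<Theta>) \<xi>" "\<psi>' \<in> sections (atlas \<Theta>) \<xi>" by auto
  show "plus_in Sec \<psi> \<psi>' \<in> vecs Sec" using section_add s by simp
  show "plus_in Sec \<psi> \<psi>' = plus_in Sec \<psi>' \<psi>"
    by (rule section_identity) (use s in \<open>auto simp: functionalD\<close>)
  show "scale_in Sec z (plus_in Sec \<psi> \<psi>') = plus_in Sec (scale_in Sec z \<psi>) (scale_in Sec z \<psi>')"
    by (rule section_identity) (use s in \<open>auto simp: functionalD algebra_simps\<close>)
  have "(\<integral>x. herm \<xi> (vscale \<xi> z (\<psi> x)) (\<psi>' x) \<partial>M) = (\<integral>x. z * herm \<xi> (\<psi> x) (\<psi>' x) \<partial>M)"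
  proof (rule Bochner_Integration.integral_cong[OF refl])
    fix x show "herm \<xi> (vscale \<xi> z (\<psi> x)) (\<psi>' x) = z * herm \<xi> (\<psi> x) (\<psi>' x)"
      using s by (intro herm_scale[of _ x]) auto
  qed
  then show "inner_in Sec (scale_in Sec z \<psi>) \<psi>' = z * inner_in Sec \<psi> \<psi>'" by simp
  have "(\<integral>x. herm \<xi> (\<psi>' x) (\<psi> x) \<partial>M) = (\<integral>x. cnj (herm \<xi> (\<psi> x) (\<psi>' x)) \<partial>M)"
  proof (rule Bochner_Integration.integral_cong[OF refl])
    fix x show "herm \<xi> (\<psi>' x) (\<psi> x) = cnj (herm \<xi> (\<psi> x) (\<psi>' x))"
      using s by (intro herm_commute[of _ x]) auto
  qed
  then show "inner_in Sec \<psi>' \<psi> = cnj (inner_in Sec \<psi> \<psi>')" by simp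
next
  fix \<psi> z z' assume "\<psi> \<in> vecs Sec"
  then have s: "\<psi> \<in> sections (atlas \<Theta>) \<xi>" by auto
  show "scale_in Sec z \<psi> \<in> vecs Sec" using section_mult[OF s smooth_fun_on_const[of _ z]] by simp
  show "plus_in Sec (zero_in Sec) \<psi> = \<psi>"
    by (rule section_identity) (use s in \<open>auto simp: functionalD functional_zero\<close>)
  show "plus_in Sec \<psi> (scale_in Sec (-1) \<psi>) = zero_in Sec"
    by (rule section_identity) (use s in \<open>auto simp: functionalD functional_zero\<close>)
  show "scale_in Sec (z + z') \<psi> = plus_in Sec (scale_in Sec z \<psi>) (scale_in Sec z' \<psi>)"
    by (rule section_identity) (use s in \<open>auto simp: functionalD algebra_simps\<close>)
  show "scale_in Sec z (scale_in Sec z' \<psi>) = scale_in Sec (z * z') \<psi>"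
    by (rule section_identity) (use s in \<open>auto simp: functionalD\<close>)
  show "scale_in Sec 1 \<psi> = \<psi>"
    by (rule section_identity) (use s in \<open>auto simp: functionalD\<close>)
  have "(\<integral>x. Re (herm \<xi> (\<psi> x) (\<psi> x)) \<partial>M) \<ge> 0"
    by (rule Bochner_Integration.integral_nonneg) (rule herm_pos[OF section_in[OF s]])
  then show "0 \<le> Re (inner_in Sec \<psi> \<psi>)" using herm_integrable[OF s s] by simp
qed (simp add: section_zero)

text \<open>Sum the inequality \<open>2 Re (u, v) \<le> (u, u) + (v, v)\<close> over all pairs.\<close>

lemma herm_sum_bound:
  assumes f: "\<And>i. i \<in> I \<Longrightarrow> f i \<in> fibre \<xi> x" and I: "finite I"
  shows "Re (herm \<xi> (fibre_sum \<xi> x f I) (fibre_sum \<xi> x f I)) \<le> card I * (\<Sum>i\<in>I. Re (herm \<xi> (f i) (f i)))"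
proof -
  let ?s = "fibre_sum \<xi> x f I"
  have s: "?s \<in> fibre \<xi> x" using f by (rule fibre_sum_in)
  have "herm \<xi> ?s ?s = (\<Sum>i\<in>I. herm \<xi> (f i) ?s)" using functional_sum[OF functional_herm[OF s] I f] .
  also have "\<dots> = (\<Sum>i\<in>I. cnj (herm \<xi> ?s (f i)))"
  proof (rule sum.cong[OF refl])
    fix i assume "i \<in> I"
    then show "herm \<xi> (f i) ?s = cnj (herm \<xi> ?s (f i))" using herm_commute[OF s f[of i]] by simp
  qed
  also have "\<dots> = (\<Sum>i\<in>I. \<Sum>j\<in>I. cnj (herm \<xi> (f j) (f i)))"
  proof (rule sum.cong[OF refl])
    fix i assume "i \<in> I"
    then show "cnj (herm \<xi> ?s (f i)) = (\<Sum>j\<in>I. cnj (herm \<xi> (f j) (f i)))"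
      using functional_sum[OF functional_herm[OF f] I f, of i] by simp
  qed
  finally have "Re (herm \<xi> ?s ?s) = (\<Sum>i\<in>I. \<Sum>j\<in>I. Re (herm \<xi> (f j) (f i)))" by simp
  also have "\<dots> \<le> (\<Sum>i\<in>I. \<Sum>j\<in>I. (Re (herm \<xi> (f i) (f i)) + Re (herm \<xi> (f j) (f j))) / 2)"
  proof (intro sum_mono)
    fix i j assume "i \<in> I" "j \<in> I"
    then have ij: "f i \<in> fibre \<xi> x" "f j \<in> fibre \<xi> x" "vscale \<xi> (-1) (f j) \<in> fibre \<xi> x" using f by auto
    let ?d = "vadd \<xi> (f i) (vscale \<xi> (-1) (f j))"
    have d: "?d \<in> fibre \<xi> x" using ij by simp
    have 1: "herm \<xi> ?d w = herm \<xi> (f i) w - herm \<xi> (f j) w" if "w \<in> fibre \<xi> x" for w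
      using herm_add[OF ij(1) that ij(3)] herm_scale[OF ij(2) that, of "-1"] by simp
    have "herm \<xi> ?d ?d = cnj (herm \<xi> ?d (f i)) - cnj (herm \<xi> ?d (f j))"
      using 1[OF d] herm_commute[OF d ij(1)] herm_commute[OF d ij(2)] by simp
    then have "Re (herm \<xi> ?d ?d) = Re (herm \<xi> (f i) (f i)) - Re (herm \<xi> (f j) (f i)) -
        Re (herm \<xi> (f i) (f j)) + Re (herm \<xi> (f j) (f j))" using 1[OF ij(1)] 1[OF ij(2)] by simp
    moreover have "Re (herm \<xi> (f i) (f j)) = Re (herm \<xi> (f j) (f i))" using herm_commute[OF ij(2,1)] by simp
    ultimately show "Re (herm \<xi> (f j) (f i)) \<le> (Re (herm \<xi> (f i) (f i)) + Re (herm \<xi> (f j) (f j))) / 2"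
      using herm_pos[OF d] by simp
  qed
  also have "\<dots> = card I * (\<Sum>i\<in>I. Re (herm \<xi> (f i) (f i)))"
    by (simp add: sum.distrib add_divide_distrib sum_divide_distrib[symmetric] sum_distrib_left[symmetric])
  finally show ?thesis .
qed

lemma trans_sec_herm:
  "g \<in> G \<Longrightarrow> \<psi> \<in> sections (atlas \<Theta>) \<xi> \<Longrightarrow>
    herm \<xi> (trans_sec g \<psi> x) (trans_sec g \<psi> x) = herm \<xi> (\<psi> (act \<Theta> (ginv g) x)) (\<psi> (act \<Theta> (ginv g) x))"
  unfolding trans_sec_def by (rule herm_rho_into) auto

text \<open>If \<open>c\<close> bounds \<open>\<bar>a\<bar>\<close>, the bound for sums gives
  \<open>\<parallel>(a \<cdot> \<psi>)(x)\<parallel>\<^sup>2 \<le> c\<^sup>2/#G \<Sum>\<^sub>g \<parallel>\<psi>(g\<^sup>-\<^sup>1 x)\<parallel>\<^sup>2\<close>, and each summand has the same integral by invariance of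
  the measure; so \<open>c\<close> bounds the operator.\<close>

lemma sec_act_bounded:
  assumes a: "a \<in> conv_algebra \<Theta>"
  shows "\<exists>c. \<forall>\<psi>\<in>vecs Sec. norm_in Sec (sec_act \<Theta> \<xi> a \<psi>) \<le> c * norm_in Sec \<psi>"
proof -
  obtain c where c: "c \<ge> 0" "\<And>g x. g \<in> G \<Longrightarrow> cmod (a (g, x)) \<le> c"
    by (rule conv_algebra_bounded[OF a]) (rule that)
  let ?n = "real (card G)"
  have n: "?n > 0" using card_G_pos by simp
  have "norm_in Sec (sec_act \<Theta> \<xi> a \<psi>) \<le> c * norm_in Sec \<psi>" if "\<psi> \<in> vecs Sec" for \<psi>
  proof -
    have \<psi>: "\<psi> \<in> sections (atlas \<Theta>) \<xi>" using that by simp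
    let ?N = "\<lambda>\<psi> x. Re (herm \<xi> (\<psi> x) (\<psi> x))"
    have pt: "?N (sec_act \<Theta> \<xi> a \<psi>) x \<le> c\<^sup>2 / ?n * (\<Sum>g\<in>G. ?N \<psi> (act \<Theta> (ginv g) x))" for x
    proof -
      let ?f = "\<lambda>g. vscale \<xi> (a (into g x)) (trans_sec g \<psi> x)"
      let ?s = "fibre_sum \<xi> x ?f G"
      have f: "?f g \<in> fibre \<xi> x" if "g \<in> G" for g using that \<psi> by simp
      have s: "?s \<in> fibre \<xi> x" using f by (rule fibre_sum_in)
      have sc: "Re (herm \<xi> (vscale \<xi> z u) (vscale \<xi> z u)) = (cmod z)\<^sup>2 * Re (herm \<xi> u u)"
        if u: "u \<in> fibre \<xi> x" for z u
      proof -
        have "herm \<xi> (vscale \<xi> z u) (vscale \<xi> z u) = z * cnj (herm \<xi> (vscale \<xi> z u) u)"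
          using herm_scale[OF u, of "vscale \<xi> z u" z] herm_commute[of "vscale \<xi> z u" x u] u by simp
        also have "\<dots> = (z * cnj z) * cnj (herm \<xi> u u)" using herm_scale[OF u u, of z] by simp
        also have "z * cnj z = of_real ((cmod z)\<^sup>2)" by (rule complex_norm_square[symmetric])
        finally show ?thesis by simp
      qed
      have "?N (sec_act \<Theta> \<xi> a \<psi>) x = (1 / ?n)\<^sup>2 * Re (herm \<xi> ?s ?s)"
        using sc[OF s, of "mass \<Theta>"] by (simp add: sec_act_eq[OF \<psi>] mass_def norm_divide)
      also have "\<dots> \<le> (1 / ?n)\<^sup>2 * (?n * (\<Sum>g\<in>G. Re (herm \<xi> (?f g) (?f g))))"
        using herm_sum_bound[OF f finite_G] by (intro mult_left_mono) auto
      also have "(\<Sum>g\<in>G. Re (herm \<xi> (?f g) (?f g))) \<le> (\<Sum>g\<in>G. c\<^sup>2 * ?N \<psi> (act \<Theta> (ginv g) x))"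
      proof (rule sum_mono)
        fix g assume g: "g \<in> G"
        have "cmod (a (into g x)) \<le> c" using c(2)[OF g] by (simp add: into_def)
        then have "(cmod (a (into g x)))\<^sup>2 \<le> c\<^sup>2" by (intro power_mono) auto
        then show "Re (herm \<xi> (?f g) (?f g)) \<le> c\<^sup>2 * ?N \<psi> (act \<Theta> (ginv g) x)"
          using sc[of "trans_sec g \<psi> x" "a (into g x)"] g \<psi> trans_sec_herm[OF g \<psi>]
            herm_pos[of "\<psi> (act \<Theta> (ginv g) x)" "act \<Theta> (ginv g) x"]
          by (simp add: mult_right_mono)
      qed
      finally show ?thesis using n by (simp add: sum_distrib_left[symmetric] power2_eq_square mult_left_mono field_simps)
    qed
    have cont: "continuous_on UNIV (\<lambda>x. herm \<xi> (\<psi> x) (\<psi> x))" using herm_sections_continuous \<psi> by blast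
    have icx: "integrable M (\<lambda>x. herm \<xi> (\<psi> (act \<Theta> (ginv g) x)) (\<psi> (act \<Theta> (ginv g) x)))" if "g \<in> G" for g
      by (rule integrable_cont) (rule continuous_on_compose2[OF cont act_continuous], use that in auto)
    have int: "(\<integral>x. ?N \<psi> (act \<Theta> (ginv g) x) \<partial>M) = Re (inner_in Sec \<psi> \<psi>)" if "g \<in> G" for g
    proof -
      have "(\<integral>x. herm \<xi> (\<psi> (act \<Theta> (ginv g) x)) (\<psi> (act \<Theta> (ginv g) x)) \<partial>M) = (\<integral>x. herm \<xi> (\<psi> x) (\<psi> x) \<partial>M)"
        by (rule invariant[OF _ cont]) (use that in simp)
      then show ?thesis using integral_Re[OF icx[OF that]] by simp
    qed
    have "Re (inner_in Sec (sec_act \<Theta> \<xi> a \<psi>) (sec_act \<Theta> \<xi> a \<psi>)) = (\<integral>x. ?N (sec_act \<Theta> \<xi> a \<psi>) x \<partial>M)"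
      using herm_integrable sec_act_section[OF a \<psi>] by simp
    also have "\<dots> \<le> (\<integral>x. c\<^sup>2 / ?n * (\<Sum>g\<in>G. ?N \<psi> (act \<Theta> (ginv g) x)) \<partial>M)"
      using pt icx herm_integrable sec_act_section[OF a \<psi>]
      by (intro integral_mono Bochner_Integration.integrable_mult_right Bochner_Integration.integrable_sum) auto
    also have "\<dots> = c\<^sup>2 / ?n * (\<Sum>g\<in>G. Re (inner_in Sec \<psi> \<psi>))"
      using icx int by (subst Bochner_Integration.integral_mult_right_zero, subst Bochner_Integration.integral_sum) auto
    also have "\<dots> = c\<^sup>2 * Re (inner_in Sec \<psi> \<psi>)" using n by simp
    finally have "sqrt (Re (inner_in Sec (sec_act \<Theta> \<xi> a \<psi>) (sec_act \<Theta> \<xi> a \<psi>))) \<le> sqrt (c\<^sup>2 * Re (inner_in Sec \<psi> \<psi>))"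
      by (rule real_sqrt_le_mono)
    then show ?thesis unfolding norm_in_def using c(1) by (simp only: real_sqrt_mult real_sqrt_abs abs_of_nonneg)
  qed
  then show ?thesis by blast
qed

text \<open>Substitute \<open>g x\<close> for \<open>x\<close> in the summand of \<open>g\<close>, by invariance of the measure; then invariance of the
  metric moves the action of \<open>g\<close> to the other argument as that of \<open>g\<^sup>-\<^sup>1\<close>.\<close>

lemma sec_act_adjoint:
  assumes a: "a \<in> conv_algebra \<Theta>" and \<psi>: "\<psi> \<in> sections (atlas \<Theta>) \<xi>" and \<psi>': "\<psi>' \<in> sections (atlas \<Theta>) \<xi>"
  shows "inner_in Sec (sec_act \<Theta> \<xi> a \<psi>) \<psi>' = inner_in Sec \<psi> (sec_act \<Theta> \<xi> (star \<Theta> a) \<psi>')"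
proof -
  let ?F = "\<lambda>g x. a (into g x) * herm \<xi> (trans_sec g \<psi> x) (\<psi>' x)"
  have cF: "continuous_on UNIV (?F g)" if "g \<in> G" for g
    using smooth_fun_on_continuous[OF conv_algebra_into_smooth[OF a that] open_UNIV]
      herm_sections_continuous[OF section_translate[OF that \<psi>] \<psi>'] by (intro continuous_on_mult)
  have "inner_in Sec (sec_act \<Theta> \<xi> a \<psi>) \<psi>' = (\<integral>x. mass \<Theta> * (\<Sum>g\<in>G. ?F g x) \<partial>M)"
    using functional_sec_act[OF \<psi> functional_herm] \<psi>' by simp
  also have "\<dots> = mass \<Theta> * (\<Sum>g\<in>G. \<integral>x. ?F g x \<partial>M)"
    using integrable_cont[OF cF] by (subst Bochner_Integration.integral_mult_right_zero, subst Bochner_Integration.integral_sum) auto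
  also have "\<dots> = mass \<Theta> * (\<Sum>g\<in>G. \<integral>x. ?F g (act \<Theta> g x) \<partial>M)"
  proof -
    have "(\<Sum>g\<in>G. \<integral>x. ?F g x \<partial>M) = (\<Sum>g\<in>G. \<integral>x. ?F g (act \<Theta> g x) \<partial>M)"
    proof (rule sum.cong[OF refl])
      fix g assume "g \<in> G"
      from invariant[OF this cF[OF this]]
      show "(\<integral>x. ?F g x \<partial>M) = (\<integral>x. ?F g (act \<Theta> g x) \<partial>M)" by (rule sym)
    qed
    then show ?thesis by (simp only:)
  qed
  also have "\<dots> = (\<integral>x. mass \<Theta> * (\<Sum>g\<in>G. ?F g (act \<Theta> g x)) \<partial>M)"
  proof -
    have ic: "integrable M (\<lambda>x. ?F g (act \<Theta> g x))" if "g \<in> G" for g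
      by (rule integrable_cont[OF continuous_on_compose2[OF cF[OF that] act_continuous[OF that]]]) simp
    show ?thesis
      by (simp only: Bochner_Integration.integral_mult_right_zero Bochner_Integration.integral_sum[OF ic])
  qed
  also have "\<dots> = (\<integral>x. herm \<xi> (\<psi> x) (sec_act \<Theta> \<xi> (star \<Theta> a) \<psi>' x) \<partial>M)"
  proof (rule Bochner_Integration.integral_cong[OF refl])
    fix x
    have "herm \<xi> (\<psi> x) (sec_act \<Theta> \<xi> (star \<Theta> a) \<psi>' x) = cnj (herm \<xi> (sec_act \<Theta> \<xi> (star \<Theta> a) \<psi>' x) (\<psi> x))"
      using herm_commute[OF sec_act_in[OF \<psi>'], of "\<psi> x"] \<psi> by simp
    also have "herm \<xi> (sec_act \<Theta> \<xi> (star \<Theta> a) \<psi>' x) (\<psi> x) =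
        mass \<Theta> * (\<Sum>g\<in>G. star \<Theta> a (into g x) * herm \<xi> (trans_sec g \<psi>' x) (\<psi> x))"
      using functional_sec_act[OF \<psi>' functional_herm] \<psi> by simp
    also have "\<dots> = mass \<Theta> * (\<Sum>g\<in>G. star \<Theta> a (into (ginv g) x) * herm \<xi> (trans_sec (ginv g) \<psi>' x) (\<psi> x))"
      using sum_inverse[of "\<lambda>g. star \<Theta> a (into g x) * herm \<xi> (trans_sec g \<psi>' x) (\<psi> x)"] by simp
    also have "cnj \<dots> = mass \<Theta> * (\<Sum>g\<in>G. ?F g (act \<Theta> g x))"
    proof -
      have "cnj (star \<Theta> a (into (ginv g) x) * herm \<xi> (trans_sec (ginv g) \<psi>' x) (\<psi> x)) = ?F g (act \<Theta> g x)"
        if g: "g \<in> G" for g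
      proof -
        let ?w = "\<psi>' (act \<Theta> g x)"
        have i: "into (ginv g) x = (ginv g, act \<Theta> g x)" using g by (simp add: into_def)
        have w: "rho \<xi> (ginv g, act \<Theta> g x) ?w \<in> fibre \<xi> x"
          using rho_in[of "ginv g" ?w "act \<Theta> g x"] g \<psi>' by simp
        have "rho \<xi> (g, x) (rho \<xi> (ginv g, act \<Theta> g x) ?w) = ?w"
          using rho_inverse(3)[of g ?w "act \<Theta> g x"] g \<psi>' by simp
        then have "herm \<xi> (rho \<xi> (g, x) (\<psi> x)) ?w = herm \<xi> (\<psi> x) (rho \<xi> (ginv g, act \<Theta> g x) ?w)"
          using herm_rho[OF g _ w, of "\<psi> x"] \<psi> by simp
        also have "\<dots> = cnj (herm \<xi> (rho \<xi> (ginv g, act \<Theta> g x) ?w) (\<psi> x))"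
          using herm_commute[OF w, of "\<psi> x"] \<psi> by simp
        finally have "cnj (herm \<xi> (trans_sec (ginv g) \<psi>' x) (\<psi> x)) = herm \<xi> (rho \<xi> (g, x) (\<psi> x)) ?w"
          using g i by (simp add: trans_sec_def)
        moreover have "cnj (star \<Theta> a (into (ginv g) x)) = a (g, x)"
          using g i by (simp add: star_def inv_arrow_def)
        ultimately show ?thesis using g by (simp add: trans_sec_def)
      qed
      moreover have "cnj (mass \<Theta>) = mass \<Theta>" by (simp add: mass_def)
      ultimately show ?thesis by simp
    qed
    finally show "mass \<Theta> * (\<Sum>g\<in>G. ?F g (act \<Theta> g x)) = herm \<xi> (\<psi> x) (sec_act \<Theta> \<xi> (star \<Theta> a) \<psi>' x)" by simp
  qed
  finally show ?thesis by simp
qed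

theorem representation_Sec: "representation \<Theta> Sec (sec_act \<Theta> \<xi>)"
  unfolding representation_def
proof (intro ballI conjI allI)
  fix a assume a: "a \<in> conv_algebra \<Theta>"
  show "bounded_in Sec Sec (sec_act \<Theta> \<xi> a)"
    unfolding bounded_in_def linear_in_def
  proof (intro conjI ballI allI sec_act_bounded[OF a])
    show "sec_act \<Theta> \<xi> a ` vecs Sec \<subseteq> vecs Sec" using sec_act_section[OF a] by auto
    fix \<psi> z assume "\<psi> \<in> vecs Sec"
    then have \<psi>: "\<psi> \<in> sections (atlas \<Theta>) \<xi>" by simp
    have z: "(\<lambda>x. vscale \<xi> z (\<psi> x)) \<in> sections (atlas \<Theta>) \<xi>"
      using section_mult[OF \<psi> smooth_fun_on_const[of _ z]] .
    have "trans_sec g (\<lambda>x. vscale \<xi> z (\<psi> x)) x = vscale \<xi> z (trans_sec g \<psi> x)" if "g \<in> G" for g x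
      unfolding trans_sec_def into_def using that \<psi> by (simp add: rho_scale)
    then show "sec_act \<Theta> \<xi> a (scale_in Sec z \<psi>) = scale_in Sec z (sec_act \<Theta> \<xi> a \<psi>)"
      using \<psi> z by (intro section_identity)
        (auto simp: sec_act_in functionalD functional_sec_act sum_distrib_left mult_ac)
    fix \<psi>' assume "\<psi>' \<in> vecs Sec"
    then have \<psi>': "\<psi>' \<in> sections (atlas \<Theta>) \<xi>" by simp
    have p: "(\<lambda>x. vadd \<xi> (\<psi> x) (\<psi>' x)) \<in> sections (atlas \<Theta>) \<xi>" using section_add[OF \<psi> \<psi>'] .
    have "trans_sec g (\<lambda>x. vadd \<xi> (\<psi> x) (\<psi>' x)) x = vadd \<xi> (trans_sec g \<psi> x) (trans_sec g \<psi>' x)" if "g \<in> G" for g x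
      unfolding trans_sec_def into_def using that \<psi> \<psi>' by (simp add: rho_add)
    then show "sec_act \<Theta> \<xi> a (plus_in Sec \<psi> \<psi>') = plus_in Sec (sec_act \<Theta> \<xi> a \<psi>) (sec_act \<Theta> \<xi> a \<psi>')"
      using \<psi> \<psi>' p by (intro section_identity)
        (auto simp: sec_act_in functionalD functional_sec_act sum.distrib algebra_simps)
  qed
  show "inner_in Sec (sec_act \<Theta> \<xi> a \<psi>) \<psi>' = inner_in Sec \<psi> (sec_act \<Theta> \<xi> (star \<Theta> a) \<psi>')"
    if "\<psi> \<in> vecs Sec" "\<psi>' \<in> vecs Sec" for \<psi> \<psi>'
    using sec_act_adjoint[OF a, of \<psi> \<psi>'] that by simp
  fix b \<psi> z assume b: "b \<in> conv_algebra \<Theta>" and "\<psi> \<in> vecs Sec"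
  then have \<psi>: "\<psi> \<in> sections (atlas \<Theta>) \<xi>" by simp
  show "sec_act \<Theta> \<xi> (conv \<Theta> a b) \<psi> = sec_act \<Theta> \<xi> a (sec_act \<Theta> \<xi> b \<psi>)" using sec_act_conv[OF a b \<psi>] .
  show "sec_act \<Theta> \<xi> (\<lambda>\<tau>. z * a \<tau> + b \<tau>) \<psi> =
      plus_in Sec (scale_in Sec z (sec_act \<Theta> \<xi> a \<psi>)) (sec_act \<Theta> \<xi> b \<psi>)"
    using \<psi> by (intro section_identity)
      (auto simp: sec_act_in functionalD functional_sec_act sum.distrib sum_distrib_left algebra_simps)
qed

end

section \<open>Morita equivalences\<close>

context two_manifolds
begin

lemma local_diffeo_pull_smooth:
  assumes F: "local_diffeo A B F" and f: "smooth_fun_on B T f"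
  shows "smooth_fun_on A (F -` T) (\<lambda>x. f (F x))"
proof (rule MA.smooth_fun_on_local)
  fix x assume x: "x \<in> F -` T"
  obtain U where U: "open U" "x \<in> U" "smooth_map_on A B U F" using local_diffeoE[OF F] by metis
  obtain D where D: "D \<in> B" "F x \<in> fst D" using MB.chart_exists .
  obtain C where C: "C \<in> A" "x \<in> fst C" using MA.chart_exists .
  let ?N = "U \<inter> F -` fst D \<inter> fst C"
  have "open (U \<inter> F -` fst D)"
    using continuous_open_preimage[OF smooth_map_on_cont[OF U(3)] U(1) MB.chart_open[OF D(1)]] .
  then have N: "open ?N" using MA.chart_open[OF C(1)] by blast
  have "smooth_on (snd C ` (fst C \<inter> (F -` T \<inter> ?N))) (\<lambda>z. (f \<circ> chart_inv D) (in_charts C D F z))"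
    by (rule smooth_on_comp[OF smooth_on_subset[OF smooth_map_onD[OF U(3) C(1) D(1)]]
          MB.smooth_fun_onD[OF f D(1)]])
      (auto simp: in_charts_def MA.chart_inv_left[OF C(1)])
  then have "smooth_on (snd C ` (fst C \<inter> (F -` T \<inter> ?N))) ((\<lambda>x. f (F x)) \<circ> chart_inv C)"
    by (rule smooth_on_cong)
      (auto simp: in_charts_def MA.chart_inv_left[OF C(1)] MB.chart_inv_left[OF D(1)])
  from MA.smooth_fun_on_chartI[OF C(1) this]
  have "smooth_fun_on A (F -` T \<inter> ?N) (\<lambda>x. f (F x))"
    by (rule MA.smooth_fun_on_subset) auto
  then show "\<exists>N. open N \<and> x \<in> N \<and> smooth_fun_on A (F -` T \<inter> N) (\<lambda>x. f (F x))"
    using N U(2) C D x by (intro exI[of _ ?N]) auto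
qed

lemma local_diffeo_push_smooth:
  assumes F: "local_diffeo A B F" and W: "open W" "inj_on F W" and f: "smooth_fun_on A W f"
  shows "smooth_fun_on B (F ` W) (\<lambda>y. f (inv_into W F y))"
proof (rule MB.smooth_fun_on_local)
  interpret BA: two_manifolds V B A ..
  fix y assume "y \<in> F ` W"
  then obtain x where x: "x \<in> W" "y = F x" by blast
  obtain U where U: "x \<in> U" "U \<subseteq> W" "inj_on F U" "open (F ` U)"
    "smooth_map_on B A (F ` U) (inv_into U F)" using local_diffeo_small[OF F W(1) x(1)] by metis
  have "smooth_fun_on B (F ` U) (\<lambda>y. f (inv_into U F y))"
    by (rule BA.smooth_fun_on_comp[OF U(5) MA.smooth_fun_on_subset[OF f U(2)] _ U(4)])
      (auto intro: inv_into_into)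
  then have "smooth_fun_on B (F ` W \<inter> F ` U) (\<lambda>y. f (inv_into W F y))"
  proof (rule MB.smooth_fun_on_mono_cong)
    fix z assume "z \<in> F ` W \<inter> F ` U"
    then obtain a where "a \<in> U" "z = F a" by blast
    then show "f (inv_into U F z) = f (inv_into W F z)" using U(2,3) W(2) by (simp add: inv_into_f_f subsetD)
  qed blast
  then show "\<exists>N. open N \<and> y \<in> N \<and> smooth_fun_on B (F ` W \<inter> N) (\<lambda>y. f (inv_into W F y))"
    using U x by blast
qed

lemma local_diffeo_open_image:
  assumes F: "local_diffeo A B F" and W: "open W"
  shows "open (F ` W)"
proof (subst open_subopen, rule ballI)
  fix y assume "y \<in> F ` W"
  then obtain x where x: "x \<in> W" "y = F x" by blast
  obtain U where "x \<in> U" "U \<subseteq> W" "open (F ` U)" using local_diffeo_small[OF F W x(1)] by metis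
  then show "\<exists>T. open T \<and> y \<in> T \<and> T \<subseteq> F ` W" using x by blast
qed

end

locale morita = X: orbifold V \<Theta> + Y: orbifold V \<Xi>
  for V :: "(real^'n::{finite,wellorder}) set"
    and \<Theta> :: "('g, 'x::{t2_space, second_countable_topology}, 'n) action_orbifold"
    and \<Xi> :: "('k, 'y::{t2_space, second_countable_topology}, 'n) action_orbifold" +
  fixes \<phi> :: "('g, 'x, 'k, 'y, 'q::{t2_space, second_countable_topology}, 'n) bitorsor"
  assumes me: "morita_equivalence V \<Theta> \<Xi> \<phi>"
begin

abbreviation \<alpha> where "\<alpha> \<equiv> lanchor \<phi>"
abbreviation \<rho> where "\<rho> \<equiv> ranchor \<phi>"

lemma
  shows atlas_Q: "smooth_atlas V (qatlas \<phi>)"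
    and surj_\<alpha>: "surj \<alpha>" and diffeo_\<alpha>: "local_diffeo (qatlas \<phi>) (atlas \<Xi>) \<alpha>"
    and surj_\<rho>: "surj \<rho>" and diffeo_\<rho>: "local_diffeo (qatlas \<phi>) (atlas \<Theta>) \<rho>"
    and ra: "right_action \<Theta> \<phi>" and la: "left_action \<Xi> \<phi>"
    and me_\<alpha>: "\<forall>q. \<forall>\<sigma>\<in>arrows_into \<Theta> (\<rho> q). \<alpha> (ract \<phi> q \<sigma>) = \<alpha> q"
    and me_\<rho>: "\<forall>q. \<forall>\<tau>\<in>arrows_from \<Xi> (\<alpha> q). \<rho> (lact \<phi> \<tau> q) = \<rho> q"
    and me_commute: "\<forall>q. \<forall>\<sigma>\<in>arrows_into \<Theta> (\<rho> q). \<forall>\<tau>\<in>arrows_from \<Xi> (\<alpha> q).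
        lact \<phi> \<tau> (ract \<phi> q \<sigma>) = ract \<phi> (lact \<phi> \<tau> q) \<sigma>"
    and me_free_right: "\<forall>q q'. \<alpha> q = \<alpha> q' \<longrightarrow> (\<exists>!\<sigma>. \<sigma> \<in> arrows_into \<Theta> (\<rho> q) \<and> ract \<phi> q \<sigma> = q')"
    and me_free_left: "\<forall>q q'. \<rho> q = \<rho> q' \<longrightarrow> (\<exists>!\<tau>. \<tau> \<in> arrows_from \<Xi> (\<alpha> q) \<and> lact \<phi> \<tau> q = q')"
  using me unfolding morita_equivalence_def by simp_all

sublocale Q: manifold V "qatlas \<phi>"
  using X.model_V atlas_Q by unfold_locales

sublocale QX: two_manifolds V "qatlas \<phi>" "atlas \<Theta>" ..
sublocale QY: two_manifolds V "qatlas \<phi>" "atlas \<Xi>" ..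
sublocale QQ: two_manifolds V "qatlas \<phi>" "qatlas \<phi>" ..

lemma cont_\<alpha>: "continuous_on UNIV \<alpha>" and cont_\<rho>: "continuous_on UNIV \<rho>"
  using local_diffeo_continuous diffeo_\<alpha> diffeo_\<rho> by blast+

text \<open>The groupoid actions define a right action of the group \<open>G\<close> and a left action of the group \<open>K\<close> on
  \<open>Q\<close>. The fibres of \<open>\<alpha>\<close> are the free orbits of \<open>G\<close>, and the fibres of \<open>\<rho>\<close> those of \<open>K\<close>.\<close>

definition R :: "'g \<Rightarrow> 'q \<Rightarrow> 'q" where "R g q = ract \<phi> q (X.into g (\<rho> q))"
definition L :: "'k \<Rightarrow> 'q \<Rightarrow> 'q" where "L k q = lact \<phi> (k, \<alpha> q) q"

lemma R_smooth: "g \<in> X.G \<Longrightarrow> smooth_map_on (qatlas \<phi>) (qatlas \<phi>) UNIV (R g)"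
  using ra[unfolded right_action_def, THEN conjunct2, THEN conjunct2]
  unfolding R_def[abs_def] X.into_def by simp

lemma L_smooth: "k \<in> Y.G \<Longrightarrow> smooth_map_on (qatlas \<phi>) (qatlas \<phi>) UNIV (L k)"
  using la[unfolded left_action_def, THEN conjunct2, THEN conjunct2]
  unfolding L_def[abs_def] by simp

lemma R_cont: "g \<in> X.G \<Longrightarrow> continuous_on UNIV (R g)" and L_cont: "k \<in> Y.G \<Longrightarrow> continuous_on UNIV (L k)"
  using R_smooth L_smooth smooth_map_on_cont by blast+

lemma
  assumes g: "g \<in> X.G"
  shows \<rho>_R [simp]: "\<rho> (R g q) = act \<Theta> (X.ginv g) (\<rho> q)"
    and \<alpha>_R [simp]: "\<alpha> (R g q) = \<alpha> q"
    and R_R: "h \<in> X.G \<Longrightarrow> R h (R g q) = R (X.gmul g h) q"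
proof -
  note r = bspec[OF spec[OF ra[unfolded right_action_def, THEN conjunct2, THEN conjunct1]] X.into_in[OF g]]
  show 1: "\<rho> (R g q) = act \<Theta> (X.ginv g) (\<rho> q)" using r by (simp add: R_def)
  show "\<alpha> (R g q) = \<alpha> q" using bspec[OF spec[OF me_\<alpha>] X.into_in[OF g]] by (simp add: R_def)
  assume h: "h \<in> X.G"
  have "ract \<phi> (ract \<phi> q (X.into g (\<rho> q))) (X.into h (act \<Theta> (X.ginv g) (\<rho> q))) =
      ract \<phi> q (comp_arrow \<Theta> (X.into g (\<rho> q)) (X.into h (act \<Theta> (X.ginv g) (\<rho> q))))"
    using r[THEN conjunct2] X.into_in[OF h] by simp
  then show "R h (R g q) = R (X.gmul g h) q"
    using 1 g h by (simp add: R_def X.comp_into)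
qed

lemma R_one [simp]: "R X.gone q = q"
  using spec[OF ra[unfolded right_action_def, THEN conjunct1], of q] by (simp add: R_def unit_arrow_def)

lemma R_inv [simp]: "g \<in> X.G \<Longrightarrow> R (X.ginv g) (R g q) = q" "g \<in> X.G \<Longrightarrow> R g (R (X.ginv g) q) = q"
  by (simp_all add: R_R)

lemma
  assumes k: "k \<in> Y.G"
  shows \<alpha>_L [simp]: "\<alpha> (L k q) = act \<Xi> k (\<alpha> q)"
    and \<rho>_L [simp]: "\<rho> (L k q) = \<rho> q"
    and L_L: "l \<in> Y.G \<Longrightarrow> L l (L k q) = L (Y.gmul l k) q"
    and L_R: "g \<in> X.G \<Longrightarrow> L k (R g q) = R g (L k q)"
proof -
  note r = bspec[OF spec[OF la[unfolded left_action_def, THEN conjunct2, THEN conjunct1]] Y.from_in[OF k]]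
  show 1: "\<alpha> (L k q) = act \<Xi> k (\<alpha> q)" using r by (simp add: L_def)
  show 2: "\<rho> (L k q) = \<rho> q" using bspec[OF spec[OF me_\<rho>] Y.from_in[OF k]] by (simp add: L_def)
  show "L l (L k q) = L (Y.gmul l k) q" if "l \<in> Y.G"
    using bspec[OF r[THEN conjunct2], of "(l, act \<Xi> k (\<alpha> q))"] that 1 k
    by (simp add: L_def comp_arrow_def)
  show "L k (R g q) = R g (L k q)" if "g \<in> X.G"
    using bspec[OF bspec[OF spec[OF me_commute] X.into_in[OF that]] Y.from_in[OF k], of q] 2
    \<alpha>_R[OF that, of q] by (simp add: L_def R_def)
qed

lemma L_one [simp]: "L Y.gone q = q"
  using spec[OF la[unfolded left_action_def, THEN conjunct1], of q] by (simp add: L_def unit_arrow_def)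

lemma ex1_unique: "\<exists>!x. P x \<Longrightarrow> P a \<Longrightarrow> P b \<Longrightarrow> a = b"
  by blast

lemma R_transitive:
  assumes "\<alpha> q = \<alpha> q'" obtains g where "g \<in> X.G" "q' = R g q"
proof -
  obtain \<sigma> where "\<sigma> \<in> arrows_into \<Theta> (\<rho> q)" "ract \<phi> q \<sigma> = q'" using me_free_right assms by blast
  then show thesis using that unfolding X.arrows_into_eq R_def by blast
qed

lemma R_free: "g \<in> X.G \<Longrightarrow> h \<in> X.G \<Longrightarrow> R g q = R h q \<Longrightarrow> g = h"
proof -
  assume gh: "g \<in> X.G" "h \<in> X.G" "R g q = R h q"
  have "\<exists>!\<sigma>. \<sigma> \<in> arrows_into \<Theta> (\<rho> q) \<and> ract \<phi> q \<sigma> = R g q"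
    using me_free_right \<alpha>_R[OF gh(1), of q] by presburger
  then have "X.into g (\<rho> q) = X.into h (\<rho> q)"
    by (rule ex1_unique) (use gh in \<open>simp_all add: R_def\<close>)
  then show "g = h" using X.into_simps(5) by metis
qed

lemma L_transitive:
  assumes "\<rho> q = \<rho> q'" obtains k where "k \<in> Y.G" "q' = L k q"
proof -
  obtain \<tau> where "\<tau> \<in> arrows_from \<Xi> (\<alpha> q)" "lact \<phi> \<tau> q = q'" using me_free_left assms by blast
  then show thesis using that unfolding Y.arrows_from_eq L_def by blast
qed

lemma L_free: "k \<in> Y.G \<Longrightarrow> l \<in> Y.G \<Longrightarrow> L k q = L l q \<Longrightarrow> k = l"
proof -
  assume kl: "k \<in> Y.G" "l \<in> Y.G" "L k q = L l q"
  have "\<exists>!\<tau>. \<tau> \<in> arrows_from \<Xi> (\<alpha> q) \<and> lact \<phi> \<tau> q = L k q"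
    using me_free_left \<rho>_L[OF kl(1), of q] by presburger
  then have "(k, \<alpha> q) = (l, \<alpha> q)"
    by (rule ex1_unique) (use kl in \<open>simp_all add: L_def\<close>)
  then show "k = l" by simp
qed

lemma sum_fibre_\<alpha>: "(\<Sum>q' | \<alpha> q' = \<alpha> q. f q') = (\<Sum>g\<in>X.G. f (R g q))"
proof -
  have "bij_betw (\<lambda>g. R g q) X.G {q'. \<alpha> q' = \<alpha> q}"
    unfolding bij_betw_def
  proof
    show "inj_on (\<lambda>g. R g q) X.G" using R_free by (auto simp: inj_on_def)
    show "(\<lambda>g. R g q) ` X.G = {q'. \<alpha> q' = \<alpha> q}"
    proof
      show "{q'. \<alpha> q' = \<alpha> q} \<subseteq> (\<lambda>g. R g q) ` X.G"
      proof
        fix q' assume "q' \<in> {q'. \<alpha> q' = \<alpha> q}"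
        then have "\<alpha> q = \<alpha> q'" by simp
        then obtain g where "g \<in> X.G" "q' = R g q" by (rule R_transitive)
        then show "q' \<in> (\<lambda>g. R g q) ` X.G" by blast
      qed
    qed auto
  qed
  from sum.reindex_bij_betw[OF this, of f] show ?thesis by simp
qed

lemma sum_fibre_\<rho>: "(\<Sum>q' | \<rho> q' = \<rho> q. f q') = (\<Sum>k\<in>Y.G. f (L k q))"
proof -
  have "bij_betw (\<lambda>k. L k q) Y.G {q'. \<rho> q' = \<rho> q}"
    unfolding bij_betw_def
  proof
    show "inj_on (\<lambda>k. L k q) Y.G" using L_free by (auto simp: inj_on_def)
    show "(\<lambda>k. L k q) ` Y.G = {q'. \<rho> q' = \<rho> q}"
    proof
      show "{q'. \<rho> q' = \<rho> q} \<subseteq> (\<lambda>k. L k q) ` Y.G"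
      proof
        fix q' assume "q' \<in> {q'. \<rho> q' = \<rho> q}"
        then have "\<rho> q = \<rho> q'" by simp
        then obtain k where "k \<in> Y.G" "q' = L k q" by (rule L_transitive)
        then show "q' \<in> (\<lambda>k. L k q) ` Y.G" by blast
      qed
    qed auto
  qed
  from sum.reindex_bij_betw[OF this, of f] show ?thesis by simp
qed

lemma obtain_\<alpha>: obtains q where "\<alpha> q = y"
  using surj_\<alpha> by (metis surjD)

lemma obtain_\<rho>: obtains q where "\<rho> q = x"
  using surj_\<rho> by (metis surjD)

text \<open>Given a cover, pick members around the finitely many points \<open>q \<cdot> g\<close> of a fibre of \<open>\<alpha>\<close>. A
  small neighbourhood \<open>U\<close> of \<open>q\<close> has all its translates in these members, and the translates fill
  the preimage of the open set \<open>\<alpha>(U)\<close>; so compactness of \<open>Y\<close> passes to \<open>Q\<close>.\<close>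

lemma compact_Q: "compact (UNIV :: 'q set)"
proof (rule compactI)
  fix \<C> :: "'q set set" assume op: "\<forall>c\<in>\<C>. open c" and cov: "UNIV \<subseteq> \<Union> \<C>"
  have "\<exists>U F. open U \<and> q \<in> U \<and> F \<subseteq> \<C> \<and> finite F \<and> (\<forall>g\<in>X.G. R g ` U \<subseteq> \<Union> F)" for q
  proof -
    have "\<forall>g. \<exists>c. c \<in> \<C> \<and> R g q \<in> c" using cov by blast
    then obtain c where c: "\<And>g. c g \<in> \<C>" "\<And>g. R g q \<in> c g" by metis
    let ?U = "\<Inter>g\<in>X.G. R g -` c g"
    have "open ?U"
    proof (rule open_INT[OF X.finite_G], rule ballI)
      fix g assume "g \<in> X.G"
      from R_cont[OF this] show "open (R g -` c g)"
        using op c(1) by (simp add: continuous_on_open_vimage)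
    qed
    then show ?thesis using c X.finite_G
      by (intro exI[of _ ?U] exI[of _ "c ` X.G"]) auto
  qed
  then obtain U F where UF: "\<And>q. open (U q)" "\<And>q. q \<in> U q" "\<And>q. F q \<subseteq> \<C>" "\<And>q. finite (F q)"
    "\<And>q g. g \<in> X.G \<Longrightarrow> R g ` U q \<subseteq> \<Union> (F q)" by metis
  have "UNIV \<subseteq> \<Union> (range (\<lambda>q. \<alpha> ` U q))"
  proof
    fix y
    obtain q where "\<alpha> q = y" by (rule obtain_\<alpha>)
    then show "y \<in> \<Union> (range (\<lambda>q. \<alpha> ` U q))" using UF(2)[of q] by blast
  qed
  moreover have "open B" if "B \<in> range (\<lambda>q. \<alpha> ` U q)" for B
    using that QY.local_diffeo_open_image[OF diffeo_\<alpha> UF(1)] by blast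
  ultimately obtain D where D: "D \<subseteq> range (\<lambda>q. \<alpha> ` U q)" "finite D" "UNIV \<subseteq> \<Union> D"
    using compactE[OF Y.compact_X] by metis
  then obtain P where P: "finite P" "D = (\<lambda>q. \<alpha> ` U q) ` P" by (metis finite_subset_image)
  have "q' \<in> \<Union> (\<Union>q\<in>P. F q)" for q'
  proof -
    have "\<alpha> q' \<in> \<Union> D" using D(3) by blast
    then obtain q a where q: "q \<in> P" "a \<in> U q" "\<alpha> a = \<alpha> q'" unfolding P(2) by force
    obtain g where "g \<in> X.G" "q' = R g a" by (rule R_transitive[OF q(3)])
    then have "q' \<in> \<Union> (F q)" using UF(5)[of g q] q(2) by blast
    then show ?thesis using q(1) by blast
  qed
  then show "\<exists>C'\<subseteq>\<C>. finite C' \<and> UNIV \<subseteq> \<Union> C'"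
    using P(1) UF(3,4) by (intro exI[of _ "\<Union>q\<in>P. F q"]) blast
qed

end

subsection \<open>The induced bundle\<close>

locale morita_bundle = morita V \<Theta> \<Xi> \<phi> + X: ebundle V \<Theta> \<xi>
  for V :: "(real^'n::{finite,wellorder}) set"
    and \<Theta> :: "('g, 'x::{t2_space, second_countable_topology}, 'n) action_orbifold"
    and \<Xi> :: "('k, 'y::{t2_space, second_countable_topology}, 'n) action_orbifold"
    and \<phi> :: "('g, 'x, 'k, 'y, 'q::{t2_space, second_countable_topology}, 'n) bitorsor"
    and \<xi> :: "('g, 'x, 'u) hbundle"
begin

abbreviation "E \<equiv> induced_bundle \<Theta> \<phi> \<xi>"
abbreviation "cl \<equiv> ind_class \<Theta> \<phi> \<xi>"

text \<open>An element of the induced bundle is an orbit of \<open>G\<close> on pairs; because \<open>G\<close> acts freely it is the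
  graph of a function on a fibre of \<open>\<alpha>\<close>, and \<open>rep_at q\<close> evaluates this function at \<open>q\<close>.\<close>

lemma cl_eq: "cl q u = (\<lambda>g. (R g q, rho \<xi> (X.ginv g, \<rho> q) u)) ` X.G"
proof -
  have "cl q u = (\<lambda>g. (R (X.ginv g) q, rho \<xi> (g, \<rho> q) u)) ` X.G"
    unfolding ind_class_def X.arrows_from_eq image_image by (rule image_cong) (auto simp: R_def)
  also have "\<dots> = (\<lambda>g. (R g q, rho \<xi> (X.ginv g, \<rho> q) u)) ` X.G"
  proof -
    have "g \<in> X.ginv ` X.G" if "g \<in> X.G" for g
      using that by (intro image_eqI[of _ _ "X.ginv g"]) auto
    then have "X.G = X.ginv ` X.G" by auto
    then have "(\<lambda>g. (R g q, rho \<xi> (X.ginv g, \<rho> q) u)) ` X.G =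
        (\<lambda>g. (R g q, rho \<xi> (X.ginv g, \<rho> q) u)) ` (X.ginv ` X.G)" by simp
    also have "\<dots> = (\<lambda>g. (R (X.ginv g) q, rho \<xi> (g, \<rho> q) u)) ` X.G"
      unfolding image_image by (rule image_cong) auto
    finally show ?thesis by simp
  qed
  finally show ?thesis .
qed

lemma cl_R:
  assumes g: "g \<in> X.G" and u: "u \<in> fibre \<xi> (\<rho> q)"
  shows "cl (R g q) (rho \<xi> (X.ginv g, \<rho> q) u) = cl q u"
proof -
  have "cl (R g q) (rho \<xi> (X.ginv g, \<rho> q) u) = (\<lambda>h. (R (X.gmul g h) q, rho \<xi> (X.ginv (X.gmul g h), \<rho> q) u)) ` X.G"
    unfolding cl_eq
  proof (rule image_cong[OF refl])
    fix h assume h: "h \<in> X.G"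
    show "(R h (R g q), rho \<xi> (X.ginv h, \<rho> (R g q)) (rho \<xi> (X.ginv g, \<rho> q) u)) =
        (R (X.gmul g h) q, rho \<xi> (X.ginv (X.gmul g h), \<rho> q) u)"
      using g h X.rho_comp[of "X.ginv g" u "\<rho> q" "X.ginv h"] u by (simp add: R_R X.grp.inv_mult_group)
  qed
  also have "\<dots> = (\<lambda>g. (R g q, rho \<xi> (X.ginv g, \<rho> q) u)) ` ((\<lambda>h. X.gmul g h) ` X.G)"
    by (simp add: image_image)
  also have "(\<lambda>h. X.gmul g h) ` X.G = X.G"
  proof
    show "X.G \<subseteq> (\<lambda>h. X.gmul g h) ` X.G"
    proof
      fix h assume h: "h \<in> X.G"
      then have "h = X.gmul g (X.gmul (X.ginv g) h)" using g by (simp add: X.grp.m_assoc[symmetric])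
      then show "h \<in> (\<lambda>h. X.gmul g h) ` X.G" using g h by blast
    qed
  qed (use g in auto)
  finally show ?thesis unfolding cl_eq .
qed

lemma rep_cl_R:
  assumes g: "g \<in> X.G" shows "rep_at (R g q) (cl q u) = rho \<xi> (X.ginv g, \<rho> q) u"
  unfolding rep_at_def
proof (rule the_equality)
  show "(R g q, rho \<xi> (X.ginv g, \<rho> q) u) \<in> cl q u" unfolding cl_eq using g by blast
  fix v assume "(R g q, v) \<in> cl q u"
  then obtain h where "h \<in> X.G" "R g q = R h q" "v = rho \<xi> (X.ginv h, \<rho> q) u" unfolding cl_eq by blast
  then show "v = rho \<xi> (X.ginv g, \<rho> q) u" using R_free[OF g] by blast
qed

lemma rep_cl [simp]: "u \<in> fibre \<xi> (\<rho> q) \<Longrightarrow> rep_at q (cl q u) = u"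
  using rep_cl_R[of X.gone q u] X.rho_one[OF X.grp.one_closed] by simp

lemma proj_cl [simp]: "ind_proj \<phi> (cl q u) = \<alpha> q"
proof -
  have "(SOME p. p \<in> cl q u) \<in> cl q u"
    by (rule someI[of _ "(R X.gone q, rho \<xi> (X.ginv X.gone, \<rho> q) u)"]) (unfold cl_eq, blast intro: X.grp.one_closed)
  then show ?thesis unfolding ind_proj_def cl_eq by auto
qed

lemma E_simps:
  "tot E = {cl q u | q u. u \<in> fibre \<xi> (\<rho> q)}" "proj E = ind_proj \<phi>"
  "vadd E z z' = cl (over \<phi> (ind_proj \<phi> z)) (vadd \<xi> (rep_at (over \<phi> (ind_proj \<phi> z)) z) (rep_at (over \<phi> (ind_proj \<phi> z)) z'))"
  "vzero E y = cl (over \<phi> y) (vzero \<xi> (\<rho> (over \<phi> y)))"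
  "vscale E c z = cl (over \<phi> (ind_proj \<phi> z)) (vscale \<xi> c (rep_at (over \<phi> (ind_proj \<phi> z)) z))"
  "rho E \<tau> z = cl (lact \<phi> \<tau> (over \<phi> (src \<tau>))) (rep_at (over \<phi> (src \<tau>)) z)"
  "herm E z z' = herm \<xi> (rep_at (over \<phi> (ind_proj \<phi> z)) z) (rep_at (over \<phi> (ind_proj \<phi> z)) z')"
  by (simp_all add: induced_bundle_def Let_def)

lemma over_\<alpha> [simp]: "\<alpha> (over \<phi> y) = y"
proof -
  obtain q where "\<alpha> q = y" by (rule obtain_\<alpha>)
  then show ?thesis unfolding over_def by (rule someI)
qed

lemma cl_in: "u \<in> fibre \<xi> (\<rho> q) \<Longrightarrow> cl q u \<in> fibre E (\<alpha> q)"
  unfolding fibre_def[of E] E_simps by auto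

lemma fibre_E:
  assumes "z \<in> fibre E (\<alpha> q)" shows "\<exists>u\<in>fibre \<xi> (\<rho> q). z = cl q u"
proof -
  obtain q' u where z: "z = cl q' u" "u \<in> fibre \<xi> (\<rho> q')" "\<alpha> q' = \<alpha> q"
    using assms unfolding fibre_def[of E] E_simps by auto
  obtain g where g: "g \<in> X.G" "q = R g q'" by (rule R_transitive[OF z(3)])
  have "rho \<xi> (X.ginv g, \<rho> q') u \<in> fibre \<xi> (\<rho> q)" using g z(2) by simp
  then show ?thesis using cl_R[OF g(1) z(2)] g(2) z(1) by auto
qed

lemma
  assumes "z \<in> fibre E (\<alpha> q)"
  shows rep_in [simp]: "rep_at q z \<in> fibre \<xi> (\<rho> q)"
    and cl_rep: "cl q (rep_at q z) = z"
    and rep_R: "g \<in> X.G \<Longrightarrow> rep_at (R g q) z = rho \<xi> (X.ginv g, \<rho> q) (rep_at q z)"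
    and proj_E: "ind_proj \<phi> z = \<alpha> q"
  using fibre_E[OF assms] by (auto simp: rep_cl_R)

lemma rep_eqI: "z \<in> fibre E (\<alpha> q) \<Longrightarrow> z' \<in> fibre E (\<alpha> q) \<Longrightarrow> rep_at q z = rep_at q z' \<Longrightarrow> z = z'"
  using cl_rep by metis

lemma over_R: obtains g where "g \<in> X.G" "q = R g (over \<phi> (\<alpha> q))"
  by (rule R_transitive[of "over \<phi> (\<alpha> q)" q]) auto

lemma
  assumes z: "z \<in> fibre E (\<alpha> q)"
  shows vadd_E: "z' \<in> fibre E (\<alpha> q) \<Longrightarrow> vadd E z z' \<in> fibre E (\<alpha> q) \<and>
      rep_at q (vadd E z z') = vadd \<xi> (rep_at q z) (rep_at q z')"
    and vscale_E: "vscale E c z \<in> fibre E (\<alpha> q) \<and> rep_at q (vscale E c z) = vscale \<xi> c (rep_at q z)"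
    and herm_E: "z' \<in> fibre E (\<alpha> q) \<Longrightarrow> herm E z z' = herm \<xi> (rep_at q z) (rep_at q z')"
    and rho_E: "k \<in> Y.G \<Longrightarrow> rho E (k, \<alpha> q) z \<in> fibre E (act \<Xi> k (\<alpha> q)) \<and>
      rep_at (L k q) (rho E (k, \<alpha> q) z) = rep_at q z"
proof -
  let ?o = "over \<phi> (\<alpha> q)"
  obtain g where g: "g \<in> X.G" "q = R g ?o" by (rule over_R)
  have gi: "X.ginv g \<in> X.G" using g by simp
  have zo: "z \<in> fibre E (\<alpha> ?o)" using z by simp
  note p = proj_E[OF z]
  have r: "rep_at q w = rho \<xi> (X.ginv g, \<rho> ?o) (rep_at ?o w)" if "w \<in> fibre E (\<alpha> q)" for w
    using rep_R[of w ?o g] that g by simp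
  show "vscale E c z \<in> fibre E (\<alpha> q) \<and> rep_at q (vscale E c z) = vscale \<xi> c (rep_at q z)"
  proof
    show 1: "vscale E c z \<in> fibre E (\<alpha> q)"
      unfolding E_simps p using cl_in[of "vscale \<xi> c (rep_at ?o z)" ?o] rep_in[OF zo] by simp
    have "rep_at ?o (vscale E c z) = vscale \<xi> c (rep_at ?o z)"
      unfolding E_simps p using rep_in[OF zo] by simp
    then show "rep_at q (vscale E c z) = vscale \<xi> c (rep_at q z)"
      using r[OF 1] r[OF z] X.rho_scale[OF gi rep_in[OF zo]] by simp
  qed
  show "rho E (k, \<alpha> q) z \<in> fibre E (act \<Xi> k (\<alpha> q)) \<and> rep_at (L k q) (rho E (k, \<alpha> q) z) = rep_at q z"
    if k: "k \<in> Y.G"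
  proof -
    have e: "rho E (k, \<alpha> q) z = cl (L k ?o) (rep_at ?o z)" unfolding E_simps L_def by (simp add: src_def)
    have u: "rep_at ?o z \<in> fibre \<xi> (\<rho> (L k ?o))" using rep_in[OF zo] k by simp
    have f: "cl (L k ?o) (rep_at ?o z) \<in> fibre E (\<alpha> (L k ?o))" using cl_in[OF u] .
    have "L k q = R g (L k ?o)" using L_R[OF k g(1), of ?o] g(2) by simp
    then have "rep_at (L k q) (cl (L k ?o) (rep_at ?o z)) = rho \<xi> (X.ginv g, \<rho> (L k ?o)) (rep_at ?o z)"
      using rep_cl_R[OF g(1)] by simp
    then show ?thesis using e f r[OF z] k by simp
  qed
  assume z': "z' \<in> fibre E (\<alpha> q)"
  then have zo': "z' \<in> fibre E (\<alpha> ?o)" by simp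
  show "vadd E z z' \<in> fibre E (\<alpha> q) \<and> rep_at q (vadd E z z') = vadd \<xi> (rep_at q z) (rep_at q z')"
  proof
    show 1: "vadd E z z' \<in> fibre E (\<alpha> q)"
      unfolding E_simps p using cl_in[of "vadd \<xi> (rep_at ?o z) (rep_at ?o z')" ?o] rep_in[OF zo] rep_in[OF zo'] by simp
    have "rep_at ?o (vadd E z z') = vadd \<xi> (rep_at ?o z) (rep_at ?o z')"
      unfolding E_simps p using rep_in[OF zo] rep_in[OF zo'] by simp
    then show "rep_at q (vadd E z z') = vadd \<xi> (rep_at q z) (rep_at q z')"
      using r[OF 1] r[OF z] r[OF z'] X.rho_add[OF gi rep_in[OF zo] rep_in[OF zo']] by simp
  qed
  show "herm E z z' = herm \<xi> (rep_at q z) (rep_at q z')"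
    unfolding E_simps p using r[OF z] r[OF z'] X.herm_rho[OF gi rep_in[OF zo] rep_in[OF zo']] by simp
qed

lemma vzero_E: "vzero E (\<alpha> q) \<in> fibre E (\<alpha> q) \<and> rep_at q (vzero E (\<alpha> q)) = vzero \<xi> (\<rho> q)"
proof -
  let ?o = "over \<phi> (\<alpha> q)"
  have z: "vzero E (\<alpha> q) \<in> fibre E (\<alpha> q)" unfolding E_simps using cl_in[of "vzero \<xi> (\<rho> ?o)" ?o] by simp
  obtain g where g: "g \<in> X.G" "q = R g ?o" by (rule over_R)
  have "rep_at q (vzero E (\<alpha> q)) = rho \<xi> (X.ginv g, \<rho> ?o) (vscale \<xi> 0 (vzero \<xi> (\<rho> ?o)))"
    unfolding E_simps using rep_cl_R[OF g(1), of ?o] g X.vzero_eq[OF X.vzero_in] by simp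
  also have "\<dots> = vscale \<xi> 0 (rho \<xi> (X.ginv g, \<rho> ?o) (vzero \<xi> (\<rho> ?o)))"
    using X.rho_scale[of "X.ginv g" "vzero \<xi> (\<rho> ?o)"] g by simp
  also have "\<dots> = vzero \<xi> (\<rho> q)"
  proof (rule X.vzero_eq)
    have "\<rho> q = act \<Theta> (X.ginv g) (\<rho> ?o)" using g \<rho>_R[OF g(1), of ?o] by simp
    then show "rho \<xi> (X.ginv g, \<rho> ?o) (vzero \<xi> (\<rho> ?o)) \<in> fibre \<xi> (\<rho> q)" using g by simp
  qed
  finally show ?thesis using z by simp
qed

text \<open>The trivialisation of the induced bundle given by a local section of \<open>\<alpha>\<close> with values in \<open>W\<close>
  and a trivialisation of \<open>\<xi>\<close>.\<close>

definition itriv :: "'q set \<Rightarrow> ('u \<Rightarrow> nat \<Rightarrow> complex) \<Rightarrow> ('q \<times> 'u) set \<Rightarrow> nat \<Rightarrow> complex" where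
  "itriv W \<Phi> z = \<Phi> (rep_at (inv_into W \<alpha> (ind_proj \<phi> z)) z)"

definition triv_data :: "'q set \<Rightarrow> 'x set \<Rightarrow> nat \<Rightarrow> ('u \<Rightarrow> nat \<Rightarrow> complex) \<Rightarrow> bool" where
  "triv_data W U r \<Phi> \<longleftrightarrow> open W \<and> inj_on \<alpha> W \<and> (U, r, \<Phi>) \<in> trivs \<xi> \<and> \<rho> ` W \<subseteq> U"

lemma trivs_E: "trivs E = {(\<alpha> ` W, r, itriv W \<Phi>) | W U r \<Phi>. triv_data W U r \<Phi>}"
  unfolding induced_bundle_def triv_data_def itriv_def[abs_def] by simp

lemma itriv_at: "triv_data W U r \<Phi> \<Longrightarrow> q \<in> W \<Longrightarrow> z \<in> fibre E (\<alpha> q) \<Longrightarrow> itriv W \<Phi> z = \<Phi> (rep_at q z)"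
  unfolding itriv_def triv_data_def by (simp add: proj_E inv_into_f_f)

lemma rep_bij: "bij_betw (rep_at q) (fibre E (\<alpha> q)) (fibre \<xi> (\<rho> q))"
  by (rule bij_betwI[where g = "cl q"]) (auto simp: cl_in cl_rep)

lemma itriv_bij:
  assumes T: "triv_data W U r \<Phi>" and q: "q \<in> W"
  shows "bij_betw (itriv W \<Phi>) (fibre E (\<alpha> q)) (coords r)"
proof -
  have "(U, r, \<Phi>) \<in> trivs \<xi>" "\<rho> q \<in> U" using T q unfolding triv_data_def by auto
  from bij_betw_trans[OF rep_bij X.triv_bij[OF this]]
  show ?thesis by (rule bij_betw_cong[THEN iffD1, rotated]) (simp add: itriv_at[OF T q])
qed

lemma itriv_inverse:
  assumes T: "triv_data W U r \<Phi>" and q: "q \<in> W" and v: "v \<in> coords r"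
  shows "inv_into (fibre E (\<alpha> q)) (itriv W \<Phi>) v \<in> fibre E (\<alpha> q)"
    and "rep_at q (inv_into (fibre E (\<alpha> q)) (itriv W \<Phi>) v) = inv_into (fibre \<xi> (\<rho> q)) \<Phi> v"
proof -
  let ?z = "inv_into (fibre E (\<alpha> q)) (itriv W \<Phi>) v"
  have z: "?z \<in> fibre E (\<alpha> q)" "itriv W \<Phi> ?z = v"
    using itriv_bij[OF T q] v by (auto simp: bij_betw_def inv_into_into f_inv_into_f)
  show "?z \<in> fibre E (\<alpha> q)" by fact
  have "(U, r, \<Phi>) \<in> trivs \<xi>" "\<rho> q \<in> U" using T q unfolding triv_data_def by auto
  note b = X.triv_bij[OF this]
  have "\<Phi> (rep_at q ?z) = v" using z itriv_at[OF T q] by simp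
  then show "rep_at q ?z = inv_into (fibre \<xi> (\<rho> q)) \<Phi> v"
    using bij_betw_inv_into_left[OF b rep_in[OF z(1)]] by simp
qed

lemma triv_data_exists: obtains W U r \<Phi> where "triv_data W U r \<Phi>" "q \<in> W"
proof -
  obtain U r \<Phi> where T: "(U, r, \<Phi>) \<in> trivs \<xi>" "\<rho> q \<in> U" using X.triv_exists by blast
  have o: "open (\<rho> -` U)" using cont_\<rho> X.triv_open[OF T(1)] by (simp add: continuous_on_open_vimage)
  have "q \<in> \<rho> -` U" using T by simp
  from QY.local_diffeo_small[OF diffeo_\<alpha> o this]
  obtain W where "open W" "q \<in> W" "W \<subseteq> \<rho> -` U" "inj_on \<alpha> W" by metis
  then show thesis using that[of W U r \<Phi>] T unfolding triv_data_def by blast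
qed

text \<open>Two local sections of \<open>\<alpha>\<close>, one of them moved by \<open>k\<close>, differ near a point by one element
  \<open>g\<close> of the discrete group \<open>G\<close>; so a change of trivialisation of the induced bundle is locally one
  of \<open>\<xi>\<close> composed with \<open>\<rho>\<close> and a local section.\<close>

lemma induced_transition_smooth:
  assumes k: "k \<in> Y.G" and T: "triv_data W U r \<Phi>" and T': "triv_data W' U' r' \<Phi>'"
    and v: "v \<in> coords r" and i: "i < r'"
  shows "smooth_fun_on (atlas \<Xi>) (\<alpha> ` W \<inter> act \<Xi> k -` (\<alpha> ` W'))
    (\<lambda>y. itriv W' \<Phi>' (rho E (k, y) (inv_into (fibre E y) (itriv W \<Phi>) v)) i)"
proof (rule Y.smooth_fun_on_local)
  have W: "open W" "inj_on \<alpha> W" "(U, r, \<Phi>) \<in> trivs \<xi>" "\<rho> ` W \<subseteq> U"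
    and W': "open W'" "inj_on \<alpha> W'" "(U', r', \<Phi>') \<in> trivs \<xi>" "\<rho> ` W' \<subseteq> U'"
    using T T' unfolding triv_data_def by auto
  fix y0 assume "y0 \<in> \<alpha> ` W \<inter> act \<Xi> k -` (\<alpha> ` W')"
  then obtain q0 q0' where q0: "q0 \<in> W" "y0 = \<alpha> q0" and q0': "q0' \<in> W'" "act \<Xi> k y0 = \<alpha> q0'" by blast
  then have "\<alpha> (L k q0) = \<alpha> q0'" using k by simp
  then obtain g where g: "g \<in> X.G" "q0' = R g (L k q0)" by (rule R_transitive)
  have gi: "X.ginv g \<in> X.G" using g by simp
  let ?N = "W \<inter> (\<lambda>q. R g (L k q)) -` W'"
  have "continuous_on UNIV (\<lambda>q. R g (L k q))"
    by (rule continuous_on_compose2[OF R_cont[OF g(1)] L_cont[OF k]]) simp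
  then have N: "open ?N" using W(1) W'(1) by (simp add: continuous_on_open_vimage open_Int)
  let ?H = "\<lambda>q. \<Phi>' (rho \<xi> (X.ginv g, \<rho> q) (inv_into (fibre \<xi> (\<rho> q)) \<Phi> v)) i"
  note E1 = bspec[OF bspec[OF bspec[OF X.eb_smooth gi] W(3), unfolded case_prod_conv] W'(3), unfolded case_prod_conv]
  have "smooth_fun_on (atlas \<Theta>) (U \<inter> act \<Theta> (X.ginv g) -` U')
      (\<lambda>x. \<Phi>' (rho \<xi> (X.ginv g, x) (inv_into (fibre \<xi> x) \<Phi> v)) i)"
    using bspec[OF E1 v] i by blast
  from QX.local_diffeo_pull_smooth[OF diffeo_\<rho> this]
  have "smooth_fun_on (qatlas \<phi>) ?N ?H"
  proof (rule Q.smooth_fun_on_subset)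
    show "?N \<subseteq> \<rho> -` (U \<inter> act \<Theta> (X.ginv g) -` U')"
    proof
      fix q assume q: "q \<in> ?N"
      then have "\<rho> (R g (L k q)) \<in> U'" "\<rho> q \<in> U" using W(4) W'(4) by auto
      then show "q \<in> \<rho> -` (U \<inter> act \<Theta> (X.ginv g) -` U')" using g k by simp
    qed
  qed
  moreover have injN: "inj_on \<alpha> ?N" using W(2) inj_on_subset by blast
  ultimately have "smooth_fun_on (atlas \<Xi>) (\<alpha> ` ?N) (\<lambda>y. ?H (inv_into ?N \<alpha> y))"
    using QY.local_diffeo_push_smooth[OF diffeo_\<alpha> N] by blast
  then have "smooth_fun_on (atlas \<Xi>) (\<alpha> ` W \<inter> act \<Xi> k -` (\<alpha> ` W') \<inter> \<alpha> ` ?N)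
    (\<lambda>y. itriv W' \<Phi>' (rho E (k, y) (inv_into (fibre E y) (itriv W \<Phi>) v)) i)"
  proof (rule Y.smooth_fun_on_mono_cong)
    fix y assume "y \<in> \<alpha> ` W \<inter> act \<Xi> k -` (\<alpha> ` W') \<inter> \<alpha> ` ?N"
    then obtain q where q: "q \<in> ?N" "y = \<alpha> q" by blast
    let ?z = "inv_into (fibre E (\<alpha> q)) (itriv W \<Phi>) v"
    have qW: "q \<in> W" using q by blast
    note z = itriv_inverse[OF T qW v]
    note rz = rho_E[OF z(1) k]
    have f: "rho E (k, \<alpha> q) ?z \<in> fibre E (\<alpha> (R g (L k q)))" using rz g k by simp
    have "R g (L k q) \<in> W'" using q by blast
    then have "itriv W' \<Phi>' (rho E (k, \<alpha> q) ?z) = \<Phi>' (rep_at (R g (L k q)) (rho E (k, \<alpha> q) ?z))"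
      using f by (rule itriv_at[OF T'])
    also have "rep_at (R g (L k q)) (rho E (k, \<alpha> q) ?z) = rho \<xi> (X.ginv g, \<rho> (L k q)) (rep_at (L k q) (rho E (k, \<alpha> q) ?z))"
      by (rule rep_R) (use rz k g in auto)
    also have "\<dots> = rho \<xi> (X.ginv g, \<rho> q) (inv_into (fibre \<xi> (\<rho> q)) \<Phi> v)"
      using rz z(2) k by simp
    finally show "?H (inv_into ?N \<alpha> y) = itriv W' \<Phi>' (rho E (k, y) (inv_into (fibre E y) (itriv W \<Phi>) v)) i"
      using inv_into_f_f[OF injN q(1)] q(2) by simp
  qed blast
  moreover have "y0 \<in> \<alpha> ` ?N" using q0 q0' g(2) by blast
  ultimately show "\<exists>N. open N \<and> y0 \<in> N \<and> smooth_fun_on (atlas \<Xi>) (\<alpha> ` W \<inter> act \<Xi> k -` (\<alpha> ` W') \<inter> N)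
    (\<lambda>y. itriv W' \<Phi>' (rho E (k, y) (inv_into (fibre E y) (itriv W \<Phi>) v)) i)"
    using QY.local_diffeo_open_image[OF diffeo_\<alpha> N] by blast
qed

lemma rho_E_one: "z \<in> fibre E (\<alpha> q) \<Longrightarrow> rho E (Y.gone, \<alpha> q) z = z"
  using rho_E[of z q Y.gone] by (intro rep_eqI[of _ q]) auto

lemma rho_E_at:
  assumes z: "z \<in> fibre E (\<alpha> q)" and k: "k \<in> Y.G"
  shows "rho E (k, \<alpha> q) z \<in> fibre E (\<alpha> (L k q))" "rep_at (L k q) (rho E (k, \<alpha> q) z) = rep_at q z"
  using rho_E[OF z k] k by auto

text \<open>For each \<open>q\<close> the map \<open>rep_at q\<close> identifies the fibre of the induced bundle over \<open>\<alpha>(q)\<close> with the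
  fibre of \<open>\<xi>\<close> over \<open>\<rho>(q)\<close>, and with it the algebraic laws carry over; smoothness of the
  transition functions is the case \<open>k = 1\<close> of \<open>induced_transition_smooth\<close>.\<close>

lemma vector_bundle_E: "vector_bundle (atlas \<Xi>) E"
  unfolding vector_bundle_def
proof (intro conjI)
  show "\<forall>y. vzero E y \<in> fibre E y \<and> (\<forall>u\<in>fibre E y. (\<forall>v\<in>fibre E y. vadd E u v \<in> fibre E y) \<and>
      (\<forall>z. vscale E z u \<in> fibre E y))"
  proof
    fix y
    obtain q where "y = \<alpha> q" using obtain_\<alpha> by metis
    then show "vzero E y \<in> fibre E y \<and> (\<forall>u\<in>fibre E y. (\<forall>v\<in>fibre E y. vadd E u v \<in> fibre E y) \<and>
      (\<forall>z. vscale E z u \<in> fibre E y))" using vzero_E vadd_E vscale_E by simp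
  qed
  show "(\<Union>(U, r, \<Phi>)\<in>trivs E. U) = UNIV"
  proof -
    have "y \<in> (\<Union>(U, r, \<Phi>)\<in>trivs E. U)" for y
    proof -
      obtain q where q: "y = \<alpha> q" using obtain_\<alpha> by metis
      obtain W U r \<Phi> where "triv_data W U r \<Phi>" "q \<in> W" by (rule triv_data_exists)
      then have "(\<alpha> ` W, r, itriv W \<Phi>) \<in> trivs E" "y \<in> \<alpha> ` W" unfolding trivs_E q by blast+
      then show ?thesis by blast
    qed
    then show ?thesis by blast
  qed
  show "\<forall>(U, r, \<Phi>)\<in>trivs E. open U \<and>
        (\<forall>x\<in>U. bij_betw \<Phi> (fibre E x) (coords r) \<and> \<Phi> (vzero E x) = (\<lambda>_. 0) \<and>
           (\<forall>u\<in>fibre E x. (\<forall>v\<in>fibre E x. \<Phi> (vadd E u v) = (\<lambda>i. \<Phi> u i + \<Phi> v i)) \<and>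
              (\<forall>z. \<Phi> (vscale E z u) = (\<lambda>i. z * \<Phi> u i))))"
  proof (rule ballI, clarify)
    fix O' r \<Psi> assume "(O', r, \<Psi>) \<in> trivs E"
    then obtain W U \<Phi> where T: "triv_data W U r \<Phi>" and O': "O' = \<alpha> ` W" "\<Psi> = itriv W \<Phi>" unfolding trivs_E by blast
    have W: "open W" "(U, r, \<Phi>) \<in> trivs \<xi>" "\<rho> ` W \<subseteq> U" using T unfolding triv_data_def by auto
    show "open O' \<and> (\<forall>x\<in>O'. bij_betw \<Psi> (fibre E x) (coords r) \<and> \<Psi> (vzero E x) = (\<lambda>_. 0) \<and>
           (\<forall>u\<in>fibre E x. (\<forall>v\<in>fibre E x. \<Psi> (vadd E u v) = (\<lambda>i. \<Psi> u i + \<Psi> v i)) \<and>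
              (\<forall>z. \<Psi> (vscale E z u) = (\<lambda>i. z * \<Psi> u i))))"
      unfolding O'
    proof (intro conjI ballI allI)
      show "open (\<alpha> ` W)" using QY.local_diffeo_open_image[OF diffeo_\<alpha> W(1)] .
      fix y assume "y \<in> \<alpha> ` W"
      then obtain q where q: "q \<in> W" "y = \<alpha> q" by blast
      have \<rho>q: "\<rho> q \<in> U" using q W by blast
      note at = itriv_at[OF T q(1)]
      show "bij_betw (itriv W \<Phi>) (fibre E y) (coords r)" unfolding q by (rule itriv_bij[OF T q(1)])
      show "itriv W \<Phi> (vzero E y) = (\<lambda>_. 0)" unfolding q
        using at vzero_E[of q] X.triv_zero[OF W(2) \<rho>q] by simp
      fix z assume "z \<in> fibre E y"
      then have z: "z \<in> fibre E (\<alpha> q)" using q by simp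
      show "itriv W \<Phi> (vscale E c z) = (\<lambda>i. c * itriv W \<Phi> z i)" for c
        using at vscale_E[OF z, of c] z X.triv_scale[OF W(2) \<rho>q rep_in[OF z]] by simp
      fix z' assume "z' \<in> fibre E y"
      then have z': "z' \<in> fibre E (\<alpha> q)" using q by simp
      show "itriv W \<Phi> (vadd E z z') = (\<lambda>i. itriv W \<Phi> z i + itriv W \<Phi> z' i)"
        using at vadd_E[OF z z'] z z' X.triv_add[OF W(2) \<rho>q rep_in[OF z] rep_in[OF z']] by simp
    qed
  qed
  show "\<forall>(U, r, \<Phi>)\<in>trivs E. \<forall>(U', r', \<Phi>')\<in>trivs E. \<forall>v\<in>coords r. \<forall>i<r'.
        smooth_fun_on (atlas \<Xi>) (U \<inter> U') (\<lambda>x. \<Phi>' (inv_into (fibre E x) \<Phi> v) i)"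
  proof (rule ballI, clarify)
    fix O1 r \<Psi> O2 r' \<Psi>' v i
    assume A: "(O1, r, \<Psi>) \<in> trivs E" "(O2, r', \<Psi>') \<in> trivs E" and v: "v \<in> coords r" and i: "i < r'"
    from A(1) obtain W U \<Phi> where T: "triv_data W U r \<Phi>" and O1: "O1 = \<alpha> ` W" "\<Psi> = itriv W \<Phi>" unfolding trivs_E by blast
    from A(2) obtain W' U' \<Phi>' where T': "triv_data W' U' r' \<Phi>'" and O2: "O2 = \<alpha> ` W'" "\<Psi>' = itriv W' \<Phi>'" unfolding trivs_E by blast
    have "smooth_fun_on (atlas \<Xi>) (\<alpha> ` W \<inter> \<alpha> ` W')
        (\<lambda>y. itriv W' \<Phi>' (inv_into (fibre E y) (itriv W \<Phi>) v) i)"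
    proof (rule Y.smooth_fun_on_mono_cong[OF induced_transition_smooth[OF Y.grp.one_closed T T' v i]])
      fix y assume "y \<in> \<alpha> ` W \<inter> \<alpha> ` W'"
      then obtain q where q: "q \<in> W" "y = \<alpha> q" by blast
      show "itriv W' \<Phi>' (rho E (Y.gone, y) (inv_into (fibre E y) (itriv W \<Phi>) v)) i =
          itriv W' \<Phi>' (inv_into (fibre E y) (itriv W \<Phi>) v) i"
        using rho_E_one[OF itriv_inverse(1)[OF T q(1) v]] q by simp
    qed auto
    then show "smooth_fun_on (atlas \<Xi>) (O1 \<inter> O2) (\<lambda>x. \<Psi>' (inv_into (fibre E x) \<Psi> v) i)"
      unfolding O1 O2 .
  qed
qed

lemma equivariant_bundle_E: "equivariant_bundle \<Xi> E"
  unfolding equivariant_bundle_def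
proof (intro conjI vector_bundle_E)
  show "\<forall>\<sigma>\<in>arrows \<Xi>. bij_betw (rho E \<sigma>) (fibre E (src \<sigma>)) (fibre E (tgt \<Xi> \<sigma>)) \<and>
        (\<forall>u\<in>fibre E (src \<sigma>).
           (\<forall>v\<in>fibre E (src \<sigma>). rho E \<sigma> (vadd E u v) = vadd E (rho E \<sigma> u) (rho E \<sigma> v)) \<and>
           (\<forall>z. rho E \<sigma> (vscale E z u) = vscale E z (rho E \<sigma> u)) \<and>
           (\<forall>\<tau>\<in>arrows_from \<Xi> (tgt \<Xi> \<sigma>). rho E (comp_arrow \<Xi> \<tau> \<sigma>) u = rho E \<tau> (rho E \<sigma> u)))"
  proof
    fix \<sigma> assume "\<sigma> \<in> arrows \<Xi>"
    then obtain k y where k: "\<sigma> = (k, y)" "k \<in> Y.G" unfolding arrows_def by auto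
    obtain q where q: "y = \<alpha> q" using obtain_\<alpha> by metis
    have t: "act \<Xi> k (\<alpha> q) = \<alpha> (L k q)" using k by simp
    note at = rho_E_at[of _ q k, OF _ k(2)]
    have bij: "bij_betw (rho E (k, \<alpha> q)) (fibre E (\<alpha> q)) (fibre E (\<alpha> (L k q)))"
    proof (rule bij_betwI[where g = "\<lambda>z. cl q (rep_at (L k q) z)"])
      show "rho E (k, \<alpha> q) \<in> fibre E (\<alpha> q) \<rightarrow> fibre E (\<alpha> (L k q))" using at by blast
      have r: "rep_at (L k q) z \<in> fibre \<xi> (\<rho> q)" if "z \<in> fibre E (\<alpha> (L k q))" for z
        using rep_in[OF that] k by simp
      then show "(\<lambda>z. cl q (rep_at (L k q) z)) \<in> fibre E (\<alpha> (L k q)) \<rightarrow> fibre E (\<alpha> q)" using cl_in by blast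
      show "cl q (rep_at (L k q) (rho E (k, \<alpha> q) z)) = z" if "z \<in> fibre E (\<alpha> q)" for z
        using at[OF that] cl_rep[OF that] by simp
      show "rho E (k, \<alpha> q) (cl q (rep_at (L k q) z)) = z" if "z \<in> fibre E (\<alpha> (L k q))" for z
        using at[OF cl_in[OF r[OF that]]] rep_cl[OF r[OF that]] that by (intro rep_eqI[of _ "L k q"]) auto
    qed
    show "bij_betw (rho E \<sigma>) (fibre E (src \<sigma>)) (fibre E (tgt \<Xi> \<sigma>)) \<and>
        (\<forall>u\<in>fibre E (src \<sigma>).
           (\<forall>v\<in>fibre E (src \<sigma>). rho E \<sigma> (vadd E u v) = vadd E (rho E \<sigma> u) (rho E \<sigma> v)) \<and>
           (\<forall>z. rho E \<sigma> (vscale E z u) = vscale E z (rho E \<sigma> u)) \<and>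
           (\<forall>\<tau>\<in>arrows_from \<Xi> (tgt \<Xi> \<sigma>). rho E (comp_arrow \<Xi> \<tau> \<sigma>) u = rho E \<tau> (rho E \<sigma> u)))"
      unfolding k(1) q Y.into_simps(3,4) t
    proof (intro conjI ballI allI bij)
      fix z assume z: "z \<in> fibre E (\<alpha> q)"
      show "rho E (k, \<alpha> q) (vscale E c z) = vscale E c (rho E (k, \<alpha> q) z)" for c
        using at[OF z] at[of "vscale E c z"] vscale_E[OF z, of c] vscale_E[OF at(1)[OF z], of c]
        by (intro rep_eqI[of _ "L k q"]) auto
      show "rho E (k, \<alpha> q) (vadd E z z') = vadd E (rho E (k, \<alpha> q) z) (rho E (k, \<alpha> q) z')"
        if z': "z' \<in> fibre E (\<alpha> q)" for z'
        using at[OF z] at[OF z'] at[of "vadd E z z'"] vadd_E[OF z z'] vadd_E[OF at(1)[OF z] at(1)[OF z']]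
        by (intro rep_eqI[of _ "L k q"]) auto
      fix \<tau> assume "\<tau> \<in> arrows_from \<Xi> (\<alpha> (L k q))"
      then obtain l where l: "l \<in> Y.G" "\<tau> = (l, \<alpha> (L k q))" unfolding Y.arrows_from_eq by blast
      have m: "Y.gmul l k \<in> Y.G" using l k by simp
      have e: "L (Y.gmul l k) q = L l (L k q)" using L_L[OF k(2) l(1)] by simp
      have "rho E (Y.gmul l k, \<alpha> q) z = rho E (l, \<alpha> (L k q)) (rho E (k, \<alpha> q) z)"
        using rho_E_at[OF z m] rho_E_at[OF at(1)[OF z] l(1)] at(2)[OF z] unfolding e
        by (intro rep_eqI[of _ "L l (L k q)"]) simp_all
      then show "rho E (comp_arrow \<Xi> \<tau> (k, \<alpha> q)) z = rho E \<tau> (rho E (k, \<alpha> q) z)"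
        unfolding l(2) comp_arrow_def by simp
    qed
  qed
  show "\<forall>y. \<forall>u\<in>fibre E y. rho E (unit_arrow \<Xi> y) u = u"
  proof (intro allI ballI)
    fix y z assume z: "z \<in> fibre E y"
    obtain q where q: "y = \<alpha> q" using obtain_\<alpha> by metis
    show "rho E (unit_arrow \<Xi> y) z = z" using rho_E_one[of z q] z unfolding unit_arrow_def q by simp
  qed
  show "\<forall>k\<in>Y.G. \<forall>(U, r, \<Phi>)\<in>trivs E. \<forall>(U', r', \<Phi>')\<in>trivs E.
        \<forall>v\<in>coords r. \<forall>i<r'. smooth_fun_on (atlas \<Xi>) (U \<inter> act \<Xi> k -` U')
          (\<lambda>x. \<Phi>' (rho E (k, x) (inv_into (fibre E x) \<Phi> v)) i)"
  proof (rule ballI, rule ballI, clarify)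
    fix k O1 r \<Psi> O2 r' \<Psi>' v i
    assume k: "k \<in> Y.G" and A: "(O1, r, \<Psi>) \<in> trivs E" "(O2, r', \<Psi>') \<in> trivs E" and v: "v \<in> coords r" and i: "i < r'"
    from A(1) obtain W U \<Phi> where T: "triv_data W U r \<Phi>" and O1: "O1 = \<alpha> ` W" "\<Psi> = itriv W \<Phi>" unfolding trivs_E by blast
    from A(2) obtain W' U' \<Phi>' where T': "triv_data W' U' r' \<Phi>'" and O2: "O2 = \<alpha> ` W'" "\<Psi>' = itriv W' \<Phi>'" unfolding trivs_E by blast
    show "smooth_fun_on (atlas \<Xi>) (O1 \<inter> act \<Xi> k -` O2) (\<lambda>x. \<Psi>' (rho E (k, x) (inv_into (fibre E x) \<Psi> v)) i)"
      unfolding O1 O2 by (rule induced_transition_smooth[OF k T T' v i])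
  qed
qed

lemma invariant_hermitian_E: "invariant_hermitian \<Xi> E"
  unfolding invariant_hermitian_def
proof (intro conjI)
  show "\<forall>x. \<forall>u\<in>fibre E x. \<forall>w\<in>fibre E x.
        (\<forall>v\<in>fibre E x. herm E (vadd E u v) w = herm E u w + herm E v w) \<and>
        (\<forall>z. herm E (vscale E z u) w = z * herm E u w) \<and> herm E w u = cnj (herm E u w)"
  proof (intro allI ballI)
    fix y u w assume uw: "u \<in> fibre E y" "w \<in> fibre E y"
    obtain q where q: "y = \<alpha> q" using obtain_\<alpha> by metis
    note u = uw(1)[unfolded q] and w = uw(2)[unfolded q]
    have "herm E (vadd E u v) w = herm E u w + herm E v w" if v: "v \<in> fibre E (\<alpha> q)" for v
      using vadd_E[OF u v] herm_E[of "vadd E u v" q w] herm_E[OF u w] herm_E[OF v w] w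
        X.herm_add[OF rep_in[OF u] rep_in[OF w] rep_in[OF v]] by simp
    moreover have "herm E (vscale E c u) w = c * herm E u w" for c
      using vscale_E[OF u] herm_E[of "vscale E c u" q w] herm_E[OF u w] w
        X.herm_scale[OF rep_in[OF u] rep_in[OF w]] by simp
    moreover have "herm E w u = cnj (herm E u w)"
      using herm_E[OF w u] herm_E[OF u w] X.herm_commute[OF rep_in[OF u] rep_in[OF w]] by simp
    ultimately show "(\<forall>v\<in>fibre E y. herm E (vadd E u v) w = herm E u w + herm E v w) \<and>
        (\<forall>z. herm E (vscale E z u) w = z * herm E u w) \<and> herm E w u = cnj (herm E u w)"
      unfolding q by blast
  qed
  show "\<forall>x. \<forall>u\<in>fibre E x. u \<noteq> vzero E x \<longrightarrow> Re (herm E u u) > 0"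
  proof (intro allI ballI impI)
    fix y u assume u': "u \<in> fibre E y" "u \<noteq> vzero E y"
    obtain q where q: "y = \<alpha> q" using obtain_\<alpha> by metis
    note u = u'(1)[unfolded q]
    have "rep_at q u \<noteq> vzero \<xi> (\<rho> q)" using rep_eqI[OF u, of "vzero E (\<alpha> q)"] vzero_E[of q] u'(2) q by auto
    then have "Re (herm \<xi> (rep_at q u) (rep_at q u)) > 0"
      using bspec[OF spec[OF X.ih_pos] rep_in[OF u]] by blast
    then show "Re (herm E u u) > 0" using herm_E[OF u u] by simp
  qed
  show "\<forall>(U, r, \<Phi>)\<in>trivs E. \<forall>v\<in>coords r. \<forall>w\<in>coords r. smooth_fun_on (atlas \<Xi>) U
        (\<lambda>x. herm E (inv_into (fibre E x) \<Phi> v) (inv_into (fibre E x) \<Phi> w))"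
  proof (rule ballI, clarify)
    fix O1 r \<Psi> v w assume A: "(O1, r, \<Psi>) \<in> trivs E" and v: "v \<in> coords r" and w: "w \<in> coords r"
    from A obtain W U \<Phi> where T: "triv_data W U r \<Phi>" and O1: "O1 = \<alpha> ` W" "\<Psi> = itriv W \<Phi>" unfolding trivs_E by blast
    have W: "open W" "inj_on \<alpha> W" "(U, r, \<Phi>) \<in> trivs \<xi>" "\<rho> ` W \<subseteq> U" using T unfolding triv_data_def by auto
    let ?h = "\<lambda>x. herm \<xi> (inv_into (fibre \<xi> x) \<Phi> v) (inv_into (fibre \<xi> x) \<Phi> w)"
    have "smooth_fun_on (atlas \<Theta>) U ?h"
      using bspec[OF bspec[OF bspec[OF X.ih_smooth W(3), unfolded case_prod_conv] v] w] .
    from Q.smooth_fun_on_subset[OF QX.local_diffeo_pull_smooth[OF diffeo_\<rho> this]] W(4)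
    have "smooth_fun_on (qatlas \<phi>) W (\<lambda>q. ?h (\<rho> q))" by blast
    from QY.local_diffeo_push_smooth[OF diffeo_\<alpha> W(1,2) this]
    have "smooth_fun_on (atlas \<Xi>) (\<alpha> ` W) (\<lambda>y. ?h (\<rho> (inv_into W \<alpha> y)))" .
    then show "smooth_fun_on (atlas \<Xi>) O1 (\<lambda>x. herm E (inv_into (fibre E x) \<Psi> v) (inv_into (fibre E x) \<Psi> w))"
      unfolding O1
    proof (rule Y.smooth_fun_on_cong)
      fix y assume "y \<in> \<alpha> ` W"
      then obtain q where q: "q \<in> W" "y = \<alpha> q" by blast
      show "?h (\<rho> (inv_into W \<alpha> y)) =
          herm E (inv_into (fibre E y) (itriv W \<Phi>) v) (inv_into (fibre E y) (itriv W \<Phi>) w)"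
        using herm_E[OF itriv_inverse(1)[OF T q(1) v] itriv_inverse(1)[OF T q(1) w]]
          itriv_inverse(2)[OF T q(1) v] itriv_inverse(2)[OF T q(1) w] inv_into_f_f[OF W(2) q(1)] q(2) by simp
    qed
  qed
  show "\<forall>\<sigma>\<in>arrows \<Xi>. \<forall>u\<in>fibre E (src \<sigma>). \<forall>v\<in>fibre E (src \<sigma>). herm E (rho E \<sigma> u) (rho E \<sigma> v) = herm E u v"
  proof (intro ballI)
    fix \<sigma> u v assume \<sigma>: "\<sigma> \<in> arrows \<Xi>" and uv: "u \<in> fibre E (src \<sigma>)" "v \<in> fibre E (src \<sigma>)"
    obtain k y where k: "\<sigma> = (k, y)" "k \<in> Y.G" using \<sigma> unfolding arrows_def by auto
    obtain q where q: "y = \<alpha> q" using obtain_\<alpha> by metis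
    have u: "u \<in> fibre E (\<alpha> q)" and v: "v \<in> fibre E (\<alpha> q)" using uv unfolding k q by simp_all
    show "herm E (rho E \<sigma> u) (rho E \<sigma> v) = herm E u v"
      unfolding k q
      using herm_E[OF rho_E_at(1)[OF u k(2)] rho_E_at(1)[OF v k(2)]] herm_E[OF u v]
        rho_E_at(2)[OF u k(2)] rho_E_at(2)[OF v k(2)] by simp
  qed
qed

sublocale E: ebundle V \<Xi> E
  using equivariant_bundle_E invariant_hermitian_E by unfold_locales

text \<open>A trivialisation of the induced bundle composed with \<open>\<alpha>\<close> is one of \<open>\<xi>\<close> composed with \<open>\<rho>\<close>, as \<open>\<alpha>\<close>
  is a local diffeomorphism: sections over \<open>Y\<close> and their families of representatives on \<open>Q\<close> are
  smooth together.\<close>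

lemma induced_section_smooth:
  assumes \<eta>: "\<eta> \<in> sections (atlas \<Xi>) E" and T: "(U, r, \<Phi>) \<in> trivs \<xi>" "i < r"
  shows "smooth_fun_on (qatlas \<phi>) (\<rho> -` U) (\<lambda>q. \<Phi> (rep_at q (\<eta> (\<alpha> q))) i)"
proof (rule Q.smooth_fun_on_local)
  fix q0 assume q0: "q0 \<in> \<rho> -` U"
  have o: "open (\<rho> -` U)" using cont_\<rho> X.triv_open[OF T(1)] by (simp add: continuous_on_open_vimage)
  from QY.local_diffeo_small[OF diffeo_\<alpha> o q0]
  obtain W where W: "open W" "q0 \<in> W" "W \<subseteq> \<rho> -` U" "inj_on \<alpha> W" by metis
  then have TD: "triv_data W U r \<Phi>" using T unfolding triv_data_def by blast
  then have "(\<alpha> ` W, r, itriv W \<Phi>) \<in> trivs E" unfolding trivs_E by blast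
  from QY.local_diffeo_pull_smooth[OF diffeo_\<alpha> E.section_smooth[OF \<eta> this T(2)]]
  have "smooth_fun_on (qatlas \<phi>) (\<rho> -` U \<inter> W) (\<lambda>q. \<Phi> (rep_at q (\<eta> (\<alpha> q))) i)"
  proof (rule Q.smooth_fun_on_mono_cong)
    fix q assume "q \<in> \<rho> -` U \<inter> W"
    then show "itriv W \<Phi> (\<eta> (\<alpha> q)) i = \<Phi> (rep_at q (\<eta> (\<alpha> q))) i"
      using itriv_at[OF TD, of q "\<eta> (\<alpha> q)"] E.section_in[OF \<eta>, of "\<alpha> q"] by simp
  qed blast
  then show "\<exists>N. open N \<and> q0 \<in> N \<and> smooth_fun_on (qatlas \<phi>) (\<rho> -` U \<inter> N) (\<lambda>q. \<Phi> (rep_at q (\<eta> (\<alpha> q))) i)"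
    using W by blast
qed

lemma induced_sectionI:
  assumes \<eta>: "\<And>y. \<eta> y \<in> fibre E y"
    and sm: "\<And>U r \<Phi> i. (U, r, \<Phi>) \<in> trivs \<xi> \<Longrightarrow> i < r \<Longrightarrow>
      smooth_fun_on (qatlas \<phi>) (\<rho> -` U) (\<lambda>q. \<Phi> (rep_at q (\<eta> (\<alpha> q))) i)"
  shows "\<eta> \<in> sections (atlas \<Xi>) E"
proof (rule E.sectionI[OF \<eta>])
  fix O1 r \<Psi> i assume A: "(O1, r, \<Psi>) \<in> trivs E" and i: "i < r"
  from A obtain W U \<Phi> where T: "triv_data W U r \<Phi>" and O1: "O1 = \<alpha> ` W" "\<Psi> = itriv W \<Phi>" unfolding trivs_E by blast
  have W: "open W" "inj_on \<alpha> W" "(U, r, \<Phi>) \<in> trivs \<xi>" "\<rho> ` W \<subseteq> U" using T unfolding triv_data_def by auto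
  have "smooth_fun_on (qatlas \<phi>) W (\<lambda>q. \<Phi> (rep_at q (\<eta> (\<alpha> q))) i)"
    using Q.smooth_fun_on_subset[OF sm[OF W(3) i]] W(4) by blast
  from QY.local_diffeo_push_smooth[OF diffeo_\<alpha> W(1,2) this]
  show "smooth_fun_on (atlas \<Xi>) O1 (\<lambda>y. \<Psi> (\<eta> y) i)"
    unfolding O1
  proof (rule Y.smooth_fun_on_cong)
    fix y assume "y \<in> \<alpha> ` W"
    then obtain q where q: "q \<in> W" "y = \<alpha> q" by blast
    then show "\<Phi> (rep_at (inv_into W \<alpha> y) (\<eta> (\<alpha> (inv_into W \<alpha> y)))) i = itriv W \<Phi> (\<eta> y) i"
      using itriv_at[OF T q(1), of "\<eta> y"] \<eta>[of y] inv_into_f_f[OF W(2) q(1)] by simp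
  qed
qed

end

section \<open>The induced volume form\<close>

definition smooth_near ::
  "('x::topological_space, 'n::finite) chart set \<Rightarrow> ('y::topological_space, 'n) chart set \<Rightarrow> ('x \<Rightarrow> 'y) \<Rightarrow> 'x \<Rightarrow> bool" where
  "smooth_near A B F x \<longleftrightarrow> (\<exists>U. open U \<and> x \<in> U \<and> smooth_map_on A B U F)"

lemma smooth_near_UNIV: "smooth_map_on A B UNIV F \<Longrightarrow> smooth_near A B F x"
  unfolding smooth_near_def by blast

lemma smooth_near_local_diffeo: "local_diffeo A B F \<Longrightarrow> smooth_near A B F x"
  unfolding smooth_near_def local_diffeo_def by meson

lemma jacobian_chain_near:
  assumes "two_manifolds V A B" "two_manifolds V B E" "smooth_near A B F x" "smooth_near B E G (F x)"
    and "C \<in> A" "x \<in> fst C" "D \<in> B" "F x \<in> fst D" "H \<in> E" "G (F x) \<in> fst H"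
  shows "jacobian V (in_charts C H (\<lambda>x. G (F x))) (snd C x) =
    jacobian V (in_charts C D F) (snd C x) * jacobian V (in_charts D H G) (snd D (F x))"
proof -
  obtain U where U: "open U" "x \<in> U" "smooth_map_on A B U F" using assms(3) unfolding smooth_near_def by blast
  obtain W where W: "open W" "F x \<in> W" "smooth_map_on B E W G" using assms(4) unfolding smooth_near_def by blast
  show ?thesis by (rule jacobian_chain[OF assms(1,2) U(3,1,2) W(3,1,2) assms(5-10)])
qed

lemma (in two_manifolds) jacobian_nonzero:
  assumes F: "local_diffeo A B F" and C: "C \<in> A" "x \<in> fst C" and D: "D \<in> B" "F x \<in> fst D"
  shows "jacobian V (in_charts C D F) (snd C x) \<noteq> 0"
proof -
  interpret BA: two_manifolds V B A ..
  interpret AA: two_manifolds V A A ..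
  obtain U where U: "open U" "x \<in> U" "inj_on F U" "open (F ` U)" "smooth_map_on A B U F"
    "smooth_map_on B A (F ` U) (inv_into U F)" using local_diffeoE[OF F] .
  have ix: "inv_into U F (F x) = x" using U by simp
  have "jacobian V (in_charts C C (\<lambda>x. inv_into U F (F x))) (snd C x) =
      jacobian V (in_charts C D F) (snd C x) * jacobian V (in_charts D C (inv_into U F)) (snd D (F x))"
    by (rule jacobian_chain[OF two_manifolds_axioms BA.two_manifolds_axioms U(5,1,2) U(6,4)])
      (use C D U(2) ix in auto)
  moreover have "jacobian V (in_charts C C (\<lambda>x. x)) (snd C x) =
      jacobian V (in_charts C C (\<lambda>x. inv_into U F (F x))) (snd C x)"
    by (rule AA.jacobian_cong[OF MA.smooth_map_on_id U(1,2)]) (use U(3) C in auto)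
  ultimately show ?thesis using MA.jacobian_id[OF C] by auto
qed

lemma (in two_manifolds) pullback_smooth:
  assumes F: "smooth_map_on A B U F" "open U" and C: "C \<in> A" and D: "D \<in> B"
    and w: "smooth_on (snd D ` fst D) (\<lambda>z. \<omega> D (chart_inv D z))"
  shows "smooth_on (snd C ` (fst C \<inter> (U \<inter> F -` fst D)))
    (\<lambda>z. jacobian V (in_charts C D F) z * (\<omega> D (F (chart_inv C z)) :: real))"
proof -
  have "smooth_on (snd C ` (fst C \<inter> U \<inter> F -` fst D)) (\<lambda>z. \<omega> D (chart_inv D (in_charts C D F z)))"
    by (rule smooth_on_comp[OF smooth_map_onD[OF F(1) C D] w])
      (auto simp: in_charts_def MA.chart_inv_left[OF C])
  then have "smooth_on (snd C ` (fst C \<inter> U \<inter> F -` fst D)) (\<lambda>z. \<omega> D (F (chart_inv C z)))"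
    by (rule smooth_on_cong) (auto simp: in_charts_def MA.chart_inv_left[OF C] MB.chart_inv_left[OF D])
  from smooth_on_mult[OF jacobian_smooth[OF F C D] this] show ?thesis by (simp add: Int_assoc)
qed

lemma (in manifold) chart_smooth_local:
  assumes C: "C \<in> A"
    and loc: "\<And>x. x \<in> fst C \<Longrightarrow> \<exists>N h. open N \<and> x \<in> N \<and> smooth_on (snd C ` (fst C \<inter> N)) h \<and>
      (\<forall>y\<in>fst C \<inter> N. h (snd C y) = f y)"
  shows "smooth_on (snd C ` fst C) (\<lambda>z. f (chart_inv C z))"
proof (rule smooth_on_local)
  fix z assume "z \<in> snd C ` fst C"
  then obtain x where x: "x \<in> fst C" "z = snd C x" by blast
  obtain N h where N: "open N" "x \<in> N" "smooth_on (snd C ` (fst C \<inter> N)) h"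
    "\<forall>y\<in>fst C \<inter> N. h (snd C y) = f y" using loc[OF x(1)] by blast
  obtain Ob where Ob: "open Ob" "snd C ` (fst C \<inter> N) = V \<inter> Ob" using chart_image_open_nbhd[OF C N(1)] .
  have "smooth_on (snd C ` (fst C \<inter> N)) (\<lambda>z. f (chart_inv C z))"
    by (rule smooth_on_cong[OF N(3)]) (use N(4) chart_inv_left[OF C] in auto)
  then have "smooth_on (snd C ` fst C \<inter> Ob) (\<lambda>z. f (chart_inv C z))"
    by (rule smooth_on_subset) (use Ob(2) chart_in_model[OF C] in auto)
  moreover have "z \<in> Ob" using x N(2) Ob(2) by blast
  ultimately show "\<exists>N. open N \<and> z \<in> N \<and> smooth_on (snd C ` fst C \<inter> N) (\<lambda>z. f (chart_inv C z))"
    using Ob(1) by blast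
qed

lemma volume_form_cont:
  "volume_form V A \<omega> \<Longrightarrow> C \<in> A \<Longrightarrow> continuous_on (snd C ` fst C) (\<lambda>z. \<omega> C (chart_inv C z))"
  unfolding volume_form_def by (blast intro: smooth_on_continuous)

locale morita_form = morita V \<Theta> \<Xi> \<phi>
  for V :: "(real^'n::{finite,wellorder}) set"
    and \<Theta> :: "('g, 'x::{t2_space, second_countable_topology}, 'n) action_orbifold"
    and \<Xi> :: "('k, 'y::{t2_space, second_countable_topology}, 'n) action_orbifold"
    and \<phi> :: "('g, 'x, 'k, 'y, 'q::{t2_space, second_countable_topology}, 'n) bitorsor" +
  fixes \<nu> :: "('x, 'n) top_form"
  assumes vol: "volume_form V (atlas \<Theta>) \<nu>"
    and form_inv: "\<And>h. h \<in> X.G \<Longrightarrow> pullback_form V (atlas \<Theta>) (atlas \<Theta>) (act \<Theta> h) \<nu> \<nu>"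
begin

abbreviation "QA \<equiv> qatlas \<phi>"
abbreviation "XA \<equiv> atlas \<Theta>"
abbreviation "YA \<equiv> atlas \<Xi>"

lemma tm: "two_manifolds V QA XA" "two_manifolds V QA YA" "two_manifolds V QA QA"
    "two_manifolds V XA XA" "two_manifolds V YA YA" "two_manifolds V YA QA" "two_manifolds V YA XA"
  by (unfold_locales)

lemma near: "smooth_near QA XA \<rho> q" "smooth_near QA YA \<alpha> q"
    "g \<in> X.G \<Longrightarrow> smooth_near QA QA (R g) q" "g \<in> X.G \<Longrightarrow> smooth_near XA XA (act \<Theta> g) x"
    "smooth_near YA YA (\<lambda>y. y) y" "smooth_near XA XA (\<lambda>x. x) x"
  using smooth_near_local_diffeo diffeo_\<rho> diffeo_\<alpha> smooth_near_UNIV R_smooth X.act_smooth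
    Y.smooth_map_on_id X.smooth_map_on_id by blast+

lemma form_pull: "h \<in> X.G \<Longrightarrow> C \<in> XA \<Longrightarrow> D \<in> XA \<Longrightarrow> x \<in> fst C \<Longrightarrow> act \<Theta> h x \<in> fst D \<Longrightarrow>
    \<nu> C x = jacobian V (in_charts C D (act \<Theta> h)) (snd C x) * \<nu> D (act \<Theta> h x)"
  using form_inv unfolding pullback_form_def by blast

lemma form_nonzero: "C \<in> XA \<Longrightarrow> x \<in> fst C \<Longrightarrow> \<nu> C x \<noteq> 0"
  and form_smooth: "C \<in> XA \<Longrightarrow> smooth_on (snd C ` fst C) (\<lambda>z. \<nu> C (chart_inv C z))"
  using vol unfolding volume_form_def by blast+

lemma form_id: "pullback_form V XA XA id \<nu> \<nu>"
  using vol unfolding volume_form_def by blast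

lemma form_transf: "C \<in> XA \<Longrightarrow> D \<in> XA \<Longrightarrow> x \<in> fst C \<Longrightarrow> x \<in> fst D \<Longrightarrow>
    \<nu> C x = jacobian V (in_charts C D (\<lambda>x. x)) (snd C x) * \<nu> D x"
  using form_id unfolding pullback_form_def id_def by blast

text \<open>The pullback \<open>\<rho>\<^sup>*\<nu>\<close>, computed with some chart around \<open>\<rho>(q)\<close>; by the transformation law of \<open>\<nu>\<close> every
  other chart gives the same value.\<close>

definition qform :: "('q, 'n) top_form" where
  "qform E q = (let C = (SOME C. C \<in> XA \<and> \<rho> q \<in> fst C) in
     jacobian V (in_charts E C \<rho>) (snd E q) * \<nu> C (\<rho> q))"

lemma qform_eq:
  assumes E: "E \<in> QA" "q \<in> fst E" and C: "C \<in> XA" "\<rho> q \<in> fst C"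
  shows "qform E q = jacobian V (in_charts E C \<rho>) (snd E q) * \<nu> C (\<rho> q)"
proof -
  define D where "D = (SOME C. C \<in> XA \<and> \<rho> q \<in> fst C)"
  have D: "D \<in> XA" "\<rho> q \<in> fst D" unfolding D_def using C by (metis (mono_tags, lifting) someI)+
  have "jacobian V (in_charts E C (\<lambda>q. (\<lambda>x. x) (\<rho> q))) (snd E q) =
      jacobian V (in_charts E D \<rho>) (snd E q) * jacobian V (in_charts D C (\<lambda>x. x)) (snd D (\<rho> q))"
    by (rule jacobian_chain_near[OF tm(1,4) near(1) near(6) E D C])
  then show ?thesis
    using form_transf[OF D(1) C(1) D(2) C(2)] unfolding qform_def D_def[symmetric] by simp
qed

text \<open>From \<open>\<rho>(q \<cdot> g) = g\<^sup>-\<^sup>1 \<rho>(q)\<close> and invariance of \<open>\<nu>\<close>: the pullback \<open>\<rho>\<^sup>*\<nu>\<close> is invariant under \<open>G\<close>.\<close>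

lemma qform_R:
  assumes g: "g \<in> X.G" and E: "E \<in> QA" "q \<in> fst E" and E': "E' \<in> QA" "R g q \<in> fst E'"
  shows "qform E q = jacobian V (in_charts E E' (R g)) (snd E q) * qform E' (R g q)"
proof -
  have gi: "X.ginv g \<in> X.G" using g by simp
  obtain C where C: "C \<in> XA" "\<rho> q \<in> fst C" using X.chart_exists .
  obtain C' where C': "C' \<in> XA" "\<rho> (R g q) \<in> fst C'" using X.chart_exists .
  have C'': "act \<Theta> (X.ginv g) (\<rho> q) \<in> fst C'" using C' g by simp
  have 1: "jacobian V (in_charts E C' (\<lambda>q. \<rho> (R g q))) (snd E q) =
      jacobian V (in_charts E E' (R g)) (snd E q) * jacobian V (in_charts E' C' \<rho>) (snd E' (R g q))"
    by (rule jacobian_chain_near[OF tm(3,1) near(3)[OF g] near(1) E E' C'])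
  have 2: "jacobian V (in_charts E C' (\<lambda>q. act \<Theta> (X.ginv g) (\<rho> q))) (snd E q) =
      jacobian V (in_charts E C \<rho>) (snd E q) * jacobian V (in_charts C C' (act \<Theta> (X.ginv g))) (snd C (\<rho> q))"
    by (rule jacobian_chain_near[OF tm(1,4) near(1) near(4)[OF gi] E C C'(1) C''])
  have "(\<lambda>q. \<rho> (R g q)) = (\<lambda>q. act \<Theta> (X.ginv g) (\<rho> q))" using g by simp
  then show ?thesis
    using 1 2 form_pull[OF gi C(1) C'(1) C(2) C''] qform_eq[OF E C] qform_eq[OF E' C'] g by simp
qed

lemma qform_transf: "E \<in> QA \<Longrightarrow> E' \<in> QA \<Longrightarrow> q \<in> fst E \<Longrightarrow> q \<in> fst E' \<Longrightarrow>
    qform E q = jacobian V (in_charts E E' (\<lambda>q. q)) (snd E q) * qform E' q"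
proof -
  have "R X.gone = (\<lambda>q. q)" by auto
  then show "E \<in> QA \<Longrightarrow> E' \<in> QA \<Longrightarrow> q \<in> fst E \<Longrightarrow> q \<in> fst E' \<Longrightarrow>
    qform E q = jacobian V (in_charts E E' (\<lambda>q. q)) (snd E q) * qform E' q"
    using qform_R[of X.gone E q E'] by simp
qed

lemma qform_nonzero: "E \<in> QA \<Longrightarrow> q \<in> fst E \<Longrightarrow> qform E q \<noteq> 0"
proof -
  assume E: "E \<in> QA" "q \<in> fst E"
  obtain C where C: "C \<in> XA" "\<rho> q \<in> fst C" using X.chart_exists .
  show ?thesis using qform_eq[OF E C] form_nonzero[OF C] QX.jacobian_nonzero[OF diffeo_\<rho> E C] by simp
qed

lemma qform_smooth:
  assumes E: "E \<in> QA" shows "smooth_on (snd E ` fst E) (\<lambda>z. qform E (chart_inv E z))"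
proof (rule Q.chart_smooth_local[OF E])
  fix q assume q: "q \<in> fst E"
  obtain C where C: "C \<in> XA" "\<rho> q \<in> fst C" using X.chart_exists .
  obtain U where U: "open U" "q \<in> U" "smooth_map_on QA XA U \<rho>" using local_diffeoE[OF diffeo_\<rho>] by metis
  let ?N = "U \<inter> \<rho> -` fst C"
  have "open ?N"
    using continuous_open_preimage[OF smooth_map_on_cont[OF U(3)] U(1) X.chart_open[OF C(1)]] .
  moreover have "smooth_on (snd E ` (fst E \<inter> ?N)) (\<lambda>z. jacobian V (in_charts E C \<rho>) z * \<nu> C (\<rho> (chart_inv E z)))"
    by (rule QX.pullback_smooth[where \<omega> = \<nu>, OF U(3,1) E C(1) form_smooth[OF C(1)]])
  moreover have "\<forall>p\<in>fst E \<inter> ?N. jacobian V (in_charts E C \<rho>) (snd E p) * \<nu> C (\<rho> (chart_inv E (snd E p))) = qform E p"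
    using qform_eq[OF E _ C(1)] Q.chart_inv_left[OF E] by simp
  ultimately show "\<exists>N h. open N \<and> q \<in> N \<and> smooth_on (snd E ` (fst E \<inter> N)) h \<and> (\<forall>p\<in>fst E \<inter> N. h (snd E p) = qform E p)"
    using U(2) C(2) by (intro exI[of _ ?N] exI) auto
qed

text \<open>Division by the Jacobian of \<open>\<alpha>\<close> descends \<open>\<rho>\<^sup>*\<nu>\<close> to \<open>Y\<close>; invariance of \<open>\<nu>\<close> under \<open>G\<close> makes the
  result independent of the point in the fibre of \<open>\<alpha>\<close>.\<close>

definition yform :: "('y, 'n) top_form" where
  "yform D y = (let E = (SOME E. E \<in> QA \<and> over \<phi> y \<in> fst E) in
     qform E (over \<phi> y) / jacobian V (in_charts E D \<alpha>) (snd E (over \<phi> y)))"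

lemma yform_eq:
  assumes E: "E \<in> QA" "q \<in> fst E" and D: "D \<in> YA" "\<alpha> q \<in> fst D"
  shows "yform D (\<alpha> q) = qform E q / jacobian V (in_charts E D \<alpha>) (snd E q)"
proof -
  let ?o = "over \<phi> (\<alpha> q)"
  define E0 where "E0 = (SOME E. E \<in> QA \<and> ?o \<in> fst E)"
  have "\<exists>E. E \<in> QA \<and> ?o \<in> fst E" using Q.chart_exists by metis
  then have E0: "E0 \<in> QA" "?o \<in> fst E0" unfolding E0_def by (metis (mono_tags, lifting) someI_ex)+
  have o: "\<alpha> ?o = \<alpha> q"
    unfolding over_def by (rule someI[of "\<lambda>p. \<alpha> p = \<alpha> q" q]) simp
  then obtain g where g: "g \<in> X.G" "q = R g ?o" by (rule R_transitive)
  have E': "R g ?o \<in> fst E" "\<alpha> (R g ?o) \<in> fst D" "\<alpha> ?o \<in> fst D" using E D g o by auto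
  have 1: "qform E0 ?o = jacobian V (in_charts E0 E (R g)) (snd E0 ?o) * qform E q"
    using qform_R[OF g(1) E0 E(1) E'(1)] g(2) by simp
  have "jacobian V (in_charts E0 D (\<lambda>p. \<alpha> (R g p))) (snd E0 ?o) =
      jacobian V (in_charts E0 E (R g)) (snd E0 ?o) * jacobian V (in_charts E D \<alpha>) (snd E (R g ?o))"
    by (rule jacobian_chain_near[OF tm(3,2) near(3)[OF g(1)] near(2) E0 E(1) E'(1) D(1) E'(2)])
  moreover have "(\<lambda>p. \<alpha> (R g p)) = \<alpha>" using g by auto
  ultimately have 2: "jacobian V (in_charts E0 D \<alpha>) (snd E0 ?o) =
      jacobian V (in_charts E0 E (R g)) (snd E0 ?o) * jacobian V (in_charts E D \<alpha>) (snd E q)"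
    using g(2) by simp
  have "jacobian V (in_charts E0 D \<alpha>) (snd E0 ?o) \<noteq> 0" by (rule QY.jacobian_nonzero[OF diffeo_\<alpha> E0 D(1) E'(3)])
  then show ?thesis unfolding yform_def E0_def[symmetric] Let_def 1 using 2 by simp
qed

text \<open>Near \<open>\<alpha>(q)\<close> the form is the pullback of \<open>\<nu>\<close> under \<open>\<rho>\<close> composed with a local inverse of \<open>\<alpha>\<close>, which
  shows that it is smooth.\<close>

lemma yform_volume: "volume_form V YA yform"
  unfolding volume_form_def
proof (intro conjI ballI)
  fix D assume D: "D \<in> YA"
  show "yform D y \<noteq> 0" if "y \<in> fst D" for y
  proof -
    obtain q where q: "\<alpha> q = y" by (rule obtain_\<alpha>)
    obtain E where E: "E \<in> QA" "q \<in> fst E" using Q.chart_exists .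
    show ?thesis using yform_eq[OF E D] q that qform_nonzero[OF E]
        QY.jacobian_nonzero[OF diffeo_\<alpha> E D] by auto
  qed
  show "smooth_on (snd D ` fst D) (\<lambda>z. yform D (chart_inv D z))"
  proof (rule Y.chart_smooth_local[OF D])
    fix y assume y: "y \<in> fst D"
    obtain q where q: "\<alpha> q = y" by (rule obtain_\<alpha>)
    obtain U1 where U1: "open U1" "q \<in> U1" "smooth_map_on QA XA U1 \<rho>" using local_diffeoE[OF diffeo_\<rho>] by metis
    obtain U where U: "open U" "q \<in> U" "U \<subseteq> U1" "inj_on \<alpha> U" "open (\<alpha> ` U)" "smooth_map_on QA YA U \<alpha>"
      "smooth_map_on YA QA (\<alpha> ` U) (inv_into U \<alpha>)" using QY.local_diffeo_small[OF diffeo_\<alpha> U1(1,2)] by metis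
    define F where "F y = \<rho> (inv_into U \<alpha> y)" for y
    have F: "smooth_map_on YA XA (\<alpha> ` U) F"
      unfolding F_def[abs_def]
      by (rule smooth_map_on_comp[OF tm(6) U(7) U1(3) _ U(5) X.atl])
        (use U(3) in \<open>auto simp: inv_into_into subsetD\<close>)
    have F\<alpha>: "F (\<alpha> p) = \<rho> p" if "p \<in> U" for p using that U(4) by (simp add: F_def)
    obtain C where C: "C \<in> XA" "\<rho> q \<in> fst C" using X.chart_exists .
    let ?N = "\<alpha> ` U \<inter> F -` fst C"
    have oN: "open ?N" using continuous_open_preimage[OF smooth_map_on_cont[OF F] U(5) X.chart_open[OF C(1)]] .
    interpret YX: two_manifolds V YA XA by (rule tm(7))
    have s: "smooth_on (snd D ` (fst D \<inter> ?N)) (\<lambda>z. jacobian V (in_charts D C F) z * \<nu> C (F (chart_inv D z)))"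
      by (rule YX.pullback_smooth[where \<omega> = \<nu>, OF F U(5) D C(1) form_smooth[OF C(1)]])
    have e: "jacobian V (in_charts D C F) (snd D w) * \<nu> C (F (chart_inv D (snd D w))) = yform D w"
      if w: "w \<in> fst D \<inter> ?N" for w
    proof -
      obtain p where p: "p \<in> U" "w = \<alpha> p" using w by blast
      then have pD: "\<alpha> p \<in> fst D" and pC: "\<rho> p \<in> fst C" using w F\<alpha> by auto
      obtain E where E: "E \<in> QA" "p \<in> fst E" using Q.chart_exists .
      have U1p: "smooth_map_on QA XA U \<rho>" using Q.smooth_map_on_subset[OF U1(3) U(3)] .
      have "jacobian V (in_charts E C \<rho>) (snd E p) = jacobian V (in_charts E C (\<lambda>p. F (\<alpha> p))) (snd E p)"
        by (rule QX.jacobian_cong[OF U1p U(1) p(1) _ E(1) C(1) E(2) pC]) (simp add: F\<alpha>)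
      also have "\<dots> = jacobian V (in_charts E D \<alpha>) (snd E p) * jacobian V (in_charts D C F) (snd D (\<alpha> p))"
        by (rule jacobian_chain[OF tm(2,7) U(6,1) p(1) F U(5)])
          (use p E D pD C pC F\<alpha> in auto)
      finally show ?thesis
        using yform_eq[OF E D pD] qform_eq[OF E C(1) pC] QY.jacobian_nonzero[OF diffeo_\<alpha> E D pD]
          Y.chart_inv_left[OF D pD] F\<alpha>[OF p(1)] p(2) by simp
    qed
    have "y \<in> ?N" using U(2) q F\<alpha>[OF U(2)] C(2) by auto
    then show "\<exists>N h. open N \<and> y \<in> N \<and> smooth_on (snd D ` (fst D \<inter> N)) h \<and> (\<forall>w\<in>fst D \<inter> N. h (snd D w) = yform D w)"
      by (intro exI[of _ ?N] exI[of _ "\<lambda>z. jacobian V (in_charts D C F) z * \<nu> C (F (chart_inv D z))"] conjI ballI)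
        (rule oN, assumption, rule s, rule e)
  qed
next
  have "yform D y = jacobian V (in_charts D D' (\<lambda>y. y)) (snd D y) * yform D' y"
    if D: "D \<in> YA" "D' \<in> YA" "y \<in> fst D" "y \<in> fst D'" for D D' y
  proof -
    obtain q where q: "\<alpha> q = y" by (rule obtain_\<alpha>)
    obtain E where E: "E \<in> QA" "q \<in> fst E" using Q.chart_exists .
    have qD: "\<alpha> q \<in> fst D" "\<alpha> q \<in> fst D'" using q D by auto
    have "jacobian V (in_charts E D' (\<lambda>q. (\<lambda>y. y) (\<alpha> q))) (snd E q) =
        jacobian V (in_charts E D \<alpha>) (snd E q) * jacobian V (in_charts D D' (\<lambda>y. y)) (snd D (\<alpha> q))"
      by (rule jacobian_chain_near[OF tm(2,5) near(2) near(5) E D(1) qD(1) D(2) qD(2)])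
    moreover have "a / j = d * (a / (j * d))" if "j \<noteq> 0" "j * d \<noteq> 0" for a j d :: real
      using that by (simp add: field_simps)
    ultimately show ?thesis
      using yform_eq[OF E D(1) qD(1)] yform_eq[OF E D(2) qD(2)] q
        QY.jacobian_nonzero[OF diffeo_\<alpha> E D(1) qD(1)] QY.jacobian_nonzero[OF diffeo_\<alpha> E D(2) qD(2)]
      by metis
  qed
  then show "pullback_form V YA YA id yform yform"
    unfolding pullback_form_def id_def by blast
qed

abbreviation "\<omega> \<equiv> induced_form V \<Theta> \<Xi> \<phi> \<nu>"

lemma qform_pullback_\<rho>: "pullback_form V QA XA \<rho> \<nu> qform"
  unfolding pullback_form_def using qform_eq by blast

text \<open>The form constructed above shows that the description of the induced form can be met; whichever
  form is chosen, its pullback to \<open>Q\<close> is \<open>\<rho>\<^sup>*\<nu>\<close>.\<close>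

lemma induced_form_works:
  shows induced_form_volume: "volume_form V YA \<omega>"
    and qform_pullback_\<alpha>: "pullback_form V QA YA \<alpha> \<omega> qform"
proof -
  let ?P = "\<lambda>\<omega>. volume_form V YA \<omega> \<and> (\<exists>\<theta>. pullback_form V QA YA \<alpha> \<omega> \<theta> \<and> pullback_form V QA XA \<rho> \<nu> \<theta>)"
  have "pullback_form V QA YA \<alpha> yform qform"
    unfolding pullback_form_def
  proof (intro ballI impI)
    fix E D q assume "E \<in> QA" "D \<in> YA" "q \<in> fst E" "\<alpha> q \<in> fst D"
    then show "qform E q = jacobian V (in_charts E D \<alpha>) (snd E q) * yform D (\<alpha> q)"
      using yform_eq[of E q D] QY.jacobian_nonzero[OF diffeo_\<alpha>, of E q D] by simp
  qed
  then have "?P yform" using yform_volume qform_pullback_\<rho> by blast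
  then have P: "?P \<omega>" unfolding induced_form_def by (rule someI[of ?P])
  then show "volume_form V YA \<omega>" by blast
  obtain \<theta> where \<theta>: "pullback_form V QA YA \<alpha> \<omega> \<theta>" "pullback_form V QA XA \<rho> \<nu> \<theta>" using P by blast
  have "\<theta> E q = qform E q" if E: "E \<in> QA" "q \<in> fst E" for E q
  proof -
    obtain C where C: "C \<in> XA" "\<rho> q \<in> fst C" using X.chart_exists .
    show ?thesis using \<theta>(2) qform_eq[OF E C] E C unfolding pullback_form_def by simp
  qed
  then show "pullback_form V QA YA \<alpha> \<omega> qform" using \<theta>(1) unfolding pullback_form_def by simp
qed

sublocale VX: volume_manifold V XA \<nu>
  using X.compact_X volume_form_cont[OF vol] form_id by unfold_locales auto

sublocale VY: volume_manifold V YA \<omega>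
  using Y.compact_X volume_form_cont[OF induced_form_volume] induced_form_volume
  by unfold_locales (auto simp: volume_form_def)

sublocale VQ: volume_manifold V QA qform
proof unfold_locales
  show "compact (UNIV :: 'q set)" by (rule compact_Q)
  show "continuous_on (snd C ` fst C) (\<lambda>z. qform C (chart_inv C z))" if "C \<in> QA" for C
    using smooth_on_continuous[OF qform_smooth[OF that]] .
  show "pullback_form V QA QA id qform qform"
    unfolding pullback_form_def id_def using qform_transf by blast
qed

abbreviation "MX \<equiv> form_measure V XA \<nu>"
abbreviation "MY \<equiv> form_measure V YA \<omega>"

text \<open>Both sides are the integral of \<open>F\<close> over \<open>Q\<close> against \<open>\<rho>\<^sup>*\<nu> = \<alpha>\<^sup>*\<omega>\<close>.\<close>

lemma fibre_integrals_agree: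
  fixes F :: "'q \<Rightarrow> complex"
  assumes F: "continuous_on UNIV F"
  shows "(\<integral>y. (\<Sum>q | \<alpha> q = y. F q) \<partial>MY) = (\<integral>x. (\<Sum>q | \<rho> q = x. F q) \<partial>MX)"
proof -
  interpret IY: two_volume_manifolds V QA YA qform \<omega> ..
  interpret IX: two_volume_manifolds V QA XA qform \<nu> ..
  show ?thesis
    using IY.integral_local_diffeo[OF diffeo_\<alpha> qform_pullback_\<alpha> F]
      IX.integral_local_diffeo[OF diffeo_\<rho> qform_pullback_\<rho> F] by simp
qed

text \<open>Up to the factor \<open>#G\<close>, the integral of \<open>h\<close> over \<open>Y\<close> is the integral over \<open>X\<close> of the sums of \<open>h \<circ> \<alpha>\<close>
  over the fibres of \<open>\<rho>\<close>, and \<open>K\<close> only permutes such a fibre.\<close>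

lemma induced_measure_invariant:
  fixes h :: "'y \<Rightarrow> complex"
  assumes k: "k \<in> Y.G" and h: "continuous_on UNIV h"
  shows "(\<integral>y. h (act \<Xi> k y) \<partial>MY) = (\<integral>y. h y \<partial>MY)"
proof -
  have const: "(\<Sum>q | \<alpha> q = y. f (\<alpha> q)) = of_nat (card X.G) * f y" for f :: "'y \<Rightarrow> complex" and y
  proof -
    obtain q where q: "\<alpha> q = y" by (rule obtain_\<alpha>)
    have "(\<Sum>q' | \<alpha> q' = \<alpha> q. f (\<alpha> q')) = (\<Sum>g\<in>X.G. f (\<alpha> (R g q)))" by (rule sum_fibre_\<alpha>)
    then show ?thesis using q by simp
  qed
  have eq: "of_nat (card X.G) * (\<integral>y. f y \<partial>MY) = (\<integral>x. (\<Sum>q | \<rho> q = x. f (\<alpha> q)) \<partial>MX)"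
    if f: "continuous_on UNIV f" for f :: "'y \<Rightarrow> complex"
  proof -
    have "continuous_on UNIV (\<lambda>q. f (\<alpha> q))" by (rule continuous_on_compose2[OF f cont_\<alpha>]) simp
    from fibre_integrals_agree[OF this] show ?thesis
      by (simp only: const Bochner_Integration.integral_mult_right_zero)
  qed
  have c: "continuous_on UNIV (\<lambda>y. h (act \<Xi> k y))"
    by (rule continuous_on_compose2[OF h Y.act_continuous[OF k]]) simp
  have "(\<Sum>q | \<rho> q = x. h (act \<Xi> k (\<alpha> q))) = (\<Sum>q | \<rho> q = x. h (\<alpha> q))" for x
  proof -
    obtain q where q: "\<rho> q = x" by (rule obtain_\<rho>)
    have "(\<Sum>l\<in>Y.G. h (act \<Xi> k (\<alpha> (L l q)))) = (\<Sum>l\<in>Y.G. h (\<alpha> (L (Y.gmul k l) q)))"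
      using k by (intro sum.cong refl) (simp add: Y.act_mult)
    also have "\<dots> = (\<Sum>l\<in>Y.G. h (\<alpha> (L l q)))"
      by (rule sum.reindex_bij_witness[of _ "\<lambda>l. Y.gmul (Y.ginv k) l" "\<lambda>l. Y.gmul k l"])
        (use k in \<open>auto simp: Y.grp.m_assoc[symmetric]\<close>)
    finally show ?thesis
      using sum_fibre_\<rho>[where q = q and f = "\<lambda>q. h (act \<Xi> k (\<alpha> q))"]
        sum_fibre_\<rho>[where q = q and f = "\<lambda>q. h (\<alpha> q)"] unfolding q by simp
  qed
  then have "of_nat (card X.G) * (\<integral>y. h (act \<Xi> k y) \<partial>MY) = of_nat (card X.G) * (\<integral>y. h y \<partial>MY)"
    using eq[OF c] eq[OF h] by simp
  then show ?thesis using X.card_G_pos by simp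
qed

end

section \<open>The isomorphism \<open>\<chi>\<close>\<close>

text \<open>That the inner product of the tensor product is positive is not visible from its formula; it is
  read off from its image under \<open>\<chi>\<close>.\<close>

lemma semi_inner_via:
  assumes "vec_space S" "semi_inner T" "linear_in S T J" and k: "(k::real) > 0"
    and inner: "\<And>v w. v \<in> vecs S \<Longrightarrow> w \<in> vecs S \<Longrightarrow> inner_in T (J v) (J w) = of_real k * inner_in S v w"
  shows "semi_inner S"
proof -
  interpret S: vec_space S by fact
  interpret T: semi_inner T by fact
  have J: "J v \<in> vecs T" if "v \<in> vecs S" for v using assms(3) that unfolding linear_in_def by blast
  have lin: "J (plus_in S v w) = plus_in T (J v) (J w)" "J (scale_in S z v) = scale_in T z (J v)"
    if "v \<in> vecs S" "w \<in> vecs S" for v w z using assms(3) that unfolding linear_in_def by auto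
  have eq: "inner_in S v w = inner_in T (J v) (J w) / of_real k" if "v \<in> vecs S" "w \<in> vecs S" for v w
    using inner[OF that] k by simp
  show ?thesis
  proof unfold_locales
    fix u v w assume u: "u \<in> vecs S" "v \<in> vecs S" "w \<in> vecs S"
    show "inner_in S (plus_in S u v) w = inner_in S u w + inner_in S v w"
      using u by (simp add: eq lin J T.inner_plus add_divide_distrib)
  next
    fix u w z assume u: "u \<in> vecs S" "w \<in> vecs S"
    show "inner_in S (scale_in S z u) w = z * inner_in S u w"
      using u lin(2)[OF u] by (simp add: eq J T.inner_scale)
    show "inner_in S w u = cnj (inner_in S u w)"
      using u T.inner_commute[OF J J, of u w] by (simp add: eq)
  next
    fix u assume u: "u \<in> vecs S"
    then show "0 \<le> Re (inner_in S u u)" using T.inner_pos[OF J[OF u]] k by (simp add: eq)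
  qed
qed

definition fsum :: "('p \<Rightarrow> complex) \<Rightarrow> ('p \<Rightarrow> complex) \<Rightarrow> complex" where
  "fsum r H = (\<Sum>p | r p \<noteq> 0. r p * H p)"

lemma fsum_superset: "finite D \<Longrightarrow> {p. r p \<noteq> 0} \<subseteq> D \<Longrightarrow> fsum r H = (\<Sum>p\<in>D. r p * H p)"
  unfolding fsum_def by (rule sum.mono_neutral_left) auto

lemma fsum_lincomb:
  assumes "finite {p. r p \<noteq> 0}" "finite {p. r' p \<noteq> 0}"
  shows "fsum (\<lambda>p. z * r p + r' p) H = z * fsum r H + fsum r' H"
proof -
  let ?D = "{p. r p \<noteq> 0} \<union> {p. r' p \<noteq> 0}"
  have D: "finite ?D" using assms by simp
  have "fsum (\<lambda>p. z * r p + r' p) H = (\<Sum>p\<in>?D. (z * r p + r' p) * H p)"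
    by (rule fsum_superset[OF D]) auto
  also have "\<dots> = z * (\<Sum>p\<in>?D. r p * H p) + (\<Sum>p\<in>?D. r' p * H p)"
    by (simp add: algebra_simps sum.distrib sum_distrib_left)
  also have "\<dots> = z * fsum r H + fsum r' H"
    using fsum_superset[OF D, of r H] fsum_superset[OF D, of r' H] by simp
  finally show ?thesis .
qed

lemma fsum_zero [simp]: "fsum (\<lambda>_. 0) H = 0"
  by (simp add: fsum_def)

lemma fsum_scale: "finite {p. r p \<noteq> 0} \<Longrightarrow> fsum (\<lambda>p. z * r p) H = z * fsum r H"
  using fsum_lincomb[of r "\<lambda>_. 0" z H] by simp

lemma fsum_diff:
  "finite {p. r p \<noteq> 0} \<Longrightarrow> finite {p. r' p \<noteq> 0} \<Longrightarrow> fsum (\<lambda>p. r p - r' p) H = fsum r H - fsum r' H"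
  using fsum_lincomb[of r' r "-1" H] by simp

lemma fsum_comb:
  assumes I: "finite I"
  shows "finite {p. (\<Sum>i\<in>I. c i * point_mass (l i) p) \<noteq> 0}"
    and "{p. (\<Sum>i\<in>I. c i * point_mass (l i) p) \<noteq> 0} \<subseteq> l ` I"
    and "fsum (\<lambda>p. \<Sum>i\<in>I. c i * point_mass (l i) p) H = (\<Sum>i\<in>I. c i * H (l i))"
proof -
  show sub: "{p. (\<Sum>i\<in>I. c i * point_mass (l i) p) \<noteq> 0} \<subseteq> l ` I"
  proof
    fix p assume "p \<in> {p. (\<Sum>i\<in>I. c i * point_mass (l i) p) \<noteq> 0}"
    then obtain i where "i \<in> I" "c i * point_mass (l i) p \<noteq> 0" by (auto elim: sum.not_neutral_contains_not_neutral)
    then show "p \<in> l ` I" by (auto simp: point_mass_def)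
  qed
  then show "finite {p. (\<Sum>i\<in>I. c i * point_mass (l i) p) \<noteq> 0}" using I finite_subset by blast
  have "fsum (\<lambda>p. \<Sum>i\<in>I. c i * point_mass (l i) p) H = (\<Sum>p\<in>l ` I. (\<Sum>i\<in>I. c i * point_mass (l i) p) * H p)"
    by (rule fsum_superset[OF _ sub]) (use I in simp)
  also have "\<dots> = (\<Sum>p\<in>l ` I. \<Sum>i\<in>I. c i * point_mass (l i) p * H p)" by (simp add: sum_distrib_right)
  also have "\<dots> = (\<Sum>i\<in>I. \<Sum>p\<in>l ` I. c i * point_mass (l i) p * H p)" by (rule sum.swap)
  also have "\<dots> = (\<Sum>i\<in>I. c i * H (l i))"
  proof (rule sum.cong[OF refl])
    fix i assume "i \<in> I"
    have "(\<Sum>p\<in>l ` I. c i * point_mass (l i) p * H p) = (\<Sum>p\<in>l ` I. if p = l i then c i * H p else 0)"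
      by (rule sum.cong) (auto simp: point_mass_def)
    then show "(\<Sum>p\<in>l ` I. c i * point_mass (l i) p * H p) = c i * H (l i)" using I \<open>i \<in> I\<close> by simp
  qed
  finally show "fsum (\<lambda>p. \<Sum>i\<in>I. c i * point_mass (l i) p) H = (\<Sum>i\<in>I. c i * H (l i))" .
qed

lemma fsum_point_mass [simp]: "fsum (point_mass p) H = H p" "finite {p'. point_mass p p' \<noteq> 0}"
  using fsum_comb(3)[of "{p}" "\<lambda>_. 1" "\<lambda>p. p" H] fsum_comb(1)[of "{p}" "\<lambda>_. 1" "\<lambda>p. p"] by simp_all

locale morita_full = morita_bundle V \<Theta> \<Xi> \<phi> \<xi> + morita_form V \<Theta> \<Xi> \<phi> \<nu>
  for V :: "(real^'n::{finite,wellorder}) set"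
    and \<Theta> :: "('g, 'x::{t2_space, second_countable_topology}, 'n) action_orbifold"
    and \<Xi> :: "('k, 'y::{t2_space, second_countable_topology}, 'n) action_orbifold"
    and \<phi> :: "('g, 'x, 'k, 'y, 'q::{t2_space, second_countable_topology}, 'n) bitorsor"
    and \<xi> :: "('g, 'x, 'u) hbundle"
    and \<nu> :: "('x, 'n) top_form"
begin

sublocale EM: ebundle_measure V \<Xi> E MY
  by unfold_locales (use VY.continuous_integrable induced_measure_invariant in auto)

abbreviation "SQ \<equiv> smooth_fun_space QA"
abbreviation "SX \<equiv> sections XA \<xi>"
abbreviation "SY \<equiv> sections YA E"

lemma target_eq: "induced_section_space V \<Theta> \<Xi> \<phi> \<xi> \<nu> = EM.Sec"
  by (simp add: induced_section_space_def)

lemma SQ_R: "f \<in> SQ \<Longrightarrow> g \<in> X.G \<Longrightarrow> smooth_fun_on QA UNIV (\<lambda>q. f (R g q))"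
  unfolding smooth_fun_space_def by (intro QQ.smooth_fun_on_comp[OF R_smooth]) auto

lemma SQ_L: "f \<in> SQ \<Longrightarrow> k \<in> Y.G \<Longrightarrow> smooth_fun_on QA UNIV (\<lambda>q. f (L k q))"
  unfolding smooth_fun_space_def by (intro QQ.smooth_fun_on_comp[OF L_smooth]) auto

text \<open>The formula for \<open>\<chi>(f \<odot> \<psi>)\<^sub>q\<close>, as a sum over the group.\<close>

definition crep :: "('q \<Rightarrow> complex) \<Rightarrow> ('x \<Rightarrow> 'u) \<Rightarrow> 'q \<Rightarrow> 'u" where
  "crep f \<psi> q = vscale \<xi> (mass \<Theta>)
     (fibre_sum \<xi> (\<rho> q) (\<lambda>g. vscale \<xi> (f (R g q)) (X.trans_sec g \<psi> (\<rho> q))) X.G)"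

lemma crep_in [simp]: "\<psi> \<in> SX \<Longrightarrow> crep f \<psi> q \<in> fibre \<xi> (\<rho> q)"
  unfolding crep_def by (auto intro!: X.vscale_in X.fibre_sum_in)

lemma functional_crep:
  assumes "\<psi> \<in> SX" "functional \<xi> (\<rho> q) h"
  shows "h (crep f \<psi> q) = mass \<Theta> * (\<Sum>g\<in>X.G. f (R g q) * h (X.trans_sec g \<psi> (\<rho> q)))"
  unfolding crep_def using assms X.finite_G
  by (simp add: X.functionalD[OF assms(2)] X.fibre_sum_in X.functional_sum)

lemma crep_arrows:
  assumes "\<psi> \<in> SX"
  shows "vscale \<xi> (1 / of_nat (card X.G)) (fibre_sum \<xi> (\<rho> q)
      (\<lambda>\<sigma>. vscale \<xi> (f (ract \<phi> q \<sigma>)) (rho \<xi> \<sigma> (\<psi> (src \<sigma>)))) (arrows_into \<Theta> (\<rho> q))) = crep f \<psi> q"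
  unfolding crep_def mass_def R_def X.trans_sec_def using assms
  by (subst X.fibre_sum_arrows_into) (auto simp: X.arrows_into_eq)

lemma functional_rho_inv:
  "g \<in> X.G \<Longrightarrow> functional \<xi> (\<rho> (R g q)) h \<Longrightarrow> functional \<xi> (\<rho> q) (\<lambda>u. h (rho \<xi> (X.ginv g, \<rho> q) u))"
  using X.functional_rho[of "X.ginv g" "act \<Theta> (X.ginv g) (\<rho> q)" h] by simp

text \<open>The substitution \<open>k = g l\<close>: along a fibre of \<open>\<alpha>\<close> the values transform as the representatives of
  one element of the induced bundle.\<close>

lemma crep_R:
  assumes g: "g \<in> X.G" and \<psi>: "\<psi> \<in> SX"
  shows "crep f \<psi> (R g q) = rho \<xi> (X.ginv g, \<rho> q) (crep f \<psi> q)"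
proof (rule X.fibre_eqI[where x = "\<rho> (R g q)"])
  show "crep f \<psi> (R g q) \<in> fibre \<xi> (\<rho> (R g q))" using \<psi> by simp
  show "rho \<xi> (X.ginv g, \<rho> q) (crep f \<psi> q) \<in> fibre \<xi> (\<rho> (R g q))" using g \<psi> by simp
  fix h assume h: "functional \<xi> (\<rho> (R g q)) h"
  have gi: "X.ginv g \<in> X.G" using g by simp
  have "h (rho \<xi> (X.ginv g, \<rho> q) (crep f \<psi> q)) =
      mass \<Theta> * (\<Sum>k\<in>X.G. f (R k q) * h (rho \<xi> (X.ginv g, \<rho> q) (X.trans_sec k \<psi> (\<rho> q))))"
    by (rule functional_crep[OF \<psi> functional_rho_inv[OF g h]])
  also have "(\<Sum>k\<in>X.G. f (R k q) * h (rho \<xi> (X.ginv g, \<rho> q) (X.trans_sec k \<psi> (\<rho> q)))) =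
      (\<Sum>l\<in>X.G. f (R l (R g q)) * h (X.trans_sec l \<psi> (\<rho> (R g q))))"
  proof (rule sum.reindex_bij_witness[of _ "\<lambda>l. X.gmul g l" "\<lambda>k. X.gmul (X.ginv g) k"])
    fix k assume k: "k \<in> X.G"
    show "X.gmul g (X.gmul (X.ginv g) k) = k" using g k by (simp add: X.grp.m_assoc[symmetric])
    have "rho \<xi> (X.ginv g, \<rho> q) (X.trans_sec k \<psi> (\<rho> q)) = X.trans_sec (X.gmul (X.ginv g) k) \<psi> (\<rho> (R g q))"
      using X.rho_trans_sec[OF gi k \<psi>, of "\<rho> (R g q)"] g by (simp add: X.into_def)
    moreover have "R (X.gmul (X.ginv g) k) (R g q) = R k q"
      using R_R[OF g, of "X.gmul (X.ginv g) k" q] g k by (simp add: X.grp.m_assoc[symmetric])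
    ultimately show "f (R (X.gmul (X.ginv g) k) (R g q)) * h (X.trans_sec (X.gmul (X.ginv g) k) \<psi> (\<rho> (R g q))) =
        f (R k q) * h (rho \<xi> (X.ginv g, \<rho> q) (X.trans_sec k \<psi> (\<rho> q)))" by simp
  next
    fix l assume l: "l \<in> X.G"
    show "X.gmul (X.ginv g) (X.gmul g l) = l" using g l by (simp add: X.grp.m_assoc[symmetric])
  qed (use g in auto)
  finally show "h (crep f \<psi> (R g q)) = h (rho \<xi> (X.ginv g, \<rho> q) (crep f \<psi> q))"
    using functional_crep[OF \<psi> h] by simp
qed

lemma crep_smooth:
  assumes f: "f \<in> SQ" and \<psi>: "\<psi> \<in> SX" and T: "(U, r, \<Phi>) \<in> trivs \<xi>" "i < r"
  shows "smooth_fun_on QA (\<rho> -` U) (\<lambda>q. \<Phi> (crep f \<psi> q) i)"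
proof -
  have "smooth_fun_on QA (\<rho> -` U) (\<lambda>q. mass \<Theta> * (\<Sum>g\<in>X.G. f (R g q) * \<Phi> (X.trans_sec g \<psi> (\<rho> q)) i))"
    using Q.smooth_fun_on_subset[OF SQ_R[OF f]]
      QX.local_diffeo_pull_smooth[OF diffeo_\<rho> X.section_smooth[OF X.section_translate[OF _ \<psi>] T]]
    by (intro Q.smooth_fun_on_mult Q.smooth_fun_on_sum Q.smooth_fun_on_const) auto
  then show ?thesis
    by (rule Q.smooth_fun_on_cong) (simp add: functional_crep[OF \<psi> X.functional_triv[OF T(1)]])
qed

abbreviation "FS \<equiv> formal_space V \<Theta> \<Xi> \<phi> \<xi> \<nu>"
abbreviation "TR \<equiv> tensor_relations \<Theta> \<phi> \<xi>"

lemma FS_simps [simp]: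
  "plus_in FS = (\<lambda>r r' p. r p + r' p)" "zero_in FS = (\<lambda>_. 0)" "scale_in FS = (\<lambda>z r p. z * r p)"
  by (simp_all add: formal_space_def)

lemma FS_iff: "r \<in> vecs FS \<longleftrightarrow> finite {p. r p \<noteq> 0} \<and> {p. r p \<noteq> 0} \<subseteq> SQ \<times> SX"
  by (simp add: formal_space_def)

lemma FS_finite: "r \<in> vecs FS \<Longrightarrow> finite {p. r p \<noteq> 0}"
  and FS_memb: "r \<in> vecs FS \<Longrightarrow> r p \<noteq> 0 \<Longrightarrow> fst p \<in> SQ \<and> snd p \<in> SX"
  unfolding FS_iff by auto

lemma FS_lincomb: "r \<in> vecs FS \<Longrightarrow> r' \<in> vecs FS \<Longrightarrow> (\<lambda>p. z * r p + r' p) \<in> vecs FS"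
proof -
  assume r: "r \<in> vecs FS" "r' \<in> vecs FS"
  have sub: "{p. z * r p + r' p \<noteq> 0} \<subseteq> {p. r p \<noteq> 0} \<union> {p. r' p \<noteq> 0}" by auto
  have "finite {p. z * r p + r' p \<noteq> 0}"
    by (rule finite_subset[OF sub]) (use r in \<open>simp add: FS_iff\<close>)
  moreover have "{p. z * r p + r' p \<noteq> 0} \<subseteq> SQ \<times> SX"
    by (rule order_trans[OF sub]) (use r in \<open>simp add: FS_iff\<close>)
  ultimately show ?thesis unfolding FS_iff by blast
qed

lemma FS_zero: "(\<lambda>_. 0) \<in> vecs FS"
  by (simp add: FS_iff)

lemma FS_diff: "r \<in> vecs FS \<Longrightarrow> r' \<in> vecs FS \<Longrightarrow> (\<lambda>p. r p - r' p) \<in> vecs FS"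
  using FS_lincomb[of r' r "-1"] by simp

lemma FS_scale: "r \<in> vecs FS \<Longrightarrow> (\<lambda>p. z * r p) \<in> vecs FS"
  using FS_lincomb[OF _ FS_zero, of r z] by simp

lemma FS_comb:
  assumes "finite I" "\<And>i. i \<in> I \<Longrightarrow> l i \<in> SQ \<times> SX"
  shows "(\<lambda>p. \<Sum>i\<in>I. c i * point_mass (l i) p) \<in> vecs FS"
  using fsum_comb(1,2)[OF assms(1), of c l] assms(2) unfolding FS_iff by blast

lemma FS_point_mass: "f \<in> SQ \<Longrightarrow> \<psi> \<in> SX \<Longrightarrow> point_mass (f, \<psi>) \<in> vecs FS"
  using FS_comb[of "{()}" "\<lambda>_. (f, \<psi>)" "\<lambda>_. 1"] by simp

lemma vec_space_FS: "vec_space FS"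
proof unfold_locales
  show "zero_in FS \<in> vecs FS" using FS_zero by simp
  show "plus_in FS v w \<in> vecs FS" if "v \<in> vecs FS" "w \<in> vecs FS" for v w
    using FS_lincomb[OF that, of 1] by simp
  show "scale_in FS z v \<in> vecs FS" if "v \<in> vecs FS" for v z
    using FS_lincomb[OF that FS_zero, of z] by simp
qed (auto simp: algebra_simps)

lemma crep_add_left: "\<psi> \<in> SX \<Longrightarrow> functional \<xi> (\<rho> q) h \<Longrightarrow>
    h (crep (\<lambda>q. f q + f' q) \<psi> q) = h (crep f \<psi> q) + h (crep f' \<psi> q)"
  by (simp add: functional_crep algebra_simps sum.distrib)

lemma crep_scale_left: "\<psi> \<in> SX \<Longrightarrow> functional \<xi> (\<rho> q) h \<Longrightarrow>
    h (crep (\<lambda>q. z * f q) \<psi> q) = z * h (crep f \<psi> q)"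
  by (simp add: functional_crep algebra_simps sum_distrib_left)

lemma crep_add_right:
  assumes "\<psi> \<in> SX" "\<psi>' \<in> SX" "functional \<xi> (\<rho> q) h"
  shows "h (crep f (\<lambda>x. vadd \<xi> (\<psi> x) (\<psi>' x)) q) = h (crep f \<psi> q) + h (crep f \<psi>' q)"
proof -
  have "X.trans_sec g (\<lambda>x. vadd \<xi> (\<psi> x) (\<psi>' x)) x = vadd \<xi> (X.trans_sec g \<psi> x) (X.trans_sec g \<psi>' x)"
    if "g \<in> X.G" for g x unfolding X.trans_sec_def X.into_def using that assms by (simp add: X.rho_add)
  then show ?thesis
    using assms X.section_add[OF assms(1,2)] X.functionalD(1)[OF assms(3)]
    by (simp add: functional_crep algebra_simps sum.distrib)
qed

lemma crep_scale_right:
  assumes "\<psi> \<in> SX" "functional \<xi> (\<rho> q) h"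
  shows "h (crep f (\<lambda>x. vscale \<xi> z (\<psi> x)) q) = z * h (crep f \<psi> q)"
proof -
  have "X.trans_sec g (\<lambda>x. vscale \<xi> z (\<psi> x)) x = vscale \<xi> z (X.trans_sec g \<psi> x)"
    if "g \<in> X.G" for g x unfolding X.trans_sec_def X.into_def using that assms by (simp add: X.rho_scale)
  then show ?thesis
    using assms X.section_mult[OF assms(1) X.smooth_fun_on_const[of _ z]] X.functionalD(2)[OF assms(2)]
    by (simp add: functional_crep algebra_simps sum_distrib_left)
qed

lemma fun_ract_eq: "fun_ract \<Theta> \<phi> f a q = mass \<Theta> * (\<Sum>k\<in>X.G. a (X.ginv k, \<rho> q) * f (R k q))"
  unfolding fun_ract_def X.sum_arrows_into R_def by simp

lemma fun_ract_SQ: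
  assumes f: "f \<in> SQ" and a: "a \<in> conv_algebra \<Theta>" shows "fun_ract \<Theta> \<phi> f a \<in> SQ"
proof -
  have "smooth_fun_on QA UNIV (\<lambda>q. a (X.ginv k, \<rho> q))" if "k \<in> X.G" for k
    using QX.local_diffeo_pull_smooth[OF diffeo_\<rho> X.conv_algebra_smooth[OF a, of "X.ginv k"]] that by simp
  then show ?thesis
    unfolding smooth_fun_space_def mem_Collect_eq fun_ract_eq[abs_def] using SQ_R[OF f]
    by (intro Q.smooth_fun_on_mult Q.smooth_fun_on_sum Q.smooth_fun_on_const) auto
qed

text \<open>Both sides are sums over pairs of group elements, with the argument of \<open>f\<close> moved by \<open>g k\<close> and by
  \<open>l\<close>; the substitution is \<open>g = l j\<close>, \<open>k = j\<^sup>-\<^sup>1\<close>.\<close>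

lemma crep_balanced:
  assumes \<psi>: "\<psi> \<in> SX" and a: "a \<in> conv_algebra \<Theta>" and h: "functional \<xi> (\<rho> q) h"
  shows "h (crep (fun_ract \<Theta> \<phi> f a) \<psi> q) = h (crep f (sec_act \<Theta> \<xi> a \<psi>) q)"
proof -
  let ?x = "\<rho> q" and ?m = "mass \<Theta>"
  let ?t = "\<lambda>g k. a (X.ginv k, act \<Theta> (X.ginv g) ?x) * f (R (X.gmul g k) q) * h (X.trans_sec g \<psi> ?x)"
  have "h (crep (fun_ract \<Theta> \<phi> f a) \<psi> q) = ?m * (\<Sum>g\<in>X.G. fun_ract \<Theta> \<phi> f a (R g q) * h (X.trans_sec g \<psi> ?x))"
    by (rule functional_crep[OF \<psi> h])
  also have "\<dots> = ?m * (\<Sum>g\<in>X.G. ?m * (\<Sum>k\<in>X.G. ?t g k))"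
    by (intro arg_cong[where f = "\<lambda>s. ?m * s"] sum.cong refl)
      (simp add: fun_ract_eq R_R sum_distrib_right mult.assoc)
  finally have L: "h (crep (fun_ract \<Theta> \<phi> f a) \<psi> q) = ?m * (?m * (\<Sum>g\<in>X.G. \<Sum>k\<in>X.G. ?t g k))"
    by (simp add: sum_distrib_left)
  have tr: "h (X.trans_sec l (sec_act \<Theta> \<xi> a \<psi>) ?x) =
      ?m * (\<Sum>j\<in>X.G. a (X.into j (act \<Theta> (X.ginv l) ?x)) * h (X.trans_sec (X.gmul l j) \<psi> ?x))" if l: "l \<in> X.G" for l
    unfolding X.trans_sec_def[of l]
    using X.functional_sec_act[OF \<psi> X.functional_rho[OF l h], of a] X.rho_trans_sec[OF l _ \<psi>] by simp
  have "h (crep f (sec_act \<Theta> \<xi> a \<psi>) q) = ?m * (\<Sum>l\<in>X.G. f (R l q) * h (X.trans_sec l (sec_act \<Theta> \<xi> a \<psi>) ?x))"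
    by (rule functional_crep[OF X.sec_act_section[OF a \<psi>] h])
  also have "\<dots> = ?m * (\<Sum>l\<in>X.G. ?m * (\<Sum>j\<in>X.G. ?t (X.gmul l j) (X.ginv j)))"
  proof (intro arg_cong[where f = "\<lambda>s. ?m * s"] sum.cong refl)
    fix l assume l: "l \<in> X.G"
    have te: "f (R l q) * (a (X.into j (act \<Theta> (X.ginv l) ?x)) * h (X.trans_sec (X.gmul l j) \<psi> ?x)) = ?t (X.gmul l j) (X.ginv j)"
      if j: "j \<in> X.G" for j
      using l j by (simp add: X.into_def X.grp.inv_mult_group X.act_mult X.grp.m_assoc)
    have "f (R l q) * h (X.trans_sec l (sec_act \<Theta> \<xi> a \<psi>) ?x) =
        ?m * (\<Sum>j\<in>X.G. f (R l q) * (a (X.into j (act \<Theta> (X.ginv l) ?x)) * h (X.trans_sec (X.gmul l j) \<psi> ?x)))"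
      unfolding tr[OF l] by (simp add: sum_distrib_left mult_ac)
    also have "\<dots> = ?m * (\<Sum>j\<in>X.G. ?t (X.gmul l j) (X.ginv j))"
      by (rule arg_cong[where f = "\<lambda>s. ?m * s"], rule sum.cong[OF refl], rule te)
    finally show "f (R l q) * h (X.trans_sec l (sec_act \<Theta> \<xi> a \<psi>) ?x) =
      ?m * (\<Sum>j\<in>X.G. ?t (X.gmul l j) (X.ginv j))" .
  qed
  also have "\<dots> = ?m * (?m * (\<Sum>l\<in>X.G. \<Sum>j\<in>X.G. ?t (X.gmul l j) (X.ginv j)))" by (simp add: sum_distrib_left)
  also have "(\<Sum>l\<in>X.G. \<Sum>j\<in>X.G. ?t (X.gmul l j) (X.ginv j)) = (\<Sum>j\<in>X.G. \<Sum>l\<in>X.G. ?t (X.gmul l j) (X.ginv j))"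
    by (rule sum.swap)
  also have "\<dots> = (\<Sum>j\<in>X.G. \<Sum>g\<in>X.G. ?t g (X.ginv j))"
  proof (rule sum.cong[OF refl])
    fix j assume "j \<in> X.G"
    then show "(\<Sum>l\<in>X.G. ?t (X.gmul l j) (X.ginv j)) = (\<Sum>g\<in>X.G. ?t g (X.ginv j))" by (rule X.sum_mult_right)
  qed
  also have "\<dots> = (\<Sum>k\<in>X.G. \<Sum>g\<in>X.G. ?t g k)" by (rule X.sum_inverse)
  also have "\<dots> = (\<Sum>g\<in>X.G. \<Sum>k\<in>X.G. ?t g k)" by (rule sum.swap)
  finally show ?thesis using L by simp
qed

text \<open>The defining relations of the tensor product are sent to zero, by bilinearity and balancedness of
  the formula for \<open>\<chi>\<close>.\<close>

lemma TR_null: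
  "r \<in> TR \<Longrightarrow> r \<in> vecs FS \<and> (\<forall>q h. functional \<xi> (\<rho> q) h \<longrightarrow> fsum r (\<lambda>p. h (crep (fst p) (snd p) q)) = 0)"
proof (induction rule: tensor_relations.induct)
  case zero
  then show ?case using FS_zero by simp
next
  case (lincomb r r' z)
  then show ?case using FS_lincomb[of r r' z] by (simp add: fsum_lincomb FS_finite)
next
  case (add_left f f' \<psi>)
  have "(\<lambda>q. f q + f' q) \<in> SQ" using add_left Q.smooth_fun_on_add unfolding smooth_fun_space_def by blast
  note pm = FS_point_mass[OF this add_left(3)] FS_point_mass[OF add_left(1,3)] FS_point_mass[OF add_left(2,3)]
  note d = FS_diff[OF pm(1,2)]
  show ?case
    using FS_diff[OF d pm(3)] add_left(3)
    by (simp add: fsum_diff[OF FS_finite[OF d] FS_finite[OF pm(3)]]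
        fsum_diff[OF FS_finite[OF pm(1)] FS_finite[OF pm(2)]] crep_add_left)
next
  case (add_right f \<psi> \<psi>')
  have "(\<lambda>x. vadd \<xi> (\<psi> x) (\<psi>' x)) \<in> SX" using X.section_add add_right by blast
  note pm = FS_point_mass[OF add_right(1) this] FS_point_mass[OF add_right(1,2)] FS_point_mass[OF add_right(1,3)]
  note d = FS_diff[OF pm(1,2)]
  show ?case
    using FS_diff[OF d pm(3)] add_right(2,3)
    by (simp add: fsum_diff[OF FS_finite[OF d] FS_finite[OF pm(3)]]
        fsum_diff[OF FS_finite[OF pm(1)] FS_finite[OF pm(2)]] crep_add_right)
next
  case (scale_left f \<psi> z)
  have "(\<lambda>q. z * f q) \<in> SQ"
    using scale_left Q.smooth_fun_on_mult[OF Q.smooth_fun_on_const] unfolding smooth_fun_space_def by blast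
  note pm = FS_point_mass[OF this scale_left(2)] FS_point_mass[OF scale_left(1,2)]
  note d = FS_scale[OF pm(2), of z]
  show ?case
    using FS_diff[OF pm(1) d] scale_left(2)
    by (simp add: fsum_diff[OF FS_finite[OF pm(1)] FS_finite[OF d]]
        fsum_scale[OF FS_finite[OF pm(2)]] crep_scale_left)
next
  case (scale_right f \<psi> z)
  have "(\<lambda>x. vscale \<xi> z (\<psi> x)) \<in> SX"
    using X.section_mult[OF scale_right(2) X.smooth_fun_on_const[of _ z]] .
  note pm = FS_point_mass[OF scale_right(1) this] FS_point_mass[OF scale_right(1,2)]
  note d = FS_scale[OF pm(2), of z]
  show ?case
    using FS_diff[OF pm(1) d] scale_right(2)
    by (simp add: fsum_diff[OF FS_finite[OF pm(1)] FS_finite[OF d]]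
        fsum_scale[OF FS_finite[OF pm(2)]] crep_scale_right)
next
  case (balance f a \<psi>)
  note pm = FS_point_mass[OF fun_ract_SQ[OF balance(1,2)] balance(3)]
    FS_point_mass[OF balance(1) X.sec_act_section[OF balance(2,3)]]
  show ?case
    using FS_diff[OF pm] balance
    by (simp add: fsum_diff[OF FS_finite[OF pm(1)] FS_finite[OF pm(2)]] crep_balanced)
qed

sublocale FQ: quotient_vec_space FS TR
proof -
  interpret vec_space FS by (rule vec_space_FS)
  show "quotient_vec_space FS TR"
  proof unfold_locales
    show "TR \<subseteq> vecs FS" using TR_null by blast
    show "zero_in FS \<in> TR" using tensor_relations.zero by simp
    show "plus_in FS m n \<in> TR" if "m \<in> TR" "n \<in> TR" for m n
      using tensor_relations.lincomb[OF that, of 1] by simp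
    show "scale_in FS z n \<in> TR" if "n \<in> TR" for n z
      using tensor_relations.lincomb[OF that tensor_relations.zero, of z] by simp
  qed
qed

subsection \<open>The image of a formal combination\<close>

definition frep :: "(('q \<Rightarrow> complex) \<times> ('x \<Rightarrow> 'u) \<Rightarrow> complex) \<Rightarrow> 'q \<Rightarrow> 'u" where
  "frep r q = fibre_sum \<xi> (\<rho> q) (\<lambda>p. vscale \<xi> (r p) (crep (fst p) (snd p) q)) {p. r p \<noteq> 0}"

definition fimage :: "(('q \<Rightarrow> complex) \<times> ('x \<Rightarrow> 'u) \<Rightarrow> complex) \<Rightarrow> 'y \<Rightarrow> ('q \<times> 'u) set" where
  "fimage r y = cl (over \<phi> y) (frep r (over \<phi> y))"

lemma frep_in: "r \<in> vecs FS \<Longrightarrow> frep r q \<in> fibre \<xi> (\<rho> q)"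
  unfolding frep_def by (rule X.fibre_sum_in) (simp add: FS_memb)

lemma functional_frep:
  assumes "r \<in> vecs FS" "functional \<xi> (\<rho> q) h"
  shows "h (frep r q) = fsum r (\<lambda>p. h (crep (fst p) (snd p) q))"
  unfolding frep_def fsum_def
  by (subst X.functional_sum[OF assms(2) FS_finite[OF assms(1)]])
    (auto intro!: sum.cong simp: X.functionalD[OF assms(2)] FS_memb[OF assms(1)])

lemma frep_R:
  assumes r: "r \<in> vecs FS" and g: "g \<in> X.G"
  shows "frep r (R g q) = rho \<xi> (X.ginv g, \<rho> q) (frep r q)"
proof (rule X.fibre_eqI[where x = "\<rho> (R g q)"])
  show "frep r (R g q) \<in> fibre \<xi> (\<rho> (R g q))" by (rule frep_in[OF r])
  show "rho \<xi> (X.ginv g, \<rho> q) (frep r q) \<in> fibre \<xi> (\<rho> (R g q))" using g frep_in[OF r] by simp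
  fix h assume h: "functional \<xi> (\<rho> (R g q)) h"
  have "h (rho \<xi> (X.ginv g, \<rho> q) (frep r q)) = fsum r (\<lambda>p. h (rho \<xi> (X.ginv g, \<rho> q) (crep (fst p) (snd p) q)))"
    by (rule functional_frep[OF r functional_rho_inv[OF g h]])
  also have "\<dots> = fsum r (\<lambda>p. h (crep (fst p) (snd p) (R g q)))"
    unfolding fsum_def using FS_memb[OF r] crep_R[OF g] by (intro sum.cong) auto
  finally show "h (frep r (R g q)) = h (rho \<xi> (X.ginv g, \<rho> q) (frep r q))"
    using functional_frep[OF r h] by simp
qed

lemma
  assumes r: "r \<in> vecs FS"
  shows fimage_in: "fimage r y \<in> fibre E y"
    and rep_fimage: "rep_at q (fimage r (\<alpha> q)) = frep r q"
proof -
  show "fimage r y \<in> fibre E y" unfolding fimage_def using cl_in[OF frep_in[OF r], of "over \<phi> y"] by simp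
  obtain g where g: "g \<in> X.G" "q = R g (over \<phi> (\<alpha> q))" by (rule over_R)
  have "rep_at (R g (over \<phi> (\<alpha> q))) (fimage r (\<alpha> q)) = frep r (R g (over \<phi> (\<alpha> q)))"
    unfolding fimage_def rep_cl_R[OF g(1)] frep_R[OF r g(1)] ..
  then show "rep_at q (fimage r (\<alpha> q)) = frep r q" using g(2) by simp
qed

lemma fimage_eqI:
  assumes "\<And>y. \<eta> y \<in> fibre E y" "\<And>y. \<eta>' y \<in> fibre E y"
    and "\<And>q h. functional \<xi> (\<rho> q) h \<Longrightarrow> h (rep_at q (\<eta> (\<alpha> q))) = h (rep_at q (\<eta>' (\<alpha> q)))"
  shows "\<eta> = \<eta>'"
proof
  fix y
  obtain q where q: "\<alpha> q = y" by (rule obtain_\<alpha>)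
  have z: "\<eta> (\<alpha> q) \<in> fibre E (\<alpha> q)" "\<eta>' (\<alpha> q) \<in> fibre E (\<alpha> q)" using assms(1,2) by blast+
  have "rep_at q (\<eta> (\<alpha> q)) = rep_at q (\<eta>' (\<alpha> q))"
    by (rule X.fibre_eqI[OF rep_in[OF z(1)] rep_in[OF z(2)] assms(3)])
  then show "\<eta> y = \<eta>' y" using rep_eqI[OF z] q by simp
qed

lemma fimage_section:
  assumes r: "r \<in> vecs FS" shows "fimage r \<in> SY"
proof (rule induced_sectionI[OF fimage_in[OF r]])
  fix U s \<Phi> i assume T: "(U, s, \<Phi>) \<in> trivs \<xi>" "i < s"
  have "smooth_fun_on QA (\<rho> -` U) (\<lambda>q. fsum r (\<lambda>p. \<Phi> (crep (fst p) (snd p) q) i))"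
    unfolding fsum_def using FS_memb[OF r] T
    by (intro Q.smooth_fun_on_sum Q.smooth_fun_on_mult Q.smooth_fun_on_const crep_smooth) auto
  then show "smooth_fun_on QA (\<rho> -` U) (\<lambda>q. \<Phi> (rep_at q (fimage r (\<alpha> q))) i)"
    by (rule Q.smooth_fun_on_cong) (simp add: rep_fimage[OF r] functional_frep[OF r X.functional_triv[OF T(1)]])
qed

lemma fimage_cong:
  assumes r: "r \<in> vecs FS" "r' \<in> vecs FS" and eq: "FQ.cls r = FQ.cls r'"
  shows "fimage r = fimage r'"
proof (rule fimage_eqI[OF fimage_in[OF r(1)] fimage_in[OF r(2)]])
  fix q h assume h: "functional \<xi> (\<rho> q) h"
  have "diff_in FS r r' \<in> TR" using FQ.coset_eq_iff[OF r] eq by simp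
  then have "(\<lambda>p. r p - r' p) \<in> TR" by (simp add: diff_in_def)
  then have "fsum (\<lambda>p. r p - r' p) (\<lambda>p. h (crep (fst p) (snd p) q)) = 0" using TR_null h by blast
  then show "h (rep_at q (fimage r (\<alpha> q))) = h (rep_at q (fimage r' (\<alpha> q)))"
    using r h by (simp add: rep_fimage functional_frep fsum_diff FS_finite)
qed

definition chi :: "(('q \<Rightarrow> complex) \<times> ('x \<Rightarrow> 'u) \<Rightarrow> complex) set \<Rightarrow> 'y \<Rightarrow> ('q \<times> 'u) set" where
  "chi a = fimage (some_rep a)"

abbreviation "TS \<equiv> tensor_space V \<Theta> \<Xi> \<phi> \<xi> \<nu>"

lemma chi_cls: "r \<in> vecs FS \<Longrightarrow> chi (FQ.cls r) = fimage r"
  unfolding chi_def by (rule fimage_cong) (auto simp: FQ.rep_closed FQ.coset_rep)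

lemma chi_linear: "linear_in TS EM.Sec chi"
  unfolding linear_in_def tensor_space_def
proof (intro conjI ballI allI subsetI)
  fix \<eta> assume "\<eta> \<in> chi ` vecs (quotient_space FS TR)"
  then show "\<eta> \<in> vecs EM.Sec" unfolding FQ.vecs_quotient by (auto simp: chi_cls fimage_section)
next
  fix a b assume "a \<in> vecs (quotient_space FS TR)" "b \<in> vecs (quotient_space FS TR)"
  then obtain r s where r: "r \<in> vecs FS" "s \<in> vecs FS" "a = FQ.cls r" "b = FQ.cls s"
    unfolding FQ.vecs_quotient by blast
  have rs: "(\<lambda>p. 1 * r p + s p) \<in> vecs FS" using FS_lincomb[OF r(1,2)] .
  have "fimage (\<lambda>p. 1 * r p + s p) = (\<lambda>y. vadd E (fimage r y) (fimage s y))"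
  proof (rule fimage_eqI)
    fix q h assume h: "functional \<xi> (\<rho> q) h"
    show "h (rep_at q (fimage (\<lambda>p. 1 * r p + s p) (\<alpha> q))) = h (rep_at q (vadd E (fimage r (\<alpha> q)) (fimage s (\<alpha> q))))"
      using vadd_E[OF fimage_in[OF r(1)] fimage_in[OF r(2)], of q] h r X.functionalD(1)[OF h] frep_in
        fsum_lincomb[OF FS_finite[OF r(1)] FS_finite[OF r(2)], of 1] functional_frep[OF rs h] rep_fimage[OF rs]
      by (simp add: rep_fimage functional_frep)
  qed (use rs r in \<open>auto intro!: fimage_in E.vadd_in\<close>)
  then show "chi (plus_in (quotient_space FS TR) a b) = plus_in EM.Sec (chi a) (chi b)"
    using r rs by (simp add: FQ.plus_quotient chi_cls)
next
  fix a z assume "a \<in> vecs (quotient_space FS TR)"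
  then obtain r where r: "r \<in> vecs FS" "a = FQ.cls r" unfolding FQ.vecs_quotient by blast
  have rs: "(\<lambda>p. z * r p + 0) \<in> vecs FS" using FS_lincomb[OF r(1) FS_zero] .
  have "fimage (\<lambda>p. z * r p + 0) = (\<lambda>y. vscale E z (fimage r y))"
  proof (rule fimage_eqI)
    fix q h assume h: "functional \<xi> (\<rho> q) h"
    show "h (rep_at q (fimage (\<lambda>p. z * r p + 0) (\<alpha> q))) = h (rep_at q (vscale E z (fimage r (\<alpha> q))))"
      using vscale_E[OF fimage_in[OF r(1)], of z q] h r X.functionalD(2)[OF h frep_in[OF r(1)]]
        fsum_lincomb[OF FS_finite[OF r(1)] FS_finite[OF FS_zero], of z] functional_frep[OF rs h] rep_fimage[OF rs]
      by (simp add: rep_fimage functional_frep)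
  qed (use rs r in \<open>auto intro!: fimage_in E.vscale_in\<close>)
  then show "chi (scale_in (quotient_space FS TR) z a) = scale_in EM.Sec z (chi a)"
    using r rs by (simp add: FQ.scale_quotient chi_cls)
qed

subsection \<open>Inner products\<close>

lemma herm_crep:
  assumes \<psi>: "\<psi> \<in> SX" and w: "w \<in> fibre \<xi> (\<rho> q)"
  shows "herm \<xi> (crep f \<psi> q) w = mass \<Theta> * (\<Sum>g\<in>X.G. f (R g q) * herm \<xi> (X.trans_sec g \<psi> (\<rho> q)) w)"
  by (rule functional_crep[OF \<psi> X.functional_herm[OF w]])

text \<open>The function on \<open>Q\<close> whose integral is, up to normalisation, both inner products.\<close>

definition overlap :: "('q \<Rightarrow> complex) \<times> ('x \<Rightarrow> 'u) \<Rightarrow> ('q \<Rightarrow> complex) \<times> ('x \<Rightarrow> 'u) \<Rightarrow> 'q \<Rightarrow> complex" where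
  "overlap p1 p2 q = cnj (fst p2 q) * herm \<xi> (crep (fst p1) (snd p1) q) (snd p2 (\<rho> q))"

lemma overlap_continuous:
  assumes "p1 \<in> SQ \<times> SX" "p2 \<in> SQ \<times> SX"
  shows "continuous_on UNIV (overlap p1 p2)"
proof -
  have p: "fst p1 \<in> SQ" "snd p1 \<in> SX" "fst p2 \<in> SQ" "snd p2 \<in> SX" using assms by auto
  have 1: "continuous_on UNIV (fst p2)"
    using Q.smooth_fun_on_continuous p(3) unfolding smooth_fun_space_def by blast
  have 2: "continuous_on UNIV (\<lambda>q. fst p1 (R g q))" if "g \<in> X.G" for g
    using Q.smooth_fun_on_continuous[OF SQ_R[OF p(1) that]] by simp
  have 3: "continuous_on UNIV (\<lambda>q. herm \<xi> (X.trans_sec g (snd p1) (\<rho> q)) (snd p2 (\<rho> q)))" if "g \<in> X.G" for g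
    by (rule continuous_on_compose2[OF X.herm_sections_continuous[OF X.section_translate[OF that p(2)] p(4)] cont_\<rho>]) simp
  have "overlap p1 p2 = (\<lambda>q. cnj (fst p2 q) * (mass \<Theta> * (\<Sum>g\<in>X.G. fst p1 (R g q) *
      herm \<xi> (X.trans_sec g (snd p1) (\<rho> q)) (snd p2 (\<rho> q)))))"
    unfolding overlap_def[abs_def] using herm_crep[OF p(2)] p(4) by simp
  then show ?thesis using 1 2 3 by (auto intro!: continuous_intros)
qed

text \<open>The pairing is defined with an arbitrary point \<open>q\<close> above \<open>x\<close>; the sum over the \<open>K\<close>-orbit of \<open>q\<close> is
  one over the whole fibre of \<open>\<rho>\<close>.\<close>

lemma pairing_eq:
  assumes g: "g \<in> X.G"
  shows "pairing \<Theta> \<Xi> \<phi> f f' (X.into g x) = mass \<Xi> * (\<Sum>q | \<rho> q = x. cnj (f q) * f' (R g q))"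
proof -
  let ?q = "SOME q. \<rho> q = x"
  obtain q0 where "\<rho> q0 = x" by (rule obtain_\<rho>)
  then have q: "\<rho> ?q = x" by (rule someI)
  have "pairing \<Theta> \<Xi> \<phi> f f' (X.into g x) = mass \<Xi> * (\<Sum>k\<in>Y.G.
      cnj (f (lact \<phi> (inv_arrow \<Xi> (Y.into k (\<alpha> ?q))) ?q)) *
      f' (ract \<phi> (lact \<phi> (inv_arrow \<Xi> (Y.into k (\<alpha> ?q))) ?q) (X.into g x)))"
    unfolding pairing_def Let_def using g by (simp add: Y.sum_arrows_into)
  also have "(\<Sum>k\<in>Y.G. cnj (f (lact \<phi> (inv_arrow \<Xi> (Y.into k (\<alpha> ?q))) ?q)) *
      f' (ract \<phi> (lact \<phi> (inv_arrow \<Xi> (Y.into k (\<alpha> ?q))) ?q) (X.into g x))) =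
      (\<Sum>k\<in>Y.G. cnj (f (L (Y.ginv k) ?q)) * f' (R g (L (Y.ginv k) ?q)))"
  proof (rule sum.cong[OF refl])
    fix k assume k: "k \<in> Y.G"
    have l: "lact \<phi> (inv_arrow \<Xi> (Y.into k (\<alpha> ?q))) ?q = L (Y.ginv k) ?q" using k by (simp add: L_def)
    have "\<rho> (L (Y.ginv k) ?q) = x" using q k by simp
    then have "ract \<phi> (L (Y.ginv k) ?q) (X.into g x) = R g (L (Y.ginv k) ?q)" by (simp add: R_def)
    then show "cnj (f (lact \<phi> (inv_arrow \<Xi> (Y.into k (\<alpha> ?q))) ?q)) *
      f' (ract \<phi> (lact \<phi> (inv_arrow \<Xi> (Y.into k (\<alpha> ?q))) ?q) (X.into g x)) =
      cnj (f (L (Y.ginv k) ?q)) * f' (R g (L (Y.ginv k) ?q))" unfolding l by simp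
  qed
  also have "\<dots> = (\<Sum>k\<in>Y.G. cnj (f (L k ?q)) * f' (R g (L k ?q)))"
    by (rule Y.sum_inverse[of "\<lambda>k. cnj (f (L k ?q)) * f' (R g (L k ?q))"])
  also have "\<dots> = (\<Sum>q | \<rho> q = \<rho> ?q. cnj (f q) * f' (R g q))"
    by (rule sum_fibre_\<rho>[where f = "\<lambda>q. cnj (f q) * f' (R g q)", symmetric])
  finally show ?thesis unfolding q .
qed

lemma herm_pairing:
  assumes "p1 \<in> SQ \<times> SX" "p2 \<in> SQ \<times> SX"
  shows "herm \<xi> (sec_act \<Theta> \<xi> (pairing \<Theta> \<Xi> \<phi> (fst p2) (fst p1)) (snd p1) x) (snd p2 x) =
    mass \<Xi> * (\<Sum>q | \<rho> q = x. overlap p1 p2 q)"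
proof -
  have p: "snd p1 \<in> SX" "snd p2 \<in> SX" using assms by auto
  let ?t = "\<lambda>g q. cnj (fst p2 q) * fst p1 (R g q) * herm \<xi> (X.trans_sec g (snd p1) x) (snd p2 x)"
  have "herm \<xi> (sec_act \<Theta> \<xi> (pairing \<Theta> \<Xi> \<phi> (fst p2) (fst p1)) (snd p1) x) (snd p2 x) =
      mass \<Theta> * (\<Sum>g\<in>X.G. pairing \<Theta> \<Xi> \<phi> (fst p2) (fst p1) (X.into g x) * herm \<xi> (X.trans_sec g (snd p1) x) (snd p2 x))"
    using X.functional_sec_act[OF p(1) X.functional_herm] p(2) by simp
  also have "\<dots> = mass \<Theta> * (\<Sum>g\<in>X.G. mass \<Xi> * (\<Sum>q | \<rho> q = x. ?t g q))"
    by (simp add: pairing_eq sum_distrib_right mult.assoc)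
  also have "\<dots> = mass \<Xi> * (mass \<Theta> * (\<Sum>g\<in>X.G. \<Sum>q | \<rho> q = x. ?t g q))"
    by (simp add: sum_distrib_left[symmetric])
  also have "(\<Sum>g\<in>X.G. \<Sum>q | \<rho> q = x. ?t g q) = (\<Sum>q | \<rho> q = x. \<Sum>g\<in>X.G. ?t g q)" by (rule sum.swap)
  also have "mass \<Theta> * \<dots> = (\<Sum>q | \<rho> q = x. overlap p1 p2 q)"
    unfolding sum_distrib_left
  proof (rule sum.cong[OF refl])
    fix q assume "q \<in> {q. \<rho> q = x}"
    then have q: "\<rho> q = x" by simp
    have "herm \<xi> (crep (fst p1) (snd p1) q) (snd p2 x) =
        mass \<Theta> * (\<Sum>g\<in>X.G. fst p1 (R g q) * herm \<xi> (X.trans_sec g (snd p1) x) (snd p2 x))"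
      using herm_crep[OF p(1), of "snd p2 (\<rho> q)" q "fst p1"] p(2) q by simp
    then show "(\<Sum>g\<in>X.G. mass \<Theta> * ?t g q) = overlap p1 p2 q"
      unfolding overlap_def q by (simp add: sum_distrib_left mult_ac)
  qed
  finally show ?thesis .
qed

text \<open>Expand the second argument as a sum over \<open>G\<close>. The metric is invariant and the representative at
  \<open>q \<cdot> g\<close> is the one at \<open>q\<close> moved by \<open>g\<^sup>-\<^sup>1\<close>, so the summand of \<open>g\<close> is the value of one function at
  \<open>q \<cdot> g\<close>, and these points run through the fibre of \<open>\<alpha>\<close>.\<close>

lemma herm_crep_crep:
  assumes "p1 \<in> SQ \<times> SX" "p2 \<in> SQ \<times> SX"
  shows "herm \<xi> (crep (fst p1) (snd p1) q) (crep (fst p2) (snd p2) q) =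
    mass \<Theta> * (\<Sum>q' | \<alpha> q' = \<alpha> q. overlap p1 p2 q')"
proof -
  have p: "snd p1 \<in> SX" "snd p2 \<in> SX" using assms by auto
  let ?c1 = "crep (fst p1) (snd p1)" and ?c2 = "crep (fst p2) (snd p2)"
  have m: "cnj (mass \<Theta>) = mass \<Theta>" by (simp add: mass_def)
  have "herm \<xi> (?c1 q) (?c2 q) = cnj (herm \<xi> (?c2 q) (?c1 q))"
    using X.herm_commute[OF crep_in[OF p(2)] crep_in[OF p(1)]] .
  also have "\<dots> = mass \<Theta> * (\<Sum>g\<in>X.G. cnj (fst p2 (R g q)) * cnj (herm \<xi> (X.trans_sec g (snd p2) (\<rho> q)) (?c1 q)))"
    using herm_crep[OF p(2) crep_in[OF p(1)]] by (simp add: m)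
  also have "\<dots> = mass \<Theta> * (\<Sum>g\<in>X.G. overlap p1 p2 (R g q))"
  proof (intro arg_cong[where f = "\<lambda>s. mass \<Theta> * s"] sum.cong refl)
    fix g assume g: "g \<in> X.G"
    let ?w = "snd p2 (\<rho> (R g q))"
    have w: "?w \<in> fibre \<xi> (act \<Theta> (X.ginv g) (\<rho> q))" using p(2) g by simp
    have c: "?c1 (R g q) \<in> fibre \<xi> (act \<Theta> (X.ginv g) (\<rho> q))" using crep_in[OF p(1), of "fst p1" "R g q"] g by simp
    have "rho \<xi> (X.into g (\<rho> q)) (?c1 (R g q)) = ?c1 q"
      unfolding crep_R[OF g p(1)] by (rule X.rho_inverse(3)[OF g crep_in[OF p(1)]])
    then have "herm \<xi> (X.trans_sec g (snd p2) (\<rho> q)) (?c1 q) = herm \<xi> ?w (?c1 (R g q))"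
      unfolding X.trans_sec_def using X.herm_rho_into[OF g w c] g by simp
    then have "cnj (herm \<xi> (X.trans_sec g (snd p2) (\<rho> q)) (?c1 q)) = herm \<xi> (?c1 (R g q)) ?w"
      using X.herm_commute[OF w c] by simp
    then show "cnj (fst p2 (R g q)) * cnj (herm \<xi> (X.trans_sec g (snd p2) (\<rho> q)) (?c1 q)) = overlap p1 p2 (R g q)"
      unfolding overlap_def by simp
  qed
  also have "(\<Sum>g\<in>X.G. overlap p1 p2 (R g q)) = (\<Sum>q' | \<alpha> q' = \<alpha> q. overlap p1 p2 q')"
    by (rule sum_fibre_\<alpha>[symmetric])
  finally show ?thesis .
qed

definition scale_factor :: real where "scale_factor = real (card Y.G) / real (card X.G)"

lemma scale_factor_pos: "scale_factor > 0"
  using X.card_G_pos Y.card_G_pos by (simp add: scale_factor_def)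

text \<open>With fibre integration, the two inner products differ by the constant factor that compares
  the normalisations of the sums over the two groups.\<close>

lemma fimage_inner:
  assumes r: "r \<in> vecs FS" and s: "s \<in> vecs FS"
  shows "inner_in EM.Sec (fimage r) (fimage s) = of_real scale_factor * inner_in FS r s"
proof -
  let ?P = "{p. r p \<noteq> 0}" and ?P' = "{p. s p \<noteq> 0}"
  have P: "finite ?P" "?P \<subseteq> SQ \<times> SX" and P': "finite ?P'" "?P' \<subseteq> SQ \<times> SX"
    using r s unfolding FS_iff by auto
  let ?c = "\<lambda>p. crep (fst p) (snd p)"
  let ?I = "\<lambda>p1 p2 y. \<Sum>q | \<alpha> q = y. overlap p1 p2 q"
  have pt: "herm E (fimage r y) (fimage s y) = (\<Sum>p1\<in>?P. \<Sum>p2\<in>?P'. r p1 * cnj (s p2) * (mass \<Theta> * ?I p1 p2 y))" for y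
  proof -
    obtain q where q: "\<alpha> q = y" by (rule obtain_\<alpha>)
    have c: "?c p q \<in> fibre \<xi> (\<rho> q)" if "p \<in> SQ \<times> SX" for p using that by auto
    have "herm E (fimage r y) (fimage s y) = herm \<xi> (frep r q) (frep s q)"
      using herm_E[OF fimage_in[OF r] fimage_in[OF s], of q] rep_fimage[OF r, of q] rep_fimage[OF s, of q] q by simp
    also have "\<dots> = (\<Sum>p1\<in>?P. r p1 * herm \<xi> (?c p1 q) (frep s q))"
      using functional_frep[OF r X.functional_herm[OF frep_in[OF s]]] unfolding fsum_def .
    also have "\<dots> = (\<Sum>p1\<in>?P. \<Sum>p2\<in>?P'. r p1 * cnj (s p2) * (mass \<Theta> * ?I p1 p2 y))"
    proof (rule sum.cong[OF refl])
      fix p1 assume p1: "p1 \<in> ?P"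
      then have p1': "p1 \<in> SQ \<times> SX" using P by blast
      have "herm \<xi> (?c p1 q) (frep s q) = cnj (herm \<xi> (frep s q) (?c p1 q))"
        using X.herm_commute[OF frep_in[OF s] c[OF p1']] .
      also have "\<dots> = (\<Sum>p2\<in>?P'. cnj (s p2) * cnj (herm \<xi> (?c p2 q) (?c p1 q)))"
        using functional_frep[OF s X.functional_herm[OF c[OF p1']]] unfolding fsum_def by simp
      also have "\<dots> = (\<Sum>p2\<in>?P'. cnj (s p2) * (mass \<Theta> * ?I p1 p2 y))"
      proof (rule sum.cong[OF refl])
        fix p2 assume "p2 \<in> ?P'"
        then have p2': "p2 \<in> SQ \<times> SX" using P' by blast
        show "cnj (s p2) * cnj (herm \<xi> (?c p2 q) (?c p1 q)) = cnj (s p2) * (mass \<Theta> * ?I p1 p2 y)"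
          using X.herm_commute[OF c[OF p2'] c[OF p1']] herm_crep_crep[OF p1' p2', of q] q by simp
      qed
      finally show "r p1 * herm \<xi> (?c p1 q) (frep s q) = (\<Sum>p2\<in>?P'. r p1 * cnj (s p2) * (mass \<Theta> * ?I p1 p2 y))"
        by (simp add: sum_distrib_left mult.assoc)
    qed
    finally show ?thesis .
  qed
  have int: "(\<integral>x. herm \<xi> (sec_act \<Theta> \<xi> (pairing \<Theta> \<Xi> \<phi> (fst p2) (fst p1)) (snd p1) x) (snd p2 x) \<partial>MX) =
      mass \<Xi> * (\<integral>y. ?I p1 p2 y \<partial>MY)" if "p1 \<in> SQ \<times> SX" "p2 \<in> SQ \<times> SX" for p1 p2
    using fibre_integrals_agree[OF overlap_continuous[OF that]] herm_pairing[OF that] by simp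
  have integrable: "integrable MY (?I p1 p2)" if p: "p1 \<in> SQ \<times> SX" "p2 \<in> SQ \<times> SX" for p1 p2
  proof -
    have pm: "point_mass p1 \<in> vecs FS" "point_mass p2 \<in> vecs FS"
      using FS_point_mass[of "fst p1" "snd p1"] FS_point_mass[of "fst p2" "snd p2"] p by auto
    have "herm E (fimage (point_mass p1) y) (fimage (point_mass p2) y) = mass \<Theta> * ?I p1 p2 y" for y
    proof -
      obtain q where q: "\<alpha> q = y" by (rule obtain_\<alpha>)
      have c: "?c p1 q \<in> fibre \<xi> (\<rho> q)" "?c p2 q \<in> fibre \<xi> (\<rho> q)" using p by auto
      have "frep (point_mass p) q = ?c p q" if "p \<in> SQ \<times> SX" "point_mass p \<in> vecs FS" for p
      proof (rule X.fibre_eqI[OF frep_in[OF that(2)]])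
        show "?c p q \<in> fibre \<xi> (\<rho> q)" using that(1) by auto
        show "h (frep (point_mass p) q) = h (?c p q)" if "functional \<xi> (\<rho> q) h" for h
          using functional_frep[OF \<open>point_mass p \<in> vecs FS\<close> that] by simp
      qed
      then show ?thesis
        using herm_E[OF fimage_in[OF pm(1)] fimage_in[OF pm(2)], of q] rep_fimage[OF pm(1), of q]
          rep_fimage[OF pm(2), of q] herm_crep_crep[OF p, of q] p pm q by simp
    qed
    then have i: "integrable MY (\<lambda>y. mass \<Theta> * ?I p1 p2 y)"
      using EM.herm_integrable[OF fimage_section[OF pm(1)] fimage_section[OF pm(2)]] by simp
    have "mass \<Theta> \<noteq> 0" using X.card_G_pos by (simp add: mass_def)
    then have "(\<lambda>y. inverse (mass \<Theta>) * (mass \<Theta> * ?I p1 p2 y)) = ?I p1 p2"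
      by (simp add: mult.assoc[symmetric])
    moreover have "integrable MY (\<lambda>y. inverse (mass \<Theta>) * (mass \<Theta> * ?I p1 p2 y))"
      by (rule Bochner_Integration.integrable_mult_right) (rule i)
    ultimately show ?thesis by (simp only:)
  qed
  have "inner_in EM.Sec (fimage r) (fimage s) =
      (\<integral>y. (\<Sum>p1\<in>?P. \<Sum>p2\<in>?P'. r p1 * cnj (s p2) * (mass \<Theta> * ?I p1 p2 y)) \<partial>MY)"
    unfolding EM.Sec_simps by (rule Bochner_Integration.integral_cong[OF refl pt])
  also have "\<dots> = (\<Sum>p1\<in>?P. \<integral>y. (\<Sum>p2\<in>?P'. r p1 * cnj (s p2) * (mass \<Theta> * ?I p1 p2 y)) \<partial>MY)"
    by (rule Bochner_Integration.integral_sum)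
      (intro Bochner_Integration.integrable_sum integrable_mult_right integrable; use P P' in blast)
  also have "\<dots> = (\<Sum>p1\<in>?P. \<Sum>p2\<in>?P'. \<integral>y. r p1 * cnj (s p2) * (mass \<Theta> * ?I p1 p2 y) \<partial>MY)"
    by (rule sum.cong[OF refl], rule Bochner_Integration.integral_sum)
      (intro integrable_mult_right integrable; use P P' in blast)
  also have "\<dots> = (\<Sum>p1\<in>?P. \<Sum>p2\<in>?P'. of_real scale_factor * (r p1 * cnj (s p2) *
      (\<integral>x. herm \<xi> (sec_act \<Theta> \<xi> (pairing \<Theta> \<Xi> \<phi> (fst p2) (fst p1)) (snd p1) x) (snd p2 x) \<partial>MX)))"
  proof (intro sum.cong refl)
    fix p1 p2 assume "p1 \<in> ?P" "p2 \<in> ?P'"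
    then have p: "p1 \<in> SQ \<times> SX" "p2 \<in> SQ \<times> SX" using P P' by blast+
    have "mass \<Theta> = of_real scale_factor * mass \<Xi>"
      using Y.card_G_pos by (simp add: mass_def scale_factor_def)
    then show "(\<integral>y. r p1 * cnj (s p2) * (mass \<Theta> * ?I p1 p2 y) \<partial>MY) = of_real scale_factor * (r p1 * cnj (s p2) *
      (\<integral>x. herm \<xi> (sec_act \<Theta> \<xi> (pairing \<Theta> \<Xi> \<phi> (fst p2) (fst p1)) (snd p1) x) (snd p2 x) \<partial>MX))"
      unfolding int[OF p] by (simp add: mult_ac)
  qed
  also have "\<dots> = of_real scale_factor * inner_in FS r s"
    by (simp add: formal_space_def sum_distrib_left)
  finally show ?thesis .
qed

lemma chi_inner:
  assumes "a \<in> vecs TS" "b \<in> vecs TS"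
  shows "inner_in EM.Sec (chi a) (chi b) = of_real scale_factor * inner_in TS a b"
proof -
  obtain r s where r: "r \<in> vecs FS" "s \<in> vecs FS" "a = FQ.cls r" "b = FQ.cls s"
    using assms unfolding tensor_space_def FQ.vecs_quotient by blast
  have "some_rep a \<in> vecs FS" "some_rep b \<in> vecs FS" using FQ.rep_closed r by auto
  from fimage_inner[OF this] show ?thesis unfolding chi_def by (simp add: tensor_space_def quotient_space_def)
qed

lemma semi_inner_TS: "semi_inner TS"
  by (rule semi_inner_via[OF _ EM.semi_inner_Sec chi_linear scale_factor_pos chi_inner])
    (auto simp: tensor_space_def FQ.vec_space_quotient)

subsection \<open>Surjectivity\<close>

text \<open>The product of a section of the induced bundle with a bump function on \<open>Q\<close>, moved to \<open>X\<close> along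
  a local inverse of \<open>\<rho>\<close>.\<close>

lemma transported_section:
  assumes U: "open U" "inj_on \<rho> U" and f: "smooth_fun_on QA UNIV f" and K: "compact K" "K \<subseteq> U"
    and f0: "\<And>q. q \<notin> K \<Longrightarrow> f q = 0" and \<eta>: "\<eta> \<in> SY"
  obtains \<psi> where "\<psi> \<in> SX" "\<And>q. q \<in> U \<Longrightarrow> \<psi> (\<rho> q) = vscale \<xi> (f q) (rep_at q (\<eta> (\<alpha> q)))"
proof -
  define s where "s q = vscale \<xi> (f q) (rep_at q (\<eta> (\<alpha> q)))" for q
  have \<eta>E: "\<eta> (\<alpha> q) \<in> fibre E (\<alpha> q)" for q using E.section_in[OF \<eta>] .
  have s_in: "s q \<in> fibre \<xi> (\<rho> q)" for q unfolding s_def using rep_in[OF \<eta>E] by simp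
  define \<psi> where "\<psi> x = (if x \<in> \<rho> ` U then s (inv_into U \<rho> x) else vzero \<xi> x)" for x
  have \<psi>\<rho>: "\<psi> (\<rho> q) = s q" if "q \<in> U" for q using that U(2) by (simp add: \<psi>_def)
  have zero: "\<psi> x = vzero \<xi> x" if "x \<notin> \<rho> ` K" for x
  proof (cases "x \<in> \<rho> ` U")
    case True
    then obtain q where q: "q \<in> U" "x = \<rho> q" by blast
    then have "q \<notin> K" using that by blast
    then show ?thesis using \<psi>\<rho>[OF q(1)] f0 q X.vzero_eq[OF rep_in[OF \<eta>E]] by (simp add: s_def)
  qed (simp add: \<psi>_def)
  have "\<psi> \<in> SX"
  proof (rule X.sectionI)
    show "\<psi> x \<in> fibre \<xi> x" for x
      using \<psi>\<rho> s_in by (cases "x \<in> \<rho> ` U") (auto simp: \<psi>_def)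
    fix U' r \<Phi> i assume T: "(U', r, \<Phi>) \<in> trivs \<xi>" "i < r"
    show "smooth_fun_on XA U' (\<lambda>x. \<Phi> (\<psi> x) i)"
    proof (rule X.smooth_fun_on_local)
      fix x assume x: "x \<in> U'"
      show "\<exists>N. open N \<and> x \<in> N \<and> smooth_fun_on XA (U' \<inter> N) (\<lambda>x. \<Phi> (\<psi> x) i)"
      proof (cases "x \<in> \<rho> ` U")
        case True
        let ?W = "U \<inter> \<rho> -` U'"
        have oW: "open ?W" using U(1) cont_\<rho> X.triv_open[OF T(1)] by (simp add: continuous_on_open_vimage open_Int)
        have iW: "inj_on \<rho> ?W" using U(2) inj_on_subset by blast
        have "smooth_fun_on QA ?W (\<lambda>q. f q * \<Phi> (rep_at q (\<eta> (\<alpha> q))) i)"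
          by (intro Q.smooth_fun_on_mult Q.smooth_fun_on_subset[OF f] Q.smooth_fun_on_subset[OF induced_section_smooth[OF \<eta> T]]) auto
        from QX.local_diffeo_push_smooth[OF diffeo_\<rho> oW iW this]
        have "smooth_fun_on XA (U' \<inter> \<rho> ` ?W) (\<lambda>x. \<Phi> (\<psi> x) i)"
        proof (rule X.smooth_fun_on_mono_cong)
          fix z assume "z \<in> U' \<inter> \<rho> ` ?W"
          then obtain q where q: "q \<in> ?W" "z = \<rho> q" by blast
          then have "\<Phi> (\<psi> z) i = f q * \<Phi> (rep_at q (\<eta> (\<alpha> q))) i"
            using \<psi>\<rho>[of q] X.triv_scale[OF T(1) _ rep_in[OF \<eta>E], of q] by (simp add: s_def)
          then show "f (inv_into ?W \<rho> z) * \<Phi> (rep_at (inv_into ?W \<rho> z) (\<eta> (\<alpha> (inv_into ?W \<rho> z)))) i = \<Phi> (\<psi> z) i"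
            using inv_into_f_f[OF iW q(1)] q(2) by simp
        qed blast
        moreover have "x \<in> \<rho> ` ?W" using True x by blast
        ultimately show ?thesis using QX.local_diffeo_open_image[OF diffeo_\<rho> oW] by blast
      next
        case False
        have "compact (\<rho> ` K)" using K(1) cont_\<rho> continuous_on_subset by (intro compact_continuous_image) auto
        then have o: "open (- \<rho> ` K)" by (simp add: compact_imp_closed open_Compl)
        have "smooth_fun_on XA (U' \<inter> - \<rho> ` K) (\<lambda>x. \<Phi> (\<psi> x) i)"
          by (rule X.smooth_fun_on_cong[OF X.smooth_fun_on_const[of _ 0]])
            (use zero X.triv_zero[OF T(1)] in auto)
        then show ?thesis using o False K(2) by (intro exI[of _ "- \<rho> ` K"]) auto
      qed
    qed
  qed
  then show thesis using that \<psi>\<rho> unfolding s_def by blast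
qed

text \<open>Bump functions \<open>f\<^sub>i\<close> with \<open>S = \<Sum> f\<^sub>i\<^sup>2 > 0\<close> write \<open>\<eta>\<close> as the image of \<open>\<Sum> f\<^sub>i/S \<odot> \<psi>\<^sub>i\<close>, where \<open>\<psi>\<^sub>i\<close> is
  \<open>f\<^sub>i \<eta>\<close> moved to \<open>X\<close>: at \<open>q\<close> every point \<open>q \<cdot> g\<close> of the fibre contributes
  \<open>\<Sum> f\<^sub>i\<^sup>2/S = 1\<close> times the representative of \<open>\<eta>\<close>.\<close>

lemma fimage_onto:
  assumes \<eta>: "\<eta> \<in> SY" obtains r where "r \<in> vecs FS" "fimage r = \<eta>"
proof -
  have "\<exists>U f K. open U \<and> inj_on \<rho> U \<and> smooth_fun_on QA UNIV f \<and> f q > (0::real) \<and> compact K \<and> K \<subseteq> U \<and>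
      (\<forall>z. z \<notin> K \<longrightarrow> f z = 0)" for q
  proof -
    obtain U where U: "open U" "q \<in> U" "inj_on \<rho> U" using local_diffeoE[OF diffeo_\<rho>] by metis
    obtain f :: "'q \<Rightarrow> real" and K where "smooth_fun_on QA UNIV f" "f q > 0" "\<And>z. f z \<ge> 0"
      "compact K" "K \<subseteq> U" "\<And>z. z \<notin> K \<Longrightarrow> f z = 0" by (rule Q.bump_function[OF U(1,2)]) (rule that)
    then show ?thesis using U by blast
  qed
  then obtain U f K where B: "\<And>q. open (U q)" "\<And>q. inj_on \<rho> (U q)" "\<And>q. smooth_fun_on QA UNIV (f q)"
    "\<And>q. f q q > (0::real)" "\<And>q. compact (K q)" "\<And>q. K q \<subseteq> U q" "\<And>q z. z \<notin> K q \<Longrightarrow> f q z = 0" by metis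
  have fc: "continuous_on UNIV (f q)" for q using Q.smooth_fun_on_continuous[OF B(3) open_UNIV] .
  have op: "open (f q -` {0<..})" for q using fc[of q] by (simp add: continuous_on_open_vimage)
  have "UNIV \<subseteq> \<Union> (range (\<lambda>q. f q -` {0<..}))" using B(4) by fastforce
  moreover have "open c" if "c \<in> range (\<lambda>q. f q -` {0<..})" for c using that op by blast
  ultimately obtain D where D: "D \<subseteq> range (\<lambda>q. f q -` {0<..})" "finite D" "UNIV \<subseteq> \<Union> D"
    using compactE[OF compact_Q] by metis
  then obtain P where P: "finite P" "D = (\<lambda>q. f q -` {0<..}) ` P" by (metis finite_subset_image)
  define S where "S q = (\<Sum>i\<in>P. f i q * f i q)" for q
  have Spos: "S q > 0" for q
  proof -
    have "q \<in> \<Union> D" using D(3) by blast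
    then obtain i where i: "i \<in> P" "f i q > 0" unfolding P(2) by auto
    then have "0 < f i q * f i q" by simp
    also have "\<dots> \<le> S q" unfolding S_def using i(1) P(1) by (intro member_le_sum) auto
    finally show ?thesis .
  qed
  let ?fc = "\<lambda>i q. complex_of_real (f i q)"
  have fsm: "smooth_fun_on QA UNIV (?fc i)" for i
    using Q.smooth_fun_on_linear_comp[OF bounded_linear_of_real B(3)] .
  define F where "F i q = ?fc i q * inverse (complex_of_real (S q))" for i q
  have "smooth_fun_on QA UNIV S" unfolding S_def[abs_def] by (intro Q.smooth_fun_on_sum Q.smooth_fun_on_mult B(3))
  from Q.smooth_fun_on_linear_comp[OF bounded_linear_of_real this]
  have "smooth_fun_on QA UNIV (\<lambda>q. inverse (complex_of_real (S q)))"
    by (rule Q.smooth_fun_on_inverse) (use Spos in \<open>simp add: less_imp_neq[symmetric]\<close>)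
  then have FSQ: "F i \<in> SQ" for i
    unfolding F_def[abs_def] smooth_fun_space_def mem_Collect_eq by (intro Q.smooth_fun_on_mult fsm)
  have "\<exists>\<psi>. \<psi> \<in> SX \<and> (\<forall>q\<in>U i. \<psi> (\<rho> q) = vscale \<xi> (?fc i q) (rep_at q (\<eta> (\<alpha> q))))" for i
  proof -
    obtain \<psi> where "\<psi> \<in> SX" "\<And>q. q \<in> U i \<Longrightarrow> \<psi> (\<rho> q) = vscale \<xi> (?fc i q) (rep_at q (\<eta> (\<alpha> q)))"
      by (rule transported_section[OF B(1,2) fsm B(5,6) _ \<eta>, of i i]) (use B(7) in auto)
    then show ?thesis by blast
  qed
  then obtain \<psi> where \<psi>: "\<And>i. \<psi> i \<in> SX"
    "\<And>i q. q \<in> U i \<Longrightarrow> \<psi> i (\<rho> q) = vscale \<xi> (?fc i q) (rep_at q (\<eta> (\<alpha> q)))" by metis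
  define r where "r = (\<lambda>p. \<Sum>i\<in>P. 1 * point_mass (F i, \<psi> i) p)"
  have r: "r \<in> vecs FS" unfolding r_def by (rule FS_comb[OF P(1)]) (use FSQ \<psi>(1) in auto)
  have "fimage r = \<eta>"
  proof (rule fimage_eqI[OF fimage_in[OF r] E.section_in[OF \<eta>]])
    fix q h assume h: "functional \<xi> (\<rho> q) h"
    let ?u = "rep_at q (\<eta> (\<alpha> q))"
    have u: "?u \<in> fibre \<xi> (\<rho> q)" using rep_in[OF E.section_in[OF \<eta>]] .
    have contribution: "F i (R g q) * h (X.trans_sec g (\<psi> i) (\<rho> q)) = of_real (f i (R g q) * f i (R g q) / S (R g q)) * h ?u"
      if g: "g \<in> X.G" for i g
    proof (cases "R g q \<in> K i")
      case True
      then have "R g q \<in> U i" using B(6) by blast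
      note p = \<psi>(2)[OF this]
      have rr: "rep_at (R g q) (\<eta> (\<alpha> q)) = rho \<xi> (X.ginv g, \<rho> q) ?u" using rep_R[OF E.section_in[OF \<eta>] g] .
      have v: "rho \<xi> (X.ginv g, \<rho> q) ?u \<in> fibre \<xi> (act \<Theta> (X.ginv g) (\<rho> q))" using g u by simp
      have "X.trans_sec g (\<psi> i) (\<rho> q) = rho \<xi> (X.into g (\<rho> q)) (vscale \<xi> (?fc i (R g q)) (rho \<xi> (X.ginv g, \<rho> q) ?u))"
        unfolding X.trans_sec_def using p rr g by simp
      also have "\<dots> = vscale \<xi> (?fc i (R g q)) (rho \<xi> (X.into g (\<rho> q)) (rho \<xi> (X.ginv g, \<rho> q) ?u))"
        unfolding X.into_def by (rule X.rho_scale[OF g v])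
      also have "\<dots> = vscale \<xi> (?fc i (R g q)) ?u" using X.rho_inverse(3)[OF g u] by simp
      finally show ?thesis using X.functionalD(2)[OF h u] by (simp add: F_def field_simps)
    qed (simp add: F_def B(7))
    have "h (rep_at q (fimage r (\<alpha> q))) = (\<Sum>i\<in>P. h (crep (F i) (\<psi> i) q))"
      unfolding rep_fimage[OF r] functional_frep[OF r h] unfolding r_def fsum_comb(3)[OF P(1)] by simp
    also have "\<dots> = (\<Sum>i\<in>P. mass \<Theta> * (\<Sum>g\<in>X.G. of_real (f i (R g q) * f i (R g q) / S (R g q)) * h ?u))"
      using functional_crep[OF \<psi>(1) h] contribution by simp
    also have "\<dots> = mass \<Theta> * (\<Sum>i\<in>P. \<Sum>g\<in>X.G. of_real (f i (R g q) * f i (R g q) / S (R g q)) * h ?u)"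
      by (simp only: sum_distrib_left)
    also have "(\<Sum>i\<in>P. \<Sum>g\<in>X.G. of_real (f i (R g q) * f i (R g q) / S (R g q)) * h ?u) =
        (\<Sum>g\<in>X.G. \<Sum>i\<in>P. of_real (f i (R g q) * f i (R g q) / S (R g q)) * h ?u)" by (rule sum.swap)
    also have "\<dots> = (\<Sum>g\<in>X.G. h ?u)"
    proof (rule sum.cong[OF refl])
      fix g
      have "(\<Sum>i\<in>P. of_real (f i (R g q) * f i (R g q) / S (R g q)) * h ?u) =
          of_real (\<Sum>i\<in>P. f i (R g q) * f i (R g q) / S (R g q)) * h ?u"
        unfolding of_real_sum sum_distrib_right ..
      also have "(\<Sum>i\<in>P. f i (R g q) * f i (R g q) / S (R g q)) = S (R g q) / S (R g q)"
        unfolding S_def[of "R g q"] sum_divide_distrib ..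
      also have "\<dots> = 1" using Spos[of "R g q"] by simp
      finally show "(\<Sum>i\<in>P. of_real (f i (R g q) * f i (R g q) / S (R g q)) * h ?u) = h ?u" by simp
    qed
    also have "mass \<Theta> * \<dots> = h ?u" using X.card_G_pos by (simp add: mass_def)
    finally show "h (rep_at q (fimage r (\<alpha> q))) = h ?u" .
  qed
  then show thesis using that r by blast
qed

lemma chi_onto: "chi ` vecs TS = vecs EM.Sec"
proof
  show "chi ` vecs TS \<subseteq> vecs EM.Sec" using chi_linear unfolding linear_in_def by blast
  show "vecs EM.Sec \<subseteq> chi ` vecs TS"
  proof
    fix \<eta> assume "\<eta> \<in> vecs EM.Sec"
    then have "\<eta> \<in> SY" by simp
    then obtain r where r: "r \<in> vecs FS" "fimage r = \<eta>" by (rule fimage_onto)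
    then have "chi (FQ.cls r) = \<eta>" using chi_cls by simp
    moreover have "FQ.cls r \<in> vecs TS" using r unfolding tensor_space_def FQ.vecs_quotient by blast
    ultimately show "\<eta> \<in> chi ` vecs TS" by blast
  qed
qed

subsection \<open>Equivariance\<close>

lemma fun_lact_eq: "fun_lact \<Xi> \<phi> b f q = mass \<Xi> * (\<Sum>k\<in>Y.G. b (Y.into k (\<alpha> q)) * f (L (Y.ginv k) q))"
  unfolding fun_lact_def Y.sum_arrows_into L_def by simp

lemma fun_lact_SQ:
  assumes f: "f \<in> SQ" and b: "b \<in> conv_algebra \<Xi>" shows "fun_lact \<Xi> \<phi> b f \<in> SQ"
proof -
  have "smooth_fun_on QA UNIV (\<lambda>q. b (Y.into k (\<alpha> q)))" if "k \<in> Y.G" for k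
    using QY.local_diffeo_pull_smooth[OF diffeo_\<alpha> Y.conv_algebra_into_smooth[OF b that]] by simp
  then show ?thesis
    unfolding smooth_fun_space_def mem_Collect_eq fun_lact_eq[abs_def] using SQ_L[OF f]
    by (intro Q.smooth_fun_on_mult Q.smooth_fun_on_sum Q.smooth_fun_on_const) auto
qed

lemma functional_rep:
  "functional \<xi> (\<rho> q) h \<Longrightarrow> functional E (\<alpha> q) (\<lambda>z. h (rep_at q z))"
  unfolding functional_def[of E] using vadd_E[of _ q] vscale_E[of _ q]
  by (simp add: X.functionalD)

lemma sec_act_rep:
  assumes \<eta>: "\<eta> \<in> SY" and h: "functional \<xi> (\<rho> q) h"
  shows "h (rep_at q (sec_act \<Xi> E b \<eta> (\<alpha> q))) =
    mass \<Xi> * (\<Sum>k\<in>Y.G. b (Y.into k (\<alpha> q)) * h (rep_at (L (Y.ginv k) q) (\<eta> (\<alpha> (L (Y.ginv k) q)))))"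
proof -
  have "rep_at q (E.trans_sec k \<eta> (\<alpha> q)) = rep_at (L (Y.ginv k) q) (\<eta> (\<alpha> (L (Y.ginv k) q)))" if k: "k \<in> Y.G" for k
  proof -
    let ?p = "L (Y.ginv k) q"
    have "Y.into k (\<alpha> q) = (k, \<alpha> ?p)" using k by (simp add: Y.into_def)
    moreover have "L k ?p = q" using k by (simp add: L_L)
    ultimately show ?thesis
      unfolding E.trans_sec_def using rho_E_at(2)[OF E.section_in[OF \<eta>] k, of ?p] k by simp
  qed
  then show ?thesis using E.functional_sec_act[OF \<eta> functional_rep[OF h], of b] by simp
qed

text \<open>The action of \<open>K\<close> on \<open>Q\<close> commutes with that of \<open>G\<close> and preserves \<open>\<rho>\<close>, so it passes through the
  sum over \<open>G\<close>.\<close>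

lemma crep_lact:
  assumes \<psi>: "\<psi> \<in> SX" and h: "functional \<xi> (\<rho> q) h"
  shows "h (crep (fun_lact \<Xi> \<phi> b f) \<psi> q) =
    mass \<Xi> * (\<Sum>k\<in>Y.G. b (Y.into k (\<alpha> q)) * h (crep f \<psi> (L (Y.ginv k) q)))"
proof -
  let ?t = "\<lambda>g k. b (Y.into k (\<alpha> q)) * f (R g (L (Y.ginv k) q)) * h (X.trans_sec g \<psi> (\<rho> q))"
  have "h (crep (fun_lact \<Xi> \<phi> b f) \<psi> q) = mass \<Theta> * (\<Sum>g\<in>X.G. fun_lact \<Xi> \<phi> b f (R g q) * h (X.trans_sec g \<psi> (\<rho> q)))"
    by (rule functional_crep[OF \<psi> h])
  also have "\<dots> = mass \<Theta> * (\<Sum>g\<in>X.G. mass \<Xi> * (\<Sum>k\<in>Y.G. ?t g k))"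
    by (intro arg_cong[where f = "\<lambda>s. mass \<Theta> * s"] sum.cong refl)
      (simp add: fun_lact_eq L_R sum_distrib_right mult.assoc)
  also have "\<dots> = mass \<Xi> * (mass \<Theta> * (\<Sum>g\<in>X.G. \<Sum>k\<in>Y.G. ?t g k))" by (simp add: sum_distrib_left[symmetric])
  also have "(\<Sum>g\<in>X.G. \<Sum>k\<in>Y.G. ?t g k) = (\<Sum>k\<in>Y.G. \<Sum>g\<in>X.G. ?t g k)" by (rule sum.swap)
  also have "mass \<Theta> * \<dots> = (\<Sum>k\<in>Y.G. b (Y.into k (\<alpha> q)) * h (crep f \<psi> (L (Y.ginv k) q)))"
    unfolding sum_distrib_left[of "mass \<Theta>"]
  proof (rule sum.cong[OF refl])
    fix k assume k: "k \<in> Y.G"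
    then have e: "\<rho> (L (Y.ginv k) q) = \<rho> q" by simp
    have "h (crep f \<psi> (L (Y.ginv k) q)) = mass \<Theta> * (\<Sum>g\<in>X.G. f (R g (L (Y.ginv k) q)) * h (X.trans_sec g \<psi> (\<rho> q)))"
      using functional_crep[OF \<psi>, of "L (Y.ginv k) q" h f] h unfolding e by simp
    then show "(\<Sum>g\<in>X.G. mass \<Theta> * ?t g k) = b (Y.into k (\<alpha> q)) * h (crep f \<psi> (L (Y.ginv k) q))"
      by (simp add: sum_distrib_left mult_ac)
  qed
  finally show ?thesis .
qed

lemma formal_act_eq: "formal_act \<Xi> \<phi> b r =
    (\<lambda>p. \<Sum>p' | r p' \<noteq> 0. r p' * point_mass (fun_lact \<Xi> \<phi> b (fst p'), snd p') p)"
  by (rule ext) (simp add: formal_act_def)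

lemma formal_act_in:
  assumes b: "b \<in> conv_algebra \<Xi>" and r: "r \<in> vecs FS" shows "formal_act \<Xi> \<phi> b r \<in> vecs FS"
  unfolding formal_act_eq
  by (rule FS_comb[OF FS_finite[OF r]]) (use FS_memb[OF r] fun_lact_SQ[OF _ b] in auto)

lemma fimage_act:
  assumes b: "b \<in> conv_algebra \<Xi>" and r: "r \<in> vecs FS"
  shows "fimage (formal_act \<Xi> \<phi> b r) = sec_act \<Xi> E b (fimage r)"
proof (rule fimage_eqI[OF fimage_in[OF formal_act_in[OF b r]] E.sec_act_in[OF fimage_section[OF r]]])
  fix q h assume h: "functional \<xi> (\<rho> q) h"
  let ?c = "\<lambda>p q. crep (fst p) (snd p) q"
  have "h (rep_at q (fimage (formal_act \<Xi> \<phi> b r) (\<alpha> q))) =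
      (\<Sum>p | r p \<noteq> 0. r p * h (crep (fun_lact \<Xi> \<phi> b (fst p)) (snd p) q))"
    unfolding rep_fimage[OF formal_act_in[OF b r]] functional_frep[OF formal_act_in[OF b r] h]
    unfolding formal_act_eq fsum_comb(3)[OF FS_finite[OF r]] by simp
  also have "\<dots> = (\<Sum>p | r p \<noteq> 0. mass \<Xi> * (\<Sum>k\<in>Y.G. b (Y.into k (\<alpha> q)) * (r p * h (?c p (L (Y.ginv k) q)))))"
  proof (rule sum.cong[OF refl])
    fix p assume "p \<in> {p. r p \<noteq> 0}"
    then have "snd p \<in> SX" using FS_memb[OF r] by blast
    from crep_lact[OF this h, of b "fst p"]
    show "r p * h (crep (fun_lact \<Xi> \<phi> b (fst p)) (snd p) q) =
        mass \<Xi> * (\<Sum>k\<in>Y.G. b (Y.into k (\<alpha> q)) * (r p * h (?c p (L (Y.ginv k) q))))"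
      by (simp add: sum_distrib_left mult_ac)
  qed
  also have "\<dots> = mass \<Xi> * (\<Sum>p | r p \<noteq> 0. \<Sum>k\<in>Y.G. b (Y.into k (\<alpha> q)) * (r p * h (?c p (L (Y.ginv k) q))))"
    by (simp only: sum_distrib_left)
  also have "(\<Sum>p | r p \<noteq> 0. \<Sum>k\<in>Y.G. b (Y.into k (\<alpha> q)) * (r p * h (?c p (L (Y.ginv k) q)))) =
      (\<Sum>k\<in>Y.G. \<Sum>p | r p \<noteq> 0. b (Y.into k (\<alpha> q)) * (r p * h (?c p (L (Y.ginv k) q))))" by (rule sum.swap)
  also have "\<dots> = (\<Sum>k\<in>Y.G. b (Y.into k (\<alpha> q)) * h (rep_at (L (Y.ginv k) q) (fimage r (\<alpha> (L (Y.ginv k) q)))))"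
  proof (rule sum.cong[OF refl])
    fix k assume k: "k \<in> Y.G"
    then have "functional \<xi> (\<rho> (L (Y.ginv k) q)) h" using h by simp
    from functional_frep[OF r this]
    show "(\<Sum>p | r p \<noteq> 0. b (Y.into k (\<alpha> q)) * (r p * h (?c p (L (Y.ginv k) q)))) =
        b (Y.into k (\<alpha> q)) * h (rep_at (L (Y.ginv k) q) (fimage r (\<alpha> (L (Y.ginv k) q))))"
      unfolding rep_fimage[OF r] fsum_def by (simp add: sum_distrib_left)
  qed
  also have "mass \<Xi> * \<dots> = h (rep_at q (sec_act \<Xi> E b (fimage r) (\<alpha> q)))"
    by (rule sec_act_rep[OF fimage_section[OF r] h, symmetric])
  finally show "h (rep_at q (fimage (formal_act \<Xi> \<phi> b r) (\<alpha> q))) = h (rep_at q (sec_act \<Xi> E b (fimage r) (\<alpha> q)))" .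
qed

abbreviation "tact \<equiv> tensor_act V \<Theta> \<Xi> \<phi> \<xi> \<nu>"

lemma
  assumes b: "b \<in> conv_algebra \<Xi>" and a: "a \<in> vecs TS"
  shows tact_in: "tact b a \<in> vecs TS" and chi_tact: "chi (tact b a) = sec_act \<Xi> E b (chi a)"
proof -
  obtain r where r: "r \<in> vecs FS" "a = FQ.cls r"
    using a unfolding tensor_space_def FQ.vecs_quotient by blast
  have s: "some_rep a \<in> vecs FS" using FQ.rep_closed r by simp
  have t: "tact b a = FQ.cls (formal_act \<Xi> \<phi> b (some_rep a))" by (simp add: tensor_act_def quotient_op_def)
  show "tact b a \<in> vecs TS"
    unfolding t tensor_space_def FQ.vecs_quotient using formal_act_in[OF b s] by blast
  show "chi (tact b a) = sec_act \<Xi> E b (chi a)"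
    unfolding t chi_cls[OF formal_act_in[OF b s]] fimage_act[OF b s] by (simp only: chi_def)
qed

lemma chi_scaled_isometry: "scaled_isometry TS EM.Sec chi scale_factor \<Xi> tact (sec_act \<Xi> E)"
proof -
  have ax: "scaled_isometry_axioms TS EM.Sec chi scale_factor \<Xi> tact (sec_act \<Xi> E)"
  proof (rule scaled_isometry_axioms.intro)
    show "linear_in TS EM.Sec chi" by (rule chi_linear)
    show "chi ` vecs TS = vecs EM.Sec" by (rule chi_onto)
    show "0 < scale_factor" by (rule scale_factor_pos)
    show "inner_in EM.Sec (chi v) (chi w) = of_real scale_factor * inner_in TS v w"
      if "v \<in> vecs TS" "w \<in> vecs TS" for v w using that by (rule chi_inner)
    show "tact b v \<in> vecs TS" if "b \<in> conv_algebra \<Xi>" "v \<in> vecs TS" for b v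
      using that by (rule tact_in)
    show "chi (tact b v) = sec_act \<Xi> E b (chi v)" if "b \<in> conv_algebra \<Xi>" "v \<in> vecs TS" for b v
      using that by (rule chi_tact)
    show "representation \<Xi> EM.Sec (sec_act \<Xi> E)" by (rule EM.representation_Sec)
    show "star \<Xi> b \<in> conv_algebra \<Xi>" if "b \<in> conv_algebra \<Xi>" for b
      using that by (rule Y.star_closed)
    show "conv \<Xi> b b' \<in> conv_algebra \<Xi>" if "b \<in> conv_algebra \<Xi>" "b' \<in> conv_algebra \<Xi>" for b b'
      using that by (rule Y.conv_closed)
    show "(\<lambda>\<tau>. z * b \<tau> + b' \<tau>) \<in> conv_algebra \<Xi>"
      if "b \<in> conv_algebra \<Xi>" "b' \<in> conv_algebra \<Xi>" for b b' z
      using that by (rule Y.comb_closed)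
  qed
  show ?thesis by (rule scaled_isometry.intro[OF semi_inner_TS EM.semi_inner_Sec ax])
qed

lemma chi_tensor:
  assumes f: "f \<in> SQ" and \<psi>: "\<psi> \<in> SX"
  shows "rep_at q (chi (tensor V \<Theta> \<Xi> \<phi> \<xi> \<nu> f \<psi>) (\<alpha> q)) = crep f \<psi> q"
proof -
  have pm: "point_mass (f, \<psi>) \<in> vecs FS" using FS_point_mass[OF f \<psi>] .
  have "frep (point_mass (f, \<psi>)) q = crep f \<psi> q"
    by (rule X.fibre_eqI[OF frep_in[OF pm] crep_in[OF \<psi>]]) (simp add: functional_frep[OF pm])
  then show ?thesis unfolding tensor_def chi_cls[OF pm] rep_fimage[OF pm] .
qed

end

theorem theorem2:
  fixes V :: "(real^'n::{finite, wellorder}) set"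
    and \<Theta> :: "('g, 'x::{t2_space, second_countable_topology}, 'n) action_orbifold"
    and \<Xi> :: "('k, 'y::{t2_space, second_countable_topology}, 'n) action_orbifold"
    and \<phi> :: "('g, 'x, 'k, 'y, 'q::{t2_space, second_countable_topology}, 'n) bitorsor"
    and \<xi> :: "('g, 'x, 'u) hbundle"
    and g :: "('x, 'n) metric_field"
    and \<nu> :: "('x, 'n) top_form"
  assumes "model_space V"
    and "compact_action_orbifold V \<Theta>"
    and "compact_action_orbifold V \<Xi>"
    and "morita_equivalence V \<Theta> \<Xi> \<phi>"
    and "equivariant_bundle \<Theta> \<xi>"
    and "invariant_hermitian \<Theta> \<xi>"
    and "riemannian_metric V (atlas \<Theta>) g"
    and "\<forall>h\<in>carrier (group_of \<Theta>). pullback_metric V (atlas \<Theta>) (atlas \<Theta>) (act \<Theta> h) g g"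
    and "riemannian_volume_form V (atlas \<Theta>) g \<nu>"
    and "\<forall>h\<in>carrier (group_of \<Theta>). pullback_form V (atlas \<Theta>) (atlas \<Theta>) (act \<Theta> h) \<nu> \<nu>"
  shows "\<exists>chi T.
      linear_in (tensor_space V \<Theta> \<Xi> \<phi> \<xi> \<nu>) (induced_section_space V \<Theta> \<Xi> \<phi> \<xi> \<nu>) chi \<and>
      (\<forall>f\<in>smooth_fun_space (qatlas \<phi>). \<forall>\<psi>\<in>sections (atlas \<Theta>) \<xi>. \<forall>y q. lanchor \<phi> q = y \<longrightarrow>
         rep_at q (chi (tensor V \<Theta> \<Xi> \<phi> \<xi> \<nu> f \<psi>) y) =
           vscale \<xi> (1 / of_nat (card (carrier (group_of \<Theta>))))
             (fibre_sum \<xi> (ranchor \<phi> q)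
                (\<lambda>\<sigma>. vscale \<xi> (f (ract \<phi> q \<sigma>)) (rho \<xi> \<sigma> (\<psi> (src \<sigma>))))
                (arrows_into \<Theta> (ranchor \<phi> q)))) \<and>
      representation_iso \<Xi>
        (hilbert_completion (tensor_space V \<Theta> \<Xi> \<phi> \<xi> \<nu>))
        (\<lambda>b. completion_op (tensor_space V \<Theta> \<Xi> \<phi> \<xi> \<nu>) (tensor_act V \<Theta> \<Xi> \<phi> \<xi> \<nu> b))
        (hilbert_completion (induced_section_space V \<Theta> \<Xi> \<phi> \<xi> \<nu>))
        (\<lambda>b. completion_op (induced_section_space V \<Theta> \<Xi> \<phi> \<xi> \<nu>) (sec_act \<Xi> (induced_bundle \<Theta> \<phi> \<xi>) b))
        T \<and>
      (\<forall>t\<in>vecs (tensor_space V \<Theta> \<Xi> \<phi> \<xi> \<nu>).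
         T (to_completion (tensor_space V \<Theta> \<Xi> \<phi> \<xi> \<nu>) t) =
           to_completion (induced_section_space V \<Theta> \<Xi> \<phi> \<xi> \<nu>) (chi t))"
proof -
  interpret morita_full V \<Theta> \<Xi> \<phi> \<xi> \<nu>
    by unfold_locales (use assms in \<open>auto simp: riemannian_volume_form_def\<close>)
  interpret I: scaled_isometry TS EM.Sec chi scale_factor \<Xi> tact "sec_act \<Xi> E"
    by (rule chi_scaled_isometry)
  show ?thesis
    unfolding target_eq
  proof (intro exI[of _ chi] exI[of _ "completion_map TS EM.Sec chi"] conjI ballI allI impI)
    show "linear_in TS EM.Sec chi" by (rule chi_linear)
    show "rep_at q (chi (tensor V \<Theta> \<Xi> \<phi> \<xi> \<nu> f \<psi>) y) =
        vscale \<xi> (1 / of_nat (card X.G)) (fibre_sum \<xi> (ranchor \<phi> q)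
          (\<lambda>\<sigma>. vscale \<xi> (f (ract \<phi> q \<sigma>)) (rho \<xi> \<sigma> (\<psi> (src \<sigma>)))) (arrows_into \<Theta> (ranchor \<phi> q)))"
      if "f \<in> SQ" "\<psi> \<in> SX" "lanchor \<phi> q = y" for f \<psi> y q
      using chi_tensor[OF that(1,2), of q] crep_arrows[OF that(2), of q f] that(3) by simp
    show "representation_iso \<Xi> (hilbert_completion TS) (\<lambda>b. completion_op TS (tact b))
        (hilbert_completion EM.Sec) (\<lambda>b. completion_op EM.Sec (sec_act \<Xi> E b)) (completion_map TS EM.Sec chi)"
      using scaled_isometry_completion_iso[OF chi_scaled_isometry] .
    show "completion_map TS EM.Sec chi (to_completion TS t) = to_completion EM.Sec (chi t)" if "t \<in> vecs TS" for t
      using I.completion_map_J_const[OF that] .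
  qed
qed

end
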